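(* (1) Assume CH. There is an almost disjoint family $\mathcal F\subseteq\mathcal A_T$ which, in any generic extension of the ground model of the form $V^{\mathrm{Fn}(\kappa,2)}$, cannot be extended to a $\mathrm{Fn}(\omega,2)$-indestructible mad family on $T$. (2) Let $W=V^{\mathrm{Fn}(\omega_1,2)}$. Then in $W$ there is an almost disjoint family $\mathcal F\subseteq\mathcal{ND}_T$ of cardinality $\aleph_1$ such that, in any generic extension of $W$ by a c.c.c. poset $\mathbb P$ with $\mathbb P\in V$, $\mathcal F$ cannot be extended to a $\mathrm{Fn}(\omega,2)$-indestructible mad family on $T$. (3) Let $W=V^{\mathrm{Fn}(\omega_1,2)}$. Then in $W$ there is an almost disjoint family $\mathcal F\subseteq\mathcal N_T$ of cardinality $\aleph_1$ such that, in any generic extension of $W$ by a c.c.c. poset $\mathbb P$ with $\mathbb P\in V$, $\mathcal F$ cannot be extended to a $\mathbb B(\omega)$-indestructible mad family on $T$.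
   Context: $T={}^{\omega>}2$ ordered by $b'\le_T b$ iff $b\subseteq b'$; $\mathcal A_T$ is the set of infinite antichains of $T$. For $f\in{}^\omega2$, $B(f)=\{f\restriction n:n\in\omega\}$; for $X\subseteq T$, $\lfloor X\rfloor=\{f:|B(f)\cap X|=\aleph_0\}$. $\mathcal{ND}_T$: infinite $X\subseteq T$ with $\lfloor X\rfloor$ nowhere dense in ${}^\omega2$; $\mathcal N_T$: infinite $X\subseteq T$ with $\lfloor X\rfloor$ of product fair-coin measure $0$. Almost disjoint = finite intersection; a mad family on $T$ is a pairwise almost disjoint family of infinite subsets of $T$ with union $T$ that is maximal among such families in $[T]^{\aleph_0}$. For a poset $\mathbb P$, a mad family $\mathcal F$ on $T$ is $\mathbb P$-destructible if in $V^{\mathbb P}$ it is no longer mad in $[T]^{\aleph_0}$, and $\mathbb P$-indestructible otherwise. $\mathrm{Fn}(\kappa,2)$ is Cohen forcing adding $\kappa$ Cohen reals, $\mathbb B(\omega)$ is the random forcing (positive-measure Borel sets of ${}^\omega2$), $V$ the ground model. *)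

theory Defs
  imports "HOL-Library.Countable_Set_Type" "HOL-Library.Extended_Nonnegative_Real"
begin

text \<open>
  The ground model \<open>V\<close> of a forcing argument is rendered, in the usual way, as a countable
  transitive model \<open>M\<close> of ZFC. A countable transitive set consists of hereditarily countable
  sets, so the ambient universe can be the datatype of hereditarily countable sets.
  For a notion that depends on the model the first argument \<open>M\<close> (or \<open>N\<close>) is the model in
  which it is evaluated, i.e. its quantifiers over infinite objects range over \<open>M\<close>; notions
  without such an argument are absolute for transitive models of ZFC.
\<close>

section \<open>Hereditarily countable sets\<close>

datatype hset = HSet (members: "hset cset")

definition elts :: "hset \<Rightarrow> hset set" where
  "elts x = rcset (members x)"

text \<open>The set with a given extension; only meaningful for countable \<open>A\<close>.\<close>
definition hset_of :: "hset set \<Rightarrow> hset" where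
  "hset_of A = HSet (acset A)"

lemma elts_hset_of [simp]: "countable A \<Longrightarrow> elts (hset_of A) = A"
  by (simp add: elts_def hset_of_def)

lemma countable_elts [simp]: "countable (elts x)"
  by (simp add: elts_def)

lemma hset_eqI: "elts x = elts y \<Longrightarrow> x = y"
  by (metis elts_def hset.expand rcset_inverse)

lemma wf_elts: "wf {(x, y). x \<in> elts y}"
proof (rule wfUNIVI)
  fix P x
  assume IH: "\<forall>x. (\<forall>y. (y, x) \<in> {(x, y). x \<in> elts y} \<longrightarrow> P y) \<longrightarrow> P x"
  show "P x"
  proof (induction x)
    case (HSet c)
    then have "\<And>y. y \<in> elts (HSet c) \<Longrightarrow> P y"
      by (simp add: elts_def cin.rep_eq)
    then show ?case using IH by blast
  qed
qed

definition opair :: "hset \<Rightarrow> hset \<Rightarrow> hset" where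
  "opair a b = hset_of {hset_of {a}, hset_of {a, b}}"

fun vnat :: "nat \<Rightarrow> hset" where
  "vnat 0 = hset_of {}"
| "vnat (Suc n) = hset_of (insert (vnat n) (elts (vnat n)))"

definition omega :: hset where
  "omega = hset_of (range vnat)"

definition is_fun :: "hset \<Rightarrow> hset set \<Rightarrow> hset set \<Rightarrow> bool" where
  "is_fun f A B \<longleftrightarrow> (\<forall>z\<in>elts f. \<exists>a\<in>A. \<exists>b\<in>B. z = opair a b) \<and> (\<forall>a\<in>A. \<exists>!b. opair a b \<in> elts f)"

definition app :: "hset \<Rightarrow> hset \<Rightarrow> hset" where
  "app f a = (THE b. opair a b \<in> elts f)"

definition transitive :: "hset set \<Rightarrow> bool" where
  "transitive A \<longleftrightarrow> (\<forall>x\<in>A. elts x \<subseteq> A)"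

definition is_ord :: "hset \<Rightarrow> bool" where
  "is_ord x \<longleftrightarrow> transitive (elts x) \<and> (\<forall>y\<in>elts x. transitive (elts y))"

section \<open>Countable transitive models of ZFC\<close>

datatype fm = Mem nat nat | Eq nat nat | Neg fm | Conj fm fm | All nat fm

fun sat :: "hset set \<Rightarrow> (nat \<Rightarrow> hset) \<Rightarrow> fm \<Rightarrow> bool" where
  "sat M e (Mem i j) \<longleftrightarrow> e i \<in> elts (e j)"
| "sat M e (Eq i j) \<longleftrightarrow> e i = e j"
| "sat M e (Neg p) \<longleftrightarrow> \<not> sat M e p"
| "sat M e (Conj p q) \<longleftrightarrow> sat M e p \<and> sat M e q"
| "sat M e (All i p) \<longleftrightarrow> (\<forall>x\<in>M. sat M (e(i := x)) p)"

text \<open>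
  The axioms of ZFC, relativized to \<open>M\<close>. In the two schemes the formula \<open>p\<close> is arbitrary and the
  assignment \<open>e\<close> supplies the parameters.
\<close>
definition ax_extensionality :: "hset set \<Rightarrow> bool" where
  "ax_extensionality M \<longleftrightarrow>
     (\<forall>a\<in>M. \<forall>b\<in>M. (\<forall>x\<in>M. x \<in> elts a \<longleftrightarrow> x \<in> elts b) \<longrightarrow> a = b)"

definition ax_foundation :: "hset set \<Rightarrow> bool" where
  "ax_foundation M \<longleftrightarrow>
     (\<forall>a\<in>M. (\<exists>x\<in>M. x \<in> elts a) \<longrightarrow>
        (\<exists>x\<in>M. x \<in> elts a \<and> \<not> (\<exists>y\<in>M. y \<in> elts x \<and> y \<in> elts a)))"

definition ax_pairing :: "hset set \<Rightarrow> bool" where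
  "ax_pairing M \<longleftrightarrow>
     (\<forall>a\<in>M. \<forall>b\<in>M. \<exists>c\<in>M. \<forall>x\<in>M. x \<in> elts c \<longleftrightarrow> x = a \<or> x = b)"

definition ax_union :: "hset set \<Rightarrow> bool" where
  "ax_union M \<longleftrightarrow>
     (\<forall>a\<in>M. \<exists>u\<in>M. \<forall>x\<in>M. x \<in> elts u \<longleftrightarrow> (\<exists>y\<in>M. y \<in> elts a \<and> x \<in> elts y))"

definition ax_power_set :: "hset set \<Rightarrow> bool" where
  "ax_power_set M \<longleftrightarrow>
     (\<forall>a\<in>M. \<exists>p\<in>M. \<forall>x\<in>M. x \<in> elts p \<longleftrightarrow> (\<forall>y\<in>M. y \<in> elts x \<longrightarrow> y \<in> elts a))"

definition ax_infinity :: "hset set \<Rightarrow> bool" where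
  "ax_infinity M \<longleftrightarrow>
     (\<exists>a\<in>M. (\<exists>z\<in>M. z \<in> elts a \<and> (\<forall>x\<in>M. x \<notin> elts z)) \<and>
        (\<forall>y\<in>M. y \<in> elts a \<longrightarrow>
          (\<exists>s\<in>M. s \<in> elts a \<and> (\<forall>x\<in>M. x \<in> elts s \<longleftrightarrow> x \<in> elts y \<or> x = y))))"

definition ax_separation :: "hset set \<Rightarrow> bool" where
  "ax_separation M \<longleftrightarrow>
     (\<forall>p e a. range e \<subseteq> M \<longrightarrow> a \<in> M \<longrightarrow>
        (\<exists>b\<in>M. \<forall>x\<in>M. x \<in> elts b \<longleftrightarrow> x \<in> elts a \<and> sat M (e(0 := x)) p))"

definition ax_replacement :: "hset set \<Rightarrow> bool" where
  "ax_replacement M \<longleftrightarrow>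
     (\<forall>p e a. range e \<subseteq> M \<longrightarrow> a \<in> M \<longrightarrow>
        (\<forall>x\<in>M. x \<in> elts a \<longrightarrow> (\<exists>!y. y \<in> M \<and> sat M (e(0 := x, 1 := y)) p)) \<longrightarrow>
        (\<exists>b\<in>M. \<forall>y\<in>M. y \<in> elts b \<longleftrightarrow> (\<exists>x\<in>M. x \<in> elts a \<and> sat M (e(0 := x, 1 := y)) p)))"

text \<open>Choice in the form that every family of pairwise disjoint nonempty sets has a transversal\<close>
definition ax_choice :: "hset set \<Rightarrow> bool" where
  "ax_choice M \<longleftrightarrow>
     (\<forall>a\<in>M. (\<forall>x\<in>M. x \<in> elts a \<longrightarrow> (\<exists>z\<in>M. z \<in> elts x)) \<longrightarrow>
        (\<forall>x\<in>M. \<forall>y\<in>M. x \<in> elts a \<longrightarrow> y \<in> elts a \<longrightarrow> x \<noteq> y \<longrightarrow>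
           \<not> (\<exists>z\<in>M. z \<in> elts x \<and> z \<in> elts y)) \<longrightarrow>
        (\<exists>c\<in>M. \<forall>x\<in>M. x \<in> elts a \<longrightarrow> (\<exists>!z. z \<in> M \<and> z \<in> elts x \<and> z \<in> elts c)))"

definition zfc_model :: "hset set \<Rightarrow> bool" where
  "zfc_model M \<longleftrightarrow>
     M \<noteq> {} \<and> ax_extensionality M \<and> ax_foundation M \<and> ax_pairing M \<and>
     ax_union M \<and> ax_power_set M \<and> ax_infinity M \<and>
     ax_separation M \<and> ax_replacement M \<and> ax_choice M"

definition ctm :: "hset set \<Rightarrow> bool" where
  "ctm M \<longleftrightarrow> countable M \<and> transitive M \<and> zfc_model M"

section \<open>Cardinality inside a model\<close>

definition equipotent_in :: "hset set \<Rightarrow> hset set \<Rightarrow> hset set \<Rightarrow> bool" where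
  "equipotent_in M A B \<longleftrightarrow> (\<exists>f\<in>M. is_fun f A B \<and> bij_betw (app f) A B)"

definition countable_in :: "hset set \<Rightarrow> hset \<Rightarrow> bool" where
  "countable_in M x \<longleftrightarrow> (\<exists>f\<in>M. is_fun f (elts x) (elts omega) \<and> inj_on (app f) (elts x))"

definition cardinal_in :: "hset set \<Rightarrow> hset \<Rightarrow> bool" where
  "cardinal_in M k \<longleftrightarrow>
     k \<in> M \<and> is_ord k \<and> (\<forall>a\<in>elts k. \<not> equipotent_in M (elts a) (elts k))"

definition is_omega1_in :: "hset set \<Rightarrow> hset \<Rightarrow> bool" where
  "is_omega1_in M w \<longleftrightarrow>
     w \<in> M \<and> is_ord w \<and> \<not> countable_in M w \<and> (\<forall>a\<in>elts w. countable_in M a)"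

definition card_aleph1_in :: "hset set \<Rightarrow> hset \<Rightarrow> bool" where
  "card_aleph1_in M x \<longleftrightarrow> (\<exists>w. is_omega1_in M w \<and> equipotent_in M (elts w) (elts x))"

section \<open>Forcing\<close>

text \<open>
  A forcing poset is given by its underlying set \<open>P\<close> and its order \<open>le\<close>; as usual in forcing,
  antisymmetry is not required. \<open>le p q\<close> says that \<open>p\<close> is the stronger condition.
\<close>
definition poset :: "hset set \<Rightarrow> (hset \<Rightarrow> hset \<Rightarrow> bool) \<Rightarrow> bool" where
  "poset P le \<longleftrightarrow>
     P \<noteq> {} \<and> (\<forall>p\<in>P. le p p) \<and> (\<forall>p\<in>P. \<forall>q\<in>P. \<forall>r\<in>P. le p q \<longrightarrow> le q r \<longrightarrow> le p r)"

definition order_of :: "hset \<Rightarrow> hset \<Rightarrow> hset \<Rightarrow> bool" where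
  "order_of L p q \<longleftrightarrow> opair p q \<in> elts L"

definition ccc_in :: "hset set \<Rightarrow> hset set \<Rightarrow> (hset \<Rightarrow> hset \<Rightarrow> bool) \<Rightarrow> bool" where
  "ccc_in M P le \<longleftrightarrow>
     (\<forall>A\<in>M. elts A \<subseteq> P \<longrightarrow>
        (\<forall>p\<in>elts A. \<forall>q\<in>elts A. p \<noteq> q \<longrightarrow> \<not> (\<exists>r\<in>P. le r p \<and> le r q)) \<longrightarrow>
        countable_in M A)"

definition generic :: "hset set \<Rightarrow> hset set \<Rightarrow> (hset \<Rightarrow> hset \<Rightarrow> bool) \<Rightarrow> hset set \<Rightarrow> bool" where
  "generic M P le G \<longleftrightarrow>
     G \<subseteq> P \<and> G \<noteq> {} \<and>
     (\<forall>p\<in>G. \<forall>q\<in>P. le p q \<longrightarrow> q \<in> G) \<and>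
     (\<forall>p\<in>G. \<forall>q\<in>G. \<exists>r\<in>G. le r p \<and> le r q) \<and>
     (\<forall>D\<in>M. elts D \<subseteq> P \<longrightarrow> (\<forall>p\<in>P. \<exists>d\<in>elts D. le d p) \<longrightarrow> G \<inter> elts D \<noteq> {})"

text \<open>
  Evaluation of names. Every set is treated as a name: elements that are not of the
  form \<open>(\<sigma>, p)\<close> with \<open>p \<in> G\<close> are ignored. Hence \<open>M[G]\<close> is the same as with hereditary \<open>P\<close>-names.
\<close>
function val :: "hset set \<Rightarrow> hset \<Rightarrow> hset" where
  "val G \<tau> = hset_of (val G ` {\<sigma>. \<exists>p\<in>G. opair \<sigma> p \<in> elts \<tau>})"
  by auto
termination
proof (relation "inv_image ({(x, y). x \<in> elts y}\<^sup>+) snd")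
  show "wf (inv_image ({(x, y). x \<in> elts y}\<^sup>+) snd)"
    by (intro wf_inv_image wf_trancl wf_elts)
next
  fix G :: "hset set" and \<tau> \<sigma>
  assume "\<sigma> \<in> {\<sigma>. \<exists>p\<in>G. opair \<sigma> p \<in> elts \<tau>}"
  then obtain p where p: "opair \<sigma> p \<in> elts \<tau>" by blast
  have "\<sigma> \<in> elts (hset_of {\<sigma>})" "hset_of {\<sigma>} \<in> elts (opair \<sigma> p)"
    by (simp_all add: opair_def)
  with p have "(\<sigma>, \<tau>) \<in> {(x, y). x \<in> elts y}\<^sup>+"
    by (blast intro: trancl.intros)
  then show "((G, \<sigma>), (G, \<tau>)) \<in> inv_image ({(x, y). x \<in> elts y}\<^sup>+) snd"
    by simp
qed

declare val.simps [simp del]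

definition gen_ext :: "hset set \<Rightarrow> hset set \<Rightarrow> hset set" where
  "gen_ext M G = val G ` M"

definition Fn :: "hset \<Rightarrow> hset set" where
  "Fn K = {p. finite (elts p) \<and>
              (\<forall>z\<in>elts p. \<exists>a\<in>elts K. \<exists>b\<in>elts (vnat 2). z = opair a b) \<and>
              (\<forall>a b c. opair a b \<in> elts p \<longrightarrow> opair a c \<in> elts p \<longrightarrow> b = c)}"

definition Fn_le :: "hset \<Rightarrow> hset \<Rightarrow> bool" where
  "Fn_le p q \<longleftrightarrow> elts q \<subseteq> elts p"

section \<open>The tree \<open>T\<close> and the Cantor space\<close>

definition T :: "hset set" where
  "T = {s. \<exists>n. is_fun s (elts (vnat n)) (elts (vnat 2))}"

definition T_le :: "hset \<Rightarrow> hset \<Rightarrow> bool" where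
  "T_le b' b \<longleftrightarrow> elts b \<subseteq> elts b'"

definition cantor :: "hset set \<Rightarrow> hset set" where
  "cantor M = {f\<in>M. is_fun f (elts omega) (elts (vnat 2))}"

definition restr :: "hset \<Rightarrow> nat \<Rightarrow> hset" where
  "restr f n = hset_of {z\<in>elts f. \<exists>a\<in>elts (vnat n). \<exists>b. z = opair a b}"

definition branch :: "hset \<Rightarrow> hset set" where
  "branch f = range (restr f)"

definition lim_set :: "hset set \<Rightarrow> hset \<Rightarrow> hset set" where
  "lim_set M X = {f\<in>cantor M. infinite (branch f \<inter> elts X)}"

definition cyl :: "hset set \<Rightarrow> hset \<Rightarrow> hset set" where
  "cyl M s = {f\<in>cantor M. elts s \<subseteq> elts f}"

text \<open>Closure and interior in the product topology, with the basic neighbourhoods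
  \<open>cyl M (restr f n)\<close> of \<open>f\<close>\<close>
definition closure_in :: "hset set \<Rightarrow> hset set \<Rightarrow> hset set" where
  "closure_in M S = {f\<in>cantor M. \<forall>n. cyl M (restr f n) \<inter> S \<noteq> {}}"

definition interior_in :: "hset set \<Rightarrow> hset set \<Rightarrow> hset set" where
  "interior_in M S = {f\<in>cantor M. \<exists>n. cyl M (restr f n) \<subseteq> S}"

definition nowhere_dense_in :: "hset set \<Rightarrow> hset set \<Rightarrow> bool" where
  "nowhere_dense_in M S \<longleftrightarrow> interior_in M (closure_in M S) = {}"

text \<open>
  The product fair-coin measure as the outer measure it generates: the infimum, over the covers by
  sequences of basic clopen sets in \<open>M\<close>, of the total weight of the cover. The cylinder over \<open>s\<close> has
  weight \<open>1/2\<close> to the length of \<open>s\<close>, which is the cardinality of \<open>s\<close>.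
\<close>
definition covers :: "hset set \<Rightarrow> hset set \<Rightarrow> hset set" where
  "covers M S =
     {c\<in>M. is_fun c (elts omega) T \<and> S \<subseteq> (\<Union>n. cyl M (app c (vnat n)))}"

definition coin_measure :: "hset set \<Rightarrow> hset set \<Rightarrow> ennreal" where
  "coin_measure M S =
     (INF c\<in>covers M S. \<Sum>n. ennreal ((1/2) ^ card (elts (app c (vnat n)))))"

section \<open>Random forcing\<close>

definition sigma_algebra_in :: "hset set \<Rightarrow> hset \<Rightarrow> bool" where
  "sigma_algebra_in M S \<longleftrightarrow>
     S \<in> M \<and> (\<forall>B\<in>elts S. elts B \<subseteq> cantor M) \<and>
     (\<forall>B\<in>elts S. \<exists>C\<in>elts S. elts C = cantor M - elts B) \<and>
     (\<forall>h\<in>M. is_fun h (elts omega) (elts S) \<longrightarrow>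
        (\<exists>U\<in>elts S. elts U = (\<Union>n. elts (app h (vnat n)))))"

definition borel_in :: "hset set \<Rightarrow> hset \<Rightarrow> bool" where
  "borel_in M B \<longleftrightarrow>
     B \<in> M \<and> elts B \<subseteq> cantor M \<and>
     (\<forall>S. sigma_algebra_in M S \<longrightarrow>
        (\<forall>U\<in>M. elts U \<subseteq> cantor M \<longrightarrow> interior_in M (elts U) = elts U \<longrightarrow> U \<in> elts S) \<longrightarrow>
        B \<in> elts S)"

definition random_forcing :: "hset set \<Rightarrow> hset set" where
  "random_forcing M = {B. borel_in M B \<and> coin_measure M (elts B) > 0}"

definition random_le :: "hset \<Rightarrow> hset \<Rightarrow> bool" where
  "random_le B C \<longleftrightarrow> elts B \<subseteq> elts C"

section \<open>Almost disjoint families on \<open>T\<close>\<close>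

definition antichains_T :: "hset set \<Rightarrow> hset set" where
  "antichains_T M =
     {X\<in>M. elts X \<subseteq> T \<and> infinite (elts X) \<and>
            (\<forall>s\<in>elts X. \<forall>t\<in>elts X. s \<noteq> t \<longrightarrow> \<not> T_le s t \<and> \<not> T_le t s)}"

definition ND_T :: "hset set \<Rightarrow> hset set" where
  "ND_T M = {X\<in>M. elts X \<subseteq> T \<and> infinite (elts X) \<and> nowhere_dense_in M (lim_set M X)}"

definition Null_T :: "hset set \<Rightarrow> hset set" where
  "Null_T M = {X\<in>M. elts X \<subseteq> T \<and> infinite (elts X) \<and> coin_measure M (lim_set M X) = 0}"

definition ad_family :: "hset \<Rightarrow> bool" where
  "ad_family F \<longleftrightarrow>
     (\<forall>X\<in>elts F. elts X \<subseteq> T \<and> infinite (elts X)) \<and>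
     (\<forall>X\<in>elts F. \<forall>Y\<in>elts F. X \<noteq> Y \<longrightarrow> finite (elts X \<inter> elts Y))"

definition mad_in :: "hset set \<Rightarrow> hset \<Rightarrow> bool" where
  "mad_in M F \<longleftrightarrow>
     F \<in> M \<and> ad_family F \<and> (\<Union>X\<in>elts F. elts X) = T \<and>
     (\<forall>F'\<in>M. ad_family F' \<and> (\<Union>X\<in>elts F'. elts X) = T \<and> elts F \<subseteq> elts F' \<longrightarrow> F' = F)"

definition destructible_in ::
    "hset set \<Rightarrow> hset set \<Rightarrow> (hset \<Rightarrow> hset \<Rightarrow> bool) \<Rightarrow> hset \<Rightarrow> bool" where
  "destructible_in M P le F \<longleftrightarrow> (\<forall>G. generic M P le G \<longrightarrow> \<not> mad_in (gen_ext M G) F)"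

definition extends_to_cohen_indestructible_in :: "hset set \<Rightarrow> hset \<Rightarrow> bool" where
  "extends_to_cohen_indestructible_in M F \<longleftrightarrow>
     (\<exists>F'\<in>M. elts F \<subseteq> elts F' \<and> mad_in M F' \<and> \<not> destructible_in M (Fn omega) Fn_le F')"

definition extends_to_random_indestructible_in :: "hset set \<Rightarrow> hset \<Rightarrow> bool" where
  "extends_to_random_indestructible_in M F \<longleftrightarrow>
     (\<exists>F'\<in>M. elts F \<subseteq> elts F' \<and> mad_in M F' \<and>
        \<not> destructible_in M (random_forcing M) random_le F')"

definition CH_in :: "hset set \<Rightarrow> bool" where
  "CH_in M \<longleftrightarrow> (\<exists>w. is_omega1_in M w \<and> equipotent_in M (elts w) (cantor M))"

end

theory Submission
  imports Defs "HOL-Library.Sublist"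
begin

text \<open>
  Suppose that \<open>F'\<close> extends the family \<open>F\<close> and stays maximal after adding a Cohen (random) real. The new
  branch \<open>B\<close> through \<open>T\<close> then meets some \<open>A \<in> F'\<close> in an infinite set. By genericity of the branch, \<open>A\<close> is
  dense above some node in the Cohen case, and is not almost covered by finitely many thin sets in the random
  case, thin meaning that the total weight of a cofinite part is arbitrarily small. So it suffices that every
  such \<open>A\<close> in the intermediate extension has infinite intersection with some \<open>X \<in> F\<close>: almost disjointness gives
  \<open>A = X\<close>, but \<open>X\<close>, being an antichain (thin), meets \<open>B\<close> in a finite set.

  For (1), a name of a dense set \<open>A\<close> can be taken to be an \<open>Fn(\<omega>, 2)\<close>-name in \<open>V\<close>, and \<open>F\<close> contains for each such
  name an antichain built along its own branch in \<open>V\<close> which every condition can force to meet \<open>A\<close> beyond any level.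
  For (2) and (3), the \<open>\<omega>\<^sub>1\<close> Cohen reals are read as \<open>\<omega>\<^sub>1\<close> streams; stream \<open>i\<close> chooses one node from each of
  infinitely many pieces of \<open>T\<close> and \<open>X i\<close> drops the choices shared with earlier streams, up to finitely many
  exceptions per stream. As the c.c.c. poset lies in \<open>V\<close> and preserves \<open>\<omega>\<^sub>1\<close>, countably many Cohen conditions
  decide \<open>A\<close> node by node; a stream not mentioned in them can be forced to choose further elements of \<open>A\<close>.
\<close>

text \<open>Definability is treated semantically: \<open>dfp\<close> and \<open>dft\<close> say that
  a predicate or an operation is given by some formula with parameters in the model, and the rules
  \<open>df\<close> assemble that formula, so that none has to be written out. In (1) the branch of
  a name \<open>R\<close> codes \<open>R\<close> with every bit repeated infinitely often. Branches
  of different names therefore still differ after finite changes, and finite changes are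
  unavoidable: the branch has to start with the node above which the name is dense. In (2) and (3)
  two demands compete. A stream must be free to choose a further element of \<open>A\<close>, but it
  drops what finitely many earlier streams have chosen. So \<open>A\<close> minus the choices of
  finitely many streams has to stay infinite. In (2) these choices form antichains and density
  survives their removal; in (3) they form thin sets, which cannot almost cover \<open>A\<close>.
  That \<open>P\<close> lies in \<open>V\<close> makes Cohen conditions and conditions of
  \<open>P\<close> independent: the former can be altered on fresh coordinates while the latter is
  kept.\<close>

abbreviation (input) hsubset :: "hset => hset => bool" (infix "\<sqsubseteq>" 50) where
 "a \<sqsubseteq> b \<equiv> elts a \<subseteq> elts b"

notation (input) iff (infixr "<->" 25)

lemma elts_sep: "elts (hset_of {x \<in> elts a. P x}) = {x \<in> elts a. P x}"
 by (rule elts_hset_of) (rule countable_subset[OF _ countable_elts[of a]], blast)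

section \<open>Definability over a transitive model\<close>

fun ren :: "(nat => nat) => fm => fm" where
 "ren r (Mem i j) = Mem (r i) (r j)"
| "ren r (Eq i j) = Eq (r i) (r j)"
| "ren r (Neg p) = Neg (ren r p)"
| "ren r (Conj p q) = Conj (ren r p) (ren r q)"
| "ren r (All i p) = All (r i) (ren r p)"

fun var_bound :: "fm => nat" where
 "var_bound (Mem i j) = max i j"
| "var_bound (Eq i j) = max i j"
| "var_bound (Neg p) = var_bound p"
| "var_bound (Conj p q) = max (var_bound p) (var_bound q)"
| "var_bound (All i p) = max i (var_bound p)"

text \<open>\<open>ren\<close> also renames bound variables, so a non-injective \<open>r\<close>
  could identify a bound variable with a free one; injectivity lets updating commute with
  renaming.\<close>

lemma sat_ren: "inj r ==> sat M e (ren r p) <-> sat M (e \<circ> r) p"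
proof (induction p arbitrary: e)
 case (All i p)
 have *: "(e(r i := x)) \<circ> r = (e \<circ> r)(i := x)" for x
  using All.prems by (auto simp: fun_eq_iff inj_eq)
 show ?case unfolding ren.simps sat.simps All.IH[OF All.prems] * ..
qed auto

lemma sat_cong: "\<forall>i \<le> var_bound p. e i = e' i ==> sat M e p <-> sat M e' p"
proof (induction p arbitrary: e e')
 case (Conj p q)
 hence "sat M e p <-> sat M e' p" "sat M e q <-> sat M e' q" by simp_all
 thus ?case by simp
next
 case (Neg p)
 hence "sat M e p <-> sat M e' p" by simp
 thus ?case by simp
next
 case (All i p)
 have "sat M (e(i := x)) p <-> sat M (e'(i := x)) p" for x
  by (rule All.IH) (use All.prems in simp)
 thus ?case by simp
qed simp_all

text \<open>The even variables hold the arguments of a definable predicate, the odd ones its parameters.\<close>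
definition mix :: "(nat => 'a) => (nat => 'a) => nat => 'a" where
 "mix e a i = (if even i then e (i div 2) else a (i div 2))"

text \<open>Renamings of this form move the argument slots of \<open>mix\<close> and fix the
  parameter slots; those of the next lemma do the opposite.\<close>

lemma inj_even_part:
 assumes "inj r"
 shows "inj (\<lambda>i::nat. if even i then 2 * r (i div 2) else i)" (is "inj ?s")
proof (rule injI)
 fix x y assume xy: "?s x = ?s y"
 have "even (?s z) <-> even z" for z by simp
 hence e: "even x <-> even y" using xy by metis
 show "x = y"
 proof (cases "even x")
  case True
  hence "x div 2 = y div 2" using xy e injD[OF assms] by simp
  thus ?thesis using True e by (metis dvd_mult_div_cancel)
 qed (use xy e in simp)
qed

lemma inj_odd_part:
 assumes "inj r"
 shows "inj (\<lambda>i::nat. if even i then i else Suc (2 * r (i div 2)))" (is "inj ?s")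
proof (rule injI)
 fix x y assume xy: "?s x = ?s y"
 have "even (?s z) <-> even z" for z by simp
 hence e: "even x <-> even y" using xy by metis
 show "x = y"
 proof (cases "even x")
  case False
  hence "x div 2 = y div 2" using xy e injD[OF assms] by simp
  thus ?thesis using False e by (metis odd_two_times_div_two_succ)
 qed (use xy e in simp)
qed

lemma mix_simps [simp]: "mix e a (2 * i) = e i" "mix e a (Suc (2 * i)) = a i"
 by (simp_all add: mix_def)

lemma range_case_nat [simp]: "range (case_nat x e) \<subseteq> M <-> x \<in> M \<and> range e \<subseteq> M"
 by (auto simp: image_subset_iff split: nat.splits)

text \<open>One formula and one parameter assignment serve all environments in \<open>M\<close>.
  Parameters form a whole sequence, which keeps arities out of the combinators.\<close>

definition dfp :: "hset set => ((nat => hset) => bool) => bool" where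
 "dfp M P <-> (\<exists>p a. range a \<subseteq> M \<and> (\<forall>e. range e \<subseteq> M --> (sat M (mix e a) p <-> P e)))"

text \<open>In the graph, slot 0 holds the value and the arguments move up by one.\<close>

definition dft :: "hset set => ((nat => hset) => hset) => bool" where
 "dft M f <-> (\<forall>e. range e \<subseteq> M --> f e \<in> M) \<and> dfp M (\<lambda>e. e 0 = f (\<lambda>i. e (Suc i)))"

lemma dfp_eqI: "dfp M P ==> (\<And>e. range e \<subseteq> M ==> Q e = P e) ==> dfp M Q"
 by (auto simp: dfp_def)

locale nonempty_class = fixes M :: "hset set" assumes nonempty: "M \<noteq> {}"
begin

lemma some_env: "\<exists>a :: nat => hset. range a \<subseteq> M"
proof -
 obtain c where "c \<in> M" using nonempty by blast
 thus ?thesis by (intro exI[of _ "\<lambda>_. c"]) auto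
qed

lemma dfp_memvar: "dfp M (\<lambda>e. e i \<in> elts (e j))"
proof -
 obtain a :: "nat => hset" where "range a \<subseteq> M" using some_env by blast
 thus ?thesis
  unfolding dfp_def by (intro exI[of _ "Mem (2 * i) (2 * j)"] exI[of _ a]) simp
qed

lemma dfp_eqvar: "dfp M (\<lambda>e. e i = e j)"
proof -
 obtain a :: "nat => hset" where "range a \<subseteq> M" using some_env by blast
 thus ?thesis
  unfolding dfp_def by (intro exI[of _ "Eq (2 * i) (2 * j)"] exI[of _ a]) simp
qed

lemma dfp_eqpar: "c \<in> M ==> dfp M (\<lambda>e. e i = c)"
 unfolding dfp_def
 by (intro exI[of _ "Eq (2 * i) (Suc (2 * 0))"] exI[of _ "\<lambda>_. c"]) (auto simp: mix_def)

lemma dfp_not: "dfp M P ==> dfp M (\<lambda>e. \<not> P e)"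
 unfolding dfp_def by (metis sat.simps(3))

lemma dfp_conj:
 assumes "dfp M P" "dfp M Q"
 shows "dfp M (\<lambda>e. P e \<and> Q e)"
proof -
 obtain p a where p: "range a \<subseteq> M" "\<And>e. range e \<subseteq> M ==> sat M (mix e a) p <-> P e"
  using assms(1) by (auto simp: dfp_def)
 obtain q b where q: "range b \<subseteq> M" "\<And>e. range e \<subseteq> M ==> sat M (mix e b) q <-> Q e"
  using assms(2) by (auto simp: dfp_def)
 \<comment> \<open>The two parameter sequences are interleaved in \<open>mix a b\<close>:
   \<open>r1\<close> sends the parameters of \<open>p\<close> to its even places, \<open>r2\<close>
   those of \<open>q\<close> to its odd places.\<close>
 define r1 r2 :: "nat => nat" where "r1 i = (if even i then i else Suc (2 * (2 * (i div 2))))"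
  and "r2 i = (if even i then i else Suc (2 * Suc (2 * (i div 2))))" for i
 have i1: "inj r1" and i2: "inj r2"
  unfolding r1_def[abs_def] r2_def[abs_def] by (rule inj_odd_part; simp add: inj_def)+
 have r: "mix e (mix a b) \<circ> r1 = mix e a" "mix e (mix a b) \<circ> r2 = mix e b" for e
 proof -
  have "mix e (mix a b) (r1 i) = mix e a i \<and> mix e (mix a b) (r2 i) = mix e b i" for i
  proof (cases "even i")
   case False
   then obtain j where "i = Suc (2 * j)" by (metis oddE Suc_eq_plus1)
   moreover have "r1 (Suc (2 * j)) = Suc (2 * (2 * j))" "r2 (Suc (2 * j)) = Suc (2 * Suc (2 * j))"
    by (simp_all add: r1_def r2_def)
   ultimately show ?thesis by (metis mix_simps)
  qed (simp add: r1_def r2_def mix_def)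
  thus "mix e (mix a b) \<circ> r1 = mix e a" "mix e (mix a b) \<circ> r2 = mix e b"
   by (auto simp: fun_eq_iff)
 qed
 show ?thesis unfolding dfp_def
  by (rule exI[of _ "Conj (ren r1 p) (ren r2 q)"], rule exI[of _ "mix a b"])
   (use p q in \<open>auto simp: sat_ren i1 i2 r mix_def\<close>)
qed

lemma dfp_ren:
 assumes "inj r" "dfp M Q"
 shows "dfp M (\<lambda>e. Q (\<lambda>i. e (r i)))"
proof -
 obtain p a where p: "range a \<subseteq> M" "\<And>e. range e \<subseteq> M ==> sat M (mix e a) p <-> Q e"
  using assms(2) by (auto simp: dfp_def)
 define s where "s i = (if even i then 2 * r (i div 2) else i)" for i
 have i: "inj s"
  using inj_even_part[OF assms(1)] by (simp add: s_def[abs_def])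
 have r: "mix e a \<circ> s = mix (\<lambda>i. e (r i)) a" for e
  by (auto simp: fun_eq_iff mix_def s_def)
 have "range (\<lambda>i. e (r i)) \<subseteq> M" if "range e \<subseteq> M" for e using that by auto
 thus ?thesis unfolding dfp_def
  by (intro exI[of _ "ren s p"] exI[of _ a]) (use p in \<open>auto simp: sat_ren i r\<close>)
qed

lemma dfp_all:
 assumes "dfp M (\<lambda>e. P (\<lambda>i. e (Suc i)) (e 0))"
 shows "dfp M (\<lambda>e. \<forall>x\<in>M. P e x)"
proof -
 obtain p a where a: "range a \<subseteq> M"
  and p: "\<And>e. range e \<subseteq> M ==> sat M (mix e a) p <-> P (\<lambda>i. e (Suc i)) (e 0)"
  using assms by (auto simp: dfp_def)
 define m where "m = var_bound p"
 \<comment> \<open>\<open>k\<close> is a permutation of the argument slots. The quantified slot 0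
   goes to \<open>m\<close>, slots 1 to \<open>m\<close> move down by one, and slots beyond
   \<open>m\<close> may stay because \<open>m\<close> bounds the variables of
   \<open>p\<close>.\<close>
 define k where "k j = (if j = 0 then m else if j \<le> m then j - 1 else j)" for j
 define r where "r i = (if even i then 2 * k (i div 2) else i)" for i
 have i: "inj r"
  unfolding r_def[abs_def] by (rule inj_even_part) (auto simp: inj_def k_def split: if_splits)
 have "sat M ((mix e a)(2 * m := x)) (ren r p) <-> P e x" if e: "range e \<subseteq> M" and x: "x \<in> M" for e x
 proof -
  have "sat M ((mix e a)(2 * m := x)) (ren r p) <-> sat M ((mix e a)(2 * m := x) \<circ> r) p"
   by (simp add: sat_ren i)
  also have "\<dots> <-> sat M (mix (case_nat x e) a) p"
  proof (rule sat_cong, intro allI impI)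
   fix i assume "i \<le> var_bound p"
   hence "i \<le> m" by (simp add: m_def)
   show "((mix e a)(2 * m := x) \<circ> r) i = mix (case_nat x e) a i"
   proof (cases "even i")
    case True
    then obtain j where j: "i = 2 * j" by blast
    show ?thesis
    proof (cases j)
     case 0 thus ?thesis by (simp add: j mix_def r_def k_def)
    next
     case (Suc l)
     hence "r i = 2 * l" "l < m" using \<open>i \<le> m\<close> by (auto simp: j r_def k_def)
     thus ?thesis by (simp add: j Suc mix_def)
    qed
   next
    case False
    hence "r i = i" "i \<noteq> 2 * m" by (auto simp: r_def)
    thus ?thesis using False by (simp add: mix_def)
   qed
  qed
  also have "\<dots> <-> P e x"
  proof -
   have "range (case_nat x e) \<subseteq> M" using e x by (auto simp: image_subset_iff split: nat.splits)
   from p[OF this] show ?thesis by simp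
  qed
  finally show ?thesis .
 qed
 thus ?thesis unfolding dfp_def
  by (intro exI[of _ "All (2 * m) (ren r p)"] exI[of _ a]) (use a in auto)
qed

lemma dfp_imp: "dfp M P ==> dfp M Q ==> dfp M (\<lambda>e. P e --> Q e)"
 by (rule dfp_eqI[OF dfp_not[OF dfp_conj[OF _ dfp_not]]]) auto

lemma dfp_disj:
 assumes "dfp M P" "dfp M Q"
 shows "dfp M (\<lambda>e. P e \<or> Q e)"
 by (rule dfp_eqI[OF dfp_imp[OF dfp_not[OF assms(1)] assms(2)]]) auto

lemma dfp_iff:
 assumes "dfp M P" "dfp M Q"
 shows "dfp M (\<lambda>e. P e <-> Q e)"
 by (rule dfp_eqI[OF dfp_conj[OF dfp_imp[OF assms] dfp_imp[OF assms(2,1)]]]) auto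

lemma dfp_ex: "dfp M (\<lambda>e. P (\<lambda>i. e (Suc i)) (e 0)) ==> dfp M (\<lambda>e. \<exists>x\<in>M. P e x)"
 by (rule dfp_eqI[OF dfp_not[OF dfp_all[OF dfp_not]]]) auto

lemma dfp_bool: "dfp M (\<lambda>e. c)"
proof (cases c)
 case True
 thus ?thesis by (intro dfp_eqI[OF dfp_eqvar[of 0 0]]) simp
next
 case False
 thus ?thesis by (intro dfp_eqI[OF dfp_not[OF dfp_eqvar[of 0 0]]]) simp
qed

section \<open>Definable operations and substitution\<close>

lemma dft_var: "dft M (\<lambda>e. e i)"
 unfolding dft_def by (auto intro: dfp_eqvar)

lemma dft_const: "c \<in> M ==> dft M (\<lambda>e. c)"
 unfolding dft_def by (auto intro: dfp_eqpar)

lemma dft_in: "dft M f ==> range e \<subseteq> M ==> f e \<in> M"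
 by (simp add: dft_def)

lemma dft_ren:
 assumes "inj r" "dft M f"
 shows "dft M (\<lambda>e. f (\<lambda>i. e (r i)))"
proof -
 have "inj (case_nat 0 (\<lambda>i. Suc (r i)))"
 proof (rule injI)
  fix x y assume "case_nat 0 (\<lambda>i. Suc (r i)) x = case_nat 0 (\<lambda>i. Suc (r i)) y"
  thus "x = y" using injD[OF assms(1)] by (cases x; cases y) auto
 qed
 from dfp_ren[OF this, of "\<lambda>e. e 0 = f (\<lambda>i. e (Suc i))"] assms(2)
 have "dfp M (\<lambda>e. e (case_nat 0 (\<lambda>i. Suc (r i)) 0) = f (\<lambda>i. e (case_nat 0 (\<lambda>i. Suc (r i)) (Suc i))))"
  unfolding dft_def by blast
 hence "dfp M (\<lambda>e. e 0 = f (\<lambda>i. e (Suc (r i))))" by simp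
 moreover have "f (\<lambda>i. e (r i)) \<in> M" if "range e \<subseteq> M" for e
 proof -
  have "range (\<lambda>i. e (r i)) \<subseteq> M" using that by auto
  thus ?thesis by (rule dft_in[OF assms(2)])
 qed
 ultimately show ?thesis unfolding dft_def by blast
qed

text \<open>Composition becomes an existential quantifier over the value of \<open>f\<close>, which
  is legitimate because \<open>f\<close> takes its values in \<open>M\<close>.\<close>

lemma dfp_subst:
 assumes "dfp M Q" "dft M f"
 shows "dfp M (\<lambda>e. Q (case_nat (f e) e))"
proof -
 have c: "case_nat (e 0) (\<lambda>i. e (Suc i)) = e" for e :: "nat => hset"
  by (auto simp: fun_eq_iff split: nat.splits)
 have "dfp M (\<lambda>e. \<exists>x\<in>M. x = f e \<and> Q (case_nat x e))"
 proof (rule dfp_ex, rule dfp_conj)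
  show "dfp M (\<lambda>e. e 0 = f (\<lambda>i. e (Suc i)))" using assms(2) by (simp add: dft_def)
  show "dfp M (\<lambda>e. Q (case_nat (e 0) (\<lambda>i. e (Suc i))))"
   by (rule dfp_eqI[OF assms(1)], rule arg_cong[of _ _ Q], rule c)
 qed
 thus ?thesis
  by (rule dfp_eqI) (use assms(2) in \<open>simp add: dft_def\<close>)
qed

lemma dfp_app1: "dfp M (\<lambda>e. R (e 0)) ==> dft M f ==> dfp M (\<lambda>e. R (f e))"
 using dfp_subst[of "\<lambda>e. R (e 0)" f] by simp

lemma inj_shift: "inj (\<lambda>i::nat. i + k)" by (simp add: inj_def)

lemma dfp_app2:
 assumes "dfp M (\<lambda>e. R (e 0) (e 1))" "dft M f" "dft M g"
 shows "dfp M (\<lambda>e. R (f e) (g e))"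
proof -
 have 1: "dfp M (\<lambda>e. R (f (\<lambda>i. e (Suc i))) (e 0))"
  using dfp_subst[OF assms(1) dft_ren[OF inj_shift[of 1] assms(2)]] by simp
 show ?thesis using dfp_subst[OF 1 assms(3)] by simp
qed

lemma dfp_app3:
 assumes "dfp M (\<lambda>e. R (e 0) (e 1) (e 2))" "dft M f" "dft M g" "dft M h"
 shows "dfp M (\<lambda>e. R (f e) (g e) (h e))"
proof -
 have 1: "dfp M (\<lambda>e. R (f (\<lambda>i. e (Suc (Suc i)))) (e 0) (e 1))"
  using dfp_subst[OF assms(1) dft_ren[OF inj_shift[of 2] assms(2)]] by (simp add: numeral_2_eq_2)
 have 2: "dfp M (\<lambda>e. R (f (\<lambda>i. e (Suc i))) (g (\<lambda>i. e (Suc i))) (e 0))"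
  using dfp_subst[OF 1 dft_ren[OF inj_shift[of 1] assms(3)]] by (simp)
 show ?thesis using dfp_subst[OF 2 assms(4)] by simp
qed

lemma dfp_app4:
 assumes "dfp M (\<lambda>e. R (e 0) (e 1) (e 2) (e 3))" "dft M f" "dft M g" "dft M h" "dft M k"
 shows "dfp M (\<lambda>e. R (f e) (g e) (h e) (k e))"
proof -
 have 1: "dfp M (\<lambda>e. R (f (\<lambda>i. e (i+3))) (e 0) (e 1) (e 2))"
  using dfp_subst[OF assms(1) dft_ren[OF inj_shift[of 3] assms(2)]] by (simp add: numeral_2_eq_2 numeral_3_eq_3)
 have 2: "dfp M (\<lambda>e. R (f (\<lambda>i. e (i+2))) (g (\<lambda>i. e (i+2))) (e 0) (e 1))"
  using dfp_subst[OF 1 dft_ren[OF inj_shift[of 2] assms(3)]] by (simp add: numeral_2_eq_2 numeral_3_eq_3)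
 have 3: "dfp M (\<lambda>e. R (f (\<lambda>i. e (i+1))) (g (\<lambda>i. e (i+1))) (h (\<lambda>i. e (i+1))) (e 0))"
  using dfp_subst[OF 2 dft_ren[OF inj_shift[of 1] assms(4)]] by (simp add: numeral_2_eq_2)
 show ?thesis using dfp_subst[OF 3 assms(5)] by simp
qed

lemma dftI: "(\<And>e. range e \<subseteq> M ==> f e \<in> M) ==> dfp M (\<lambda>e. e 0 = f (\<lambda>i. e (Suc i))) ==> dft M f"
 unfolding dft_def by blast

lemma dft_graph: "dft M f ==> dfp M (\<lambda>e. e 0 = f (\<lambda>i. e (Suc i)))"
 unfolding dft_def by blast

lemma dft_weak: "dft M f ==> dft M (\<lambda>e. f (\<lambda>i. e (Suc i)))"
 by (rule dft_ren[OF inj_Suc])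

lemma dft_app1:
 assumes "dft M (\<lambda>e. F (e 0))" "dft M f"
 shows "dft M (\<lambda>e. F (f e))"
proof (rule dftI)
 fix e :: "nat => hset" assume "range e \<subseteq> M"
 hence "f e \<in> M" by (rule dft_in[OF assms(2)])
 hence "range (\<lambda>_::nat. f e) \<subseteq> M" by auto
 from dft_in[OF assms(1) this] show "F (f e) \<in> M" .
next
 have "dfp M (\<lambda>e. e 0 = F (e 1))" using dft_graph[OF assms(1)] by simp
 thus "dfp M (\<lambda>e. e 0 = F (f (\<lambda>i. e (Suc i))))"
  by (rule dfp_app2[where R = "\<lambda>x y. x = F y"]) (rule dft_var dft_weak[OF assms(2)])+
qed

lemma dft_app2:
 assumes "dft M (\<lambda>e. F (e 0) (e 1))" "dft M f" "dft M g"
 shows "dft M (\<lambda>e. F (f e) (g e))"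
proof (rule dftI)
 fix e :: "nat => hset" assume e: "range e \<subseteq> M"
 have "range (case_nat (f e) (\<lambda>_. g e)) \<subseteq> M"
  using dft_in[OF assms(2) e] dft_in[OF assms(3) e] by simp
 from dft_in[OF assms(1) this] show "F (f e) (g e) \<in> M" by simp
next
 have "dfp M (\<lambda>e. e 0 = F (e 1) (e 2))" using dft_graph[OF assms(1)] by (simp add: numeral_2_eq_2)
 thus "dfp M (\<lambda>e. e 0 = F (f (\<lambda>i. e (Suc i))) (g (\<lambda>i. e (Suc i))))"
  by (rule dfp_app3[where R = "\<lambda>x y z. x = F y z"])
   (rule dft_var dft_weak[OF assms(2)] dft_weak[OF assms(3)])+
qed

lemma dft_app3:
 assumes "dft M (\<lambda>e. F (e 0) (e 1) (e 2))" "dft M f" "dft M g" "dft M h"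
 shows "dft M (\<lambda>e. F (f e) (g e) (h e))"
proof (rule dftI)
 fix e :: "nat => hset" assume e: "range e \<subseteq> M"
 have "range (case_nat (f e) (case_nat (g e) (\<lambda>_. h e))) \<subseteq> M"
  using dft_in[OF assms(2) e] dft_in[OF assms(3) e] dft_in[OF assms(4) e] by simp
 from dft_in[OF assms(1) this] show "F (f e) (g e) (h e) \<in> M" by (simp add: numeral_2_eq_2)
next
 have "dfp M (\<lambda>e. e 0 = F (e 1) (e 2) (e 3))"
  using dft_graph[OF assms(1)] by (simp add: numeral_2_eq_2 numeral_3_eq_3)
 thus "dfp M (\<lambda>e. e 0 = F (f (\<lambda>i. e (Suc i))) (g (\<lambda>i. e (Suc i))) (h (\<lambda>i. e (Suc i))))"
  by (rule dfp_app4[where R = "\<lambda>x y z u. x = F y z u"])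
   (rule dft_var dft_weak[OF assms(2)] dft_weak[OF assms(3)] dft_weak[OF assms(4)])+
qed

lemma dfp_mem: "dft M f ==> dft M g ==> dfp M (\<lambda>e. f e \<in> elts (g e))"
 by (rule dfp_app2[where R = "\<lambda>x y. x \<in> elts y"]) (rule dfp_memvar)

lemma dfp_eq: "dft M f ==> dft M g ==> dfp M (\<lambda>e. f e = g e)"
 by (rule dfp_app2[where R = "\<lambda>x y. x = y"]) (rule dfp_eqvar)

lemma dft_if:
 assumes "dfp M P" "dft M f" "dft M g"
 shows "dft M (\<lambda>e. if P e then f e else g e)"
proof (rule dftI)
 fix e :: "nat => hset" assume e: "range e \<subseteq> M"
 show "(if P e then f e else g e) \<in> M"
  using dft_in[OF assms(2) e] dft_in[OF assms(3) e] by simp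
next
 have "dfp M (\<lambda>e. (P (\<lambda>i. e (Suc i)) \<and> e 0 = f (\<lambda>i. e (Suc i))) \<or>
         (\<not> P (\<lambda>i. e (Suc i)) \<and> e 0 = g (\<lambda>i. e (Suc i))))"
  by (intro dfp_disj dfp_conj dfp_not dft_graph dfp_ren[OF inj_Suc] assms)
 thus "dfp M (\<lambda>e. e 0 = (if P (\<lambda>i. e (Suc i)) then f (\<lambda>i. e (Suc i)) else g (\<lambda>i. e (Suc i))))"
  by (rule dfp_eqI) simp
qed

end

section \<open>Closure properties of countable transitive models\<close>

lemma hset_of_inject: "countable A ==> countable B ==> hset_of A = hset_of B <-> A = B"
 by (metis elts_hset_of)

lemma hset_of_elts [simp]: "hset_of (elts x) = x"
 by (rule hset_eqI) simp

lemma elts_opair: "elts (opair a b) = {hset_of {a}, hset_of {a, b}}"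
 by (simp add: opair_def)

lemma opair_inject [simp]: "opair a b = opair c d <-> a = c \<and> b = d"
proof
 assume "opair a b = opair c d"
 hence "{hset_of {a}, hset_of {a, b}} = {hset_of {c}, hset_of {c, d}}"
  by (metis elts_opair)
 thus "a = c \<and> b = d"
  by (auto simp: doubleton_eq_iff hset_of_inject)
qed simp

lemma countable_sep [simp]: "countable {x \<in> elts a. P x}"
 by (rule countable_subset[of _ "elts a"]) auto

definition hUn :: "hset => hset" where "hUn a = hset_of (\<Union>(elts ` elts a))"
definition hun :: "hset => hset => hset" where "hun a b = hset_of (elts a \<union> elts b)"
definition hins :: "hset => hset => hset" where "hins a b = hset_of (insert a (elts b))"
definition hemp :: hset where "hemp = hset_of {}"
definition hgraph :: "hset => (hset => hset) => hset" where
 "hgraph a F = hset_of ((\<lambda>x. opair x (F x)) ` elts a)"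
text \<open>\<open>app\<close> is a definite description. The union of all values is a genuine
  set-theoretic term, defined for every argument, and it agrees with the value wherever that is
  unique.\<close>

definition ap :: "hset => hset => hset" where
 "ap f x = hUn (hset_of {y \<in> elts (hUn (hUn f)). opair x y \<in> elts f})"
definition hdom :: "hset => hset" where
 "hdom f = hset_of {x \<in> elts (hUn (hUn f)). \<exists>y\<in>elts (hUn (hUn f)). opair x y \<in> elts f}"
definition hprod :: "hset => hset => hset" where
 "hprod a b = hset_of (\<Union>x\<in>elts a. opair x ` elts b)"

lemma elts_hUn [simp]: "elts (hUn a) = \<Union>(elts ` elts a)"
 unfolding hUn_def by (subst elts_hset_of) auto
lemma elts_hun [simp]: "elts (hun a b) = elts a \<union> elts b"
 by (simp add: hun_def)
lemma elts_hins [simp]: "elts (hins a b) = insert a (elts b)"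
 by (simp add: hins_def)
lemma elts_hemp [simp]: "elts hemp = {}"
 by (simp add: hemp_def)
lemma elts_hgraph [simp]: "elts (hgraph a F) = (\<lambda>x. opair x (F x)) ` elts a"
 by (simp add: hgraph_def)
lemma elts_hprod [simp]: "elts (hprod a b) = (\<Union>x\<in>elts a. opair x ` elts b)"
 unfolding hprod_def by (subst elts_hset_of) auto

lemma opair_in_hUn:
 assumes "opair x y \<in> elts f"
 shows "x \<in> elts (hUn (hUn f))" "y \<in> elts (hUn (hUn f))"
proof -
 have "hset_of {x, y} \<in> elts (hUn f)" using assms by (auto simp: elts_opair intro!: bexI[of _ "opair x y"])
 hence "(hset_of {x, y}) \<sqsubseteq> (hUn (hUn f))" unfolding elts_hUn[of "hUn f"] by blast
 thus "x \<in> elts (hUn (hUn f))" "y \<in> elts (hUn (hUn f))" by simp_all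
qed

lemma elts_hdom [simp]: "elts (hdom f) = {x. \<exists>y. opair x y \<in> elts f}"
proof -
 have "elts (hdom f) = {x \<in> elts (hUn (hUn f)). \<exists>y\<in>elts (hUn (hUn f)). opair x y \<in> elts f}"
  unfolding hdom_def by (rule elts_sep)
 thus ?thesis using opair_in_hUn by blast
qed

lemma ap_eq:
 assumes "opair x y \<in> elts f" "\<And>z. opair x z \<in> elts f ==> z = y"
 shows "ap f x = y"
proof -
 have "{y \<in> elts (hUn (hUn f)). opair x y \<in> elts f} = {y}"
  using assms opair_in_hUn by blast
 thus ?thesis unfolding ap_def by (intro hset_eqI) simp
qed

lemma ap_hgraph [simp]: "x \<in> elts a ==> ap (hgraph a F) x = F x"
 by (rule ap_eq) auto

lemma is_fun_ap:
 assumes "is_fun f A B" "x \<in> A"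
 shows "opair x (ap f x) \<in> elts f" "ap f x \<in> B" "app f x = ap f x" "opair x y \<in> elts f <-> y = ap f x"
proof -
 have ex1: "\<exists>!b. opair x b \<in> elts f" using assms unfolding is_fun_def by (elim conjE) (rule bspec)
 define b where "b = (THE b. opair x b \<in> elts f)"
 have b1: "opair x b \<in> elts f" unfolding b_def by (rule theI'[OF ex1])
 have b2: "z = b" if "opair x z \<in> elts f" for z using ex1 b1 that by (elim ex1E) metis
 have ab: "ap f x = b" using b1 b2 by (rule ap_eq)
 show "opair x (ap f x) \<in> elts f" unfolding ab by (rule b1)
 have "\<exists>a\<in>A. \<exists>c\<in>B. opair x b = opair a c"
  using assms(1) unfolding is_fun_def by (elim conjE) (drule bspec[OF _ b1])
 thus "ap f x \<in> B" unfolding ab by (elim bexE) simp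
 show "app f x = ap f x" unfolding app_def ab b_def ..
 show "opair x y \<in> elts f <-> y = ap f x" unfolding ab by (rule iffI, erule b2, simp add: b1)
qed

lemma is_fun_hgraph: "(\<And>x. x \<in> elts a ==> F x \<in> B) ==> is_fun (hgraph a F) (elts a) B"
 unfolding is_fun_def by auto

lemma vnat_Suc: "vnat (Suc n) = hins (vnat n) (vnat n)"
 by (simp add: hins_def)

lemma vnat_0: "vnat 0 = hemp"
 by (simp add: hemp_def)

lemma elts_vnat: "elts (vnat n) = vnat ` {..<n}"
 by (induction n) (auto simp: lessThan_Suc)

lemma mem_irrefl: "x \<notin> elts x"
 using wf_not_refl[OF wf_elts, of x] by simp

lemma vnat_inject [simp]: "vnat m = vnat n <-> m = n"
proof
 assume "vnat m = vnat n"
 have m: "vnat i \<in> elts (vnat j)" if "i < j" for i j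
  using that unfolding elts_vnat[of j] by blast
 have "\<not> m < n" "\<not> n < m"
  using mem_irrefl[of "vnat n"] m[of m n] m[of n m] \<open>vnat m = vnat n\<close> by auto
 thus "m = n" by simp
qed simp

lemma vnat_mem [simp]: "vnat m \<in> elts (vnat n) <-> m < n"
 by (auto simp: elts_vnat)

lemma elts_omega [simp]: "elts omega = range vnat"
 by (simp add: omega_def)

declare vnat.simps [simp del]

named_theorems df

text \<open>Choice is kept apart: its proof in a generic extension already uses the definability
  rules for the extension, and these rest on the other axioms.\<close>

definition zf_ctm :: "hset set => bool" where
 "zf_ctm M <-> countable M \<and> transitive M \<and> M \<noteq> {} \<and> ax_extensionality M \<and> ax_foundation M \<and> ax_pairing M \<and>
   ax_union M \<and> ax_power_set M \<and> ax_infinity M \<and> ax_separation M \<and> ax_replacement M"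

locale zfmodel = fixes M :: "hset set" assumes zf: "zf_ctm M"
begin

sublocale nonempty_class M
 by standard (use zf in \<open>simp add: zf_ctm_def\<close>)

lemma countM: "A \<subseteq> M ==> countable A"
 using zf countable_subset unfolding zf_ctm_def by blast

lemma trM: "x \<in> M ==> y \<in> elts x ==> y \<in> M"
 using zf unfolding zf_ctm_def transitive_def by blast

lemma subM: "x \<in> M ==> elts x \<subseteq> M"
 using trM by blast

lemmas [df] = dfp_all dfp_ex dfp_not dfp_conj dfp_disj dfp_imp dfp_iff dfp_bool dfp_mem dfp_eq
 dft_var dft_const dft_if

lemma inM: "dft M (\<lambda>e. a) ==> a \<in> M"
 using dft_in some_env by fastforce

lemma dfp_inst:
 assumes "dfp M Q" "range b \<subseteq> M"
 shows "dfp M (\<lambda>e. Q (\<lambda>i. if i < k then e i else b i))"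
proof -
 obtain p a where p: "range a \<subseteq> M" "\<And>e. range e \<subseteq> M ==> sat M (mix e a) p <-> Q e"
  using assms(1) by (auto simp: dfp_def)
 define r where "r i = (if odd i then Suc (2 * (2 * (i div 2))) else if i div 2 < k then i
  else Suc (2 * Suc (2 * (i div 2))))" for i
 have odd: "r (Suc (2 * j)) = Suc (2 * (2 * j))" for j by (simp add: r_def)
 have even: "r (2 * j) = (if j < k then 2 * j else Suc (2 * Suc (2 * j)))" for j by (simp add: r_def)
 have ex: "\<exists>j. i = 2 * j \<or> i = Suc (2 * j)" for i :: nat by presburger
 have i: "inj r"
 proof (rule injI)
  fix x y assume xy: "r x = r y"
  obtain u v where u: "x = 2 * u \<or> x = Suc (2 * u)" and v: "y = 2 * v \<or> y = Suc (2 * v)"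
   using ex by metis
  show "x = y" using u v
  proof (elim disjE)
   assume *: "x = 2 * u" "y = 2 * v"
   show ?thesis using xy unfolding * even by (simp split: if_splits; presburger)
  next
   assume *: "x = 2 * u" "y = Suc (2 * v)"
   show ?thesis using xy unfolding * even odd by (simp split: if_splits; presburger)
  next
   assume *: "x = Suc (2 * u)" "y = 2 * v"
   show ?thesis using xy unfolding * even odd by (simp split: if_splits; presburger)
  next
   assume *: "x = Suc (2 * u)" "y = Suc (2 * v)"
   show ?thesis using xy unfolding * odd by simp
  qed
 qed
 have r: "mix e (mix a b) \<circ> r = mix (\<lambda>i. if i < k then e i else b i) a" for e
 proof
  fix i
  obtain j where "i = 2 * j \<or> i = Suc (2 * j)" using ex by metis
  thus "(mix e (mix a b) \<circ> r) i = mix (\<lambda>i. if i < k then e i else b i) a i"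
  proof
   assume *: "i = 2 * j"
   show ?thesis unfolding * comp_apply even by (simp only: mix_simps split: if_split) simp
  next
   assume *: "i = Suc (2 * j)"
   show ?thesis unfolding * comp_apply odd by (simp only: mix_simps)
  qed
 qed
 have "range (\<lambda>i. if i < k then e i else b i) \<subseteq> M" if "range e \<subseteq> M" for e
  using that assms(2) by auto
 moreover have "range (mix a b) \<subseteq> M" using p(1) assms(2) by (auto simp: mix_def)
 ultimately show ?thesis unfolding dfp_def
  by (intro exI[of _ "ren r p"] exI[of _ "mix a b"]) (simp add: sat_ren i r p(2))
qed

lemma sep:
 assumes "dfp M (\<lambda>e. P (e 0))" "a \<in> M"
 shows "hset_of {x \<in> elts a. P x} \<in> M"
proof -
 obtain p b where b: "range b \<subseteq> M"
  and p: "\<And>e. range e \<subseteq> M ==> sat M (mix e b) p <-> P (e 0)"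
  using assms(1) by (auto simp: dfp_def)
 define e where "e = mix (\<lambda>_. a) b"
 have e: "range e \<subseteq> M" using b assms(2) by (auto simp: e_def mix_def)
 have "e(0 := x) = mix ((\<lambda>_. a)(0 := x)) b" for x
 proof
  fix i :: nat
  show "(e(0 := x)) i = mix ((\<lambda>_. a)(0 := x)) b i"
  proof (cases "even i")
   case True
   then obtain k where "i = 2 * k" by blast
   thus ?thesis by (simp add: e_def mix_def)
  qed (auto simp: e_def mix_def)
 qed
 moreover have "range ((\<lambda>_. a)(0 := x)) \<subseteq> M" if "x \<in> M" for x :: hset
  using that assms(2) by auto
 ultimately have s: "sat M (e(0 := x)) p <-> P x" if "x \<in> M" for x
  using p[of "(\<lambda>_. a)(0 := x)"] that by (metis fun_upd_same)
 have "ax_separation M" using zf by (simp add: zf_ctm_def)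
 then obtain c where c: "c \<in> M" "\<forall>x\<in>M. x \<in> elts c <-> x \<in> elts a \<and> sat M (e(0 := x)) p"
  unfolding ax_separation_def using e assms(2) by blast
 hence "elts c = {x \<in> elts a. P x}"
  using s subM[OF c(1)] subM[OF assms(2)] by blast
 thus ?thesis using c(1) by (metis hset_of_elts)
qed

lemma repl:
 assumes "dfp M (\<lambda>e. R (e 0) (e 1))" "a \<in> M"
  and f: "\<And>x. x \<in> elts a ==> f x \<in> M" "\<And>x y. x \<in> elts a ==> y \<in> M ==> R x y <-> y = f x"
 shows "hset_of (f ` elts a) \<in> M"
proof -
 obtain p b where b: "range b \<subseteq> M"
  and p: "\<And>e. range e \<subseteq> M ==> sat M (mix e b) p <-> R (e 0) (e 1)"
  using assms(1) by (auto simp: dfp_def)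
 \<comment> \<open>\<open>mix\<close> puts the two arguments at the variables 0 and 2 while the
   axiom reads them at 0 and 1, hence this transposition.\<close>
 define r :: "nat => nat" where "r i = (if i = 1 then 2 else if i = 2 then 1 else i)" for i
 have r: "inj r" by (auto simp: inj_def r_def)
 define e where "e = mix (\<lambda>_. a) b \<circ> r"
 have e: "range e \<subseteq> M" using b assms(2) by (auto simp: e_def mix_def)
 have eq: "e(0 := x, 1 := y) \<circ> r = mix ((\<lambda>_. a)(0 := x, 1 := y)) b" (is "_ = mix ?E b") for x y
 proof
  fix i :: nat
  consider "i = 0" | "i = 1" | "i = 2" | "i > 2" by linarith
  thus "(e(0 := x, 1 := y) \<circ> r) i = mix ?E b i"
  proof cases
   case 4
   show ?thesis
   proof (cases "even i")
    case True
    then obtain k where "i = 2 * k" by blast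
    thus ?thesis using 4 by (simp add: e_def mix_def r_def)
   qed (use 4 in \<open>simp add: e_def mix_def r_def\<close>)
  qed (simp_all add: e_def mix_def r_def)
 qed
 have s: "sat M (e(0 := x, 1 := y)) (ren r p) <-> R x y" if "x \<in> M" "y \<in> M" for x y
 proof -
  let ?E = "(\<lambda>_. a)(0 := x, 1 := y) :: nat => hset"
  have rE: "range ?E \<subseteq> M" using that assms(2) by auto
  have "sat M (e(0 := x, 1 := y)) (ren r p) = sat M (mix ?E b) p"
   unfolding sat_ren[OF r] eq ..
  also have "\<dots> = R (?E 0) (?E 1)" by (rule p[OF rE])
  finally show ?thesis by simp
 qed
 have ex1: "\<exists>!y. y \<in> M \<and> sat M (e(0 := x, 1 := y)) (ren r p)" if "x \<in> M" "x \<in> elts a" for x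
 proof (rule ex1I[of _ "f x"], intro conjI)
  show "f x \<in> M" by (rule f(1)[OF that(2)])
  thus "sat M (e(0 := x, 1 := f x)) (ren r p)"
   unfolding s[OF that(1) \<open>f x \<in> M\<close>] f(2)[OF that(2) \<open>f x \<in> M\<close>] by simp
 next
  fix y assume "y \<in> M \<and> sat M (e(0 := x, 1 := y)) (ren r p)"
  thus "y = f x" using s[OF that(1)] f(2)[OF that(2)] by blast
 qed
 have "ax_replacement M" using zf by (simp add: zf_ctm_def)
 note ax = this[unfolded ax_replacement_def, rule_format]
 from ax[OF e assms(2) ex1] obtain c where c: "c \<in> M"
  and c2': "\<forall>y\<in>M. y \<in> elts c <-> (\<exists>x\<in>M. x \<in> elts a \<and> sat M (e(0 := x, 1 := y)) (ren r p))"
  by (rule bexE)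
 note c2 = c2'[rule_format]
 have "y \<in> elts c <-> y \<in> f ` elts a" if y: "y \<in> M" for y
 proof -
  have "sat M (e(0 := x, 1 := y)) (ren r p) <-> y = f x" if "x \<in> elts a" "x \<in> M" for x
   using s[OF that(2) y] f(2)[OF that(1) y] by simp
  thus ?thesis unfolding c2[OF y] using trM[OF assms(2)] by blast
 qed
 moreover have "f ` elts a \<subseteq> M" using f(1) by blast
 ultimately have "elts c = f ` elts a" using subM[OF c] by blast
 thus ?thesis using c by (metis hset_of_elts)
qed

lemma eq_iff_M: "a \<in> M ==> b \<in> M ==> a = b <-> (\<forall>x\<in>M. x \<in> elts a <-> x \<in> elts b)"
 using subM[of a] subM[of b] by (intro iffI) (simp, rule hset_eqI, blast)

text \<open>By extensionality the graph of \<open>f\<close> says that both sides have the same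
  members in \<open>M\<close>, so only membership in the value has to be defined.\<close>

lemma dft_ext:
 assumes "\<And>e. range e \<subseteq> M ==> f e \<in> M"
  and "\<And>e x. range e \<subseteq> M ==> x \<in> M ==> x \<in> elts (f e) <-> P e x"
  and "dfp M (\<lambda>e. P (\<lambda>i. e (Suc i)) (e 0))"
 shows "dft M f"
proof (rule dftI)
 have i: "inj (\<lambda>i. case i of 0 => 0 | Suc j => Suc (Suc j))"
 proof (rule injI)
  fix x y :: nat assume "(case x of 0 => 0 | Suc j => Suc (Suc j)) = (case y of 0 => 0 | Suc j => Suc (Suc j))"
  thus "x = y" by (cases x; cases y) auto
 qed
 have P: "dfp M (\<lambda>e. P (\<lambda>i. e (Suc (Suc i))) (e 0))"
  using dfp_ren[OF i assms(3)] by simp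
 have "dfp M (\<lambda>e. \<forall>x\<in>M. x \<in> elts (e 0) <-> P (\<lambda>i. e (Suc i)) x)"
  by (intro dfp_all dfp_iff dfp_memvar P)
 thus "dfp M (\<lambda>e. e 0 = f (\<lambda>i. e (Suc i)))"
 proof (rule dfp_eqI)
  fix e :: "nat => hset" assume e: "range e \<subseteq> M"
  have e': "range (\<lambda>i. e (Suc i)) \<subseteq> M" using e by auto
  have "e 0 \<in> M" using e by auto
  moreover have "f (\<lambda>i. e (Suc i)) \<in> M" by (rule assms(1)[OF e'])
  ultimately have "e 0 = f (\<lambda>i. e (Suc i)) <-> (\<forall>x\<in>M. x \<in> elts (e 0) <-> x \<in> elts (f (\<lambda>i. e (Suc i))))"
   by (rule eq_iff_M)
  thus "(e 0 = f (\<lambda>i. e (Suc i))) = (\<forall>x\<in>M. x \<in> elts (e 0) <-> P (\<lambda>i. e (Suc i)) x)"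
   using assms(2)[OF e'] by simp
 qed
qed (fact assms(1))

lemma dfp_ball [df]:
 assumes "dft M f" "dfp M (\<lambda>e. P (\<lambda>i. e (Suc i)) (e 0))"
 shows "dfp M (\<lambda>e. \<forall>x\<in>elts (f e). P e x)"
proof -
 have "dfp M (\<lambda>e. \<forall>x\<in>M. x \<in> elts (f e) --> P e x)"
  by (intro dfp_all dfp_imp dfp_mem dft_var dft_weak[OF assms(1)] assms(2))
 thus ?thesis
 proof (rule dfp_eqI)
  fix e :: "nat => hset" assume "range e \<subseteq> M"
  from subM[OF dft_in[OF assms(1) this]]
  show "(\<forall>x\<in>elts (f e). P e x) = (\<forall>x\<in>M. x \<in> elts (f e) --> P e x)" by blast
 qed
qed

lemma dfp_bex [df]:
 assumes "dft M f" "dfp M (\<lambda>e. P (\<lambda>i. e (Suc i)) (e 0))"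
 shows "dfp M (\<lambda>e. \<exists>x\<in>elts (f e). P e x)"
 by (rule dfp_eqI[OF dfp_not[OF dfp_ball[OF assms(1) dfp_not[OF assms(2)]]]]) auto

lemma dfp_subset [df]: "dft M f ==> dft M g ==> dfp M (\<lambda>e. f e \<sqsubseteq> g e)"
 by (rule dfp_app2[where R = "\<lambda>x y. x \<sqsubseteq> y"], unfold subset_eq) (intro dfp_ball dfp_mem dft_var)

section \<open>Set operations as definable terms\<close>

lemma pair_inM: "a \<in> M ==> b \<in> M ==> hset_of {a, b} \<in> M"
proof -
 assume ab: "a \<in> M" "b \<in> M"
 have "ax_pairing M" using zf by (simp add: zf_ctm_def)
 note ax = this[unfolded ax_pairing_def, THEN bspec, OF ab(1), THEN bspec, OF ab(2)]
 then obtain c where c: "c \<in> M" "\<forall>x\<in>M. x \<in> elts c <-> x = a \<or> x = b"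
  by (rule bexE)
 hence "elts c = {a, b}" using subM[OF c(1)] ab by blast
 thus ?thesis using c(1) by (metis hset_of_elts)
qed

lemma hUn_inM:
 assumes a: "a \<in> M"
 shows "hUn a \<in> M"
proof -
 have "ax_union M" using zf by (simp add: zf_ctm_def)
 note ax = this[unfolded ax_union_def, THEN bspec, OF a]
 then obtain c where c: "c \<in> M" and c2: "\<forall>x\<in>M. x \<in> elts c <-> (\<exists>y\<in>M. y \<in> elts a \<and> x \<in> elts y)"
  by (rule bexE)
 have "x \<in> elts c <-> x \<in> elts (hUn a)" if "x \<in> M" for x
  using bspec[OF c2 that] trM[OF a] by auto
 moreover have "elts (hUn a) \<subseteq> M" using trM[OF trM[OF a]] by auto
 ultimately have "elts c = elts (hUn a)" using subM[OF c] by blast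
 thus ?thesis using c by (metis hset_of_elts)
qed

definition hPow :: "hset => hset" where "hPow a = hset_of {x \<in> M. x \<sqsubseteq> a}"

lemma elts_hPow [simp]: "elts (hPow a) = {x \<in> M. x \<sqsubseteq> a}"
 unfolding hPow_def by (rule elts_hset_of) (rule countM, auto)

lemma hPow_inM:
 assumes a: "a \<in> M"
 shows "hPow a \<in> M"
proof -
 have "ax_power_set M" using zf by (simp add: zf_ctm_def)
 note ax = this[unfolded ax_power_set_def, THEN bspec, OF a]
 then obtain c where c: "c \<in> M" and c2: "\<forall>x\<in>M. x \<in> elts c <-> (\<forall>y\<in>M. y \<in> elts x --> y \<in> elts a)"
  by (rule bexE)
 have "x \<in> elts c <-> x \<in> elts (hPow a)" if "x \<in> M" for x
  using bspec[OF c2 that] subM[OF that] that by auto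
 hence "elts c = elts (hPow a)" using subM[OF c] by auto
 thus ?thesis using c by (metis hset_of_elts)
qed

lemma dft_pair [df]:
 assumes "dft M f" "dft M g"
 shows "dft M (\<lambda>e. hset_of {f e, g e})"
 by (rule dft_ext[where P = "\<lambda>e x. x = f e \<or> x = g e"])
  (use dft_in[OF assms(1)] dft_in[OF assms(2)] pair_inM in simp,
   simp, intro dfp_disj dfp_eq dft_var dft_weak[OF assms(1)] dft_weak[OF assms(2)])

lemma dft_single [df]: "dft M f ==> dft M (\<lambda>e. hset_of {f e})"
 using dft_pair[of f f] by simp

lemma dft_opair [df]: "dft M f ==> dft M g ==> dft M (\<lambda>e. opair (f e) (g e))"
 unfolding opair_def by (intro dft_pair dft_single)

lemma dft_hUn [df]: "dft M f ==> dft M (\<lambda>e. hUn (f e))"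
proof (rule dft_app1[where F = hUn])
 show "dft M (\<lambda>e. hUn (e 0))"
 proof (rule dft_ext[where P = "\<lambda>e x. \<exists>y\<in>elts (e 0). x \<in> elts y"])
  show "dfp M (\<lambda>e. \<exists>y\<in>elts (e (Suc 0)). e 0 \<in> elts y)"
   by (intro df)
 qed (simp_all add: hUn_inM image_subset_iff)
qed

lemma dft_hPow [df]: "dft M f ==> dft M (\<lambda>e. hPow (f e))"
proof (rule dft_app1[where F = hPow])
 show "dft M (\<lambda>e. hPow (e 0))"
  by (rule dft_ext[where P = "\<lambda>e x. x \<sqsubseteq> e 0"]) (simp_all add: hPow_inM image_subset_iff dfp_subset dft_var)
qed

lemma dft_hun [df]:
 assumes "dft M f" "dft M g"
 shows "dft M (\<lambda>e. hun (f e) (g e))"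
proof -
 have "hun a b = hUn (hset_of {a, b})" for a b by (rule hset_eqI) simp
 thus ?thesis by (simp only:) (intro df assms)
qed

lemma dft_hins [df]:
 assumes "dft M f" "dft M g"
 shows "dft M (\<lambda>e. hins (f e) (g e))"
proof -
 have "hins a b = hun (hset_of {a}) b" for a b by (rule hset_eqI) simp
 thus ?thesis by (simp only:) (intro df assms)
qed

lemma dft_sep [df]:
 assumes "dft M f" "dfp M (\<lambda>e. P (\<lambda>i. e (Suc i)) (e 0))"
 shows "dft M (\<lambda>e. hset_of {x \<in> elts (f e). P e x})"
proof (rule dft_ext[where P = "\<lambda>e x. x \<in> elts (f e) \<and> P e x"])
 fix e :: "nat => hset" assume e: "range e \<subseteq> M"
 hence "range (case_nat (e 0) e) \<subseteq> M" by auto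
 from dfp_inst[OF assms(2) this, of 1] have "dfp M (\<lambda>E. P e (E 0))" by simp
 thus "hset_of {x \<in> elts (f e). P e x} \<in> M"
  by (rule sep) (rule dft_in[OF assms(1) e])
qed (simp, intro df dft_weak[OF assms(1)] assms(2))

lemma dft_repl [df]:
 assumes "dft M f" "dft M (\<lambda>e. F (\<lambda>i. e (Suc i)) (e 0))"
 shows "dft M (\<lambda>e. hset_of (F e ` elts (f e)))"
proof (rule dft_ext[where P = "\<lambda>e y. \<exists>x\<in>elts (f e). y = F e x"])
 fix e :: "nat => hset" assume e: "range e \<subseteq> M"
 have F: "F e x \<in> M" if "x \<in> M" for x
  using dft_in[OF assms(2), of "case_nat x e"] e that by simp
 have "range (case_nat (e 0) (case_nat (e 0) e)) \<subseteq> M" using e by auto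
 from dfp_inst[OF dft_graph[OF assms(2)] this, of 2]
 have "dfp M (\<lambda>E. E 0 = F e (E 1))" by (simp add: numeral_2_eq_2)
 hence "dfp M (\<lambda>E. E 1 = F e (E 0))"
  by (rule dfp_app2[where R = "\<lambda>y x. y = F e x"]) (rule dft_var)+
 thus "hset_of (F e ` elts (f e)) \<in> M"
 proof (rule repl)
  show fe: "f e \<in> M" by (rule dft_in[OF assms(1) e])
  show "F e x \<in> M" if "x \<in> elts (f e)" for x by (rule F, rule trM[OF fe that])
 qed simp
next
 have "inj (case_nat 0 (\<lambda>i. Suc (Suc i)))"
 proof (rule injI)
  fix x y :: nat assume "case_nat 0 (\<lambda>i. Suc (Suc i)) x = case_nat 0 (\<lambda>i. Suc (Suc i)) y"
  thus "x = y" by (cases x; cases y) auto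
 qed
 from dft_ren[OF this assms(2)]
 have "dft M (\<lambda>e. F (\<lambda>i. e (Suc (Suc i))) (e 0))" by simp
 thus "dfp M (\<lambda>e. \<exists>x\<in>elts (f (\<lambda>i. e (Suc i))). e 0 = F (\<lambda>i. e (Suc i)) x)"
  by (intro dfp_bex dfp_eq dft_weak[OF assms(1)] dft_var)
qed auto

lemma dft_UN [df]:
 assumes "dft M f" "dft M (\<lambda>e. F (\<lambda>i. e (Suc i)) (e 0))"
 shows "dft M (\<lambda>e. hset_of (\<Union>x\<in>elts (f e). elts (F e x)))"
proof -
 have "hset_of (\<Union>x\<in>elts (f e). elts (F e x)) = hUn (hset_of (F e ` elts (f e)))" for e
  by (simp add: hUn_def)
 thus ?thesis using dft_hUn[OF dft_repl[OF assms]] by simp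
qed

lemma dft_hgraph [df]: "dft M f ==> dft M (\<lambda>e. F (\<lambda>i. e (Suc i)) (e 0)) ==> dft M (\<lambda>e. hgraph (f e) (F e))"
 unfolding hgraph_def by (intro df)

lemma dft_ap [df]: "dft M f ==> dft M g ==> dft M (\<lambda>e. ap (f e) (g e))"
 by (rule dft_app2[where F = ap], unfold ap_def) (intro df)

lemma dft_hdom [df]: "dft M f ==> dft M (\<lambda>e. hdom (f e))"
 by (rule dft_app1[where F = hdom], unfold hdom_def) (intro df)

lemma dft_hprod [df]: "dft M f ==> dft M g ==> dft M (\<lambda>e. hprod (f e) (g e))"
proof (rule dft_app2[where F = hprod])
 have "hprod a b = hset_of (\<Union>x\<in>elts a. elts (hset_of ((\<lambda>y. opair x y) ` elts b)))" for a b
  by (simp add: hprod_def)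
 thus "dft M (\<lambda>e. hprod (e 0) (e 1))"
  by (simp only:) (intro df)
qed

end

text \<open>The unbounded unique existence in \<open>is_fun\<close> is traded for the term
  \<open>ap f a\<close>, after which all quantifiers range over sets.\<close>

lemma is_fun_iff:
 "is_fun f (elts A) (elts B) <-> (\<forall>z\<in>elts f. \<exists>a\<in>elts A. \<exists>b\<in>elts B. z = opair a b) \<and>
   (\<forall>a\<in>elts A. opair a (ap f a) \<in> elts f \<and> (\<forall>b\<in>elts B. opair a b \<in> elts f --> b = ap f a))"
 (is "?l <-> ?r1 \<and> ?r2")
proof
 assume l: ?l
 have ?r1 using l unfolding is_fun_def by (rule conjunct1)
 moreover have ?r2 using is_fun_ap(1)[OF l] is_fun_ap(4)[OF l] by simp
 ultimately show "?r1 \<and> ?r2" ..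
next
 assume r: "?r1 \<and> ?r2"
 have "\<exists>!b. opair a b \<in> elts f" if a: "a \<in> elts A" for a
 proof (rule ex1I)
  show "opair a (ap f a) \<in> elts f" using r a by simp
  fix b assume b: "opair a b \<in> elts f"
  from bspec[OF conjunct1[OF r] b] have "b \<in> elts B" by (elim bexE) simp
  thus "b = ap f a" using r a b by simp
 qed
 thus ?l using conjunct1[OF r] unfolding is_fun_def by simp
qed

lemma hgraph_cong: "a = b ==> (\<And>x. x \<in> elts b ==> F x = G x) ==> hgraph a F = hgraph b G"
 by (rule hset_eqI) simp

subsection \<open>Transitive closure\<close>

definition TC :: "hset => hset" where
 "TC x = hset_of {y. (y, x) \<in> {(x, y). x \<in> elts y}\<^sup>+}"

lemma elt_trancl_unfold:
 "{y. (y, x) \<in> {(x, y). x \<in> elts y}\<^sup>+} = (\<Union>y\<in>elts x. insert y {z. (z, y) \<in> {(x, y). x \<in> elts y}\<^sup>+})"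
 by (auto elim: tranclE intro: trancl.intros)

lemma countable_elt_trancl: "countable {y. (y, x) \<in> {(x, y). x \<in> elts y}\<^sup>+}"
proof (induction x rule: wf_induct_rule[OF wf_elts])
 case (1 x)
 thus ?case by (subst elt_trancl_unfold) simp
qed

lemma elts_TC': "elts (TC x) = {y. (y, x) \<in> {(x, y). x \<in> elts y}\<^sup>+}"
 unfolding TC_def by (rule elts_hset_of[OF countable_elt_trancl])

lemma elts_TC: "elts (TC x) = (\<Union>y\<in>elts x. insert y (elts (TC y)))"
 unfolding elts_TC' by (rule elt_trancl_unfold)

lemma TC_eq: "TC x = hun x (hUn (hset_of (TC ` elts x)))"
 by (rule hset_eqI) (subst elts_TC, auto)

lemma TC_induct [case_names step]:
 "(\<And>x. (\<And>y. y \<in> elts (TC x) ==> P y) ==> P x) ==> P x"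
 by (rule wf_induct_rule[OF wf_trancl[OF wf_elts]]) (simp add: elts_TC')

lemma elts_induct [case_names step]:
 "(\<And>x. (\<And>y. y \<in> elts x ==> P y) ==> P x) ==> P x"
 by (rule wf_induct_rule[OF wf_elts]) simp

lemma elts_sub_TC: "y \<in> elts x ==> y \<in> elts (TC x)"
 by (subst elts_TC) blast

lemma TC_step: "z \<in> elts y ==> y \<in> elts (TC x) ==> z \<in> elts (TC x)"
 unfolding elts_TC' using trancl_into_trancl2[of z y] by simp

lemma transitive_TC: "transitive (elts (TC x))"
 unfolding transitive_def using TC_step by (intro ballI subsetI)

lemma TC_trans: "y \<in> elts (TC x) ==> TC y \<sqsubseteq> TC x"
 unfolding elts_TC' by auto

lemma TC_least:
 assumes "transitive (elts z)" "x \<sqsubseteq> z"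
 shows "TC x \<sqsubseteq> z"
 using assms(2)
proof (induction x rule: elts_induct)
 case (step x)
 have "TC y \<sqsubseteq> z" if "y \<in> elts x" for y
  using step.IH[OF that] step.prems that assms(1) unfolding transitive_def by auto
 thus ?case using step.prems by (subst elts_TC) blast
qed

lemma TC_sub_transitive: "transitive (elts d) ==> x \<in> elts d ==> TC x \<sqsubseteq> d"
 by (rule TC_least) (auto simp: transitive_def)

text \<open>The level of the cumulative hierarchy of \<open>M\<close> at the rank of
  \<open>x\<close>, by recursion on \<open>x\<close> itself, so that neither ordinals nor ranks have
  to be developed.\<close>

function vv :: "hset set => hset => hset" where
 "vv M x = hset_of (\<Union>y\<in>elts x. {u \<in> M. u \<sqsubseteq> vv M y})"
 by auto
termination
 by (relation "inv_image {(x, y). x \<in> elts y} snd") (auto intro: wf_inv_image wf_elts)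
declare vv.simps [simp del]

context zfmodel
begin

lemma hemp_inM [simp]: "hemp \<in> M"
proof -
 obtain a where "a \<in> M" using nonempty by blast
 hence "hset_of {x \<in> elts a. False} \<in> M" by (intro sep dfp_bool)
 thus ?thesis by (simp add: hemp_def)
qed

lemma inM_simps [simp]:
 "a \<in> M ==> b \<in> M ==> opair a b \<in> M"
 "a \<in> M ==> b \<in> M ==> hun a b \<in> M"
 "a \<in> M ==> b \<in> M ==> hins a b \<in> M"
 "a \<in> M ==> b \<in> M ==> hprod a b \<in> M"
 "a \<in> M ==> b \<in> M ==> ap a b \<in> M"
 "a \<in> M ==> hUn a \<in> M"
 "a \<in> M ==> hPow a \<in> M"
 "a \<in> M ==> hdom a \<in> M"
 "a \<in> M ==> hset_of {a} \<in> M"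
 by (rule inM, (intro df; assumption))+

lemma finite_inM: "finite A ==> A \<subseteq> M ==> hset_of A \<in> M"
proof (induction A rule: finite_induct)
 case empty
 thus ?case using hemp_inM by (simp add: hemp_def)
next
 case (insert x A)
 have "hset_of (insert x A) = hins x (hset_of A)"
  by (rule hset_eqI) (simp add: countable_finite insert.hyps)
 thus ?case using insert by simp
qed

lemma vnat_inM [simp]: "vnat n \<in> M"
 by (induction n) (simp_all add: vnat_0 vnat_Suc)

lemma omega_inM [simp]: "omega \<in> M"
proof -
 define I where "I b <-> hemp \<in> elts b \<and> (\<forall>y\<in>elts b. hins y y \<in> elts b)" for b
 have "ax_infinity M" using zf by (simp add: zf_ctm_def)
 then obtain a z where a: "a \<in> M" and z: "z \<in> M" "z \<in> elts a" "\<forall>x\<in>M. x \<notin> elts z"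
  and s: "\<forall>y\<in>M. y \<in> elts a --> (\<exists>s\<in>M. s \<in> elts a \<and> (\<forall>x\<in>M. x \<in> elts s <-> x \<in> elts y \<or> x = y))"
  unfolding ax_infinity_def by (elim bexE conjE) simp
 have "z = hemp" using z subM[OF z(1)] by (intro hset_eqI) auto
 moreover have "hins y y \<in> elts a" if y: "y \<in> elts a" for y
 proof -
  have yM: "y \<in> M" by (rule trM[OF a y])
  obtain t where t: "t \<in> M" "t \<in> elts a" "\<forall>x\<in>M. x \<in> elts t <-> x \<in> elts y \<or> x = y"
   using bspec[OF s yM] y by (elim impE bexE) auto
  have "x \<in> elts t <-> x \<in> elts (hins y y)" if "x \<in> M" for x
   using t(3) that by auto
  hence "t = hins y y" using eq_iff_M[OF t(1), of "hins y y"] yM by simp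
  thus ?thesis using t(2) by simp
 qed
 ultimately have Ia: "I a" using z(2) unfolding I_def by simp
 define o' where "o' = hset_of {x \<in> elts a. \<forall>b\<in>M. I b --> x \<in> elts b}"
 have oM: "o' \<in> M" unfolding o'_def I_def by (rule inM, intro df a hemp_inM)
 have elo: "elts o' = {x \<in> elts a. \<forall>b\<in>M. I b --> x \<in> elts b}" unfolding o'_def by simp
 have vI: "vnat n \<in> elts b" if "I b" for n b
  using that by (induction n) (simp_all add: I_def vnat_0 vnat_Suc)
 have Io: "I o'" using Ia unfolding I_def elo by simp
 have "elts o' \<subseteq> range vnat"
 proof (rule ccontr)
  assume "\<not> elts o' \<subseteq> range vnat"
  then obtain u0 where u0: "u0 \<in> elts o' - range vnat" by blast
  obtain u where u: "u \<in> elts o' - range vnat"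
   and min: "\<And>y. (y, u) \<in> {(x, y). x \<in> elts y} ==> y \<notin> elts o' - range vnat"
   by (rule wfE_min[OF wf_elts u0]) blast
  \<comment> \<open>Deleting an \<in>-minimal non-numeral \<open>u\<close> keeps the set inductive,
    as a predecessor of \<open>u\<close> would be a numeral and then so would \<open>u\<close>. This
    contradicts that \<open>o'\<close> is the least inductive set.\<close>
  define b where "b = hset_of {x \<in> elts o'. x \<noteq> u}"
  have uM: "u \<in> M" using u trM[OF oM] by simp
  have bM: "b \<in> M" unfolding b_def by (rule inM, intro df oM uM)
  have eb: "elts b = {x \<in> elts o'. x \<noteq> u}" unfolding b_def by simp
  have "hemp \<noteq> u" using u vnat_0 by (metis DiffD2 rangeI)
  moreover have "hins y y \<noteq> u" if y: "y \<in> elts o'" for y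
  proof
   assume yu: "hins y y = u"
   hence "y \<in> elts u" by (metis elts_hins insertI1)
   hence "y \<in> range vnat" using min[of y] y by simp
   then obtain n where "y = vnat n" by blast
   hence "u = vnat (Suc n)" using yu by (simp add: vnat_Suc)
   thus False using u by simp
  qed
  ultimately have "I b" using Io unfolding I_def eb by simp
  hence "u \<in> elts b" using u bM unfolding elo by simp
  thus False by (simp add: b_def)
 qed
 hence "elts o' = range vnat" using vI[OF Io] by auto
 hence "o' = omega" by (intro hset_eqI) simp
 thus ?thesis using oM by simp
qed

lemma dfp_is_fun [df]:
 "dft M f ==> dft M g ==> dft M h ==> dfp M (\<lambda>e. is_fun (f e) (elts (g e)) (elts (h e)))"
 by (rule dfp_app3[where R = "\<lambda>f g h. is_fun f (elts g) (elts h)"], unfold is_fun_iff) (intro df)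

lemma dfp_transitive [df]: "dft M f ==> dfp M (\<lambda>e. transitive (elts (f e)))"
 by (rule dfp_app1[where R = "\<lambda>x. transitive (elts x)"], unfold transitive_def) (intro df)

lemma dfp_is_ord [df]: "dft M f ==> dfp M (\<lambda>e. is_ord (f e))"
 by (rule dfp_app1[where R = is_ord], unfold is_ord_def) (intro df)

text \<open>A first-order description within \<open>M\<close>. Definability of \<open>TC\<close>
  cannot come from \<open>recursion\<close>, whose statement already involves
  \<open>TC\<close>.\<close>

definition isTC :: "hset => hset => bool" where
 "isTC y z <-> y \<sqsubseteq> z \<and> transitive (elts z) \<and>
   (\<forall>z'\<in>M. transitive (elts z') --> y \<sqsubseteq> z' --> z \<sqsubseteq> z')"

lemma isTC_iff: "TC y \<in> M ==> z \<in> M ==> isTC y z <-> z = TC y"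
proof
 assume *: "TC y \<in> M" "z \<in> M" "isTC y z"
 have "y \<sqsubseteq> TC y" using elts_sub_TC by blast
 hence "z \<sqsubseteq> TC y" using * transitive_TC unfolding isTC_def by simp
 moreover have "TC y \<sqsubseteq> z" using * TC_least unfolding isTC_def by simp
 ultimately show "z = TC y" by (intro hset_eqI) simp
next
 assume "z = TC y"
 thus "isTC y z" unfolding isTC_def using TC_least transitive_TC elts_sub_TC by auto
qed

lemma dfp_isTC: "dfp M (\<lambda>e. isTC (e i) (e j))"
 unfolding isTC_def by (intro df)

lemma TC_inM [simp]: "x \<in> M ==> TC x \<in> M"
proof (induction x rule: elts_induct)
 case (step x)
 have T: "TC y \<in> M" if "y \<in> elts x" for y by (rule step.IH[OF that trM[OF step.prems that]])
 have "hset_of (TC ` elts x) \<in> M"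
  by (rule repl[where R = isTC]) (simp_all add: dfp_isTC[of 0 1, simplified] step.prems T isTC_iff)
 thus ?case unfolding TC_eq[of x] using step.prems by simp
qed

lemma dft_TC [df]: "dft M f ==> dft M (\<lambda>e. TC (f e))"
proof (rule dft_app1[where F = TC])
 show "dft M (\<lambda>e. TC (e 0))"
 proof (rule dftI)
  show "dfp M (\<lambda>e. e 0 = TC (e (Suc 0)))"
   by (rule dfp_eqI[OF dfp_isTC[of 1 0]]) (simp add: isTC_iff image_subset_iff)
 qed (simp add: image_subset_iff)
qed

subsection \<open>Recursion inside the model\<close>

text \<open>Recursion by approximations: \<open>att a f d\<close> says that \<open>f\<close> obeys
  the equation on a transitive set \<open>d\<close>. Approximations agree by induction, and
  replacement glues them to one at the next set. The equation may consult all of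
  \<open>TC x\<close>, which the forcing relation needs; \<open>a\<close> is a parameter.\<close>

lemma recursion:
 assumes Phi: "dft M (\<lambda>e. \<Phi> (e 0) (e 1) (e 2))"
  and H: "\<And>a x. a \<in> M ==> x \<in> M ==> H a x = \<Phi> a x (hgraph (TC x) (H a))"
 shows "dft M (\<lambda>e. H (e 0) (e 1))"
proof -
 note P3 = dft_app3[OF Phi]
 define att where "att a f d <-> transitive (elts d) \<and>
  (\<forall>x\<in>elts d. ap f x = \<Phi> a x (hgraph (TC x) (\<lambda>y. ap f y)))" for a f d
 define R where "R a x z <-> (\<exists>f\<in>M. \<exists>d\<in>M. att a f d \<and> x \<in> elts d \<and> z = ap f x)" for a x z
 have dR: "dfp M (\<lambda>e. R (e i) (e j) (e k))" for i j k
  unfolding R_def att_def by (intro df P3)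
 have PM: "\<Phi> a x f \<in> M" if "a \<in> M" "x \<in> M" "f \<in> M" for a x f
  by (rule inM, intro P3 dft_const that)
 have uniq: "ap f x = H a x" if "att a f d" "a \<in> M" "d \<in> M" "x \<in> elts d" for a f d x
  using that(4)
 proof (induction x rule: TC_induct)
  case (step x)
  have sub: "TC x \<sqsubseteq> d"
   using that(1) step.prems unfolding att_def by (intro TC_sub_transitive) simp_all
  have "hgraph (TC x) (\<lambda>y. ap f y) = hgraph (TC x) (H a)"
   by (rule hgraph_cong[OF refl], rule step.IH) (use sub in blast)+
  hence "ap f x = \<Phi> a x (hgraph (TC x) (H a))"
   using that(1) step.prems unfolding att_def by simp
  thus ?case using H[OF that(2) trM[OF that(3) step.prems]] by simp
 qed
 have RH: "R a x z ==> a \<in> M ==> z = H a x" for a x z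
  unfolding R_def by (elim bexE conjE) (simp only: uniq)
 have ex: "R a x (H a x) \<and> H a x \<in> M" if a: "a \<in> M" and "x \<in> M" for a x
  using that(2)
 proof (induction x rule: TC_induct)
  case (step x)
  have yM: "y \<in> M" if "y \<in> elts (TC x)" for y using trM[OF TC_inM[OF step.prems] that] .
  define G where "G = hgraph (TC x) (H a)"
  have G: "G \<in> M" unfolding G_def hgraph_def
  proof (rule repl[where R = "\<lambda>y z. \<exists>v\<in>M. R a y v \<and> z = opair y v"])
   have "dfp M (\<lambda>e. R a (e i) (e j))" for i j
    by (rule dfp_app3[where R = R, OF dR]) (intro df a)+
   thus "dfp M (\<lambda>e. \<exists>v\<in>M. R a (e 0) v \<and> e 1 = opair (e 0) v)"
    by (intro df)
   fix y z assume y: "y \<in> elts (TC x)" "z \<in> M"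
   show "(\<exists>v\<in>M. R a y v \<and> z = opair y v) <-> z = opair y (H a y)"
   proof
    assume "\<exists>v\<in>M. R a y v \<and> z = opair y v"
    then obtain v where "R a y v" "z = opair y v" by (elim bexE conjE)
    thus "z = opair y (H a y)" using RH[OF \<open>R a y v\<close> a] by simp
   next
    assume "z = opair y (H a y)"
    thus "\<exists>v\<in>M. R a y v \<and> z = opair y v"
     using step.IH[OF y(1) yM[OF y(1)]] by (intro bexI[of _ "H a y"]) simp_all
   qed
  qed (use step yM in simp_all)
  have Hx: "H a x = \<Phi> a x G" using H[OF a step.prems] by (simp add: G_def)
  hence HM: "H a x \<in> M" using PM[OF a step.prems G] by simp
  define d where "d = hins x (TC x)"
  define f where "f = hgraph d (H a)"
  have "f = hins (opair x (H a x)) G" unfolding f_def G_def d_def by (rule hset_eqI) simp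
  hence fM: "f \<in> M" using HM G step.prems by simp
  have dM: "d \<in> M" using step.prems by (simp add: d_def)
  have td: "transitive (elts d)"
   unfolding transitive_def d_def using elts_sub_TC TC_step by auto
  have "ap f y = \<Phi> a y (hgraph (TC y) (\<lambda>z. ap f z))" if y: "y \<in> elts d" for y
  proof -
   have "hgraph (TC y) (\<lambda>z. ap f z) = hgraph (TC y) (H a)"
    by (rule hgraph_cong) (use TC_sub_transitive[OF td y] in \<open>auto simp: f_def\<close>)
   thus ?thesis using H[OF a trM[OF dM y]] y by (simp add: f_def)
  qed
  hence "att a f d" unfolding att_def using td by simp
  moreover have "x \<in> elts d" by (simp add: d_def)
  ultimately have "R a x (H a x)" unfolding R_def
   by (intro bexI[OF _ fM] bexI[OF _ dM]) (simp add: f_def)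
  thus ?case using HM by simp
 qed
 show ?thesis
 proof (rule dftI)
  show "dfp M (\<lambda>e. e 0 = H (e (Suc 0)) (e (Suc 1)))"
  proof (rule dfp_eqI[OF dR[of 1 2 0]])
   fix e :: "nat => hset" assume "range e \<subseteq> M"
   hence "e 1 \<in> M" "e 2 \<in> M" by auto
   hence "e 0 = H (e 1) (e 2) <-> R (e 1) (e 2) (e 0)"
    using conjunct1[OF ex[of "e 1" "e 2"]] RH[of "e 1" "e 2" "e 0"] by (intro iffI) simp_all
   moreover have "Suc 0 = 1" "Suc 1 = 2" by simp_all
   ultimately show "(e 0 = H (e (Suc 0)) (e (Suc 1))) = R (e 1) (e 2) (e 0)" by (simp only:)
  qed
 next
  fix e :: "nat => hset" assume "range e \<subseteq> M"
  hence "e 0 \<in> M" "e 1 \<in> M" by auto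
  from ex[OF this] show "H (e 0) (e 1) \<in> M" by simp
 qed
qed

subsection \<open>Collection\<close>

lemma elts_vv: "elts (vv M x) = (\<Union>y\<in>elts x. {u \<in> M. u \<sqsubseteq> vv M y})"
proof -
 have "(\<Union>y\<in>elts x. {u \<in> M. u \<sqsubseteq> vv M y}) \<subseteq> M" by blast
 thus ?thesis by (subst vv.simps) (rule elts_hset_of[OF countM])
qed

lemma dft_vv [df]: "dft M f ==> dft M (\<lambda>e. vv M (f e))"
proof (rule dft_app1[where F = "vv M"])
 have "dft M (\<lambda>e. (\<lambda>_. vv M) (e 0) (e 1))"
 proof (rule recursion[where \<Phi> = "\<lambda>a x f. hset_of (\<Union>y\<in>elts x. elts (hPow (ap f y)))"])
  fix a x :: hset
  have "vv M x = hset_of (\<Union>y\<in>elts x. elts (hPow (ap (hgraph (TC x) (vv M)) y)))"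
   by (subst vv.simps) (simp add: elts_sub_TC)
  thus "vv M x = hset_of (\<Union>y\<in>elts x. elts (hPow (ap (hgraph (TC x) (vv M)) y)))" .
 qed (intro df)
 from dft_app2[OF this, of "\<lambda>e. hemp" "\<lambda>e. e 0"] show "dft M (\<lambda>e. vv M (e 0))"
  by (simp add: dft_const dft_var)
qed

lemma mem_vv: "x \<in> M ==> x \<sqsubseteq> vv M x"
proof (induction x rule: elts_induct)
 case (step x)
 show ?case
 proof
  fix y assume y: "y \<in> elts x"
  thus "y \<in> elts (vv M x)"
   using step.IH[OF y trM[OF step.prems y]] trM[OF step.prems y] unfolding elts_vv[of x] by blast
 qed
qed

lemma in_vv: "u \<in> elts (vv M x) <-> u \<in> M \<and> (\<exists>y\<in>elts x. u \<sqsubseteq> vv M y)"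
 unfolding elts_vv[of x] by blast

text \<open>Comparability of ranks: the second alternative means that \<open>y\<close> has smaller
  rank than \<open>x\<close>. With well-founded induction this yields least levels.\<close>

lemma vv_linear: "vv M x \<sqsubseteq> vv M y \<or> (\<exists>z\<in>elts x. vv M y \<sqsubseteq> vv M z)"
proof (induction x arbitrary: y rule: elts_induct)
 case (step x)
 show ?case
 proof (subst disj_imp, rule impI)
  assume "\<not> vv M x \<sqsubseteq> vv M y"
  then obtain u where u: "u \<in> elts (vv M x)" "u \<notin> elts (vv M y)" unfolding subset_iff by (simp only: not_all not_imp) (elim exE conjE)
  from u(1)[unfolded in_vv] obtain z where z: "z \<in> elts x" "u \<in> M" "u \<sqsubseteq> vv M z"
   by (elim conjE bexE)
  have ex: "\<exists>v\<in>elts z. vv M w \<sqsubseteq> vv M v" if w: "w \<in> elts y" for w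
  proof -
   have "\<not> u \<sqsubseteq> vv M w" using u(2) z(2) w unfolding in_vv by simp
   hence "\<not> vv M z \<sqsubseteq> vv M w" by (rule contrapos_nn) (rule order_trans[OF z(3)])
   thus ?thesis using step.IH[OF z(1), of w] by simp
  qed
  have "vv M y \<sqsubseteq> vv M z"
  proof
   fix t assume "t \<in> elts (vv M y)"
   then obtain w where w: "t \<in> M" "w \<in> elts y" "t \<sqsubseteq> vv M w"
    unfolding in_vv by (elim conjE bexE)
   obtain v where v: "v \<in> elts z" "vv M w \<sqsubseteq> vv M v" using ex[OF w(2)] by (rule bexE)
   show "t \<in> elts (vv M z)" unfolding in_vv
    using w(1) v(1) order_trans[OF w(3) v(2)] by (intro conjI bexI)
  qed
  thus "\<exists>z\<in>elts x. vv M y \<sqsubseteq> vv M z" using z(1) by (rule bexI)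
 qed
qed

lemma vv_least:
 assumes "Q y"
 shows "\<exists>y. Q y \<and> (\<forall>z. Q z --> vv M y \<sqsubseteq> vv M z)"
proof -
 have "\<exists>y. Q y \<and> (\<forall>z. Q z --> vv M y \<sqsubseteq> vv M z)"
  if "Q y" "vv M y \<sqsubseteq> vv M x" for x y
  using that
 proof (induction x arbitrary: y rule: elts_induct)
  case (step x)
  show ?case
  proof (cases "\<forall>z. Q z --> vv M y \<sqsubseteq> vv M z")
   case True
   thus ?thesis using step.prems(1) by blast
  next
   case False
   then obtain y' where y': "Q y'" "\<not> vv M y \<sqsubseteq> vv M y'" by blast
   have "\<not> vv M x \<sqsubseteq> vv M y'" using y'(2) by (rule contrapos_nn) (rule order_trans[OF step.prems(2)])
   then obtain z where z: "z \<in> elts x" "vv M y' \<sqsubseteq> vv M z"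
    using vv_linear[of x y'] by (elim disjE bexE) simp_all
   show ?thesis by (rule step.IH[OF z(1) y'(1) z(2)])
  qed
 qed
 from this[OF assms subset_refl] show ?thesis .
qed

text \<open>Scott's trick: replacement needs a unique value, and while witnesses are not unique, the
  least level of the hierarchy containing one is.\<close>

lemma collection:
 assumes R: "dfp M (\<lambda>e. R (e 0) (e 1))" and a: "a \<in> M"
 obtains b where "b \<in> M" "\<And>x y. x \<in> elts a ==> y \<in> M ==> R x y ==> \<exists>y\<in>elts b. R x y"
proof -
 note R2 = dfp_app2[OF R]
 define W where "W x v <-> (\<exists>y\<in>elts v. R x y)" for x v
 \<comment> \<open>The last disjunct supplies the default \<open>hemp\<close> where there is no
   witness, so that \<open>S\<close> is functional on all of \<open>a\<close>.\<close>
 define S where "S x v <-> (W x v \<and> (\<exists>z\<in>M. v = vv M z) \<and> (\<forall>z\<in>M. W x (vv M z) --> v \<sqsubseteq> vv M z))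
  \<or> (\<not> (\<exists>y\<in>M. R x y) \<and> v = hemp)" for x v
 have vM: "vv M z \<in> M" if "z \<in> M" for z by (rule inM, intro df that)
 have WR: "\<exists>z\<in>M. W x (vv M z)" if "y \<in> M" "R x y" for x y
 proof -
  have s: "hset_of {y} \<in> M" using that(1) by simp
  have "y \<in> elts (vv M (hset_of {y}))" using mem_vv[OF s] by simp
  thus ?thesis unfolding W_def using that(2) by (intro bexI[OF _ s]) (rule bexI)
 qed
 have RW: "\<exists>y\<in>M. R x y" if "W x v" "v \<in> M" for x v
  using that(1) subM[OF that(2)] unfolding W_def by blast
 have ex: "\<exists>v. v \<in> M \<and> S x v" for x
 proof (cases "\<exists>y\<in>M. R x y")
  case True
  then obtain y where "y \<in> M" "R x y" by (rule bexE)
  from WR[OF this] obtain z0 where z0: "z0 \<in> M \<and> W x (vv M z0)" by (elim bexE) simp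
  from vv_least[of "\<lambda>z. z \<in> M \<and> W x (vv M z)", OF z0]
  obtain z where z: "z \<in> M" "W x (vv M z)"
   and l: "\<forall>z'. z' \<in> M \<and> W x (vv M z') --> vv M z \<sqsubseteq> vv M z'"
   by (elim exE conjE)
  have "S x (vv M z)" unfolding S_def using z l by (intro disjI1 conjI bexI[of _ z]) simp_all
  thus ?thesis using vM[OF z(1)] by (intro exI[of _ "vv M z"]) simp
 next
  case False
  thus ?thesis by (intro exI[of _ hemp]) (simp add: S_def)
 qed
 have uni: "v = v'" if "S x v" "S x v'" "v \<in> M" "v' \<in> M" for x v v'
 proof (cases "\<exists>y\<in>M. R x y")
  case True
  hence *: "W x v" "W x v'" "\<exists>z\<in>M. v = vv M z" "\<exists>z\<in>M. v' = vv M z"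
   "\<forall>z\<in>M. W x (vv M z) --> v \<sqsubseteq> vv M z" "\<forall>z\<in>M. W x (vv M z) --> v' \<sqsubseteq> vv M z"
   using that(1,2) unfolding S_def by simp_all
  obtain z z' where z: "z \<in> M" "v = vv M z" "z' \<in> M" "v' = vv M z'" using *(3,4) by (elim bexE)
  have "v \<sqsubseteq> v'" "v' \<sqsubseteq> v" using * z by simp_all
  thus ?thesis by (intro hset_eqI) simp
 next
  case False
  hence "\<not> W x v" "\<not> W x v'" using RW[of x v] RW[of x v'] that(3,4) by blast+
  thus ?thesis using that(1,2) by (simp add: S_def)
 qed
 define F where "F x = (SOME v. v \<in> M \<and> S x v)" for x
 have F: "F x \<in> M" "S x (F x)" for x using someI_ex[OF ex[of x]] by (simp_all add: F_def)
 have "hset_of (F ` elts a) \<in> M"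
 proof (rule repl[where R = S])
  show "dfp M (\<lambda>e. S (e 0) (e 1))" unfolding S_def W_def by (intro df R2 hemp_inM)
  fix x y assume "y \<in> M"
  thus "S x y <-> y = F x" using uni[of x y "F x"] F[of x] by (intro iffI) simp_all
 qed (simp_all add: a F)
 hence b: "hUn (hset_of (F ` elts a)) \<in> M" by simp
 show thesis
 proof (rule that[OF b])
  fix x y assume x: "x \<in> elts a" "y \<in> M" "R x y"
  hence "\<exists>y\<in>M. R x y" by (intro bexI)
  hence "W x (F x)" using F(2)[of x] unfolding S_def by simp
  then obtain y where y: "y \<in> elts (F x)" "R x y" unfolding W_def by (rule bexE)
  have "y \<in> elts (hUn (hset_of (F ` elts a)))" using x(1) y(1) by auto
  thus "\<exists>y\<in>elts (hUn (hset_of (F ` elts a))). R x y"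
   using y(2) by (intro bexI)
 qed
qed

end

subsection \<open>Ordinals\<close>

lemma is_ord_mem: "is_ord a ==> b \<in> elts a ==> is_ord b"
 unfolding is_ord_def transitive_def by blast

lemma is_ord_trans: "is_ord a ==> b \<in> elts a ==> c \<in> elts b ==> c \<in> elts a"
 unfolding is_ord_def transitive_def by blast

lemma is_ord_linear: "is_ord a ==> is_ord b ==> a \<in> elts b \<or> a = b \<or> b \<in> elts a"
proof (induction a arbitrary: b rule: elts_induct)
 case (step a)
 note IHa = step.IH and a = step.prems(1)
 from step.prems(2) show ?case
 proof (induction b rule: elts_induct)
  case (step b)
  show ?case
  proof (rule ccontr)
   assume n: "\<not> ?thesis"
   have 1: "c \<in> elts b" if c: "c \<in> elts a" for c
    using IHa[OF c is_ord_mem[OF a c] step.prems] n is_ord_trans[OF a c] c by auto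
   have 2: "c \<in> elts a" if c: "c \<in> elts b" for c
    using step.IH[OF c is_ord_mem[OF step.prems c]] n is_ord_trans[OF step.prems c] c by auto
   have "elts a = elts b" by (rule subset_antisym[OF subsetI[OF 1] subsetI[OF 2]])
   thus False using n hset_eqI[of a b] by simp
  qed
 qed
qed

lemma is_ord_irrefl: "is_ord a ==> b \<in> elts a ==> a \<notin> elts b"
 using is_ord_trans[of a b a] mem_irrefl[of a] by blast

lemma is_ordI: "transitive (elts a) ==> (\<And>b. b \<in> elts a ==> is_ord b) ==> is_ord a"
 unfolding is_ord_def by blast

lemma is_ord_vnat [simp]: "is_ord (vnat n)"
 by (induction n) (auto simp: is_ord_def transitive_def elts_vnat)

lemma is_ord_omega [simp]: "is_ord omega"
 by (rule is_ordI) (auto simp: transitive_def elts_vnat)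

lemma ord_least:
 assumes "x \<in> A" "\<And>x. x \<in> A ==> is_ord (h x)"
 shows "\<exists>x\<in>A. \<forall>y\<in>A. h y \<notin> elts (h x)"
proof -
 obtain z where z: "z \<in> h ` A" and m: "\<And>y. (y, z) \<in> {(x, y). x \<in> elts y} ==> y \<notin> h ` A"
  by (rule wfE_min[OF wf_elts, of "h x" "h ` A"]) (use assms(1) in blast)+
 thus ?thesis by blast
qed

text \<open>Zermelo's enumeration of \<open>n\<close> along the ordinals: \<open>s\<close> chooses
  from what has not been used at the members of \<open>x\<close>. The value \<open>n\<close>, which
  is no member of itself, signals exhaustion.\<close>

function zer :: "hset => hset => hset => hset" where
 "zer s n x = (let r = hset_of {u \<in> elts n. u \<notin> zer s n ` elts x} in if r = hemp then n else ap s r)"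
 by auto
termination
 by (relation "inv_image {(x, y). x \<in> elts y} (snd \<circ> snd)") (auto intro!: wf_inv_image wf_elts)
declare zer.simps [simp del]

locale ctmodel = zfmodel + assumes choice: "ax_choice M"

lemma ctm_iff: "ctm M <-> ctmodel M"
 by (auto simp: ctm_def zfc_model_def ctmodel_def zfmodel_def zf_ctm_def ctmodel_axioms_def)

context ctmodel
begin

text \<open>Burali-Forti: the ordinals in such a set would form an ordinal that is a member of
  itself.\<close>

lemma no_all_ordinals: "b \<in> M ==> \<exists>x\<in>M. is_ord x \<and> x \<notin> elts b"
proof (rule ccontr)
 assume b: "b \<in> M" and n: "\<not> (\<exists>x\<in>M. is_ord x \<and> x \<notin> elts b)"
 define z where "z = hset_of {x \<in> elts b. is_ord x}"
 have zM: "z \<in> M" unfolding z_def by (rule inM, intro df b)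
 have ez: "elts z = {x \<in> elts b. is_ord x}" by (simp add: z_def)
 have "is_ord z"
 proof (rule is_ordI)
  show "transitive (elts z)" unfolding transitive_def
  proof (intro ballI subsetI)
   fix x y assume x: "x \<in> elts z" and y: "y \<in> elts x"
   hence "is_ord y" using is_ord_mem[of x y] by (simp add: ez)
   moreover have "y \<in> M" by (rule trM[OF trM[OF zM x] y])
   ultimately show "y \<in> elts z" using n by (simp add: ez)
  qed
 qed (simp add: ez)
 hence "z \<in> elts z" using n zM by (simp add: ez)
 thus False using mem_irrefl by blast
qed

subsection \<open>Choice\<close>

text \<open>The axiom speaks of disjoint families, so each nonempty subset \<open>x\<close> of
  \<open>n\<close> is replaced by \<open>{x} \<times> x\<close>; a transversal of these is the graph
  of a choice function.\<close>

lemma choice_function: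
 assumes n: "n \<in> M"
 obtains s where "s \<in> M" "\<And>x. x \<in> M ==> x \<sqsubseteq> n ==> x \<noteq> hemp ==> ap s x \<in> elts x"
proof -
 define Q where "Q = hset_of {x \<in> elts (hPow n). x \<noteq> hemp}"
 have eQ: "elts Q = {x \<in> M. x \<sqsubseteq> n \<and> x \<noteq> hemp}" unfolding Q_def
  by (subst elts_sep) auto
 have Q: "Q \<in> M" unfolding Q_def by (rule inM, intro df n hemp_inM)
 define A where "A = hset_of ((\<lambda>x. hprod (hset_of {x}) x) ` elts Q)"
 have A: "A \<in> M" unfolding A_def by (rule inM, intro df Q)
 have eA: "elts A = (\<lambda>x. hprod (hset_of {x}) x) ` elts Q" by (simp add: A_def)
 have ne: "elts x \<noteq> {}" if "x \<in> elts Q" for x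
  using that hset_eqI[of x hemp] by (auto simp: eQ)
 have "ax_choice M" by (rule choice)
 note ac = this[unfolded ax_choice_def, THEN bspec, OF A, THEN mp, THEN mp]
 have 1: "\<forall>x\<in>M. x \<in> elts A --> (\<exists>z\<in>M. z \<in> elts x)"
 proof (intro ballI impI)
  fix y assume y: "y \<in> M" "y \<in> elts A"
  then obtain x where x: "x \<in> elts Q" "y = hprod (hset_of {x}) x" unfolding eA by blast
  obtain u where "u \<in> elts x" using ne[OF x(1)] by blast
  hence "opair x u \<in> elts y" using x by simp
  thus "\<exists>z\<in>M. z \<in> elts y" using trM[OF y(1)] by (intro bexI)
 qed
 have 2: "\<forall>x\<in>M. \<forall>y\<in>M. x \<in> elts A --> y \<in> elts A --> x \<noteq> y --> \<not> (\<exists>z\<in>M. z \<in> elts x \<and> z \<in> elts y)"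
  unfolding eA by auto
 from ac[OF 1 2] obtain c where c: "c \<in> M" and
  c2: "\<forall>x\<in>M. x \<in> elts A --> (\<exists>!z. z \<in> M \<and> z \<in> elts x \<and> z \<in> elts c)" by (rule bexE)
 define s where "s = hset_of {z \<in> elts c. \<exists>x\<in>elts Q. z \<in> elts (hprod (hset_of {x}) x)}"
 have s: "s \<in> M" unfolding s_def by (rule inM, intro df c Q)
 show thesis
 proof (rule that[OF s])
  fix x assume x: "x \<in> M" "x \<sqsubseteq> n" "x \<noteq> hemp"
  hence xQ: "x \<in> elts Q" by (simp add: eQ)
  hence xA: "hprod (hset_of {x}) x \<in> elts A" unfolding eA by blast
  from c2[rule_format, OF trM[OF A xA] xA]
  obtain z where z': "z \<in> M \<and> z \<in> elts (hprod (hset_of {x}) x) \<and> z \<in> elts c"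
   and u': "\<forall>z'. z' \<in> M \<and> z' \<in> elts (hprod (hset_of {x}) x) \<and> z' \<in> elts c --> z' = z"
   by (rule ex1E)
  note z = conjunct1[OF conjunct2[OF z']] conjunct2[OF conjunct2[OF z']]
  note u = u'[rule_format]
  obtain y where y: "y \<in> elts x" "z = opair x y" using z(1) by auto
  have "ap s x = y"
  proof (rule ap_eq)
   show "opair x y \<in> elts s" using z y xQ by (auto simp: s_def)
   fix y' assume "opair x y' \<in> elts s"
   hence *: "opair x y' \<in> elts c" "y' \<in> elts x" by (auto simp: s_def)
   have "opair x y' = z" by (rule u) (use trM[OF c *(1)] * in simp)
   thus "y' = y" using y by simp
  qed
  thus "ap s x \<in> elts x" using y by simp
 qed
qed

lemma zermelo:
 assumes n: "n \<in> M"
 obtains h where "h \<in> M" "\<And>x. x \<in> elts n ==> is_ord (ap h x)" "inj_on (ap h) (elts n)"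
proof -
 obtain s where s: "s \<in> M" and sx: "\<And>x. x \<in> M ==> x \<sqsubseteq> n ==> x \<noteq> hemp ==> ap s x \<in> elts x"
  by (rule choice_function[OF n]) blast
 define H where "H = zer s n"
 define r where "r x = hset_of {u \<in> elts n. u \<notin> H ` elts x}" for x
 have Hr: "H x = (if r x = hemp then n else ap s (r x))" for x
  unfolding H_def r_def by (subst zer.simps) (simp add: Let_def)
 have "dft M (\<lambda>e. (\<lambda>_. H) (e 0) (e 1))"
 proof (rule recursion[where \<Phi> = "\<lambda>a x f. if hset_of {u \<in> elts n. \<not> (\<exists>y\<in>elts x. u = ap f y)} = hemp then n
   else ap s (hset_of {u \<in> elts n. \<not> (\<exists>y\<in>elts x. u = ap f y)})"])
  fix a x :: hset
  have "r x = hset_of {u \<in> elts n. \<not> (\<exists>y\<in>elts x. u = ap (hgraph (TC x) H) y)}"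
   unfolding r_def by (rule arg_cong[of _ _ hset_of]) (auto simp: elts_sub_TC)
  thus "H x = (if hset_of {u \<in> elts n. \<not> (\<exists>y\<in>elts x. u = ap (hgraph (TC x) H) y)} = hemp then n
   else ap s (hset_of {u \<in> elts n. \<not> (\<exists>y\<in>elts x. u = ap (hgraph (TC x) H) y)}))"
   using Hr[of x] by simp
 qed (intro df n s hemp_inM)
 from dft_app2[OF this, of "\<lambda>e. hemp" "\<lambda>e. e 0"] have dH0: "dft M (\<lambda>e. H (e 0))"
  by (simp add: dft_const dft_var)
 note dH = dft_app1[OF dH0]
 have r2: "r x = hset_of {u \<in> elts n. \<not> (\<exists>y\<in>elts x. u = H y)}" for x
  unfolding r_def by (rule arg_cong[of _ _ hset_of]) auto
 have rM: "r x \<in> M" if "x \<in> M" for x unfolding r2 by (rule inM, intro df dH n that)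
 have er: "elts (r x) = {u \<in> elts n. u \<notin> H ` elts x}" for x by (simp add: r_def)
 have Hx: "H x \<in> elts n \<and> H x \<notin> H ` elts x" if "x \<in> M" "H x \<noteq> n" for x
 proof -
  have "r x \<noteq> hemp" using Hr[of x] that(2) by (simp split: if_splits)
  moreover have "r x \<sqsubseteq> n" by (auto simp: er)
  ultimately have "ap s (r x) \<in> elts (r x)" using sx[OF rM[OF that(1)]] by simp
  thus ?thesis using Hr[of x] \<open>r x \<noteq> hemp\<close> by (simp add: er)
 qed
 \<comment> \<open>If \<open>n\<close> were never exhausted, \<open>H\<close> would inject the
   ordinals of \<open>M\<close> into \<open>n\<close>, and collecting preimages would put all of
   them into one set.\<close>
 have "\<exists>a\<in>M. is_ord a \<and> H a = n"
 proof (rule ccontr)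
  assume c: "\<not> ?thesis"
  have inj: "H a \<noteq> H b" if "a \<in> M" "b \<in> M" "is_ord a" "is_ord b" "a \<in> elts b" for a b
  proof
   assume "H a = H b"
   hence "H b \<in> H ` elts b" using that(5) by (metis imageI)
   thus False using Hx[of b] c that by simp
  qed
  obtain b where b: "b \<in> M" and b2: "\<And>x y. x \<in> elts n ==> y \<in> M ==> is_ord y \<and> H y = x ==> \<exists>y\<in>elts b. is_ord y \<and> H y = x"
   by (rule collection[where R = "\<lambda>x y. is_ord y \<and> H y = x", OF _ n]) (intro df dH, blast)
  have "x \<in> elts b" if x: "x \<in> M" "is_ord x" for x
  proof -
   have "H x \<in> elts n" using Hx[OF x(1)] c x by auto
   from b2[OF this x(1)] x(2) obtain y where y: "y \<in> elts b" "is_ord y" "H y = H x" by auto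
   hence "y = x" using is_ord_linear[OF y(2) x(2)] inj[of x y] inj[of y x] x trM[OF b y(1)] by auto
   thus ?thesis using y by simp
  qed
  thus False using no_all_ordinals[OF b] by blast
 qed
 then obtain a where a: "a \<in> M" "is_ord a" "H a = n" by blast
 \<comment> \<open>If something were left over at \<open>a\<close>, the chosen element would be
   \<open>n\<close>, hence a member of \<open>n\<close>.\<close>
 have "\<not> ap s (r a) \<in> elts (r a)" if "r a \<noteq> hemp"
  using a(3) Hr[of a] that mem_irrefl[of n] by (auto simp: er)
 hence "r a = hemp" using sx[OF rM[OF a(1)]] er[of a] by auto
 hence onto: "elts n \<subseteq> H ` elts a" using er[of a] by auto
 define R where "R x b <-> is_ord b \<and> H b = x \<and> (\<forall>c\<in>elts b. H c \<noteq> x)" for x b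
 have ex: "\<exists>b. b \<in> M \<and> R x b" if x: "x \<in> elts n" for x
 proof -
  obtain b0 where b0: "b0 \<in> {b \<in> elts a. H b = x}" using onto x by auto
  obtain b where b: "b \<in> elts a" "H b = x" and m: "\<forall>c\<in>{b \<in> elts a. H b = x}. c \<notin> elts b"
   using ord_least[OF b0, of id] is_ord_mem[OF a(2)] by auto
  have "H c \<noteq> x" if c: "c \<in> elts b" for c
   using bspec[OF m, of c] is_ord_trans[OF a(2) b(1) c] c by blast
  hence "R x b" unfolding R_def using is_ord_mem[OF a(2) b(1)] b(2) by simp
  thus ?thesis using trM[OF a(1) b(1)] by blast
 qed
 have uni: "b = b'" if "R x b" "R x b'" for x b b'
  using that is_ord_linear[of b b'] unfolding R_def by auto
 define F where "F x = (SOME b. b \<in> M \<and> R x b)" for x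
 have F: "F x \<in> M" "R x (F x)" if "x \<in> elts n" for x
  using someI_ex[OF ex[OF that]] by (simp_all add: F_def)
 have "hgraph n F \<in> M" unfolding hgraph_def
 proof (rule repl[where R = "\<lambda>x z. \<exists>b\<in>M. R x b \<and> z = opair x b"])
  show "dfp M (\<lambda>e. \<exists>b\<in>M. R (e 0) b \<and> e 1 = opair (e 0) b)"
   unfolding R_def by (intro df dH)
  fix x y assume x: "x \<in> elts n"
  show "(\<exists>b\<in>M. R x b \<and> y = opair x b) <-> y = opair x (F x)"
  proof
   assume "\<exists>b\<in>M. R x b \<and> y = opair x b"
   then obtain b where "R x b" "y = opair x b" by (elim bexE conjE)
   thus "y = opair x (F x)" using uni[OF _ F(2)[OF x]] by simp
  next
   assume "y = opair x (F x)"
   thus "\<exists>b\<in>M. R x b \<and> y = opair x b" using F[OF x] by (intro bexI conjI)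
  qed
 qed (use n F trM[OF n] in simp_all)
 thus thesis
 proof (rule that)
  show "is_ord (ap (hgraph n F) x)" if "x \<in> elts n" for x
   using F(2)[OF that] that by (simp add: R_def)
  show "inj_on (ap (hgraph n F)) (elts n)"
  proof (rule inj_onI)
   fix x y assume "x \<in> elts n" "y \<in> elts n" "ap (hgraph n F) x = ap (hgraph n F) y"
   thus "x = y" using F(2)[of x] F(2)[of y] by (simp add: R_def)
  qed
 qed
qed

text \<open>Collection gives a set of candidate witnesses, \<open>zermelo\<close> maps it
  injectively to ordinals, and the witness of least index is definable. This is the form in which
  choice in the model is used from here on.\<close>

lemma uniformize:
 assumes R: "dfp M (\<lambda>e. R (e 0) (e 1))" and a: "a \<in> M"
  and ex: "\<And>x. x \<in> elts a ==> \<exists>y\<in>M. R x y"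
 obtains F where "hgraph a F \<in> M" "\<And>x. x \<in> elts a ==> F x \<in> M" "\<And>x. x \<in> elts a ==> R x (F x)"
proof -
 note R2 = dfp_app2[OF R]
 obtain b where b: "b \<in> M" and b2: "\<And>x y. x \<in> elts a ==> y \<in> M ==> R x y ==> \<exists>y\<in>elts b. R x y"
  by (rule collection[OF R a]) blast
 obtain h where h: "h \<in> M" and ho: "\<And>x. x \<in> elts b ==> is_ord (ap h x)" and hi: "inj_on (ap h) (elts b)"
  by (rule zermelo[OF b]) blast
 define S where "S x y <-> y \<in> elts b \<and> R x y \<and> (\<forall>z\<in>elts b. R x z --> \<not> ap h z \<in> elts (ap h y))" for x y
 have exS: "\<exists>y. S x y" if x: "x \<in> elts a" for x
 proof -
  obtain y0 where "y0 \<in> {y \<in> elts b. R x y}" using ex[OF x] b2[OF x] by auto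
  from ord_least[OF this, of "ap h"] ho show ?thesis unfolding S_def by auto
 qed
 have uni: "y = z" if "S x y" "S x z" for x y z
 proof -
  have "ap h y = ap h z" using that is_ord_linear[of "ap h y" "ap h z"] ho unfolding S_def by auto
  thus ?thesis using hi that unfolding S_def inj_on_def by simp
 qed
 define F where "F x = (SOME y. S x y)" for x
 have F: "S x (F x)" if "x \<in> elts a" for x unfolding F_def by (rule someI_ex[OF exS[OF that]])
 have FM: "F x \<in> M" if "x \<in> elts a" for x using F[OF that] trM[OF b] by (simp add: S_def)
 have "hgraph a F \<in> M" unfolding hgraph_def
 proof (rule repl[where R = "\<lambda>x z. \<exists>y\<in>M. S x y \<and> z = opair x y"])
  show "dfp M (\<lambda>e. \<exists>y\<in>M. S (e 0) y \<and> e 1 = opair (e 0) y)"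
   unfolding S_def by (intro df R2 h b)
  fix x z assume x: "x \<in> elts a"
  show "(\<exists>y\<in>M. S x y \<and> z = opair x y) <-> z = opair x (F x)"
  proof
   assume "\<exists>y\<in>M. S x y \<and> z = opair x y"
   then obtain y where "S x y" "z = opair x y" by (elim bexE conjE)
   thus "z = opair x (F x)" using uni[OF _ F[OF x]] by simp
  next
   assume "z = opair x (F x)"
   thus "\<exists>y\<in>M. S x y \<and> z = opair x y" using F[OF x] FM[OF x] by (intro bexI conjI)
  qed
 qed (use a FM trM[OF a] in simp_all)
 thus thesis by (rule that) (use F FM in \<open>simp_all add: S_def\<close>)
qed

end

subsection \<open>Finite and countable sets\<close>

definition hfst :: "hset => hset" where
 "hfst p = hUn (hset_of {a \<in> elts (hUn p). \<exists>b\<in>elts (hUn p). p = opair a b})"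
definition hsnd :: "hset => hset" where
 "hsnd p = hUn (hset_of {b \<in> elts (hUn p). \<exists>a\<in>elts (hUn p). p = opair a b})"

lemma elts_hUn_opair: "elts (hUn (opair a b)) = {a, b}"
 by (auto simp: elts_opair)

lemma opair_in_image [simp]: "opair a b \<in> opair c ` B <-> a = c \<and> b \<in> B"
 by auto

lemma opair_in_hprod: "opair a b \<in> elts (hprod x y) <-> a \<in> elts x \<and> b \<in> elts y"
 by auto

lemma hfst_opair [simp]: "hfst (opair a b) = a"
proof -
 have "{x \<in> elts (hUn (opair a b)). \<exists>y\<in>elts (hUn (opair a b)). opair a b = opair x y} = {a}"
  unfolding elts_hUn_opair by auto
 thus ?thesis unfolding hfst_def by (intro hset_eqI) simp
qed

lemma hsnd_opair [simp]: "hsnd (opair a b) = b"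
proof -
 have "{x \<in> elts (hUn (opair a b)). \<exists>y\<in>elts (hUn (opair a b)). opair a b = opair y x} = {b}"
  unfolding elts_hUn_opair by auto
 thus ?thesis unfolding hsnd_def by (intro hset_eqI) simp
qed

lemma hun_vnat: "hun (vnat i) (vnat j) = vnat (max i j)"
 by (rule hset_eqI) (cases "i \<le> j"; auto simp: elts_vnat max_def)

lemma card_elts_vnat [simp]: "card (elts (vnat n)) = n" "finite (elts (vnat n))"
 unfolding elts_vnat by (subst card_image) (auto simp: inj_on_def)

context ctmodel
begin

lemma dft_hfst [df]: "dft M f ==> dft M (\<lambda>e. hfst (f e))"
 by (rule dft_app1[where F = hfst], unfold hfst_def) (intro df)

lemma dft_hsnd [df]: "dft M f ==> dft M (\<lambda>e. hsnd (f e))"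
 by (rule dft_app1[where F = hsnd], unfold hsnd_def) (intro df)

lemma hgraph_inM:
 assumes S: "dfp M (\<lambda>e. S (e 0) (e 1))" and a: "a \<in> M"
  and F: "\<And>x. x \<in> elts a ==> F x \<in> M" "\<And>x y. x \<in> elts a ==> y \<in> M ==> S x y <-> y = F x"
 shows "hgraph a F \<in> M"
 unfolding hgraph_def
proof (rule repl[where R = "\<lambda>x z. \<exists>y\<in>M. S x y \<and> z = opair x y"])
 show "dfp M (\<lambda>e. \<exists>y\<in>M. S (e 0) y \<and> e 1 = opair (e 0) y)"
  by (intro df dfp_app2[OF S])
 fix x z assume x: "x \<in> elts a"
 show "(\<exists>y\<in>M. S x y \<and> z = opair x y) <-> z = opair x (F x)"
 proof
  assume "\<exists>y\<in>M. S x y \<and> z = opair x y"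
  then obtain y where "y \<in> M" "S x y" "z = opair x y" by (elim bexE conjE)
  thus "z = opair x (F x)" using F(2)[OF x] by simp
 next
  assume "z = opair x (F x)"
  thus "\<exists>y\<in>M. S x y \<and> z = opair x y" using F(1)[OF x] F(2)[OF x] by (intro bexI conjI) simp_all
 qed
qed (use a F(1) trM[OF a] in simp_all)

lemma cnt_iff:
 assumes x: "x \<in> M"
 shows "countable_in M x <-> (\<exists>f\<in>M. (\<forall>y\<in>elts x. ap f y \<in> elts omega) \<and>
  (\<forall>y\<in>elts x. \<forall>z\<in>elts x. ap f y = ap f z --> y = z))" (is "_ <-> ?r")
proof
 assume "countable_in M x"
 then obtain f where f: "f \<in> M" "is_fun f (elts x) (elts omega)" "inj_on (app f) (elts x)"
  unfolding countable_in_def by (elim bexE conjE)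
 have "ap f y = ap f z --> y = z" if "y \<in> elts x" "z \<in> elts x" for y z
  using inj_onD[OF f(3), of y z] is_fun_ap(3)[OF f(2)] that by simp
 moreover have "\<forall>y\<in>elts x. ap f y \<in> elts omega" using is_fun_ap(2)[OF f(2)] by blast
 ultimately show ?r using f(1) by (intro bexI[OF _ f(1)]) simp
next
 assume ?r
 then obtain f where f: "f \<in> M" "\<And>y. y \<in> elts x ==> ap f y \<in> elts omega"
  "\<And>y z. y \<in> elts x ==> z \<in> elts x ==> ap f y = ap f z ==> y = z"
  by (elim bexE conjE) (simp del: elts_omega)
 define h where "h = hgraph x (\<lambda>y. ap f y)"
 have h: "h \<in> M" unfolding h_def by (rule inM, intro df x f(1))
 have hf: "is_fun h (elts x) (elts omega)" unfolding h_def by (rule is_fun_hgraph) (rule f(2))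
 have "app h y = ap f y" if "y \<in> elts x" for y
  using is_fun_ap(3)[OF hf that] that by (simp add: h_def)
 hence "inj_on (app h) (elts x)" using f(3) by (simp add: inj_on_def)
 thus "countable_in M x" unfolding countable_in_def using h hf by (intro bexI conjI)
qed

lemma hgraph_id_inM: "x \<in> M ==> hgraph x (\<lambda>a. a) \<in> M"
 by (rule inM, intro df)

lemma cntI:
 assumes x: "x \<in> M" and g: "hgraph x F \<in> M" and F: "\<And>a. a \<in> elts x ==> F a \<in> elts omega"
  and i: "\<And>a b. a \<in> elts x ==> b \<in> elts x ==> F a = F b ==> a = b"
 shows "countable_in M x"
 unfolding cnt_iff[OF x] using F i by (intro bexI[OF _ g]) (simp del: elts_omega)

lemma cntE:
 assumes "countable_in M x" "x \<in> M"
 obtains f where "f \<in> M" "\<And>y. y \<in> elts x ==> ap f y \<in> elts omega"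
  "\<And>y z. y \<in> elts x ==> z \<in> elts x ==> ap f y = ap f z ==> y = z"
 using assms(1) unfolding cnt_iff[OF assms(2)] by (elim bexE conjE) (simp del: elts_omega)

lemma dfp_countable_in [df]: "dft M f ==> dfp M (\<lambda>e. countable_in M (f e))"
proof (rule dfp_app1[where R = "countable_in M"])
 show "dfp M (\<lambda>e. countable_in M (e 0))"
 proof (rule dfp_eqI)
  show "dfp M (\<lambda>e. \<exists>f\<in>M. (\<forall>y\<in>elts (e 0). ap f y \<in> elts omega) \<and>
   (\<forall>y\<in>elts (e 0). \<forall>z\<in>elts (e 0). ap f y = ap f z --> y = z))"
   by (intro df omega_inM)
 qed (rule cnt_iff, auto)
qed

lemma cnt_inj:
 assumes x: "x \<in> M" and y: "y \<in> M" "countable_in M y" and g: "hgraph x F \<in> M"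
  and F: "\<And>a. a \<in> elts x ==> F a \<in> elts y"
  and i: "\<And>a b. a \<in> elts x ==> b \<in> elts x ==> F a = F b ==> a = b"
 shows "countable_in M x"
proof -
 obtain f where f: "f \<in> M" "\<And>u. u \<in> elts y ==> ap f u \<in> elts omega"
  "\<And>u z. u \<in> elts y ==> z \<in> elts y ==> ap f u = ap f z ==> u = z"
  by (rule cntE[OF y(2,1)]) (rule that)
 have "hgraph x (\<lambda>a. ap f (ap (hgraph x F) a)) \<in> M" by (rule inM, intro df x g f(1))
 also have "hgraph x (\<lambda>a. ap f (ap (hgraph x F) a)) = hgraph x (\<lambda>a. ap f (F a))"
  by (rule hgraph_cong) simp_all
 finally show ?thesis
  by (rule cntI[OF x]) (rule f(2)[OF F], assumption, rule i, assumption+, rule f(3), (rule F, assumption)+)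
qed

lemma cnt_subset: "countable_in M y ==> y \<in> M ==> x \<in> M ==> x \<sqsubseteq> y ==> countable_in M x"
 by (rule cnt_inj[of x y "\<lambda>a. a"]) (blast intro: hgraph_id_inM)+

lemma cnt_surj:
 assumes x: "x \<in> M" "countable_in M x" and y: "y \<in> M" and R: "dfp M (\<lambda>e. R (e 0) (e 1))"
  and ex: "\<And>b. b \<in> elts y ==> \<exists>a\<in>elts x. R a b"
  and fn: "\<And>a b c. a \<in> elts x ==> b \<in> elts y ==> c \<in> elts y ==> R a b ==> R a c ==> b = c"
 shows "countable_in M y"
proof -
 obtain F where F: "hgraph y F \<in> M" "\<And>b. b \<in> elts y ==> F b \<in> elts x \<and> R (F b) b"
 proof (rule uniformize[where R = "\<lambda>b a. a \<in> elts x \<and> R a b", OF _ y])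
  show "dfp M (\<lambda>e. e 1 \<in> elts x \<and> R (e 1) (e 0))" by (intro df dfp_app2[OF R] x(1))
  show "\<exists>a\<in>M. a \<in> elts x \<and> R a b" if "b \<in> elts y" for b
   using ex[OF that] trM[OF x(1)] by blast
 qed (rule that)
 show ?thesis
 proof (rule cnt_inj[OF y x F(1)])
  fix a b assume *: "a \<in> elts y" "b \<in> elts y" "F a = F b"
  show "a = b" by (rule fn[of "F a"]) (use F(2)[OF *(1)] F(2)[OF *(2)] * in simp_all)
 qed (use F(2) in simp)
qed

definition bijM :: "hset => hset => bool" where
 "bijM y n <-> (\<exists>f\<in>M. (\<forall>z\<in>elts y. ap f z \<in> elts n) \<and> (\<forall>m\<in>elts n. \<exists>z\<in>elts y. ap f z = m) \<and>
   (\<forall>z\<in>elts y. \<forall>z'\<in>elts y. ap f z = ap f z' --> z = z'))"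

lemma dfp_bijM [df]: "dft M f ==> dft M g ==> dfp M (\<lambda>e. bijM (f e) (g e))"
 by (rule dfp_app2[where R = bijM], unfold bijM_def) (intro df)

text \<open>Finiteness and finite cardinality are absolute: a bijection between finite sets is a
  finite set of members of \<open>M\<close>, hence a member of \<open>M\<close>.\<close>

lemma bijM_iff:
 assumes "y \<in> M"
 shows "bijM y (vnat k) <-> finite (elts y) \<and> card (elts y) = k"
proof
 assume "bijM y (vnat k)"
 then obtain f where f: "\<forall>z\<in>elts y. ap f z \<in> elts (vnat k)" "\<forall>m\<in>elts (vnat k). \<exists>z\<in>elts y. ap f z = m"
  "\<forall>z\<in>elts y. \<forall>z'\<in>elts y. ap f z = ap f z' --> z = z'" unfolding bijM_def by (elim bexE conjE)
 have "ap f ` elts y = elts (vnat k)"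
 proof
  show "ap f ` elts y \<subseteq> elts (vnat k)" by (rule image_subsetI, rule bspec[OF f(1)])
  show "elts (vnat k) \<subseteq> ap f ` elts y" using f(2) by (metis image_eqI subsetI)
 qed
 hence "bij_betw (ap f) (elts y) (elts (vnat k))"
  using f(3) unfolding bij_betw_def inj_on_def by simp
 thus "finite (elts y) \<and> card (elts y) = k"
  using bij_betw_finite bij_betw_same_card card_elts_vnat by metis
next
 assume fin: "finite (elts y) \<and> card (elts y) = k"
 then obtain h where h: "bij_betw h (elts y) {0..<k}" using ex_bij_betw_finite_nat[of "elts y"] by auto
 define f where "f = hgraph y (\<lambda>z. vnat (h z))"
 have fM: "f \<in> M" unfolding f_def hgraph_def
  by (rule finite_inM) (use fin trM[OF assms] in auto)
 have apf: "ap f z = vnat (h z)" if "z \<in> elts y" for z using that by (simp add: f_def)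
 have 1: "\<forall>z\<in>elts y. ap f z \<in> elts (vnat k)"
  using bij_betwE[OF h] apf by simp
 have 2: "\<forall>m\<in>elts (vnat k). \<exists>z\<in>elts y. ap f z = m"
 proof
  fix m assume "m \<in> elts (vnat k)"
  then obtain i where i: "m = vnat i" "i \<in> {0..<k}" by (auto simp: elts_vnat)
  then obtain z where "z \<in> elts y" "h z = i" using h unfolding bij_betw_def by (metis imageE)
  thus "\<exists>z\<in>elts y. ap f z = m" using apf i by (intro bexI[of _ z]) simp_all
 qed
 have 3: "\<forall>z\<in>elts y. \<forall>z'\<in>elts y. ap f z = ap f z' --> z = z'"
  using h apf unfolding bij_betw_def inj_on_def by simp
 show "bijM y (vnat k)" unfolding bijM_def using 1 2 3 by (intro bexI[OF _ fM] conjI)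
qed

lemma finite_iff: "y \<in> M ==> finite (elts y) <-> (\<exists>n\<in>elts omega. bijM y n)"
 by (simp add: bijM_iff)

lemma dfp_finite [df]: "dft M f ==> dfp M (\<lambda>e. finite (elts (f e)))"
proof (rule dfp_app1[where R = "\<lambda>x. finite (elts x)"])
 show "dfp M (\<lambda>e. finite (elts (e 0)))"
 proof (rule dfp_eqI)
  show "dfp M (\<lambda>e. \<exists>n\<in>elts omega. bijM (e 0) n)" by (intro df omega_inM)
 qed (rule finite_iff, auto)
qed

text \<open>Each element is sent to its number of predecessors, which increases strictly along
  \<open>R\<close>; totality makes the map injective.\<close>

lemma cnt_by_order:
 assumes Y: "Y \<in> M" and R: "dfp M (\<lambda>e. R (e 0) (e 1))"
  and irr: "\<And>x. x \<in> elts Y ==> \<not> R x x"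
  and tr: "\<And>x y z. x \<in> elts Y ==> y \<in> elts Y ==> z \<in> elts Y ==> R x y ==> R y z ==> R x z"
  and tot: "\<And>x y. x \<in> elts Y ==> y \<in> elts Y ==> x \<noteq> y ==> R x y \<or> R y x"
  and fin: "\<And>y. y \<in> elts Y ==> finite {z \<in> elts Y. R z y}"
 shows "countable_in M Y"
proof -
 note R2 = dfp_app2[OF R]
 define P where "P y = hset_of {z \<in> elts Y. R z y}" for y
 have eP: "elts (P y) = {z \<in> elts Y. R z y}" for y by (simp add: P_def)
 have PM: "P y \<in> M" if "y \<in> M" for y unfolding P_def by (rule inM, intro df R2 Y that)
 define F where "F y = vnat (card (elts (P y)))" for y
 have lt: "card (elts (P y)) < card (elts (P z))" if "y \<in> elts Y" "z \<in> elts Y" "R y z" for y z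
 proof (rule psubset_card_mono)
  show "finite (elts (P z))" unfolding eP by (rule fin[OF that(2)])
  have "P y \<sqsubseteq> P z" unfolding eP using tr that by blast
  moreover have "y \<in> elts (P z)" "y \<notin> elts (P y)" unfolding eP using that irr[of y] by simp_all
  ultimately show "elts (P y) \<subset> elts (P z)" by blast
 qed
 show ?thesis
 proof (rule cntI[OF Y])
  show "hgraph Y F \<in> M"
  proof (rule hgraph_inM[where S = "\<lambda>y n. n \<in> elts omega \<and> bijM (P y) n", OF _ Y])
   show "dfp M (\<lambda>e. e 1 \<in> elts omega \<and> bijM (P (e 0)) (e 1))"
    unfolding P_def by (intro df R2 Y omega_inM)
   fix y n assume y: "y \<in> elts Y"
   show "(n \<in> elts omega \<and> bijM (P y) n) = (n = F y)"
    using bijM_iff[OF PM[OF trM[OF Y y]]] fin[OF y] by (auto simp: F_def eP)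
  qed (simp add: F_def)
  fix a b assume ab: "a \<in> elts Y" "b \<in> elts Y" "F a = F b"
  hence "\<not> R a b" "\<not> R b a" using lt[of a b] lt[of b a] by (auto simp: F_def)
  thus "a = b" using tot ab by blast
 qed (simp add: F_def)
qed

lemma cnt_omega2: "countable_in M (hprod omega omega)"
proof -
 \<comment> \<open>The union of two numerals is their maximum. \<open>R\<close> is Goedel's ordering
   of pairs, by maximum and then lexicographically, so a pair has only finitely many
   predecessors.\<close>
 define R where "R p q <-> hun (hfst p) (hsnd p) \<in> elts (hun (hfst q) (hsnd q)) \<or>
  (hun (hfst p) (hsnd p) = hun (hfst q) (hsnd q) \<and> (hfst p \<in> elts (hfst q) \<or> (hfst p = hfst q \<and> hsnd p \<in> elts (hsnd q))))" for p q
 have R: "R (opair (vnat i) (vnat j)) (opair (vnat k) (vnat l)) <->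
  max i j < max k l \<or> (max i j = max k l \<and> (i < k \<or> (i = k \<and> j < l)))" for i j k l
  by (simp add: R_def hun_vnat del: elts_hun)
 have eY: "elts (hprod omega omega) = range (\<lambda>(i, j). opair (vnat i) (vnat j))"
  by auto
 show ?thesis
 proof (rule cnt_by_order[where R = R])
  show "dfp M (\<lambda>e. R (e 0) (e 1))" unfolding R_def by (intro df)
  fix y assume "y \<in> elts (hprod omega omega)"
  then obtain k l where y: "y = opair (vnat k) (vnat l)" unfolding eY by auto
  have "{z \<in> elts (hprod omega omega). R z y} \<subseteq> (\<lambda>(i, j). opair (vnat i) (vnat j)) ` ({..max k l} \<times> {..max k l})"
  proof
   fix z assume z: "z \<in> {z \<in> elts (hprod omega omega). R z y}"
   then obtain i j where ij: "z = opair (vnat i) (vnat j)" unfolding eY by auto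
   with z have "max i j \<le> max k l" using R[of i j k l] y by auto
   thus "z \<in> (\<lambda>(i, j). opair (vnat i) (vnat j)) ` ({..max k l} \<times> {..max k l})"
    unfolding ij by (intro image_eqI[of _ _ "(i, j)"]) auto
  qed
  thus "finite {z \<in> elts (hprod omega omega). R z y}" by (rule finite_subset) simp
 next
  fix x y z assume *: "x \<in> elts (hprod omega omega)" "y \<in> elts (hprod omega omega)" "z \<in> elts (hprod omega omega)" "R x y" "R y z"
  obtain i j k l m n where [simp]: "x = opair (vnat i) (vnat j)" "y = opair (vnat k) (vnat l)" "z = opair (vnat m) (vnat n)"
   using *(1-3) unfolding eY by auto
  show "R x z" using *(4,5) by (simp add: R) linarith
 next
  fix x y assume *: "x \<in> elts (hprod omega omega)" "y \<in> elts (hprod omega omega)" "x \<noteq> y"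
  obtain i j k l where [simp]: "x = opair (vnat i) (vnat j)" "y = opair (vnat k) (vnat l)"
   using *(1,2) unfolding eY by auto
  show "R x y \<or> R y x" using *(3) by (simp add: R) linarith
 qed (auto simp: eY R simp del: elts_hprod)
qed

lemma cnt_prod:
 assumes x: "x \<in> M" "countable_in M x" and y: "y \<in> M" "countable_in M y"
 shows "countable_in M (hprod x y)"
proof -
 obtain f where f: "f \<in> M" "\<And>u. u \<in> elts x ==> ap f u \<in> elts omega"
  "\<And>u z. u \<in> elts x ==> z \<in> elts x ==> ap f u = ap f z ==> u = z"
  by (rule cntE[OF x(2,1)]) (rule that)
 obtain g where g: "g \<in> M" "\<And>u. u \<in> elts y ==> ap g u \<in> elts omega"
  "\<And>u z. u \<in> elts y ==> z \<in> elts y ==> ap g u = ap g z ==> u = z"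
  by (rule cntE[OF y(2,1)]) (rule that)
 show ?thesis
 proof (rule cnt_inj[where F = "\<lambda>p. opair (ap f (hfst p)) (ap g (hsnd p))", OF _ _ cnt_omega2])
  show "hgraph (hprod x y) (\<lambda>p. opair (ap f (hfst p)) (ap g (hsnd p))) \<in> M"
   by (rule inM, intro df x y f(1) g(1))
  fix a assume "a \<in> elts (hprod x y)"
  then obtain u v where "u \<in> elts x" "v \<in> elts y" "a = opair u v" by auto
  thus "opair (ap f (hfst a)) (ap g (hsnd a)) \<in> elts (hprod omega omega)"
   using f(2)[of u] g(2)[of v] by (simp only: opair_in_hprod hfst_opair hsnd_opair)
  fix b assume "b \<in> elts (hprod x y)"
  then obtain u' v' where "u' \<in> elts x" "v' \<in> elts y" "b = opair u' v'" by auto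
  thus "opair (ap f (hfst a)) (ap g (hsnd a)) = opair (ap f (hfst b)) (ap g (hsnd b)) ==> a = b"
   using f(3)[of u u'] g(3)[of v v'] \<open>u \<in> elts x\<close> \<open>v \<in> elts y\<close> \<open>a = opair u v\<close> by simp
 qed (use x y in simp_all)
qed

text \<open>Choice inside \<open>M\<close> picks an injection \<open>G x\<close> for each member and
  a member \<open>K u\<close> for each element; number of the member and number within the member
  form a code in the square of \<open>omega\<close>.\<close>

lemma cnt_UN:
 assumes a: "a \<in> M" "countable_in M a" and c: "\<And>x. x \<in> elts a ==> countable_in M x"
 shows "countable_in M (hUn a)"
proof -
 define Inj where "Inj x f <-> (\<forall>y\<in>elts x. ap f y \<in> elts omega) \<and> (\<forall>y\<in>elts x. \<forall>z\<in>elts x. ap f y = ap f z --> y = z)" for x f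
 obtain g where g: "g \<in> M" "\<And>u. u \<in> elts a ==> ap g u \<in> elts omega"
  "\<And>u z. u \<in> elts a ==> z \<in> elts a ==> ap g u = ap g z ==> u = z"
  by (rule cntE[OF a(2,1)]) (rule that)
 obtain G where G: "hgraph a G \<in> M" "\<And>x. x \<in> elts a ==> Inj x (G x)"
 proof (rule uniformize[where R = Inj, OF _ a(1)])
  show "dfp M (\<lambda>e. Inj (e 0) (e 1))" unfolding Inj_def by (intro df omega_inM)
  show "\<exists>f\<in>M. Inj x f" if "x \<in> elts a" for x
   using c[OF that] unfolding cnt_iff[OF trM[OF a(1) that]] Inj_def .
 qed (rule that)
 define U where "U = hUn a"
 have U: "U \<in> M" using a(1) by (simp add: U_def)
 obtain K where K: "hgraph U K \<in> M" "\<And>u. u \<in> elts U ==> K u \<in> elts a \<and> u \<in> elts (K u)"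
 proof (rule uniformize[where R = "\<lambda>u x. x \<in> elts a \<and> u \<in> elts x", OF _ U])
  show "dfp M (\<lambda>e. e 1 \<in> elts a \<and> e 0 \<in> elts (e 1))" by (intro df a(1))
  show "\<exists>x\<in>M. x \<in> elts a \<and> u \<in> elts x" if "u \<in> elts U" for u
   using that trM[OF a(1)] unfolding U_def by auto
 qed (rule that)
 define F where "F u = opair (ap g (ap (hgraph U K) u)) (ap (ap (hgraph a G) (ap (hgraph U K) u)) u)" for u
 have Fu: "F u = opair (ap g (K u)) (ap (G (K u)) u)" if "u \<in> elts U" for u
  using K(2)[OF that] that by (simp add: F_def)
 show ?thesis unfolding U_def[symmetric]
 proof (rule cnt_inj[where F = F, OF U _ cnt_omega2])
  show "hgraph U F \<in> M" unfolding F_def by (rule inM, intro df U K(1) G(1) g(1))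
  fix u assume u: "u \<in> elts U"
  show "F u \<in> elts (hprod omega omega)"
   using g(2)[of "K u"] G(2)[of "K u"] K(2)[OF u] unfolding Fu[OF u] Inj_def opair_in_hprod by blast
  fix v assume v: "v \<in> elts U" and e: "F u = F v"
  hence e2: "ap g (K u) = ap g (K v)" "ap (G (K u)) u = ap (G (K v)) v" by (simp_all add: Fu u)
  hence k: "K u = K v" using g(3)[of "K u" "K v"] K(2)[OF u] K(2)[OF v] by simp
  have "Inj (K u) (G (K u))" using G(2) K(2)[OF u] by simp
  thus "u = v" using e2(2) k K(2)[OF u] K(2)[OF v] unfolding Inj_def by simp
 qed simp
qed

lemma cnt_omega: "countable_in M omega"
 by (rule cntI[where F = "\<lambda>x. x"]) (simp_all add: hgraph_id_inM)

definition hFin :: "hset => hset" where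
 "hFin x = hset_of {y \<in> elts (hPow x). finite (elts y)}"

lemma dft_hFin [df]: "dft M f ==> dft M (\<lambda>e. hFin (f e))"
 by (rule dft_app1[where F = hFin], unfold hFin_def) (intro df)

lemma elts_hFin: "x \<in> M ==> elts (hFin x) = {y. y \<sqsubseteq> x \<and> finite (elts y)}"
proof -
 assume x: "x \<in> M"
 have "y \<in> M" if "y \<sqsubseteq> x" "finite (elts y)" for y
  using finite_inM[OF that(2)] that(1) subM[OF x] by simp
 thus ?thesis unfolding hFin_def by (subst elts_sep) auto
qed

text \<open>Induction on the size: inserting an element maps pairs of a set of size \<open>k\<close>
  and a point onto the sets of size \<open>k + 1\<close>.\<close>

lemma cnt_Fin:
 assumes x: "x \<in> M" "countable_in M x"
 shows "countable_in M (hFin x)"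
proof -
 define N where "N n = hset_of {y \<in> elts (hPow x). bijM y n}" for n
 have NM: "N n \<in> M" if "n \<in> M" for n unfolding N_def by (rule inM, intro df x that)
 have eN: "elts (N (vnat k)) = {y \<in> M. y \<sqsubseteq> x \<and> finite (elts y) \<and> card (elts y) = k}" for k
  unfolding N_def by (subst elts_sep) (auto simp: bijM_iff)
 have cN: "countable_in M (N (vnat k))" for k
 proof (induction k)
  case 0
  have "y = hemp" if "y \<in> elts (N (vnat 0))" for y
   using that hset_eqI[of y hemp] unfolding eN by auto
  hence "(N (vnat 0)) \<sqsubseteq> (hset_of {hemp})" by auto
  moreover have "countable_in M (hset_of {hemp})"
  proof (rule cntI[where F = "\<lambda>_. hemp"])
   show "hgraph (hset_of {hemp}) (\<lambda>_. hemp) \<in> M" by (rule inM, intro df hemp_inM)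
  qed (auto simp: vnat_0[symmetric])
  ultimately show ?case using cnt_subset[of "hset_of {hemp}"] NM by simp
 next
  case (Suc k)
  show ?case
  proof (rule cnt_surj[where x = "hprod (N (vnat k)) x" and R = "\<lambda>p y. y = hins (hsnd p) (hfst p)"])
   show "countable_in M (hprod (N (vnat k)) x)" by (rule cnt_prod) (use NM Suc x in simp_all)
   show "dfp M (\<lambda>e. e 1 = hins (hsnd (e 0)) (hfst (e 0)))" by (intro df)
   fix y assume y: "y \<in> elts (N (vnat (Suc k)))"
   hence fy: "finite (elts y)" "card (elts y) = Suc k" "y \<sqsubseteq> x" unfolding eN by simp_all
   then obtain b where b: "b \<in> elts y" by fastforce
   define y' where "y' = hset_of (elts y - {b})"
   have c: "countable (elts y - {b})" by simp
   have ey': "elts y' = elts y - {b}" unfolding y'_def by (rule elts_hset_of[OF c])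
   have "y' \<in> M" unfolding y'_def by (rule finite_inM) (use fy subM[OF x(1)] in auto)
   hence "y' \<in> elts (N (vnat k))" unfolding eN using fy b ey' by auto
   moreover have "y = hins b y'" by (rule hset_eqI) (use b ey' in auto)
   ultimately show "\<exists>p\<in>elts (hprod (N (vnat k)) x). y = hins (hsnd p) (hfst p)"
    using b fy by (intro bexI[of _ "opair y' b"]) auto
  qed (use NM x in simp_all)
 qed
 have "hFin x = hUn (hset_of (N ` elts omega))"
 proof (rule hset_eqI)
  have "elts (hUn (hset_of (N ` elts omega))) = (\<Union>k. elts (N (vnat k)))"
   by (simp only: elts_hUn elts_omega image_image) (simp add: image_image)
  also have "\<dots> = elts (hFin x)"
   unfolding eN hFin_def by (subst elts_sep) auto
  finally show "elts (hFin x) = elts (hUn (hset_of (N ` elts omega)))" ..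
 qed
 moreover have "hset_of (N ` elts omega) \<in> M" unfolding N_def by (rule inM, intro df x omega_inM)
 moreover have "countable_in M (hset_of (N ` elts omega))"
 proof (rule cnt_surj[OF omega_inM cnt_omega, where R = "\<lambda>n y. y = N n"])
  show "hset_of (N ` elts omega) \<in> M" by fact
  show "dfp M (\<lambda>e. e 1 = N (e 0))" unfolding N_def by (intro df x)
 qed auto
 ultimately show ?thesis using cnt_UN[of "hset_of (N ` elts omega)"] cN by auto
qed

end

section \<open>Forcing\<close>

lemma elts_val: "elts (val G \<tau>) = val G ` {\<sigma>. \<exists>p\<in>G. opair \<sigma> p \<in> elts \<tau>}"
proof -
 have "{\<sigma>. \<exists>p\<in>G. opair \<sigma> p \<in> elts \<tau>} \<subseteq> elts (hUn (hUn \<tau>))"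
  using opair_in_hUn(1) by blast
 hence "countable {\<sigma>. \<exists>p\<in>G. opair \<sigma> p \<in> elts \<tau>}" by (rule countable_subset) simp
 thus ?thesis by (subst val.simps) simp
qed

lemma in_valI: "opair \<sigma> p \<in> elts \<tau> ==> p \<in> G ==> val G \<sigma> \<in> elts (val G \<tau>)"
 unfolding elts_val by blast

lemma in_valE:
 assumes "x \<in> elts (val G \<tau>)"
 obtains \<sigma> p where "x = val G \<sigma>" "opair \<sigma> p \<in> elts \<tau>" "p \<in> G"
 using assms unfolding elts_val by blast

lemma name_in_TC: "opair \<sigma> p \<in> elts \<tau> ==> \<sigma> \<in> elts (TC \<tau>) \<and> p \<in> elts (TC \<tau>)"
proof -
 assume "opair \<sigma> p \<in> elts \<tau>"
 hence "opair \<sigma> p \<in> elts (TC \<tau>)" by (rule elts_sub_TC)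
 hence "hset_of {\<sigma>, p} \<in> elts (TC \<tau>)" by (rule TC_step[rotated]) (simp add: elts_opair)
 thus ?thesis by (intro conjI; elim TC_step[rotated]) simp_all
qed

text \<open>Forcing of equality of names by recursion on the first name. Whenever a condition puts a
  potential member of one side in, densely many stronger ones equate it with a member of the other
  side. All quantifiers are bounded by \<open>P\<close> and transitive closures, so the relation can
  be computed in the model.\<close>

function feq :: "hset => hset => hset => hset => hset => bool" where
 "feq P L \<sigma> \<tau> p <->
  (\<forall>\<rho>\<in>elts (TC \<sigma>). \<forall>q\<in>elts P. opair \<rho> q \<in> elts \<sigma> --> (\<forall>r\<in>elts P. opair r p \<in> elts L --> opair r q \<in> elts L -->
   (\<exists>s\<in>elts P. opair s r \<in> elts L \<and> (\<exists>\<rho>'\<in>elts (TC \<tau>). \<exists>q'\<in>elts P. opair \<rho>' q' \<in> elts \<tau> \<and> opair s q' \<in> elts L \<and> feq P L \<rho> \<rho>' s)))) \<and>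
  (\<forall>\<rho>'\<in>elts (TC \<tau>). \<forall>q'\<in>elts P. opair \<rho>' q' \<in> elts \<tau> --> (\<forall>r\<in>elts P. opair r p \<in> elts L --> opair r q' \<in> elts L -->
   (\<exists>s\<in>elts P. opair s r \<in> elts L \<and> (\<exists>\<rho>\<in>elts (TC \<sigma>). \<exists>q\<in>elts P. opair \<rho> q \<in> elts \<sigma> \<and> opair s q \<in> elts L \<and> feq P L \<rho> \<rho>' s))))"
 by pat_completeness auto
termination
proof (relation "inv_image ({(x, y). x \<in> elts y}\<^sup>+) (\<lambda>(P, L, \<sigma>, \<tau>, p). \<sigma>)")
 show "wf (inv_image ({(x, y). x \<in> elts y}\<^sup>+) (\<lambda>(P, L, \<sigma>, \<tau>, p). \<sigma>))"
  by (intro wf_inv_image wf_trancl wf_elts)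
qed (simp_all add: elts_TC')
declare feq.simps [simp del]

locale forcing = ctmodel M for M :: "hset set" +
 fixes P L :: hset
 assumes P [simp]: "P \<in> M" and L [simp]: "L \<in> M" and po: "poset (elts P) (order_of L)"
begin

abbreviation le :: "hset => hset => bool" where "le p q \<equiv> opair p q \<in> elts L"

lemma le_refl: "p \<in> elts P ==> le p p"
 using po unfolding poset_def order_of_def by blast

lemma le_trans: "p \<in> elts P ==> q \<in> elts P ==> r \<in> elts P ==> le p q ==> le q r ==> le p r"
 using po unfolding poset_def order_of_def by blast

lemma P_M: "p \<in> elts P ==> p \<in> M"
 by (rule trM[OF P])

abbreviation fq :: "hset => hset => hset => bool" where "fq \<equiv> feq P L"

text \<open>\<open>recursion\<close> runs over one argument, \<open>feq\<close> over two. So the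
  value at \<sigma> is the whole set of pairs of a name \<tau> in \<open>TC d\<close> and a
  condition forcing equality. The bound \<open>d\<close> stays fixed because members of
  \<open>TC \<tau>\<close> stay in \<open>TC d\<close>; at the end it is the singleton of
  \<tau>.\<close>

lemma dfp_feq [df]:
 assumes "dft M f" "dft M g" "dft M h"
 shows "dfp M (\<lambda>e. h e \<in> elts P \<and> fq (f e) (g e) (h e))"
proof -
 define body where "body D \<sigma> \<tau> p <->
  (\<forall>\<rho>\<in>elts (TC \<sigma>). \<forall>q\<in>elts P. opair \<rho> q \<in> elts \<sigma> --> (\<forall>r\<in>elts P. le r p --> le r q -->
   (\<exists>s\<in>elts P. le s r \<and> (\<exists>\<rho>'\<in>elts (TC \<tau>). \<exists>q'\<in>elts P. opair \<rho>' q' \<in> elts \<tau> \<and> le s q' \<and> opair \<rho>' s \<in> elts (ap D \<rho>))))) \<and>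
  (\<forall>\<rho>'\<in>elts (TC \<tau>). \<forall>q'\<in>elts P. opair \<rho>' q' \<in> elts \<tau> --> (\<forall>r\<in>elts P. le r p --> le r q' -->
   (\<exists>s\<in>elts P. le s r \<and> (\<exists>\<rho>\<in>elts (TC \<sigma>). \<exists>q\<in>elts P. opair \<rho> q \<in> elts \<sigma> \<and> le s q \<and> opair \<rho>' s \<in> elts (ap D \<rho>)))))"
  for D \<sigma> \<tau> p
 define H where "H d \<sigma> = hset_of {z \<in> elts (hprod (TC d) P). fq \<sigma> (hfst z) (hsnd z)}" for d \<sigma>
 have eH: "elts (H d \<sigma>) = {z \<in> elts (hprod (TC d) P). fq \<sigma> (hfst z) (hsnd z)}" for d \<sigma>
  unfolding H_def by (rule elts_sep)
 have Hm: "opair \<tau> p \<in> elts (H d \<sigma>) <-> \<tau> \<in> elts (TC d) \<and> p \<in> elts P \<and> fq \<sigma> \<tau> p" for d \<sigma> \<tau> p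
  unfolding eH by (auto simp: opair_in_hprod simp del: elts_hprod)
 have dH: "dft M (\<lambda>e. H (e 0) (e 1))"
 proof (rule recursion[where \<Phi> = "\<lambda>d \<sigma> D. hset_of {z \<in> elts (hprod (TC d) P). body D \<sigma> (hfst z) (hsnd z)}"])
  show "dft M (\<lambda>e. hset_of {z \<in> elts (hprod (TC (e 0)) P). body (e 2) (e 1) (hfst z) (hsnd z)})"
   unfolding body_def by (intro df P L)
 next
  fix d \<sigma> :: hset
  have "fq \<sigma> \<tau> p <-> body (hgraph (TC \<sigma>) (H d)) \<sigma> \<tau> p" if \<tau>: "\<tau> \<in> elts (TC d)" for \<tau> p
  proof -
   have sub: "\<rho>' \<in> elts (TC d)" if "\<rho>' \<in> elts (TC \<tau>)" for \<rho>' using TC_trans[OF \<tau>] that by (rule subsetD)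
   show ?thesis unfolding body_def by (subst feq.simps) (simp add: Hm sub cong: ball_cong bex_cong conj_cong)
  qed
  hence "{z \<in> elts (hprod (TC d) P). fq \<sigma> (hfst z) (hsnd z)} =
   {z \<in> elts (hprod (TC d) P). body (hgraph (TC \<sigma>) (H d)) \<sigma> (hfst z) (hsnd z)}"
   by (intro Collect_cong conj_cong refl) auto
  thus "H d \<sigma> = hset_of {z \<in> elts (hprod (TC d) P). body (hgraph (TC \<sigma>) (H d)) \<sigma> (hfst z) (hsnd z)}"
   unfolding H_def[of d \<sigma>] by (rule arg_cong)
 qed
 have "dfp M (\<lambda>e. opair (e 1) (e 2) \<in> elts (H (hset_of {e 1}) (e 0)))"
  by (intro df dft_app2[OF dH])
 moreover have "opair \<tau> p \<in> elts (H (hset_of {\<tau>}) \<sigma>) <-> p \<in> elts P \<and> fq \<sigma> \<tau> p" for \<sigma> \<tau> p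
  unfolding Hm using elts_sub_TC[of \<tau> "hset_of {\<tau>}"] by simp
 ultimately have "dfp M (\<lambda>e. e 2 \<in> elts P \<and> fq (e 0) (e 1) (e 2))" by simp
 from dfp_app3[where R = "\<lambda>\<sigma> \<tau> p. p \<in> elts P \<and> fq \<sigma> \<tau> p", OF this assms] show ?thesis .
qed

lemma fq_mono: "fq \<sigma> \<tau> p ==> q \<in> elts P ==> p \<in> elts P ==> le q p ==> fq \<sigma> \<tau> q"
proof -
 assume f: "fq \<sigma> \<tau> p" and q: "q \<in> elts P" "p \<in> elts P" "le q p"
 have "le r p" if "r \<in> elts P" "le r q" for r by (rule le_trans[OF that(1) q(1,2) that(2) q(3)])
 thus ?thesis using f unfolding feq.simps[of P L \<sigma> \<tau>] by simp
qed

lemma fq_dense: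
 assumes p: "p \<in> elts P" and d: "\<And>q. q \<in> elts P ==> le q p ==> \<exists>r\<in>elts P. le r q \<and> fq \<sigma> \<tau> r"
 shows "fq \<sigma> \<tau> p"
 unfolding feq.simps[of P L \<sigma> \<tau>]
proof (intro conjI ballI impI)
 fix \<rho> q r assume *: "\<rho> \<in> elts (TC \<sigma>)" "q \<in> elts P" "opair \<rho> q \<in> elts \<sigma>" "r \<in> elts P" "le r p" "le r q"
 obtain r1 where r1: "r1 \<in> elts P" "le r1 r" "fq \<sigma> \<tau> r1" using d[OF *(4,5)] by (elim bexE conjE)
 have "le r1 q" by (rule le_trans[OF r1(1) *(4) *(2) r1(2) *(6)])
 from conjunct1[OF r1(3)[unfolded feq.simps[of P L \<sigma> \<tau>]], rule_format, OF *(1,2,3) r1(1) le_refl[OF r1(1)] this]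
 obtain s where s: "s \<in> elts P" "le s r1" "\<exists>\<rho>'\<in>elts (TC \<tau>). \<exists>q'\<in>elts P. opair \<rho>' q' \<in> elts \<tau> \<and> le s q' \<and> fq \<rho> \<rho>' s"
  by (elim bexE[where A = "elts P"] conjE)
 have "le s r" by (rule le_trans[OF s(1) r1(1) *(4) s(2) r1(2)])
 thus "\<exists>s\<in>elts P. le s r \<and> (\<exists>\<rho>'\<in>elts (TC \<tau>). \<exists>q'\<in>elts P. opair \<rho>' q' \<in> elts \<tau> \<and> le s q' \<and> fq \<rho> \<rho>' s)"
  by (intro bexI[OF _ s(1)] conjI[OF _ s(3)])
next
 fix \<rho>' q r assume *: "\<rho>' \<in> elts (TC \<tau>)" "q \<in> elts P" "opair \<rho>' q \<in> elts \<tau>" "r \<in> elts P" "le r p" "le r q"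
 obtain r1 where r1: "r1 \<in> elts P" "le r1 r" "fq \<sigma> \<tau> r1" using d[OF *(4,5)] by (elim bexE conjE)
 have "le r1 q" by (rule le_trans[OF r1(1) *(4) *(2) r1(2) *(6)])
 from conjunct2[OF r1(3)[unfolded feq.simps[of P L \<sigma> \<tau>]], rule_format, OF *(1,2,3) r1(1) le_refl[OF r1(1)] this]
 obtain s where s: "s \<in> elts P" "le s r1" "\<exists>\<rho>\<in>elts (TC \<sigma>). \<exists>q\<in>elts P. opair \<rho> q \<in> elts \<sigma> \<and> le s q \<and> fq \<rho> \<rho>' s"
  by (elim bexE[where A = "elts P"] conjE)
 have "le s r" by (rule le_trans[OF s(1) r1(1) *(4) s(2) r1(2)])
 thus "\<exists>s\<in>elts P. le s r \<and> (\<exists>\<rho>\<in>elts (TC \<sigma>). \<exists>q\<in>elts P. opair \<rho> q \<in> elts \<sigma> \<and> le s q \<and> fq \<rho> \<rho>' s)"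
  by (intro bexI[OF _ s(1)] conjI[OF _ s(3)])
qed

section \<open>The forcing relation for arbitrary formulas\<close>

definition fmem :: "hset => hset => hset => bool" where
 "fmem \<sigma> \<tau> p <-> (\<forall>r\<in>elts P. le r p -->
   (\<exists>s\<in>elts P. le s r \<and> (\<exists>\<rho>\<in>elts (TC \<tau>). \<exists>q\<in>elts P. opair \<rho> q \<in> elts \<tau> \<and> le s q \<and> s \<in> elts P \<and> fq \<sigma> \<rho> s)))"

text \<open>Every member of \<open>M\<close> counts as a name, so the quantifier clause runs over
  \<open>M\<close>. The relation is arranged so that forcing densely below \<open>p\<close> implies
  forcing at \<open>p\<close> (\<open>forces_dense\<close>).\<close>

primrec forces :: "fm => (nat => hset) => hset => bool" where
 "forces (Mem i j) e p <-> fmem (e i) (e j) p"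
| "forces (Eq i j) e p <-> fq (e i) (e j) p"
| "forces (Neg \<phi>) e p <-> (\<forall>q\<in>elts P. le q p --> \<not> forces \<phi> e q)"
| "forces (Conj \<phi> \<psi>) e p <-> forces \<phi> e p \<and> forces \<psi> e p"
| "forces (All i \<phi>) e p <-> (\<forall>x\<in>M. forces \<phi> (e(i := x)) p)"

lemma forces_mono: "forces \<phi> e p ==> q \<in> elts P ==> p \<in> elts P ==> le q p ==> forces \<phi> e q"
proof (induction \<phi> arbitrary: e p q)
 case (Mem i j)
 have "le r p" if "r \<in> elts P" "le r q" for r
  by (rule le_trans[OF that(1) Mem.prems(2,3) that(2) Mem.prems(4)])
 thus ?case using Mem.prems(1) by (simp add: fmem_def)
next
 case (Eq i j)
 thus ?case using fq_mono by simp
next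
 case (Neg \<phi>)
 have "le r p" if "r \<in> elts P" "le r q" for r
  by (rule le_trans[OF that(1) Neg.prems(2,3) that(2) Neg.prems(4)])
 thus ?case using Neg.prems(1) by simp
next
 case (Conj \<phi>1 \<phi>2)
 thus ?case by (metis forces.simps(4))
next
 case (All i \<phi>)
 thus ?case by (metis forces.simps(5))
qed

lemma forces_dense:
 "p \<in> elts P ==> (\<And>q. q \<in> elts P ==> le q p ==> \<exists>r\<in>elts P. le r q \<and> forces \<phi> e r) ==> forces \<phi> e p"
proof (induction \<phi> arbitrary: e p)
 case (Mem i j)
 show ?case unfolding forces.simps fmem_def
 proof (intro ballI impI)
  fix r assume r: "r \<in> elts P" "le r p"
  obtain r1 where r1: "r1 \<in> elts P" "le r1 r" "fmem (e i) (e j) r1"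
   using Mem.prems(2)[OF r] by (elim bexE conjE) simp
  from r1(3)[unfolded fmem_def, rule_format, OF r1(1) le_refl[OF r1(1)]]
  obtain s where s: "s \<in> elts P" "le s r1"
   "\<exists>\<rho>\<in>elts (TC (e j)). \<exists>q\<in>elts P. opair \<rho> q \<in> elts (e j) \<and> le s q \<and> s \<in> elts P \<and> fq (e i) \<rho> s"
   by (elim bexE[where A = "elts P"] conjE)
  have "le s r" by (rule le_trans[OF s(1) r1(1) r(1) s(2) r1(2)])
  thus "\<exists>s\<in>elts P. le s r \<and> (\<exists>\<rho>\<in>elts (TC (e j)). \<exists>q\<in>elts P. opair \<rho> q \<in> elts (e j) \<and> le s q \<and> s \<in> elts P \<and> fq (e i) \<rho> s)"
   by (intro bexI[OF _ s(1)] conjI[OF _ s(3)])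
 qed
next
 case (Eq i j)
 thus ?case using fq_dense by simp
next
 case (Neg \<phi>)
 show ?case unfolding forces.simps
 proof (intro ballI impI notI)
  fix q assume q: "q \<in> elts P" "le q p" "forces \<phi> e q"
  obtain r where r: "r \<in> elts P" "le r q" "forces (Neg \<phi>) e r" using Neg.prems(2)[OF q(1,2)] by (elim bexE conjE)
  have "forces \<phi> e r" by (rule forces_mono[OF q(3) r(1) q(1) r(2)])
  thus False using r(3) r(1) le_refl[OF r(1)] by simp
 qed
next
 case (Conj \<phi>1 \<phi>2)
 have "forces \<phi>1 e p" by (rule Conj.IH(1)[OF Conj.prems(1)]) (use Conj.prems(2) in \<open>metis forces.simps(4)\<close>)
 moreover have "forces \<phi>2 e p" by (rule Conj.IH(2)[OF Conj.prems(1)]) (use Conj.prems(2) in \<open>metis forces.simps(4)\<close>)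
 ultimately show ?case by simp
next
 case (All i \<phi>)
 have "forces \<phi> (e(i := x)) p" if "x \<in> M" for x
  by (rule All.IH[OF All.prems(1)]) (use All.prems(2) that in \<open>metis forces.simps(5)\<close>)
 thus ?case by simp
qed

text \<open>Slot 0 holds the condition and the rest the names. Membership in \<open>P\<close> is
  carried along since \<open>dfp_feq\<close> provides the atomic case only together with it.\<close>

lemma dfp_forces: "dfp M (\<lambda>e. e 0 \<in> elts P \<and> forces \<phi> (\<lambda>i. e (Suc i)) (e 0))"
proof (induction \<phi>)
 case (Mem i j)
 have "dfp M (\<lambda>e. e 0 \<in> elts P \<and> fmem (e (Suc i)) (e (Suc j)) (e 0))"
  unfolding fmem_def by (intro df P L)
 thus ?case by simp
next
 case (Eq i j)
 have "dfp M (\<lambda>e. e 0 \<in> elts P \<and> fq (e (Suc i)) (e (Suc j)) (e 0))" by (intro df)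
 thus ?case by simp
next
 case (Neg \<phi>)
 let ?Q = "\<lambda>e. e 0 \<in> elts P \<and> forces \<phi> (\<lambda>i. e (Suc i)) (e 0)"
 let ?r = "\<lambda>i. case i of 0 => 0 | Suc j => Suc (Suc j)"
 have i: "inj ?r"
 proof (rule injI)
  fix x y :: nat assume "?r x = ?r y" thus "x = y" by (cases x; cases y) auto
 qed
 have 1: "dfp M (\<lambda>e. e 0 \<in> elts P \<and> forces \<phi> (\<lambda>i. e (Suc (Suc i))) (e 0))"
  using dfp_ren[OF i Neg] by simp
 have "dfp M (\<lambda>e. e 0 \<in> elts P \<and> (\<forall>q\<in>elts P. le q (e 0) --> \<not> (q \<in> elts P \<and> forces \<phi> (\<lambda>i. e (Suc i)) q)))"
  by (intro df P L 1)
 thus ?case by (rule dfp_eqI) simp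
next
 case (Conj \<phi>1 \<phi>2)
 show ?case by (rule dfp_eqI[OF dfp_conj[OF Conj.IH]]) auto
next
 case (All i \<phi>)
 \<comment> \<open>Under the quantifier slot 0 holds the quantified name and slot 1 the condition.
   The condition therefore moves up by one, variable \<open>i\<close> is read at slot 0, and all
   other variables shift by two.\<close>
 let ?r = "\<lambda>n. case n of 0 => Suc 0 | Suc j => if j = i then 0 else Suc (Suc j)"
 have inj: "inj ?r"
 proof (rule injI)
  fix x y :: nat assume "?r x = ?r y" thus "x = y" by (cases x; cases y) (auto split: if_splits)
 qed
 have eq: "(\<lambda>j. e (?r (Suc j))) = (\<lambda>j. e (Suc (Suc j)))(i := e 0)" for e :: "nat => hset" by auto
 have "dfp M (\<lambda>e. e (Suc 0) \<in> elts P \<and> forces \<phi> (\<lambda>j. e (?r (Suc j))) (e (Suc 0)))"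
  using dfp_ren[OF inj All] by simp
 hence 1: "dfp M (\<lambda>e. e (Suc 0) \<in> elts P \<and> forces \<phi> ((\<lambda>j. e (Suc (Suc j)))(i := e 0)) (e (Suc 0)))"
  unfolding eq .
 have "dfp M (\<lambda>e. \<forall>x\<in>M. e 0 \<in> elts P \<and> forces \<phi> ((\<lambda>j. e (Suc j))(i := x)) (e 0))"
  by (rule dfp_all) (rule 1)
 thus ?case
 proof (rule dfp_eqI)
  fix e :: "nat => hset"
  show "(e 0 \<in> elts P \<and> forces (All i \<phi>) (\<lambda>i. e (Suc i)) (e 0)) <->
   (\<forall>x\<in>M. e 0 \<in> elts P \<and> forces \<phi> ((\<lambda>j. e (Suc j))(i := x)) (e 0))"
   using hemp_inM by (simp only: forces.simps) blast
 qed
qed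

lemma dfp_forces': "range b \<subseteq> M ==> dfp M (\<lambda>e. e 0 \<in> elts P \<and> forces \<phi> b (e 0))"
 using dfp_inst[OF dfp_forces[of \<phi>], of "case_nat hemp b" 1] by simp

end

section \<open>Generic filters and the truth lemma\<close>

locale generic_ext = forcing M P L for M P L +
 fixes G :: "hset set"
 assumes gen: "generic M (elts P) (order_of L) G"
begin

lemma G_P: "p \<in> G ==> p \<in> elts P"
 using gen unfolding generic_def by blast

lemma G_up: "p \<in> G ==> q \<in> elts P ==> le p q ==> q \<in> G"
 using gen unfolding generic_def order_of_def by blast

lemma G_dir: "p \<in> G ==> q \<in> G ==> \<exists>r\<in>G. le r p \<and> le r q"
 using gen unfolding generic_def order_of_def by blast

lemma G_ne: "\<exists>p. p \<in> G"
 using gen unfolding generic_def by blast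

lemma G_dense:
 assumes Q: "dfp M (\<lambda>e. Q (e 0))" and d: "\<And>p. p \<in> elts P ==> \<exists>q\<in>elts P. le q p \<and> Q q"
 shows "\<exists>q\<in>G. Q q"
proof -
 define D where "D = hset_of {q \<in> elts P. Q q}"
 have eD: "elts D = {q \<in> elts P. Q q}" by (simp add: D_def)
 have D: "D \<in> M" unfolding D_def by (rule sep[OF Q P])
 have "\<forall>p\<in>elts P. \<exists>d\<in>elts D. order_of L d p" unfolding eD order_of_def
 proof
  fix p assume "p \<in> elts P"
  then obtain q where "q \<in> elts P" "le q p" "Q q" using d by blast
  thus "\<exists>d\<in>{q \<in> elts P. Q q}. le d p" by blast
 qed
 moreover have "D \<sqsubseteq> P" by (auto simp: eD)
 ultimately have "G \<inter> elts D \<noteq> {}" using gen D unfolding generic_def by blast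
 thus ?thesis unfolding eD by blast
qed

lemma G_dense_below:
 assumes Q: "dfp M (\<lambda>e. Q (e 0))" and p: "p \<in> G"
  and d: "\<And>r. r \<in> elts P ==> le r p ==> \<exists>s\<in>elts P. le s r \<and> Q s"
 shows "\<exists>s\<in>G. le s p \<and> Q s"
proof -
 have pP: "p \<in> elts P" by (rule G_P[OF p])
 \<comment> \<open>A set dense below \<open>p\<close> becomes dense once the conditions incompatible
   with \<open>p\<close> are added, and no condition of the latter kind is in the filter together
   with \<open>p\<close>.\<close>
 have "\<exists>s\<in>G. (le s p \<and> Q s) \<or> \<not> (\<exists>r\<in>elts P. le r s \<and> le r p)"
 proof (rule G_dense)
  show "dfp M (\<lambda>e. (le (e 0) p \<and> Q (e 0)) \<or> \<not> (\<exists>r\<in>elts P. le r (e 0) \<and> le r p))"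
   by (intro df Q P L P_M[OF pP])
  fix q assume q: "q \<in> elts P"
  show "\<exists>s\<in>elts P. le s q \<and> ((le s p \<and> Q s) \<or> \<not> (\<exists>r\<in>elts P. le r s \<and> le r p))"
  proof (cases "\<exists>r\<in>elts P. le r q \<and> le r p")
   case True
   then obtain r where r: "r \<in> elts P" "le r q" "le r p" by (elim bexE conjE)
   obtain s where s: "s \<in> elts P" "le s r" "Q s" using d[OF r(1,3)] by (elim bexE conjE)
   have "le s q" "le s p" using le_trans[OF s(1) r(1) _ s(2)] r q pP by simp_all
   thus ?thesis using s by (intro bexI[of _ s]) simp_all
  next
   case False
   thus ?thesis using q le_refl[OF q] by (intro bexI[of _ q]) simp_all
  qed
 qed
 then obtain s where s: "s \<in> G" "(le s p \<and> Q s) \<or> \<not> (\<exists>r\<in>elts P. le r s \<and> le r p)" by (rule bexE)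
 obtain r where "r \<in> G" "le r s" "le r p" using G_dir[OF s(1) p] by (elim bexE conjE)
 hence "\<exists>r\<in>elts P. le r s \<and> le r p" using G_P by (intro bexI conjI)
 thus ?thesis using s by (intro bexI[of _ s]) simp_all
qed

text \<open>Induction on the first name. If equality is forced, density places each element of one
  value in the other. Conversely a failure to force equality is itself witnessed by a condition, and
  conditions of one of these kinds are dense.\<close>

lemma fq_truth: "\<sigma> \<in> M ==> \<tau> \<in> M ==> val G \<sigma> = val G \<tau> <-> (\<exists>p\<in>G. fq \<sigma> \<tau> p)"
proof (induction \<sigma> arbitrary: \<tau> rule: TC_induct)
 case (step \<sigma>)
 note \<sigma> = step.prems(1) and \<tau> = step.prems(2)
 have IH: "val G \<rho> = val G \<rho>' <-> (\<exists>p\<in>G. fq \<rho> \<rho>' p)" if "\<rho> \<in> elts (TC \<sigma>)" "\<rho>' \<in> elts (TC \<tau>)" for \<rho> \<rho>'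
  by (rule step.IH[OF that(1) trM[OF TC_inM[OF \<sigma>] that(1)] trM[OF TC_inM[OF \<tau>] that(2)]])
 define B1 where "B1 \<rho> s <-> (\<exists>\<rho>'\<in>elts (TC \<tau>). \<exists>q'\<in>elts P. opair \<rho>' q' \<in> elts \<tau> \<and> le s q' \<and> (s \<in> elts P \<and> fq \<rho> \<rho>' s))" for \<rho> s
 define B2 where "B2 \<rho>' s <-> (\<exists>\<rho>\<in>elts (TC \<sigma>). \<exists>q\<in>elts P. opair \<rho> q \<in> elts \<sigma> \<and> le s q \<and> (s \<in> elts P \<and> fq \<rho> \<rho>' s))" for \<rho>' s
 have E: "fq \<sigma> \<tau> p <-> (\<forall>\<rho>\<in>elts (TC \<sigma>). \<forall>q\<in>elts P. opair \<rho> q \<in> elts \<sigma> --> (\<forall>r\<in>elts P. le r p --> le r q --> (\<exists>s\<in>elts P. le s r \<and> B1 \<rho> s))) \<and>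
  (\<forall>\<rho>'\<in>elts (TC \<tau>). \<forall>q'\<in>elts P. opair \<rho>' q' \<in> elts \<tau> --> (\<forall>r\<in>elts P. le r p --> le r q' --> (\<exists>s\<in>elts P. le s r \<and> B2 \<rho>' s)))" for p
  unfolding B1_def B2_def by (subst feq.simps) (simp cong: bex_cong conj_cong)
 have dB1: "dfp M (\<lambda>e. B1 (f e) (g e))" if "dft M f" "dft M g" for f g
  by (rule dfp_app2[where R = B1, OF _ that], unfold B1_def) (intro df P L \<tau>)
 have dB2: "dfp M (\<lambda>e. B2 (f e) (g e))" if "dft M f" "dft M g" for f g
  by (rule dfp_app2[where R = B2, OF _ that], unfold B2_def) (intro df P L \<sigma>)
 have below: "\<exists>r\<in>G. le r p \<and> le r q" if "p \<in> G" "q \<in> G" for p q using G_dir[OF that] .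
 have B1v: "\<exists>\<rho>' q'. opair \<rho>' q' \<in> elts \<tau> \<and> q' \<in> G \<and> val G \<rho> = val G \<rho>'" if b: "s \<in> G" "B1 \<rho> s" "\<rho> \<in> elts (TC \<sigma>)" for s \<rho>
 proof -
  obtain \<rho>' q' where *: "\<rho>' \<in> elts (TC \<tau>)" "q' \<in> elts P" "opair \<rho>' q' \<in> elts \<tau>" "le s q'" "fq \<rho> \<rho>' s"
   using b(2) unfolding B1_def by (elim bexE conjE)
  thus ?thesis using IH[OF b(3) *(1)] G_up[OF b(1) *(2,4)] b(1) by blast
 qed
 have B2v: "\<exists>\<rho> q. opair \<rho> q \<in> elts \<sigma> \<and> q \<in> G \<and> val G \<rho> = val G \<rho>'" if b: "s \<in> G" "B2 \<rho>' s" "\<rho>' \<in> elts (TC \<tau>)" for s \<rho>'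
 proof -
  obtain \<rho> q where *: "\<rho> \<in> elts (TC \<sigma>)" "q \<in> elts P" "opair \<rho> q \<in> elts \<sigma>" "le s q" "fq \<rho> \<rho>' s"
   using b(2) unfolding B2_def by (elim bexE conjE)
  thus ?thesis using IH[OF *(1) b(3)] G_up[OF b(1) *(2,4)] b(1) by blast
 qed
 show ?case
 proof
  assume "\<exists>p\<in>G. fq \<sigma> \<tau> p"
  then obtain p where p: "p \<in> G" "fq \<sigma> \<tau> p" by (rule bexE)
  have pP: "p \<in> elts P" by (rule G_P[OF p(1)])
  have "(val G \<sigma>) \<sqsubseteq> (val G \<tau>)"
  proof
   fix x assume "x \<in> elts (val G \<sigma>)"
   then obtain \<rho> q where x: "x = val G \<rho>" "opair \<rho> q \<in> elts \<sigma>" "q \<in> G" by (rule in_valE)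
   have \<rho>: "\<rho> \<in> elts (TC \<sigma>)" using name_in_TC[OF x(2)] by simp
   obtain t where t: "t \<in> G" "le t p" "le t q" using below[OF p(1) x(3)] by (elim bexE conjE)
   have "\<exists>s\<in>G. le s t \<and> B1 \<rho> s"
   proof (rule G_dense_below[OF _ t(1)])
    show "dfp M (\<lambda>e. B1 \<rho> (e 0))" by (intro dB1 df trM[OF TC_inM[OF \<sigma>] \<rho>])
    fix r assume r: "r \<in> elts P" "le r t"
    have "le r p" "le r q" using le_trans[OF r(1) G_P[OF t(1)] _ r(2)] t pP G_P[OF x(3)] by simp_all
    thus "\<exists>s\<in>elts P. le s r \<and> B1 \<rho> s" using p(2)[unfolded E] \<rho> x(2) G_P[OF x(3)] r(1) by simp
   qed
   then obtain s where s: "s \<in> G" "B1 \<rho> s" by (elim bexE conjE)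
   obtain \<rho>' q' where "opair \<rho>' q' \<in> elts \<tau>" "q' \<in> G" "val G \<rho> = val G \<rho>'" using B1v[OF s \<rho>] by (elim exE conjE)
   thus "x \<in> elts (val G \<tau>)" using in_valI x(1) by metis
  qed
  moreover have "(val G \<tau>) \<sqsubseteq> (val G \<sigma>)"
  proof
   fix x assume "x \<in> elts (val G \<tau>)"
   then obtain \<rho> q where x: "x = val G \<rho>" "opair \<rho> q \<in> elts \<tau>" "q \<in> G" by (rule in_valE)
   have \<rho>: "\<rho> \<in> elts (TC \<tau>)" using name_in_TC[OF x(2)] by simp
   obtain t where t: "t \<in> G" "le t p" "le t q" using below[OF p(1) x(3)] by (elim bexE conjE)
   have "\<exists>s\<in>G. le s t \<and> B2 \<rho> s"
   proof (rule G_dense_below[OF _ t(1)])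
    show "dfp M (\<lambda>e. B2 \<rho> (e 0))" by (intro dB2 df trM[OF TC_inM[OF \<tau>] \<rho>])
    fix r assume r: "r \<in> elts P" "le r t"
    have "le r p" "le r q" using le_trans[OF r(1) G_P[OF t(1)] _ r(2)] t pP G_P[OF x(3)] by simp_all
    thus "\<exists>s\<in>elts P. le s r \<and> B2 \<rho> s" using p(2)[unfolded E] \<rho> x(2) G_P[OF x(3)] r(1) by simp
   qed
   then obtain s where s: "s \<in> G" "B2 \<rho> s" by (elim bexE conjE)
   obtain \<rho>' q' where "opair \<rho>' q' \<in> elts \<sigma>" "q' \<in> G" "val G \<rho>' = val G \<rho>" using B2v[OF s \<rho>] by (elim exE conjE)
   thus "x \<in> elts (val G \<sigma>)" using in_valI x(1) by metis
  qed
  ultimately show "val G \<sigma> = val G \<tau>" by (intro hset_eqI) simp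
 next
  assume eq: "val G \<sigma> = val G \<tau>"
  \<comment> \<open>Reasons for a failure: \<open>p\<close> puts a member of one name in, but
    nothing below \<open>p\<close> equates it with a member of the other name. Equal values exclude
    both reasons for conditions in the filter.\<close>
  define F1 where "F1 p <-> (\<exists>\<rho>\<in>elts (TC \<sigma>). \<exists>q\<in>elts P. opair \<rho> q \<in> elts \<sigma> \<and> le p q \<and> (\<forall>s\<in>elts P. le s p --> \<not> B1 \<rho> s))" for p
  define F2 where "F2 p <-> (\<exists>\<rho>\<in>elts (TC \<tau>). \<exists>q\<in>elts P. opair \<rho> q \<in> elts \<tau> \<and> le p q \<and> (\<forall>s\<in>elts P. le s p --> \<not> B2 \<rho> s))" for p
  have "\<exists>p\<in>G. (p \<in> elts P \<and> fq \<sigma> \<tau> p) \<or> F1 p \<or> F2 p"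
  proof (rule G_dense)
   show "dfp M (\<lambda>e. (e 0 \<in> elts P \<and> fq \<sigma> \<tau> (e 0)) \<or> F1 (e 0) \<or> F2 (e 0))"
    unfolding F1_def F2_def by (intro df P L dB1 dB2 \<sigma> \<tau>)
   fix p assume p: "p \<in> elts P"
   show "\<exists>q\<in>elts P. le q p \<and> ((q \<in> elts P \<and> fq \<sigma> \<tau> q) \<or> F1 q \<or> F2 q)"
   proof (cases "fq \<sigma> \<tau> p")
    case True
    thus ?thesis using p le_refl[OF p] by (intro bexI[of _ p]) simp_all
   next
    case False
    then consider
     \<rho> q r where "\<rho> \<in> elts (TC \<sigma>)" "q \<in> elts P" "opair \<rho> q \<in> elts \<sigma>" "r \<in> elts P" "le r p" "le r q" "\<not> (\<exists>s\<in>elts P. le s r \<and> B1 \<rho> s)"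
    | \<rho> q r where "\<rho> \<in> elts (TC \<tau>)" "q \<in> elts P" "opair \<rho> q \<in> elts \<tau>" "r \<in> elts P" "le r p" "le r q" "\<not> (\<exists>s\<in>elts P. le s r \<and> B2 \<rho> s)"
     unfolding E by blast
    thus ?thesis
    proof cases
     case 1
     hence "F1 r" unfolding F1_def by (intro bexI[of _ \<rho>] bexI[of _ q] conjI) simp_all
     thus ?thesis using 1 by (intro bexI[of _ r]) simp_all
    next
     case 2
     hence "F2 r" unfolding F2_def by (intro bexI[of _ \<rho>] bexI[of _ q] conjI) simp_all
     thus ?thesis using 2 by (intro bexI[of _ r]) simp_all
    qed
   qed
  qed
  then obtain p where p: "p \<in> G" "(p \<in> elts P \<and> fq \<sigma> \<tau> p) \<or> F1 p \<or> F2 p" by (rule bexE)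
  have pP: "p \<in> elts P" by (rule G_P[OF p(1)])
  have "\<not> F1 p"
  proof
   assume "F1 p"
   then obtain \<rho> q where \<rho>: "\<rho> \<in> elts (TC \<sigma>)" "q \<in> elts P" "opair \<rho> q \<in> elts \<sigma>" "le p q" and n: "\<forall>s\<in>elts P. le s p --> \<not> B1 \<rho> s"
    unfolding F1_def by (elim bexE conjE)
   have "val G \<rho> \<in> elts (val G \<tau>)" using in_valI[OF \<rho>(3) G_up[OF p(1) \<rho>(2,4)]] eq by simp
   then obtain \<rho>' q' where \<rho>': "val G \<rho> = val G \<rho>'" "opair \<rho>' q' \<in> elts \<tau>" "q' \<in> G" by (rule in_valE)
   have T: "\<rho>' \<in> elts (TC \<tau>)" using name_in_TC[OF \<rho>'(2)] by simp
   obtain r where r: "r \<in> G" "fq \<rho> \<rho>' r" using IH[OF \<rho>(1) T] \<rho>'(1) by auto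
   obtain t where t: "t \<in> G" "le t p" "le t q'" using below[OF p(1) \<rho>'(3)] by (elim bexE conjE)
   obtain s where s: "s \<in> G" "le s t" "le s r" using below[OF t(1) r(1)] by (elim bexE conjE)
   note sP = G_P[OF s(1)] and tP = G_P[OF t(1)]
   have "fq \<rho> \<rho>' s" by (rule fq_mono[OF r(2) sP G_P[OF r(1)] s(3)])
   moreover have "le s p" "le s q'" using le_trans[OF sP tP _ s(2)] t pP G_P[OF \<rho>'(3)] by simp_all
   ultimately have "B1 \<rho> s" unfolding B1_def using T \<rho>'(2) G_P[OF \<rho>'(3)] sP by (intro bexI conjI)
   thus False using n sP \<open>le s p\<close> by simp
  qed
  moreover have "\<not> F2 p"
  proof
   assume "F2 p"
   then obtain \<rho> q where \<rho>: "\<rho> \<in> elts (TC \<tau>)" "q \<in> elts P" "opair \<rho> q \<in> elts \<tau>" "le p q" and n: "\<forall>s\<in>elts P. le s p --> \<not> B2 \<rho> s"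
    unfolding F2_def by (elim bexE conjE)
   have "val G \<rho> \<in> elts (val G \<sigma>)" using in_valI[OF \<rho>(3) G_up[OF p(1) \<rho>(2,4)]] eq by simp
   then obtain \<rho>' q' where \<rho>': "val G \<rho> = val G \<rho>'" "opair \<rho>' q' \<in> elts \<sigma>" "q' \<in> G" by (rule in_valE)
   have T: "\<rho>' \<in> elts (TC \<sigma>)" using name_in_TC[OF \<rho>'(2)] by simp
   obtain r where r: "r \<in> G" "fq \<rho>' \<rho> r" using IH[OF T \<rho>(1)] \<rho>'(1) by auto
   obtain t where t: "t \<in> G" "le t p" "le t q'" using below[OF p(1) \<rho>'(3)] by (elim bexE conjE)
   obtain s where s: "s \<in> G" "le s t" "le s r" using below[OF t(1) r(1)] by (elim bexE conjE)
   note sP = G_P[OF s(1)] and tP = G_P[OF t(1)]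
   have "fq \<rho>' \<rho> s" by (rule fq_mono[OF r(2) sP G_P[OF r(1)] s(3)])
   moreover have "le s p" "le s q'" using le_trans[OF sP tP _ s(2)] t pP G_P[OF \<rho>'(3)] by simp_all
   ultimately have "B2 \<rho> s" unfolding B2_def using T \<rho>'(2) G_P[OF \<rho>'(3)] sP by (intro bexI conjI)
   thus False using n sP \<open>le s p\<close> by simp
  qed
  ultimately show "\<exists>p\<in>G. fq \<sigma> \<tau> p" using p by (intro bexI[OF _ p(1)]) simp
 qed
qed

text \<open>For negation and quantification the point is that deciding conditions are dense: one
  that does not force a universal statement extends to one that forbids some instance below itself.
  Mutual compatibility within the filter does the rest.\<close>

lemma truth: "range e \<subseteq> M ==> sat (gen_ext M G) (\<lambda>i. val G (e i)) \<phi> <-> (\<exists>p\<in>G. forces \<phi> e p)"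
proof (induction \<phi> arbitrary: e)
 case (Mem i j)
 have eM: "e i \<in> M" "e j \<in> M" using Mem by auto
 show ?case unfolding sat.simps forces.simps
 proof
  assume "val G (e i) \<in> elts (val G (e j))"
  then obtain \<rho> q where x: "val G (e i) = val G \<rho>" "opair \<rho> q \<in> elts (e j)" "q \<in> G" by (rule in_valE)
  have \<rho>: "\<rho> \<in> elts (TC (e j))" using name_in_TC[OF x(2)] by simp
  obtain r where r: "r \<in> G" "fq (e i) \<rho> r"
   using fq_truth[OF eM(1) trM[OF TC_inM[OF eM(2)] \<rho>]] x(1) by auto
  obtain p where p: "p \<in> G" "le p q" "le p r" using G_dir[OF x(3) r(1)] by (elim bexE conjE)
  have "fmem (e i) (e j) p" unfolding fmem_def
  proof (intro ballI impI)
   fix t assume t: "t \<in> elts P" "le t p"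
   have "le t q" "le t r" using le_trans[OF t(1) G_P[OF p(1)] _ t(2)] p G_P[OF x(3)] G_P[OF r(1)] by simp_all
   moreover have "fq (e i) \<rho> t" by (rule fq_mono[OF r(2) t(1) G_P[OF r(1)] \<open>le t r\<close>])
   ultimately show "\<exists>s\<in>elts P. le s t \<and> (\<exists>\<rho>\<in>elts (TC (e j)). \<exists>q\<in>elts P. opair \<rho> q \<in> elts (e j) \<and> le s q \<and> s \<in> elts P \<and> fq (e i) \<rho> s)"
    using t(1) le_refl[OF t(1)] \<rho> x(2) G_P[OF x(3)] by (intro bexI[of _ t] conjI bexI[of _ \<rho>] bexI[of _ q])
  qed
  thus "\<exists>p\<in>G. fmem (e i) (e j) p" using p(1) by (rule bexI)
 next
  assume "\<exists>p\<in>G. fmem (e i) (e j) p"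
  then obtain p where p: "p \<in> G" "fmem (e i) (e j) p" by (rule bexE)
  have "\<exists>s\<in>G. le s p \<and> (\<exists>\<rho>\<in>elts (TC (e j)). \<exists>q\<in>elts P. opair \<rho> q \<in> elts (e j) \<and> le s q \<and> s \<in> elts P \<and> fq (e i) \<rho> s)"
  proof (rule G_dense_below[OF _ p(1)])
   show "dfp M (\<lambda>e'. \<exists>\<rho>\<in>elts (TC (e j)). \<exists>q\<in>elts P. opair \<rho> q \<in> elts (e j) \<and> le (e' 0) q \<and> e' 0 \<in> elts P \<and> fq (e i) \<rho> (e' 0))"
    by (intro df P L eM)
  qed (use p(2) in \<open>simp add: fmem_def\<close>)
  then obtain s \<rho> q where s: "s \<in> G" "\<rho> \<in> elts (TC (e j))" "q \<in> elts P" "opair \<rho> q \<in> elts (e j)" "le s q" "fq (e i) \<rho> s"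
   by (elim bexE conjE)
  have "val G (e i) = val G \<rho>" using fq_truth[OF eM(1) trM[OF TC_inM[OF eM(2)] s(2)]] s(1,6) by auto
  thus "val G (e i) \<in> elts (val G (e j))" using in_valI[OF s(4) G_up[OF s(1,3,5)]] by simp
 qed
next
 case (Eq i j)
 hence "e i \<in> M" "e j \<in> M" by auto
 thus ?case using fq_truth by simp
next
 case (Neg \<phi>)
 note IH = Neg.IH[OF Neg.prems]
 have "\<exists>p\<in>G. (p \<in> elts P \<and> forces \<phi> e p) \<or> (\<forall>q\<in>elts P. le q p --> \<not> (q \<in> elts P \<and> forces \<phi> e q))"
 proof (rule G_dense)
  show "dfp M (\<lambda>e'. (e' 0 \<in> elts P \<and> forces \<phi> e (e' 0)) \<or> (\<forall>q\<in>elts P. le q (e' 0) --> \<not> (q \<in> elts P \<and> forces \<phi> e q)))"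
   by (intro df P L dfp_forces' dfp_app1[OF dfp_forces'] Neg.prems)
  fix p assume p: "p \<in> elts P"
  show "\<exists>q\<in>elts P. le q p \<and> ((q \<in> elts P \<and> forces \<phi> e q) \<or> (\<forall>r\<in>elts P. le r q --> \<not> (r \<in> elts P \<and> forces \<phi> e r)))"
  proof (cases "\<exists>q\<in>elts P. le q p \<and> forces \<phi> e q")
   case True
   then obtain q where "q \<in> elts P" "le q p" "forces \<phi> e q" by (elim bexE conjE)
   thus ?thesis by (intro bexI[of _ q]) simp_all
  next
   case False
   thus ?thesis using p le_refl[OF p] by (intro bexI[of _ p]) simp_all
  qed
 qed
 then obtain p where p: "p \<in> G" "(p \<in> elts P \<and> forces \<phi> e p) \<or> (\<forall>q\<in>elts P. le q p --> \<not> (q \<in> elts P \<and> forces \<phi> e q))" by (rule bexE)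
 show ?case unfolding sat.simps IH
 proof
  assume "\<not> (\<exists>p\<in>G. forces \<phi> e p)"
  hence "forces (Neg \<phi>) e p" using p by simp
  thus "\<exists>p\<in>G. forces (Neg \<phi>) e p" using p(1) by (rule bexI)
 next
  assume "\<exists>p\<in>G. forces (Neg \<phi>) e p"
  then obtain r where r: "r \<in> G" "forces (Neg \<phi>) e r" by (rule bexE)
  show "\<not> (\<exists>p\<in>G. forces \<phi> e p)"
  proof
   assume "\<exists>p\<in>G. forces \<phi> e p"
   then obtain t where t: "t \<in> G" "forces \<phi> e t" by (rule bexE)
   obtain s where s: "s \<in> G" "le s r" "le s t" using G_dir[OF r(1) t(1)] by (elim bexE conjE)
   have "forces \<phi> e s" by (rule forces_mono[OF t(2) G_P[OF s(1)] G_P[OF t(1)] s(3)])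
   thus False using r(2) s(2) G_P[OF s(1)] by simp
  qed
 qed
next
 case (Conj \<phi> \<psi>)
 show ?case unfolding sat.simps forces.simps Conj.IH(1)[OF Conj.prems] Conj.IH(2)[OF Conj.prems]
 proof
  assume "(\<exists>p\<in>G. forces \<phi> e p) \<and> (\<exists>p\<in>G. forces \<psi> e p)"
  then obtain p q where pq: "p \<in> G" "forces \<phi> e p" "q \<in> G" "forces \<psi> e q" by (elim bexE conjE)
  obtain s where s: "s \<in> G" "le s p" "le s q" using G_dir[OF pq(1,3)] by (elim bexE conjE)
  have "forces \<phi> e s" by (rule forces_mono[OF pq(2) G_P[OF s(1)] G_P[OF pq(1)] s(2)])
  moreover have "forces \<psi> e s" by (rule forces_mono[OF pq(4) G_P[OF s(1)] G_P[OF pq(3)] s(3)])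
  ultimately show "\<exists>p\<in>G. forces \<phi> e p \<and> forces \<psi> e p" using s(1) by (intro bexI conjI)
 qed blast
next
 case (All i \<phi>)
 have rng: "range (e(i := x)) \<subseteq> M" if "x \<in> M" for x using All.prems that by auto
 have upd: "(\<lambda>j. val G ((e(i := x)) j)) = (\<lambda>j. val G (e j))(i := val G x)" for x by auto
 have IH: "sat (gen_ext M G) ((\<lambda>j. val G (e j))(i := val G x)) \<phi> <-> (\<exists>p\<in>G. forces \<phi> (e(i := x)) p)" if "x \<in> M" for x
  using All.IH[OF rng[OF that]] unfolding upd .
 have sat: "sat (gen_ext M G) (\<lambda>j. val G (e j)) (All i \<phi>) <-> (\<forall>x\<in>M. \<exists>p\<in>G. forces \<phi> (e(i := x)) p)"
  unfolding sat.simps gen_ext_def by (simp add: IH[unfolded gen_ext_def])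
 show ?case unfolding sat
 proof
  assume all: "\<forall>x\<in>M. \<exists>p\<in>G. forces \<phi> (e(i := x)) p"
  define A where "A x q <-> q \<in> elts P \<and> forces \<phi> (e(i := x)) q" for x q
  have dA: "dfp M (\<lambda>e'. A (e' 0) (e' 1))"
  proof -
   let ?r = "\<lambda>n. case n of 0 => Suc 0 | Suc j => if j = i then 0 else Suc (Suc j)"
   have inj: "inj ?r"
   proof (rule injI)
    fix x y :: nat assume "?r x = ?r y" thus "x = y" by (cases x; cases y) (auto split: if_splits)
   qed
   define b where "b = case_nat hemp (case_nat hemp e)"
   have b: "range b \<subseteq> M" using All.prems unfolding b_def by simp
   have "dfp M (\<lambda>e. e (Suc 0) \<in> elts P \<and> forces \<phi> (\<lambda>j. e (?r (Suc j))) (e (Suc 0)))"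
    using dfp_ren[OF inj dfp_forces[of \<phi>]] by simp
   from dfp_inst[OF this b, of 2]
   have 1: "dfp M (\<lambda>e'. e' (Suc 0) \<in> elts P \<and> forces \<phi> (\<lambda>j. if ?r (Suc j) < 2 then e' (?r (Suc j)) else b (?r (Suc j))) (e' (Suc 0)))"
    by simp
   have "(\<lambda>j. if ?r (Suc j) < 2 then e' (?r (Suc j)) else b (?r (Suc j))) = e(i := e' 0)" for e' :: "nat => hset"
    by (auto simp: b_def)
   with 1 show ?thesis unfolding A_def by simp
  qed
  have "\<exists>p\<in>G. (p \<in> elts P \<and> forces (All i \<phi>) e p) \<or> (\<exists>x\<in>M. \<forall>q\<in>elts P. le q p --> \<not> A x q)"
  proof (rule G_dense)
   show "dfp M (\<lambda>e'. (e' 0 \<in> elts P \<and> forces (All i \<phi>) e (e' 0)) \<or> (\<exists>x\<in>M. \<forall>q\<in>elts P. le q (e' 0) --> \<not> A x q))"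
    by (intro df P L dfp_forces' dfp_app2[OF dA] All.prems)
   fix p assume p: "p \<in> elts P"
   show "\<exists>q\<in>elts P. le q p \<and> ((q \<in> elts P \<and> forces (All i \<phi>) e q) \<or> (\<exists>x\<in>M. \<forall>r\<in>elts P. le r q --> \<not> A x r))"
   proof (cases "forces (All i \<phi>) e p")
    case True
    thus ?thesis using p le_refl[OF p] by (intro bexI[of _ p]) simp_all
   next
    case False
    then obtain x where x: "x \<in> M" "\<not> forces \<phi> (e(i := x)) p" by auto
    have "\<exists>q\<in>elts P. le q p \<and> \<not> (\<exists>r\<in>elts P. le r q \<and> forces \<phi> (e(i := x)) r)"
    proof (rule ccontr)
     assume "\<not> ?thesis"
     hence "forces \<phi> (e(i := x)) p" by (intro forces_dense[OF p]) simp
     thus False using x(2) by simp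
    qed
    then obtain q where "q \<in> elts P" "le q p" "\<not> (\<exists>r\<in>elts P. le r q \<and> forces \<phi> (e(i := x)) r)" by (elim bexE conjE)
    thus ?thesis using x(1) unfolding A_def by (intro bexI[of _ q] conjI disjI2 bexI[of _ x]) simp_all
   qed
  qed
  then obtain p where p: "p \<in> G" "(p \<in> elts P \<and> forces (All i \<phi>) e p) \<or> (\<exists>x\<in>M. \<forall>q\<in>elts P. le q p --> \<not> A x q)" by (rule bexE)
  from p(2) show "\<exists>p\<in>G. forces (All i \<phi>) e p"
  proof
   assume "\<exists>x\<in>M. \<forall>q\<in>elts P. le q p --> \<not> A x q"
   then obtain x where x: "x \<in> M" "\<forall>q\<in>elts P. le q p --> \<not> A x q" by (rule bexE)
   obtain t where t: "t \<in> G" "forces \<phi> (e(i := x)) t" using bspec[OF all x(1)] by (rule bexE)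
   obtain s where s: "s \<in> G" "le s p" "le s t" using G_dir[OF p(1) t(1)] by (elim bexE conjE)
   have "forces \<phi> (e(i := x)) s" by (rule forces_mono[OF t(2) G_P[OF s(1)] G_P[OF t(1)] s(3)])
   thus ?thesis using x(2) s(2) G_P[OF s(1)] unfolding A_def by simp
  qed (use p(1) in blast)
 next
  assume "\<exists>p\<in>G. forces (All i \<phi>) e p"
  thus "\<forall>x\<in>M. \<exists>p\<in>G. forces \<phi> (e(i := x)) p" by auto
 qed
qed

end

subsection \<open>Generic extensions are models\<close>

text \<open>Check names relative to one condition: a poset need not have a largest element, so any
  member of the filter plays that role. The same holds for the names of pairs below.\<close>

function ck :: "hset => hset => hset" where
 "ck p x = hset_of ((\<lambda>y. opair (ck p y) p) ` elts x)"
 by auto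
termination
 by (relation "inv_image {(x, y). x \<in> elts y} snd") (auto intro!: wf_inv_image wf_elts)
declare ck.simps [simp del]

lemma elts_ck: "elts (ck p x) = (\<lambda>y. opair (ck p y) p) ` elts x"
 by (subst ck.simps) simp

lemma val_ck:
 assumes "p \<in> G"
 shows "val G (ck p x) = x"
proof (induction x rule: elts_induct)
 case (step x)
 have "{\<sigma>. \<exists>q\<in>G. opair \<sigma> q \<in> elts (ck p x)} = ck p ` elts x"
  unfolding elts_ck using assms by auto
 hence "elts (val G (ck p x)) = (\<lambda>y. val G (ck p y)) ` elts x"
  unfolding elts_val by (simp add: image_image)
 also have "\<dots> = (\<lambda>y. y) ` elts x" by (rule image_cong[OF refl]) (rule step)
 finally show ?case by (intro hset_eqI) simp
qed

definition pairname :: "hset => hset => hset => hset" where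
 "pairname p \<sigma> \<tau> = hset_of {opair \<sigma> p, opair \<tau> p}"

lemma val_pairname: "p \<in> G ==> val G (pairname p \<sigma> \<tau>) = hset_of {val G \<sigma>, val G \<tau>}"
proof -
 assume "p \<in> G"
 hence "{\<sigma>'. \<exists>q\<in>G. opair \<sigma>' q \<in> elts (pairname p \<sigma> \<tau>)} = {\<sigma>, \<tau>}"
  by (auto simp: pairname_def)
 thus ?thesis by (intro hset_eqI) (simp add: elts_val)
qed

definition opname :: "hset => hset => hset => hset" where
 "opname p \<sigma> \<tau> = pairname p (pairname p \<sigma> \<sigma>) (pairname p \<sigma> \<tau>)"

lemma val_opname: "p \<in> G ==> val G (opname p \<sigma> \<tau>) = opair (val G \<sigma>) (val G \<tau>)"
 by (simp add: opname_def val_pairname opair_def)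

context zfmodel
begin

lemma dft_ck [df]: "dft M f ==> dft M g ==> dft M (\<lambda>e. ck (f e) (g e))"
proof (rule dft_app2[where F = ck])
 show "dft M (\<lambda>e. ck (e 0) (e 1))"
 proof (rule recursion[where \<Phi> = "\<lambda>p x f. hset_of ((\<lambda>y. opair (ap f y) p) ` elts x)"])
  fix p x :: hset
  have "(\<lambda>y. opair (ck p y) p) ` elts x = (\<lambda>y. opair (ap (hgraph (TC x) (ck p)) y) p) ` elts x"
   by (rule image_cong[OF refl]) (simp add: elts_sub_TC)
  thus "ck p x = hset_of ((\<lambda>y. opair (ap (hgraph (TC x) (ck p)) y) p) ` elts x)"
   by (subst ck.simps) simp
 qed (intro df)
qed

lemma dft_pairname [df]: "dft M k ==> dft M f ==> dft M g ==> dft M (\<lambda>e. pairname (k e) (f e) (g e))"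
 by (rule dft_app3[where F = pairname], unfold pairname_def) (intro df)

lemma dft_opname [df]: "dft M k ==> dft M f ==> dft M g ==> dft M (\<lambda>e. opname (k e) (f e) (g e))"
 by (rule dft_app3[where F = opname], unfold opname_def) (intro df)

lemma ck_M [simp]: "p \<in> M ==> x \<in> M ==> ck p x \<in> M"
 by (rule inM, intro df)

lemma ground_sub_ext: "p \<in> G ==> p \<in> M ==> x \<in> M ==> x \<in> gen_ext M G"
 unfolding gen_ext_def using val_ck[of p G x] by (metis ck_M imageI)

text \<open>The only extension of a mad family that will be tested: one new set, described by
  membership of conditions in \<open>G\<close>. The statement asks of \<open>G\<close> only one
  member in \<open>M\<close> and so serves Cohen and random forcing alike.\<close>

lemma ext_insert:
 assumes p: "p \<in> G" "p \<in> M" and F: "F \<in> M" and X: "X \<in> M" and D: "hgraph X D \<in> M"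
 shows "hins (hset_of {t \<in> elts X. D t \<in> G}) F \<in> gen_ext M G"
proof -
 define \<beta> where "\<beta> = hset_of ((\<lambda>t. opair (ck p t) (ap (hgraph X D) t)) ` elts X)"
 define \<nu> where "\<nu> = hins (opair \<beta> p) (hset_of ((\<lambda>x. opair (ck p x) p) ` elts F))"
 have "\<nu> \<in> M" unfolding \<nu>_def \<beta>_def by (rule inM, intro df p F X D)
 have "elts \<beta> = (\<lambda>t. opair (ck p t) (D t)) ` elts X" unfolding \<beta>_def by simp
 hence "{\<sigma>. \<exists>q\<in>G. opair \<sigma> q \<in> elts \<beta>} = ck p ` {t \<in> elts X. D t \<in> G}" by auto
 hence "elts (val G \<beta>) = {t \<in> elts X. D t \<in> G}"
  unfolding elts_val by (simp add: image_image val_ck[OF p(1)])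
 hence v\<beta>: "val G \<beta> = hset_of {t \<in> elts X. D t \<in> G}" by (metis hset_of_elts)
 have "{\<sigma>. \<exists>q\<in>G. opair \<sigma> q \<in> elts \<nu>} = insert \<beta> (ck p ` elts F)"
  using p(1) by (auto simp: \<nu>_def)
 hence "elts (val G \<nu>) = insert (val G \<beta>) (elts F)"
  unfolding elts_val[of G \<nu>] by (simp add: image_image val_ck[OF p(1)])
 hence "val G \<nu> = hins (hset_of {t \<in> elts X. D t \<in> G}) F"
  by (intro hset_eqI) (simp add: v\<beta>)
 thus ?thesis unfolding gen_ext_def using \<open>\<nu> \<in> M\<close> by (metis imageI)
qed

lemma gen_ext_transitive: "transitive (gen_ext M G)"
 unfolding transitive_def
proof (intro ballI subsetI)
 fix x y assume "x \<in> gen_ext M G" "y \<in> elts x"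
 then obtain \<tau> where "\<tau> \<in> M" "y \<in> elts (val G \<tau>)" unfolding gen_ext_def by blast
 then obtain \<sigma> p where "y = val G \<sigma>" "opair \<sigma> p \<in> elts \<tau>" by (elim in_valE) blast
 hence "\<sigma> \<in> M" using trM[OF TC_inM[OF \<open>\<tau> \<in> M\<close>]] name_in_TC by blast
 thus "y \<in> gen_ext M G" unfolding gen_ext_def using \<open>y = val G \<sigma>\<close> by blast
qed

end

context forcing
begin

lemma dfp_forces2:
 assumes b: "range b \<subseteq> M"
 shows "dfp M (\<lambda>e. e 2 \<in> elts P \<and> forces \<phi> (b(0 := e 0, 1 := e 1)) (e 2))"
proof -
 define r :: "nat => nat" where "r n = (if n = 0 then 2 else if n = 1 then 0 else if n = 2 then 1 else n)" for n
 have r: "inj r" by (auto simp: inj_def r_def)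
 define b' where "b' n = (if n < 3 then hemp else b (n - 1))" for n
 have b': "range b' \<subseteq> M" using b by (auto simp: b'_def)
 have r0: "r 0 = 2" by (simp add: r_def)
 have "dfp M (\<lambda>e. e 2 \<in> elts P \<and> forces \<phi> (\<lambda>i. e (r (Suc i))) (e 2))"
  using dfp_ren[OF r dfp_forces[of \<phi>]] unfolding r0 .
 from dfp_inst[OF this b', of 3]
 have 1: "dfp M (\<lambda>e. e 2 \<in> elts P \<and> forces \<phi> (\<lambda>i. if r (Suc i) < 3 then e (r (Suc i)) else b' (r (Suc i))) (e 2))"
  by simp
 have "(\<lambda>i. if r (Suc i) < 3 then e (r (Suc i)) else b' (r (Suc i))) = b(0 := e 0, 1 := e 1)" for e :: "nat => hset"
  by (auto simp: fun_eq_iff r_def b'_def)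
 with 1 show ?thesis by simp
qed

lemmas dfp_forces3 = dfp_app3[OF dfp_forces2]

lemma dfp_forces_at:
 assumes "range b \<subseteq> M" "dft M f" "dft M h"
 shows "dfp M (\<lambda>e. h e \<in> elts P \<and> forces \<phi> (b(0 := f e)) (h e))"
proof -
 have "b 1 \<in> M" using assms(1) by auto
 note 1 = dfp_forces3[OF assms(1,2) dft_const[OF this] assms(3), of \<phi>]
 have "b(0 := x, 1 := b 1) = b(0 := x)" for x by auto
 with 1 show ?thesis by (simp only:)
qed

end

section \<open>The axioms of ZFC in the extension\<close>

context generic_ext
begin

abbreviation N :: "hset set" where "N \<equiv> gen_ext M G"

definition p0 :: hset where "p0 = (SOME p. p \<in> G)"

lemma p0 [simp]: "p0 \<in> G" "p0 \<in> M" "p0 \<in> elts P"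
proof -
 show "p0 \<in> G" unfolding p0_def by (rule someI_ex[OF G_ne])
 thus "p0 \<in> elts P" by (rule G_P)
 thus "p0 \<in> M" by (rule P_M)
qed

lemma M_sub_N: "x \<in> M ==> x \<in> N"
 by (rule ground_sub_ext[of p0]) simp_all

lemma val_N: "\<sigma> \<in> M ==> val G \<sigma> \<in> N"
 unfolding gen_ext_def by blast

lemma trN: "x \<in> N ==> y \<in> elts x ==> y \<in> N"
 using gen_ext_transitive unfolding transitive_def by blast

lemma nameE:
 assumes "x \<in> N" obtains \<sigma> where "\<sigma> \<in> M" "x = val G \<sigma>"
 using assms unfolding gen_ext_def by blast

lemma envE:
 assumes "range e \<subseteq> N"
 obtains b where "range b \<subseteq> M" "e = (\<lambda>i. val G (b i))"
proof -
 have "\<forall>i. \<exists>s. s \<in> M \<and> e i = val G s" using assms unfolding gen_ext_def by blast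
 then obtain b where "\<forall>i. b i \<in> M \<and> e i = val G (b i)" by metis
 hence "range b \<subseteq> M" "e = (\<lambda>i. val G (b i))" by (simp_all add: image_subset_iff fun_eq_iff)
 thus thesis by (rule that)
qed

lemma sub_name_TC: "\<tau> \<in> M ==> opair \<sigma> q \<in> elts \<tau> ==> \<sigma> \<in> M"
 using trM[OF TC_inM] name_in_TC by blast

lemma truth2:
 assumes b: "range b \<subseteq> M" and "\<sigma> \<in> M" "\<nu> \<in> M"
 shows "sat N ((\<lambda>i. val G (b i))(0 := val G \<sigma>, 1 := val G \<nu>)) \<phi> <-> (\<exists>p\<in>G. forces \<phi> (b(0 := \<sigma>, 1 := \<nu>)) p)"
proof -
 have "range (b(0 := \<sigma>, 1 := \<nu>)) \<subseteq> M" using assms by auto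
 moreover have "(\<lambda>i. val G ((b(0 := \<sigma>, 1 := \<nu>)) i)) = (\<lambda>i. val G (b i))(0 := val G \<sigma>, 1 := val G \<nu>)" by auto
 ultimately show ?thesis using truth[of "b(0 := \<sigma>, 1 := \<nu>)" \<phi>] by simp
qed

lemma truth1:
 assumes b: "range b \<subseteq> M" and "\<sigma> \<in> M"
 shows "sat N ((\<lambda>i. val G (b i))(0 := val G \<sigma>)) \<phi> <-> (\<exists>p\<in>G. forces \<phi> (b(0 := \<sigma>)) p)"
proof -
 have "range (b(0 := \<sigma>)) \<subseteq> M" using assms by auto
 moreover have "(\<lambda>i. val G ((b(0 := \<sigma>)) i)) = (\<lambda>i. val G (b i))(0 := val G \<sigma>)" by auto
 ultimately show ?thesis using truth[of "b(0 := \<sigma>)" \<phi>] by simp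
qed

text \<open>The name pairs names from \<tau> with conditions forcing them into \<tau> and forcing
  \<phi>. That it can be found among the subsets of \<open>TC \<tau> \<times> P\<close> is what
  bounds the names of subsets for the power set axiom.\<close>

lemma sep_name:
 assumes b: "range b \<subseteq> M" and \<tau>: "\<tau> \<in> M"
 shows "\<exists>\<nu>\<in>M. elts \<nu> \<subseteq> elts (hprod (TC \<tau>) P) \<and>
  elts (val G \<nu>) = {x \<in> elts (val G \<tau>). sat N ((\<lambda>i. val G (b i))(0 := x)) \<phi>}"
proof -
 define Q where "Q \<sigma> p <-> (\<exists>q\<in>elts P. opair \<sigma> q \<in> elts \<tau> \<and> le p q \<and> (p \<in> elts P \<and> forces \<phi> (b(0 := \<sigma>)) p))" for \<sigma> p
 define \<nu> where "\<nu> = hset_of {z \<in> elts (hprod (TC \<tau>) P). Q (hfst z) (hsnd z)}"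
 have e\<nu>: "elts \<nu> = {z \<in> elts (hprod (TC \<tau>) P). Q (hfst z) (hsnd z)}"
  unfolding \<nu>_def by (rule elts_sep)
 have mem: "opair \<sigma> p \<in> elts \<nu> <-> p \<in> elts P \<and> Q \<sigma> p" for \<sigma> p
  unfolding e\<nu> using name_in_TC[of \<sigma>] by (auto simp: opair_in_hprod Q_def simp del: elts_hprod)
 have "\<nu> \<in> M" unfolding \<nu>_def Q_def by (rule inM, intro df P L \<tau> dfp_forces_at b)
 moreover have "elts \<nu> \<subseteq> elts (hprod (TC \<tau>) P)" unfolding e\<nu> by blast
 moreover have "elts (val G \<nu>) = {x \<in> elts (val G \<tau>). sat N ((\<lambda>i. val G (b i))(0 := x)) \<phi>}"
 proof (intro set_eqI iffI)
  fix x assume "x \<in> elts (val G \<nu>)"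
  then obtain \<sigma> p where x: "x = val G \<sigma>" "opair \<sigma> p \<in> elts \<nu>" "p \<in> G" by (rule in_valE)
  then obtain q where q: "q \<in> elts P" "opair \<sigma> q \<in> elts \<tau>" "le p q" "forces \<phi> (b(0 := \<sigma>)) p"
   unfolding mem Q_def by (elim conjE bexE)
  have "x \<in> elts (val G \<tau>)" using in_valI[OF q(2) G_up[OF x(3) q(1,3)]] x(1) by simp
  moreover have "sat N ((\<lambda>i. val G (b i))(0 := x)) \<phi>"
   unfolding x(1) truth1[OF b sub_name_TC[OF \<tau> q(2)]] using x(3) q(4) by (rule bexI[rotated])
  ultimately show "x \<in> {x \<in> elts (val G \<tau>). sat N ((\<lambda>i. val G (b i))(0 := x)) \<phi>}" by simp
 next
  fix x assume "x \<in> {x \<in> elts (val G \<tau>). sat N ((\<lambda>i. val G (b i))(0 := x)) \<phi>}"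
  hence x: "x \<in> elts (val G \<tau>)" and s: "sat N ((\<lambda>i. val G (b i))(0 := x)) \<phi>" by simp_all
  obtain \<sigma> q where q: "x = val G \<sigma>" "opair \<sigma> q \<in> elts \<tau>" "q \<in> G" using x by (rule in_valE)
  note \<sigma> = sub_name_TC[OF \<tau> q(2)]
  obtain r where r: "r \<in> G" "forces \<phi> (b(0 := \<sigma>)) r" using s unfolding q(1) truth1[OF b \<sigma>] by (rule bexE)
  obtain p where p: "p \<in> G" "le p q" "le p r" using G_dir[OF q(3) r(1)] by (elim bexE conjE)
  have "forces \<phi> (b(0 := \<sigma>)) p" by (rule forces_mono[OF r(2) G_P[OF p(1)] G_P[OF r(1)] p(3)])
  hence "opair \<sigma> p \<in> elts \<nu>" unfolding mem Q_def using G_P[OF p(1)] G_P[OF q(3)] q(2) p(2) by blast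
  thus "x \<in> elts (val G \<nu>)" using in_valI[OF _ p(1)] q(1) by simp
 qed
 ultimately show ?thesis by blast
qed

lemma ax_sep_N: "ax_separation N"
 unfolding ax_separation_def
proof (intro allI impI)
 fix \<phi> :: fm and e :: "nat => hset" and a assume e: "range e \<subseteq> N" and a: "a \<in> N"
 obtain b where b: "range b \<subseteq> M" and eb: "e = (\<lambda>i. val G (b i))" by (rule envE[OF e])
 obtain \<tau> where \<tau>: "\<tau> \<in> M" "a = val G \<tau>" by (rule nameE[OF a])
 from sep_name[OF b \<tau>(1), of \<phi>] obtain \<nu> where \<nu>: "\<nu> \<in> M"
  "elts (val G \<nu>) = {x \<in> elts (val G \<tau>). sat N ((\<lambda>i. val G (b i))(0 := x)) \<phi>}" by (elim bexE conjE)
 show "\<exists>c\<in>N. \<forall>x\<in>N. x \<in> elts c <-> x \<in> elts a \<and> sat N (e(0 := x)) \<phi>"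
  by (rule bexI[OF _ val_N[OF \<nu>(1)]]) (simp add: \<nu>(2) \<tau>(2) eb)
qed

lemma ax_repl_N: "ax_replacement N"
 unfolding ax_replacement_def
proof (intro allI impI)
 fix \<phi> :: fm and e :: "nat => hset" and a assume e: "range e \<subseteq> N" and a: "a \<in> N"
  and fn: "\<forall>x\<in>N. x \<in> elts a --> (\<exists>!y. y \<in> N \<and> sat N (e(0 := x, 1 := y)) \<phi>)"
 obtain b where b: "range b \<subseteq> M" and eb: "e = (\<lambda>i. val G (b i))" by (rule envE[OF e])
 obtain \<tau> where \<tau>: "\<tau> \<in> M" "a = val G \<tau>" by (rule nameE[OF a])
 define R where "R z y <-> hsnd z \<in> elts P \<and> forces \<phi> (b(0 := hfst z, 1 := y)) (hsnd z)" for z y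
 \<comment> \<open>Collection in the ground model, over pairs of a name and a condition, bounds the
   names needed for the values.\<close>
 obtain B where B: "B \<in> M" and B2: "\<And>z y. z \<in> elts (hprod (TC \<tau>) P) ==> y \<in> M ==> R z y ==> \<exists>y\<in>elts B. R z y"
 proof (rule collection[of R "hprod (TC \<tau>) P"])
  show "dfp M (\<lambda>e. R (e 0) (e 1))" unfolding R_def by (intro df dfp_forces3 b)
 qed (use \<tau> in \<open>simp_all\<close>)
 define Q where "Q \<nu> p <-> (\<exists>\<sigma>\<in>elts (TC \<tau>). \<exists>q\<in>elts P. opair \<sigma> q \<in> elts \<tau> \<and> le p q \<and> (p \<in> elts P \<and> forces \<phi> (b(0 := \<sigma>, 1 := \<nu>)) p))" for \<nu> p
 define \<nu> where "\<nu> = hset_of {z \<in> elts (hprod B P). Q (hfst z) (hsnd z)}"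
 have e\<nu>: "elts \<nu> = {z \<in> elts (hprod B P). Q (hfst z) (hsnd z)}"
  unfolding \<nu>_def by (rule elts_sep)
 have mem: "opair y p \<in> elts \<nu> <-> y \<in> elts B \<and> p \<in> elts P \<and> Q y p" for y p
  unfolding e\<nu> by (auto simp: opair_in_hprod simp del: elts_hprod)
 have \<nu>M: "\<nu> \<in> M" unfolding \<nu>_def Q_def by (rule inM, intro df P L \<tau> B dfp_forces3 b)
 have "y \<in> elts (val G \<nu>) <-> (\<exists>x\<in>N. x \<in> elts a \<and> sat N (e(0 := x, 1 := y)) \<phi>)" if y: "y \<in> N" for y
 proof
  assume "y \<in> elts (val G \<nu>)"
  then obtain \<eta> p where x: "y = val G \<eta>" "opair \<eta> p \<in> elts \<nu>" "p \<in> G" by (rule in_valE)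
  then obtain \<sigma> q where q: "q \<in> elts P" "opair \<sigma> q \<in> elts \<tau>" "le p q" "forces \<phi> (b(0 := \<sigma>, 1 := \<eta>)) p" and \<eta>: "\<eta> \<in> elts B"
   unfolding mem Q_def by (elim conjE bexE)
  have "val G \<sigma> \<in> elts a" using in_valI[OF q(2) G_up[OF x(3) q(1,3)]] \<tau>(2) by simp
  moreover have "sat N (e(0 := val G \<sigma>, 1 := y)) \<phi>"
   unfolding x(1) eb truth2[OF b sub_name_TC[OF \<tau>(1) q(2)] trM[OF B \<eta>]] using x(3) q(4) by (rule bexI[rotated])
  ultimately show "\<exists>x\<in>N. x \<in> elts a \<and> sat N (e(0 := x, 1 := y)) \<phi>"
   using trN[OF a] by (intro bexI[of _ "val G \<sigma>"]) simp_all
 next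
  assume "\<exists>x\<in>N. x \<in> elts a \<and> sat N (e(0 := x, 1 := y)) \<phi>"
  then obtain x where x: "x \<in> N" "x \<in> elts a" "sat N (e(0 := x, 1 := y)) \<phi>" by (elim bexE conjE)
  obtain \<sigma> q where q: "x = val G \<sigma>" "opair \<sigma> q \<in> elts \<tau>" "q \<in> G" using x(2) unfolding \<tau>(2) by (rule in_valE)
  obtain \<eta> where \<eta>: "\<eta> \<in> M" "y = val G \<eta>" by (rule nameE[OF y])
  note \<sigma> = sub_name_TC[OF \<tau>(1) q(2)]
  obtain r where r: "r \<in> G" "forces \<phi> (b(0 := \<sigma>, 1 := \<eta>)) r" using x(3) unfolding q(1) \<eta>(2) eb truth2[OF b \<sigma> \<eta>(1)] by (rule bexE)
  have "\<sigma> \<in> elts (TC \<tau>)" using name_in_TC[OF q(2)] by simp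
  hence "opair \<sigma> r \<in> elts (hprod (TC \<tau>) P)" using G_P[OF r(1)] by (simp only: opair_in_hprod)
  from B2[OF this \<eta>(1)] r G_P[OF r(1)] obtain y' where y': "y' \<in> elts B" "forces \<phi> (b(0 := \<sigma>, 1 := y')) r"
   unfolding R_def by auto
  have y'M: "y' \<in> M" by (rule trM[OF B y'(1)])
  have "sat N (e(0 := x, 1 := val G y')) \<phi>"
   unfolding q(1) eb truth2[OF b \<sigma> y'M] using r(1) y'(2) by (rule bexI[rotated])
  hence yy: "val G y' = y" using fn[rule_format, OF x(1,2)] x(3) y val_N[OF y'M] by blast
  obtain p where p: "p \<in> G" "le p q" "le p r" using G_dir[OF q(3) r(1)] by (elim bexE conjE)
  have "forces \<phi> (b(0 := \<sigma>, 1 := y')) p" by (rule forces_mono[OF y'(2) G_P[OF p(1)] G_P[OF r(1)] p(3)])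
  hence "opair y' p \<in> elts \<nu>" unfolding mem Q_def
   using y'(1) G_P[OF p(1)] G_P[OF q(3)] q(2) p(2) \<open>\<sigma> \<in> elts (TC \<tau>)\<close> by blast
  thus "y \<in> elts (val G \<nu>)" using in_valI[OF _ p(1)] yy by metis
 qed
 thus "\<exists>c\<in>N. \<forall>y\<in>N. y \<in> elts c <-> (\<exists>x\<in>N. x \<in> elts a \<and> sat N (e(0 := x, 1 := y)) \<phi>)"
  using val_N[OF \<nu>M] by blast
qed

lemma zf_N: "zf_ctm N"
proof -
 have "countable N" unfolding gen_ext_def by (intro countable_image countM[OF subset_refl])
 moreover have "transitive N" by (rule gen_ext_transitive)
 moreover have "N \<noteq> {}" using M_sub_N[OF hemp_inM] by blast
 moreover have "ax_extensionality N" unfolding ax_extensionality_def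
 proof (intro ballI impI)
  fix a b assume *: "a \<in> N" "b \<in> N" "\<forall>x\<in>N. x \<in> elts a <-> x \<in> elts b"
  have "x \<in> elts a <-> x \<in> elts b" for x using *(3) trN[OF *(1), of x] trN[OF *(2), of x] by blast
  thus "a = b" by (intro hset_eqI) blast
 qed
 moreover have "ax_foundation N" unfolding ax_foundation_def
 proof (intro ballI impI)
  fix a assume a: "a \<in> N" "\<exists>x\<in>N. x \<in> elts a"
  then obtain x where "x \<in> elts a" by blast
  obtain z where z: "z \<in> elts a" and m: "\<And>y. (y, z) \<in> {(x, y). x \<in> elts y} ==> y \<notin> elts a"
   by (rule wfE_min[OF wf_elts \<open>x \<in> elts a\<close>]) blast
  thus "\<exists>x\<in>N. x \<in> elts a \<and> \<not> (\<exists>y\<in>N. y \<in> elts x \<and> y \<in> elts a)" using trN[OF a(1) z] by auto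
 qed
 moreover have "ax_pairing N" unfolding ax_pairing_def
 proof (intro ballI)
  fix a b assume "a \<in> N" "b \<in> N"
  then obtain \<sigma> \<tau> where *: "\<sigma> \<in> M" "\<tau> \<in> M" "a = val G \<sigma>" "b = val G \<tau>" by (metis nameE)
  have "pairname p0 \<sigma> \<tau> \<in> M" by (rule inM, intro df p0 *)
  thus "\<exists>c\<in>N. \<forall>x\<in>N. x \<in> elts c <-> x = a \<or> x = b"
   using val_pairname[OF p0(1), of \<sigma> \<tau>] * by (intro bexI[OF _ val_N]) simp_all
 qed
 moreover have "ax_union N" unfolding ax_union_def
 proof (intro ballI)
  fix a assume "a \<in> N"
  then obtain \<tau> where \<tau>: "\<tau> \<in> M" "a = val G \<tau>" by (rule nameE)
  define Q where "Q \<rho> p <-> (\<exists>\<sigma>\<in>elts (TC \<tau>). \<exists>q\<in>elts P. \<exists>q'\<in>elts P. opair \<sigma> q \<in> elts \<tau> \<and> opair \<rho> q' \<in> elts \<sigma> \<and> le p q \<and> le p q')" for \<rho> p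
  define \<nu> where "\<nu> = hset_of {z \<in> elts (hprod (TC \<tau>) P). Q (hfst z) (hsnd z)}"
  have e\<nu>: "elts \<nu> = {z \<in> elts (hprod (TC \<tau>) P). Q (hfst z) (hsnd z)}"
   unfolding \<nu>_def by (rule elts_sep)
  have mem: "opair y p \<in> elts \<nu> <-> y \<in> elts (TC \<tau>) \<and> p \<in> elts P \<and> Q y p" for y p
   unfolding e\<nu> by (auto simp: opair_in_hprod simp del: elts_hprod)
  have \<nu>M: "\<nu> \<in> M" unfolding \<nu>_def Q_def by (rule inM, intro df P L \<tau>)
  have "x \<in> elts (val G \<nu>) <-> (\<exists>y\<in>N. y \<in> elts a \<and> x \<in> elts y)" for x
  proof
   assume "x \<in> elts (val G \<nu>)"
   then obtain \<rho> p where x: "x = val G \<rho>" "opair \<rho> p \<in> elts \<nu>" "p \<in> G" by (rule in_valE)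
   then obtain \<sigma> q q' where q: "q \<in> elts P" "q' \<in> elts P" "opair \<sigma> q \<in> elts \<tau>" "opair \<rho> q' \<in> elts \<sigma>" "le p q" "le p q'"
    unfolding mem Q_def by (elim conjE bexE)
   have "val G \<sigma> \<in> elts a" "x \<in> elts (val G \<sigma>)"
    using in_valI[OF q(3) G_up[OF x(3) q(1,5)]] in_valI[OF q(4) G_up[OF x(3) q(2,6)]] x(1) \<tau>(2) by simp_all
   thus "\<exists>y\<in>N. y \<in> elts a \<and> x \<in> elts y" using trN[OF \<open>a \<in> N\<close>] by blast
  next
   assume "\<exists>y\<in>N. y \<in> elts a \<and> x \<in> elts y"
   then obtain y where y: "y \<in> elts (val G \<tau>)" "x \<in> elts y" unfolding \<tau>(2) by blast
   obtain \<sigma> q where q: "y = val G \<sigma>" "opair \<sigma> q \<in> elts \<tau>" "q \<in> G" using y(1) by (rule in_valE)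
   obtain \<rho> q' where q': "x = val G \<rho>" "opair \<rho> q' \<in> elts \<sigma>" "q' \<in> G" using y(2) unfolding q(1) by (rule in_valE)
   obtain p where p: "p \<in> G" "le p q" "le p q'" using G_dir[OF q(3) q'(3)] by (elim bexE conjE)
   have \<sigma>: "\<sigma> \<in> elts (TC \<tau>)" using name_in_TC[OF q(2)] by simp
   moreover have "\<rho> \<in> elts (TC \<tau>)" using name_in_TC[OF q'(2)] TC_trans[OF \<sigma>] by blast
   ultimately have "opair \<rho> p \<in> elts \<nu>" unfolding mem Q_def using G_P p q(2,3) q'(2,3) by blast
   thus "x \<in> elts (val G \<nu>)" using in_valI[OF _ p(1)] q'(1) by simp
  qed
  thus "\<exists>u\<in>N. \<forall>x\<in>N. x \<in> elts u <-> (\<exists>y\<in>N. y \<in> elts a \<and> x \<in> elts y)"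
   using val_N[OF \<nu>M] by blast
 qed
 moreover have "ax_infinity N" unfolding ax_infinity_def
 proof (rule bexI[OF _ M_sub_N[OF omega_inM]], rule conjI)
  have "hemp \<in> elts omega" using vnat_0 by (metis elts_omega rangeI)
  thus "\<exists>z\<in>N. z \<in> elts omega \<and> (\<forall>x\<in>N. x \<notin> elts z)"
   by (intro bexI[OF _ M_sub_N[OF hemp_inM]]) simp
  show "\<forall>y\<in>N. y \<in> elts omega --> (\<exists>s\<in>N. s \<in> elts omega \<and> (\<forall>x\<in>N. x \<in> elts s <-> x \<in> elts y \<or> x = y))"
  proof (intro ballI impI)
   fix y assume "y \<in> elts omega"
   then obtain n where n: "y = vnat n" by auto
   have "vnat (Suc n) \<in> elts omega" by simp
   moreover have "x \<in> elts (vnat (Suc n)) <-> x \<in> elts y \<or> x = y" for x unfolding n vnat_Suc by auto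
   ultimately show "\<exists>s\<in>N. s \<in> elts omega \<and> (\<forall>x\<in>N. x \<in> elts s <-> x \<in> elts y \<or> x = y)"
    by (intro bexI[OF _ M_sub_N[OF vnat_inM[of "Suc n"]]]) blast
  qed
 qed
 moreover have "ax_power_set N" unfolding ax_power_set_def
 proof (intro ballI)
  fix a assume aN: "a \<in> N"
  then obtain \<tau> where \<tau>: "\<tau> \<in> M" "a = val G \<tau>" by (rule nameE)
  \<comment> \<open>By \<open>sep_name\<close> each subset of \<open>a\<close> in the extension has
    a name among the subsets of \<open>TC \<tau> \<times> P\<close>. So \<pi> names a set containing
    all of them, and separation then cuts it down to subsets of \<open>a\<close>.\<close>
  define \<pi> where "\<pi> = hset_of ((\<lambda>\<nu>. opair \<nu> p0) ` elts (hPow (hprod (TC \<tau>) P)))"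
  have \<pi>: "\<pi> \<in> M" unfolding \<pi>_def by (rule inM, intro df P \<tau> p0)
  have mem: "x \<in> elts (val G \<pi>)" if x: "x \<in> N" "x \<sqsubseteq> a" for x
  proof -
   obtain \<xi> where \<xi>: "\<xi> \<in> M" "x = val G \<xi>" by (rule nameE[OF x(1)])
   have "range (\<lambda>_::nat. \<xi>) \<subseteq> M" using \<xi> by auto
   from sep_name[OF this \<tau>(1), of "Mem 0 1"] obtain \<nu> where \<nu>: "\<nu> \<in> M" "elts \<nu> \<subseteq> elts (hprod (TC \<tau>) P)"
    "elts (val G \<nu>) = {y \<in> elts a. y \<in> elts x}" unfolding \<tau>(2) \<xi>(2) by auto
   have "elts (val G \<nu>) = elts x" using \<nu>(3) x(2) by blast
   hence "val G \<nu> = x" by (rule hset_eqI)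
   moreover have "opair \<nu> p0 \<in> elts \<pi>"
   proof -
    have "elts \<pi> = (\<lambda>\<nu>. opair \<nu> p0) ` elts (hPow (hprod (TC \<tau>) P))"
     unfolding \<pi>_def by (rule elts_hset_of[OF countable_image[OF countable_elts]])
    moreover have "\<nu> \<in> elts (hPow (hprod (TC \<tau>) P))" using \<nu>(1,2) by (simp del: elts_hprod)
    ultimately show ?thesis by (metis (no_types, lifting) imageI)
   qed
   ultimately show ?thesis using in_valI[OF _ p0(1)] by metis
  qed
  have "range (\<lambda>_::nat. a) \<subseteq> N" using aN by auto
  from ax_sep_N[unfolded ax_separation_def, rule_format, OF this val_N[OF \<pi>], of "All 1 (Neg (Conj (Mem 1 0) (Neg (Mem 1 2))))"]
  obtain p where p: "p \<in> N" "\<forall>x\<in>N. x \<in> elts p <-> x \<in> elts (val G \<pi>) \<and> (\<forall>y\<in>N. y \<in> elts x --> y \<in> elts a)"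
   by (elim bexE) simp
  show "\<exists>p\<in>N. \<forall>x\<in>N. x \<in> elts p <-> (\<forall>y\<in>N. y \<in> elts x --> y \<in> elts a)"
  proof (rule bexI[OF _ p(1)], intro ballI)
   fix x assume x: "x \<in> N"
   have "x \<sqsubseteq> a" if "\<forall>y\<in>N. y \<in> elts x --> y \<in> elts a" using that trN[OF x] by blast
   thus "x \<in> elts p <-> (\<forall>y\<in>N. y \<in> elts x --> y \<in> elts a)" using p(2) x mem[OF x] by blast
  qed
 qed
 ultimately show ?thesis using ax_sep_N ax_repl_N unfolding zf_ctm_def by blast
qed

lemma val_graph_N: "n \<in> M ==> hgraph n (val G) \<in> N"
proof -
 assume n: "n \<in> M"
 define \<nu> where "\<nu> = hset_of ((\<lambda>\<rho>. opair (opname p0 (ck p0 \<rho>) \<rho>) p0) ` elts n)"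
 have "\<nu> \<in> M" unfolding \<nu>_def by (rule inM, intro df p0 n)
 have "{\<sigma>. \<exists>q\<in>G. opair \<sigma> q \<in> elts \<nu>} = (\<lambda>\<rho>. opname p0 (ck p0 \<rho>) \<rho>) ` elts n" by (auto simp: \<nu>_def)
 hence "elts (val G \<nu>) = (\<lambda>\<rho>. opair \<rho> (val G \<rho>)) ` elts n"
  unfolding elts_val by (simp add: image_image val_opname val_ck)
 hence "val G \<nu> = hgraph n (val G)" by (intro hset_eqI) simp
 thus ?thesis using val_N[OF \<open>\<nu> \<in> M\<close>] by simp
qed

lemma G_N: "hset_of G \<in> N"
proof -
 define \<nu> where "\<nu> = hset_of ((\<lambda>p. opair (ck p0 p) p) ` elts P)"
 have "\<nu> \<in> M" unfolding \<nu>_def by (rule inM, intro df p0 P)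
 have "{\<sigma>. \<exists>q\<in>G. opair \<sigma> q \<in> elts \<nu>} = ck p0 ` G" using G_P by (auto simp: \<nu>_def)
 hence "elts (val G \<nu>) = G" unfolding elts_val by (simp add: image_image val_ck)
 hence "val G \<nu> = hset_of G" by (metis hset_of_elts)
 thus ?thesis using val_N[OF \<open>\<nu> \<in> M\<close>] by simp
qed

lemma elts_G [simp]: "elts (hset_of G) = G"
 by (rule elts_hset_of, rule countM) (use G_P P_M in blast)

text \<open>Every element of a member of \<open>a\<close> has a name in \<open>TC \<tau>\<close>,
  and the ground model maps these names injectively to ordinals. The transversal takes from each
  member of \<open>a\<close> the element with the least name.\<close>

lemma ac_N: "ax_choice N"
 unfolding ax_choice_def
proof (intro ballI impI)
 interpret N: zfmodel N by standard (rule zf_N)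
 fix a assume a: "a \<in> N" and ne: "\<forall>x\<in>N. x \<in> elts a --> (\<exists>z\<in>N. z \<in> elts x)"
  and dj: "\<forall>x\<in>N. \<forall>y\<in>N. x \<in> elts a --> y \<in> elts a --> x \<noteq> y --> \<not> (\<exists>z\<in>N. z \<in> elts x \<and> z \<in> elts y)"
 obtain \<tau> where \<tau>: "\<tau> \<in> M" "a = val G \<tau>" by (rule nameE[OF a])
 define n where "n = TC \<tau>"
 have n: "n \<in> M" using \<tau> by (simp add: n_def)
 obtain h where h: "h \<in> M" and ho: "\<And>x. x \<in> elts n ==> is_ord (ap h x)" and hi: "inj_on (ap h) (elts n)"
  by (rule zermelo[OF n]) blast
 define v where "v = hgraph n (val G)"
 have v: "v \<in> N" unfolding v_def by (rule val_graph_N[OF n])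
 have mv: "opair \<rho> z \<in> elts v <-> \<rho> \<in> elts n \<and> z = val G \<rho>" for \<rho> z by (auto simp: v_def)
 define W where "W x \<rho> z <-> opair \<rho> z \<in> elts v \<and> (\<forall>\<rho>'\<in>elts n. (\<exists>z'\<in>elts x. opair \<rho>' z' \<in> elts v) --> ap h \<rho>' \<notin> elts (ap h \<rho>))" for x \<rho> z
 define c where "c = hset_of {z \<in> elts (hUn a). \<exists>x\<in>elts a. z \<in> elts x \<and> (\<exists>\<rho>\<in>elts n. W x \<rho> z)}"
 have c: "c \<in> N" unfolding c_def W_def by (rule N.inM, intro df a v M_sub_N[OF n] M_sub_N[OF h])
 have ec: "z \<in> elts c <-> (\<exists>x\<in>elts a. z \<in> elts x \<and> (\<exists>\<rho>\<in>elts n. W x \<rho> z))" for z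
  unfolding c_def by (subst elts_sep) auto
 have "\<exists>!z. z \<in> N \<and> z \<in> elts x \<and> z \<in> elts c" if x: "x \<in> elts a" for x
 proof -
  have xN: "x \<in> N" by (rule trN[OF a x])
  obtain z1 where z1: "z1 \<in> elts x" using ne xN x by blast
  obtain \<sigma> q where q: "x = val G \<sigma>" "opair \<sigma> q \<in> elts \<tau>" using x unfolding \<tau>(2) by (rule in_valE)
  obtain \<rho>1 q1 where q1: "z1 = val G \<rho>1" "opair \<rho>1 q1 \<in> elts \<sigma>" using z1 unfolding q(1) by (rule in_valE)
  have "\<rho>1 \<in> elts n" unfolding n_def using name_in_TC[OF q(2)] name_in_TC[OF q1(2)] TC_trans by blast
  hence "\<rho>1 \<in> {\<rho> \<in> elts n. val G \<rho> \<in> elts x}" using z1 q1(1) by simp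
  from ord_least[OF this, of "ap h"] ho obtain \<rho> where \<rho>: "\<rho> \<in> elts n" "val G \<rho> \<in> elts x"
   "\<forall>\<rho>'\<in>{\<rho> \<in> elts n. val G \<rho> \<in> elts x}. ap h \<rho>' \<notin> elts (ap h \<rho>)" by auto
  have W: "W x \<rho> (val G \<rho>)" unfolding W_def mv using \<rho> by auto
  show ?thesis
  proof (rule ex1I[of _ "val G \<rho>"])
   show "val G \<rho> \<in> N \<and> val G \<rho> \<in> elts x \<and> val G \<rho> \<in> elts c"
    unfolding ec using \<rho>(1,2) W x trN[OF xN \<rho>(2)] by blast
   fix z assume z: "z \<in> N \<and> z \<in> elts x \<and> z \<in> elts c"
   then obtain x' \<eta> where x': "x' \<in> elts a" "z \<in> elts x'" "\<eta> \<in> elts n" "W x' \<eta> z" unfolding ec by blast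
   have "x' = x" using dj xN trN[OF a x'(1)] x x'(1,2) z by blast
   hence W': "W x \<eta> z" using x'(4) by simp
   have z\<eta>: "z = val G \<eta>" using W' unfolding W_def mv by simp
   have "ap h \<eta> \<notin> elts (ap h \<rho>)" using \<rho>(3) x'(3) z z\<eta> by simp
   moreover have "ap h \<rho> \<notin> elts (ap h \<eta>)"
    using W' \<rho>(1,2) unfolding W_def mv by auto
   ultimately have "ap h \<eta> = ap h \<rho>" using is_ord_linear[OF ho[OF x'(3)] ho[OF \<rho>(1)]] by blast
   hence "\<eta> = \<rho>" using inj_onD[OF hi _ x'(3) \<rho>(1)] by simp
   thus "z = val G \<rho>" using z\<eta> by simp
  qed
 qed
 thus "\<exists>c\<in>N. \<forall>x\<in>N. x \<in> elts a --> (\<exists>!z. z \<in> N \<and> z \<in> elts x \<and> z \<in> elts c)"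
  using c by blast
qed

lemma ctmodel_N: "ctmodel N"
 by standard (rule zf_N, rule ac_N)

text \<open>Later arguments see a name of \<open>A\<close> only through this relation, with the
  condition as first component: it records which conditions force \<open>t\<close> into
  \<open>A\<close>, and lies in the ground model.\<close>

lemma nice_name:
 assumes A: "A \<in> N" and X: "X \<in> M"
 obtains \<nu> where "\<nu> \<in> M" "\<And>t. t \<in> elts X ==> t \<in> elts A <-> (\<exists>p\<in>G. opair p t \<in> elts \<nu>)"
  "\<And>p t. opair p t \<in> elts \<nu> ==> p \<in> elts P \<and> t \<in> elts X"
  "\<And>p q t. opair p t \<in> elts \<nu> ==> q \<in> elts P ==> le q p ==> opair q t \<in> elts \<nu>"
proof -
 obtain \<xi> where \<xi>: "\<xi> \<in> M" "A = val G \<xi>" by (rule nameE[OF A])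
 have r: "range (\<lambda>_::nat. \<xi>) \<subseteq> M" using \<xi> by auto
 let ?b = "\<lambda>t. (\<lambda>_::nat. \<xi>)(0 := ck p0 t)"
 define \<nu> where "\<nu> = hset_of {z \<in> elts (hprod P X). hfst z \<in> elts P \<and> forces (Mem 0 1) (?b (hsnd z)) (hfst z)}"
 have mem: "opair p t \<in> elts \<nu> <-> p \<in> elts P \<and> t \<in> elts X \<and> forces (Mem 0 1) (?b t) p" for p t
  unfolding \<nu>_def by (subst elts_sep) (auto simp: opair_in_hprod simp del: elts_hprod)
 show thesis
 proof (rule that)
  show "\<nu> \<in> M" unfolding \<nu>_def by (rule inM, intro df P X dfp_forces_at r p0)
  fix t assume t: "t \<in> elts X"
  have "t \<in> elts A <-> (\<exists>p\<in>G. forces (Mem 0 1) (?b t) p)"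
   using truth1[OF r, of "ck p0 t" "Mem 0 1"] trM[OF X t] by (simp add: val_ck \<xi>(2))
  thus "t \<in> elts A <-> (\<exists>p\<in>G. opair p t \<in> elts \<nu>)" unfolding mem using t G_P by blast
 next
  fix p q t assume *: "opair p t \<in> elts \<nu>" "q \<in> elts P" "le q p"
  thus "opair q t \<in> elts \<nu>" unfolding mem using forces_mono[of "Mem 0 1" "?b t" p q] by blast
 qed (simp add: mem)
qed

end

section \<open>The tree and Cohen forcing in a model\<close>

definition vb :: "bool => hset" where "vb b = vnat (if b then 1 else 0)"

lemma vb_inject [simp]: "vb b = vb c <-> b = c"
 by (simp add: vb_def)

lemma elts_2: "elts (vnat 2) = range vb"
proof -
 have "range vb = {vnat 0, vnat 1}" by (auto simp: vb_def UNIV_bool)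
 moreover have "{..<2::nat} = {0, 1}" by auto
 ultimately show ?thesis by (simp add: elts_vnat)
qed

lemma vb_in_2 [simp]: "vb b \<in> elts (vnat 2)"
 by (simp add: elts_2)

definition str :: "bool list => hset" where
 "str u = hset_of ((\<lambda>i. opair (vnat i) (vb (u ! i))) ` {..<length u})"

lemma elts_str: "elts (str u) = (\<lambda>i. opair (vnat i) (vb (u ! i))) ` {..<length u}"
 by (simp add: str_def countable_finite)

lemma finite_str [simp]: "finite (elts (str u))"
 by (simp add: elts_str)

lemma card_str [simp]: "card (elts (str u)) = length u"
 unfolding elts_str by (subst card_image) (auto simp: inj_on_def)

lemma opair_in_str [simp]: "opair (vnat i) (vb b) \<in> elts (str u) <-> i < length u \<and> u ! i = b"
 by (auto simp: elts_str)

lemma is_fun_str: "is_fun (str u) (elts (vnat (length u))) (elts (vnat 2))"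
 unfolding is_fun_def elts_2
proof (intro conjI ballI)
 fix z assume "z \<in> elts (str u)"
 thus "\<exists>a\<in>elts (vnat (length u)). \<exists>b\<in>range vb. z = opair a b" by (auto simp: elts_str)
next
 fix a assume "a \<in> elts (vnat (length u))"
 then obtain i where "a = vnat i" "i < length u" by (auto simp: elts_vnat)
 thus "\<exists>!b. opair a b \<in> elts (str u)"
  by (intro ex1I[of _ "vb (u ! i)"]) (auto simp: elts_str)
qed

lemma is_fun_2E:
 assumes f: "is_fun f A (elts (vnat 2))" and i: "a \<in> A"
 shows "opair a (vb b) \<in> elts f <-> (opair a (vb True) \<in> elts f) = b"
proof -
 have "ap f a \<in> range vb" using is_fun_ap(2)[OF f i] by (simp add: elts_2)
 then obtain c where "ap f a = vb c" by blast
 thus ?thesis using is_fun_ap(4)[OF f i] by auto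
qed

lemma is_fun_nat_eq_str:
 assumes "is_fun s (elts (vnat n)) (elts (vnat 2))"
 shows "s = str (map (\<lambda>i. opair (vnat i) (vb True) \<in> elts s) [0..<n])"
proof (rule hset_eqI, intro set_eqI iffI)
 fix z assume z: "z \<in> elts s"
 then obtain a b where "a \<in> elts (vnat n)" "b \<in> elts (vnat 2)" and zz: "z = opair a b"
  using assms unfolding is_fun_def by blast
 then obtain i c where i: "a = vnat i" "i < n" "b = vb c" by (auto simp: elts_vnat[of n] elts_2)
 hence "(opair (vnat i) (vb True) \<in> elts s) = c" using is_fun_2E[OF assms, of "vnat i" c] z zz by simp
 thus "z \<in> elts (str (map (\<lambda>i. opair (vnat i) (vb True) \<in> elts s) [0..<n]))"
  using i zz by simp
next
 fix z assume "z \<in> elts (str (map (\<lambda>i. opair (vnat i) (vb True) \<in> elts s) [0..<n]))"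
 then obtain i where i: "i < n" "z = opair (vnat i) (vb (opair (vnat i) (vb True) \<in> elts s))" by (auto simp: elts_str)
 define c where "c <-> opair (vnat i) (vb True) \<in> elts s"
 have "vnat i \<in> elts (vnat n)" using i by simp
 from is_fun_2E[OF assms this, of c] have "opair (vnat i) (vb c) \<in> elts s" by (simp add: c_def)
 thus "z \<in> elts s" using i(2) by (simp only: c_def)
qed

lemma T_str: "T = range str"
proof
 show "T \<subseteq> range str" unfolding T_def using is_fun_nat_eq_str by blast
 show "range str \<subseteq> T" unfolding T_def using is_fun_str by blast
qed

lemma prefix_nth: "prefix u v <-> length u \<le> length v \<and> (\<forall>i<length u. v ! i = u ! i)"
proof
 assume "prefix u v"
 thus "length u \<le> length v \<and> (\<forall>i<length u. v ! i = u ! i)" by (auto simp: prefix_def nth_append)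
next
 assume *: "length u \<le> length v \<and> (\<forall>i<length u. v ! i = u ! i)"
 hence "take (length u) v = u" by (intro nth_equalityI) auto
 thus "prefix u v" by (metis take_is_prefix)
qed

lemma str_subset [simp]: "str u \<sqsubseteq> str v <-> prefix u v"
proof
 assume s: "str u \<sqsubseteq> str v"
 have "i < length v \<and> v ! i = u ! i" if "i < length u" for i
 proof -
  have "opair (vnat i) (vb (u ! i)) \<in> elts (str u)" using that by simp
  hence "opair (vnat i) (vb (u ! i)) \<in> elts (str v)" using s by blast
  thus ?thesis by simp
 qed
 thus "prefix u v" unfolding prefix_nth by (metis leI less_irrefl)
next
 assume "prefix u v"
 thus "str u \<sqsubseteq> str v" unfolding prefix_nth by (auto simp: elts_str)
qed

lemma str_inject [simp]: "str u = str v <-> u = v"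
proof
 assume "str u = str v"
 hence "prefix u v" "prefix v u" using str_subset[of u v] str_subset[of v u] by simp_all
 thus "u = v" by (rule prefix_order.antisym)
qed simp

lemma inj_str: "inj str"
 by (rule injI) simp

definition TT :: hset where "TT = hset_of T"

lemma elts_TT [simp]: "elts TT = T"
 unfolding TT_def T_str by (rule elts_hset_of) simp

lemma str_in_T [simp]: "str u \<in> T"
 by (simp add: T_str)

lemma hdom_str: "hdom (str u) = vnat (length u)"
 by (rule hset_eqI) (auto simp: elts_str elts_vnat)

definition bits :: "hset => nat => bool" where
 "bits f i <-> opair (vnat i) (vb True) \<in> elts f"

abbreviation upto_bits :: "(nat => bool) => nat => bool list" where
 "upto_bits x n \<equiv> map x [0..<n]"

lemma cantor_opair: "f \<in> cantor M ==> opair (vnat i) (vb b) \<in> elts f <-> bits f i = b"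
 unfolding bits_def cantor_def using is_fun_2E[of f "elts omega" "vnat i" b] by simp

lemma cantor_elts: "f \<in> cantor M ==> elts f = range (\<lambda>i. opair (vnat i) (vb (bits f i)))"
proof (intro set_eqI iffI)
 fix z assume f: "f \<in> cantor M" and z: "z \<in> elts f"
 then obtain a b where "a \<in> elts omega" "b \<in> elts (vnat 2)" and zz: "z = opair a b"
  unfolding cantor_def is_fun_def by blast
 then obtain i c where i: "a = vnat i" "b = vb c" by (auto simp: elts_2)
 thus "z \<in> range (\<lambda>i. opair (vnat i) (vb (bits f i)))" using cantor_opair[OF f] z zz by auto
qed (use cantor_opair in auto)

lemma restr_str: "f \<in> cantor M ==> restr f n = str (upto_bits (bits f) n)"
proof -
 assume f: "f \<in> cantor M"
 have "{z \<in> elts f. \<exists>a\<in>elts (vnat n). \<exists>b. z = opair a b} = elts (str (upto_bits (bits f) n))"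
  unfolding cantor_elts[OF f] by (auto simp: elts_str)
 thus ?thesis unfolding restr_def by simp
qed

lemma str_sub_cantor: "f \<in> cantor M ==> str u \<sqsubseteq> f <-> u = upto_bits (bits f) (length u)"
proof
 assume f: "f \<in> cantor M" and s: "str u \<sqsubseteq> f"
 have "u ! i = bits f i" if "i < length u" for i
 proof -
  have "opair (vnat i) (vb (u ! i)) \<in> elts (str u)" using that by simp
  thus ?thesis using s cantor_opair[OF f] by blast
 qed
 thus "u = upto_bits (bits f) (length u)" by (intro nth_equalityI) simp_all
next
 assume f: "f \<in> cantor M" and u: "u = upto_bits (bits f) (length u)"
 have "opair (vnat i) (vb (u ! i)) \<in> elts f" if "i < length u" for i
 proof -
  have "u ! i = bits f i" using that by (subst u) simp
  thus ?thesis using cantor_opair[OF f] by simp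
 qed
 thus "str u \<sqsubseteq> f" by (auto simp: elts_str)
qed

lemma branch_str: "f \<in> cantor M ==> branch f = range (\<lambda>n. str (upto_bits (bits f) n))"
 unfolding branch_def by (simp add: restr_str)

definition antich :: "hset set => bool" where
 "antich X <-> (\<forall>s\<in>X. \<forall>t\<in>X. s \<sqsubseteq> t --> s = t)"

definition chain_T :: "hset set => bool" where
 "chain_T B <-> B \<subseteq> T \<and> (\<forall>s\<in>B. \<forall>t\<in>B. s \<sqsubseteq> t \<or> t \<sqsubseteq> s)"

lemma antich_chain: "antich X ==> chain_T B ==> finite (X \<inter> B)"
proof (cases "X \<inter> B = {}")
 case False
 assume a: "antich X" and c: "chain_T B"
 obtain x where x: "x \<in> X \<inter> B" using False by blast
 have "X \<inter> B \<subseteq> {x}"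
 proof
  fix y assume y: "y \<in> X \<inter> B"
  hence "x \<sqsubseteq> y \<or> y \<sqsubseteq> x" using c x unfolding chain_T_def by simp
  thus "y \<in> {x}" using a x y unfolding antich_def by auto
 qed
 thus ?thesis by (rule finite_subset) simp
qed simp

definition dense_above :: "hset => hset set => bool" where
 "dense_above s A <-> (\<forall>s'\<in>T. s \<sqsubseteq> s' --> (\<exists>t\<in>A. t \<in> T \<and> s' \<sqsubseteq> t))"

section \<open>Cohen forcing as a member of the model\<close>

definition FN :: "hset => hset" where "FN K = hset_of (Fn K)"
definition FnL :: "hset => hset" where
 "FnL K = hset_of {z \<in> elts (hprod (FN K) (FN K)). hsnd z \<sqsubseteq> hfst z}"

lemma Fn_eq: "Fn K = {p. p \<sqsubseteq> (hprod K (vnat 2)) \<and> finite (elts p) \<and>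
  (\<forall>z\<in>elts p. \<forall>z'\<in>elts p. hfst z = hfst z' --> z = z')}" (is "_ = ?R")
proof (intro set_eqI iffI)
 fix p assume p: "p \<in> Fn K"
 have 1: "\<exists>a\<in>elts K. \<exists>b\<in>elts (vnat 2). z = opair a b" if "z \<in> elts p" for z using p that unfolding Fn_def by blast
 have 2: "b = c" if "opair a b \<in> elts p" "opair a c \<in> elts p" for a b c using p that unfolding Fn_def by blast
 have "z \<in> elts (hprod K (vnat 2))" if "z \<in> elts p" for z using 1[OF that] by (auto simp: opair_in_hprod simp del: elts_hprod)
 moreover have "z = z'" if z: "z \<in> elts p" "z' \<in> elts p" "hfst z = hfst z'" for z z'
  using 1[OF z(1)] 1[OF z(2)] z 2 by auto
 ultimately show "p \<in> ?R" using p unfolding Fn_def by blast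
next
 fix p assume p: "p \<in> ?R"
 hence 1: "\<exists>a\<in>elts K. \<exists>b\<in>elts (vnat 2). z = opair a b" if "z \<in> elts p" for z
  using that by (auto dest!: subsetD)
 have 2: "b = c" if "opair a b \<in> elts p" "opair a c \<in> elts p" for a b c
 proof -
  have "opair a b = opair a c" using p that by (metis (mono_tags, lifting) hfst_opair mem_Collect_eq)
  thus ?thesis by simp
 qed
 show "p \<in> Fn K" unfolding Fn_def mem_Collect_eq
 proof (intro conjI ballI allI impI)
  show "finite (elts p)" using p by simp
  fix z assume "z \<in> elts p" thus "\<exists>a\<in>elts K. \<exists>b\<in>elts (vnat 2). z = opair a b" by (rule 1)
 next
  fix a b c assume "opair a b \<in> elts p" "opair a c \<in> elts p" thus "b = c" by (rule 2)
 qed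
qed

lemma Fn_fun: "p \<in> Fn K ==> opair a b \<in> elts p ==> opair a c \<in> elts p ==> b = c"
 unfolding Fn_def by blast

lemma FnI:
 assumes "finite (elts p)" "\<And>z. z \<in> elts p ==> \<exists>a\<in>elts K. \<exists>b. z = opair a (vb b)"
  "\<And>a b c. opair a (vb b) \<in> elts p ==> opair a (vb c) \<in> elts p ==> b = c"
 shows "p \<in> Fn K"
proof -
 have "\<exists>a\<in>elts K. \<exists>b\<in>elts (vnat 2). z = opair a b" if "z \<in> elts p" for z
  using assms(2)[OF that] by (elim bexE exE) (intro bexI, auto)
 moreover have "b = c" if h: "opair a b \<in> elts p" "opair a c \<in> elts p" for a b c
 proof -
  obtain b' c' where "b = vb b'" "c = vb c'" using assms(2)[OF h(1)] assms(2)[OF h(2)] by auto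
  thus ?thesis using assms(3) h by simp
 qed
 ultimately show ?thesis using assms(1) unfolding Fn_def mem_Collect_eq by (intro conjI ballI allI impI)
qed

lemma FnD:
 assumes "p \<in> Fn K" "z \<in> elts p"
 obtains a b where "a \<in> elts K" "z = opair a (vb b)"
proof -
 obtain a b where ab: "a \<in> elts K" "b \<in> elts (vnat 2)" "z = opair a b" using assms unfolding Fn_def by blast
 then obtain c where "b = vb c" unfolding elts_2 by blast
 thus thesis using ab that by blast
qed

lemma Fn_sub: "p \<in> Fn K ==> q \<sqsubseteq> p ==> q \<in> Fn K"
 unfolding Fn_eq using finite_subset by blast

lemma Fn_hun:
 assumes "p \<in> Fn K" "q \<in> Fn K" "\<And>a b c. opair a (vb b) \<in> elts p ==> opair a (vb c) \<in> elts q ==> b = c"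
 shows "hun p q \<in> Fn K"
proof (rule FnI)
 show "finite (elts (hun p q))" using assms(1,2) unfolding Fn_def by simp
 show "\<exists>a\<in>elts K. \<exists>b. z = opair a (vb b)" if "z \<in> elts (hun p q)" for z
  using that assms(1,2) by (auto elim: FnD)
 fix a b c assume "opair a (vb b) \<in> elts (hun p q)" "opair a (vb c) \<in> elts (hun p q)"
 thus "b = c" using Fn_fun[OF assms(1), of a "vb b" "vb c"] Fn_fun[OF assms(2), of a "vb b" "vb c"]
  assms(3)[of a b c] assms(3)[of a c b] by auto
qed

lemma hemp_Fn: "hemp \<in> Fn K"
 by (simp add: Fn_def)

lemma str_Fn: "str u \<in> Fn omega"
 by (rule FnI) (auto simp: elts_str)

context ctmodel
begin

lemma TT_inM [simp]: "TT \<in> M" and cnt_TT: "countable_in M TT"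
proof -
 define Q where "Q = hFin (hprod omega (vnat 2))"
 have Q: "Q \<in> M" unfolding Q_def by (rule inM, intro df omega_inM vnat_inM)
 have Teq: "T = {s \<in> elts Q. \<exists>n\<in>elts omega. is_fun s (elts n) (elts (vnat 2))}"
 proof (intro set_eqI iffI)
  fix s assume s: "s \<in> T"
  then obtain u where u: "s = str u" unfolding T_str by blast
  have "s \<sqsubseteq> (hprod omega (vnat 2))" unfolding u elts_str by (auto simp: opair_in_hprod simp del: elts_hprod)
  hence "s \<in> elts Q" unfolding Q_def by (subst elts_hFin) (simp_all add: u)
  thus "s \<in> {s \<in> elts Q. \<exists>n\<in>elts omega. is_fun s (elts n) (elts (vnat 2))}"
   using is_fun_str[of u] u by auto
 qed (auto simp: T_def)
 have e: "TT = hset_of {s \<in> elts Q. \<exists>n\<in>elts omega. is_fun s (elts n) (elts (vnat 2))}"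
  unfolding TT_def by (rule arg_cong[OF Teq])
 show TM: "TT \<in> M" unfolding e by (rule inM, intro df Q omega_inM vnat_inM)
 have "countable_in M (vnat 2)" by (rule cnt_subset[OF cnt_omega]) (auto simp: elts_vnat)
 hence "countable_in M Q" unfolding Q_def by (intro cnt_Fin cnt_prod) (simp_all add: cnt_omega)
 thus "countable_in M TT" by (rule cnt_subset[OF _ Q TM]) (use Teq in auto)
qed

lemma str_inM [simp]: "str u \<in> M"
 using trM[OF TT_inM, of "str u"] by simp

lemma elts_FN: "K \<in> M ==> elts (FN K) = Fn K"
 and FN_inM [simp]: "K \<in> M ==> FN K \<in> M"
 and FN_eq: "K \<in> M ==> FN K = hset_of {p \<in> elts (hFin (hprod K (vnat 2))). \<forall>z\<in>elts p. \<forall>z'\<in>elts p. hfst z = hfst z' --> z = z'}"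
proof -
 assume K: "K \<in> M"
 hence KM: "hprod K (vnat 2) \<in> M" by simp
 have F: "Fn K = {p \<in> elts (hFin (hprod K (vnat 2))). \<forall>z\<in>elts p. \<forall>z'\<in>elts p. hfst z = hfst z' --> z = z'}"
  unfolding Fn_eq elts_hFin[OF KM] by blast
 show "elts (FN K) = Fn K" unfolding FN_def F by (rule elts_sep)
 show e: "FN K = hset_of {p \<in> elts (hFin (hprod K (vnat 2))). \<forall>z\<in>elts p. \<forall>z'\<in>elts p. hfst z = hfst z' --> z = z'}"
  unfolding FN_def F ..
 show "FN K \<in> M" unfolding e by (rule inM, intro df K vnat_inM)
qed

lemma dft_FN [df]:
 assumes "dft M f"
 shows "dft M (\<lambda>e. FN (f e))"
proof (rule dft_app1[where F = FN, OF _ assms])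
 have 1: "dft M (\<lambda>e. hset_of {p \<in> elts (hFin (hprod (e 0) (vnat 2))). \<forall>z\<in>elts p. \<forall>z'\<in>elts p. hfst z = hfst z' --> z = z'})"
  by (intro df vnat_inM)
 show "dft M (\<lambda>e. FN (e 0))"
 proof (rule dftI)
  fix e :: "nat => hset" assume "range e \<subseteq> M"
  thus "FN (e 0) \<in> M" by (intro FN_inM) auto
 next
  show "dfp M (\<lambda>e. e 0 = FN (e (Suc 0)))"
  proof (rule dfp_eqI[OF dft_graph[OF 1]])
   fix e :: "nat => hset" assume "range e \<subseteq> M"
   hence "e (Suc 0) \<in> M" by auto
   from FN_eq[OF this]
   show "(e 0 = FN (e (Suc 0))) = (e 0 = hset_of {p \<in> elts (hFin (hprod (e (Suc 0)) (vnat 2))). \<forall>z\<in>elts p. \<forall>z'\<in>elts p. hfst z = hfst z' --> z = z'})"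
    by (simp only:)
  qed
 qed
qed

lemma FnL_inM [simp]: "K \<in> M ==> FnL K \<in> M"
 unfolding FnL_def by (rule inM, intro df)

lemma FnL_iff: "K \<in> M ==> opair p q \<in> elts (FnL K) <-> p \<in> Fn K \<and> q \<in> Fn K \<and> q \<sqsubseteq> p"
 unfolding FnL_def by (subst elts_sep) (auto simp: opair_in_hprod elts_FN simp del: elts_hprod)

lemma forcing_Fn: "K \<in> M ==> forcing M (FN K) (FnL K)"
 by standard (auto simp: poset_def order_of_def FnL_iff elts_FN intro: hemp_Fn)

lemma generic_Fn: "K \<in> M ==> generic M (Fn K) Fn_le G <-> generic M (elts (FN K)) (order_of (FnL K)) G"
proof -
 assume K: "K \<in> M"
 have "order_of (FnL K) p q <-> Fn_le p q" if "p \<in> Fn K" "q \<in> Fn K" for p q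
  using that by (simp add: order_of_def FnL_iff[OF K] Fn_le_def)
 thus ?thesis unfolding generic_def elts_FN[OF K]
  by (intro conj_cong refl ball_cong imp_cong bex_cong) (blast | auto)+
qed

lemma generic_ext_Fn: "K \<in> M ==> generic M (Fn K) Fn_le G ==> generic_ext M (FN K) (FnL K) G"
 using generic_Fn forcing_Fn by (simp add: generic_ext_def generic_ext_axioms_def)

text \<open>Otherwise the new set could be added to \<open>F\<close>, which would then be a proper
  subset of an almost disjoint family with union \<open>T\<close> in the extension.\<close>

lemma mad_hits:
 assumes F: "F \<in> M" and p: "p \<in> G" "p \<in> M" and D: "hgraph TT D \<in> M"
  and mad: "mad_in (gen_ext M G) F" and inf: "infinite {t \<in> T. D t \<in> G}"
 shows "\<exists>A\<in>elts F. infinite (elts A \<inter> {t \<in> T. D t \<in> G})"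
proof (rule ccontr)
 assume n: "\<not> ?thesis"
 define B where "B = hset_of {t \<in> elts TT. D t \<in> G}"
 have eB: "elts B = {t \<in> T. D t \<in> G}" unfolding B_def by (subst elts_sep) simp
 have ad: "ad_family F" and U: "(\<Union>X\<in>elts F. elts X) = T"
  and max: "\<And>F'. F' \<in> gen_ext M G ==> ad_family F' ==> (\<Union>X\<in>elts F'. elts X) = T ==> F \<sqsubseteq> F' ==> F' = F"
  using mad unfolding mad_in_def by blast+
 have fin: "finite (elts X \<inter> elts B)" if "X \<in> elts F" for X using n that unfolding eB by blast
 have "hins B F \<in> gen_ext M G" unfolding B_def by (rule ext_insert[OF p F TT_inM D])
 moreover have "ad_family (hins B F)"
  using ad fin inf unfolding ad_family_def elts_hins by (auto simp: eB Int_commute)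
 moreover have "(\<Union>X\<in>elts (hins B F). elts X) = T" using U by (auto simp: eB)
 ultimately have "hins B F = F" by (rule max) auto
 hence "B \<in> elts F" by (metis elts_hins insertI1)
 from fin[OF this] show False using inf by (simp add: eB)
qed

lemma cohen_hits:
 assumes F: "F \<in> M" and adT: "\<And>X. X \<in> elts F ==> elts X \<subseteq> T"
  and G: "generic M (Fn omega) Fn_le G" and mad: "mad_in (gen_ext M G) F"
 obtains A B s where "A \<in> elts F" "chain_T B" "infinite (elts A \<inter> B)" "s \<in> T" "dense_above s (elts A)"
proof -
 interpret G: generic_ext M "FN omega" "FnL omega" G by (rule generic_ext_Fn[OF omega_inM G])
 have P: "elts (FN omega) = Fn omega" by (rule elts_FN[OF omega_inM])
 have le: "opair p q \<in> elts (FnL omega) <-> p \<in> Fn omega \<and> q \<in> Fn omega \<and> q \<sqsubseteq> p" for p q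
  by (rule FnL_iff[OF omega_inM])
 \<comment> \<open>Nodes of \<open>T\<close> are Cohen conditions, and those in the filter are the
   initial segments of the new real.\<close>
 define B where "B = {t \<in> T. t \<in> G}"
 have compat: "\<exists>r\<in>Fn omega. p \<sqsubseteq> r \<and> q \<sqsubseteq> r" if "p \<in> G" "q \<in> G" for p q
  using G.G_dir[OF that] unfolding le by blast
 have chain: "chain_T B" unfolding chain_T_def
 proof (intro conjI ballI)
  fix s t assume "s \<in> B" "t \<in> B"
  then obtain u v where uv: "s = str u" "t = str v" "str u \<in> G" "str v \<in> G" unfolding B_def T_str by auto
  obtain r where r: "r \<in> Fn omega" "str u \<sqsubseteq> r" "str v \<sqsubseteq> r" using compat[OF uv(3,4)] by blast
  have "u ! i = v ! i" if "i < length u" "i < length v" for i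
  proof -
   have "opair (vnat i) (vb (u ! i)) \<in> elts (str u)" "opair (vnat i) (vb (v ! i)) \<in> elts (str v)" using that by simp_all
   thus ?thesis using Fn_fun[OF r(1)] r(2,3) by (metis subsetD vb_inject)
  qed
  thus "s \<sqsubseteq> t \<or> t \<sqsubseteq> s"
   unfolding uv str_subset prefix_nth by (cases "length u \<le> length v") auto
 qed (auto simp: B_def)
 \<comment> \<open>Every Cohen condition is contained in a node, so density on \<open>T\<close> is
   enough for density in the forcing.\<close>
 have meet: "\<exists>t\<in>G. t \<in> T \<and> Q t" if Q: "dfp M (\<lambda>e. Q (e 0))" and d: "\<And>s. s \<in> T ==> \<exists>t\<in>T. s \<sqsubseteq> t \<and> Q t" for Q
 proof (rule G.G_dense)
  show "dfp M (\<lambda>e. e 0 \<in> T \<and> Q (e 0))"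
   unfolding elts_TT[symmetric] by (intro df Q TT_inM)
  fix p assume "p \<in> elts (FN omega)"
  hence p: "p \<in> Fn omega" by (simp add: P)
  have fin: "finite (elts p)" using p by (simp add: Fn_def)
  have "finite (hfst ` elts p)" using fin by simp
  then obtain n where n: "\<forall>i. vnat i \<in> hfst ` elts p --> i < n"
  proof -
   have "finite {i. vnat i \<in> hfst ` elts p}"
    using finite_vimageI[OF \<open>finite (hfst ` elts p)\<close>, of vnat] by (simp add: vimage_def inj_def)
   then obtain n where "\<forall>i\<in>{i. vnat i \<in> hfst ` elts p}. i < n" using finite_nat_set_iff_bounded by auto
   thus thesis by (intro that) auto
  qed
  \<comment> \<open>Places below \<open>n\<close> where \<open>p\<close> is undefined get the bit
    False.\<close>
  define u where "u = upto_bits (\<lambda>i. opair (vnat i) (vb True) \<in> elts p) n"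
  have "p \<sqsubseteq> str u"
  proof
   fix z assume z: "z \<in> elts p"
   then obtain a b where ab: "a \<in> elts omega" "z = opair a (vb b)" using p by (elim FnD)
   then obtain i where i: "z = opair (vnat i) (vb b)" by auto
   hence "vnat i \<in> hfst ` elts p" using z by force
   hence "i < n" using n by blast
   moreover have "(opair (vnat i) (vb True) \<in> elts p) = b"
    using Fn_fun[OF p, of "vnat i" "vb b" "vb True"] z i by (cases b) auto
   ultimately show "z \<in> elts (str u)" by (simp add: i u_def)
  qed
  moreover obtain t where t: "t \<in> T" "str u \<sqsubseteq> t" "Q t" using d[of "str u"] by auto
  moreover have "t \<in> Fn omega" using t(1) str_Fn unfolding T_str by blast
  ultimately show "\<exists>q\<in>elts (FN omega). opair q p \<in> elts (FnL omega) \<and> q \<in> T \<and> Q q"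
   using p unfolding P le by (intro bexI[of _ t]) auto
 qed
 have long: "\<exists>t\<in>B. n < card (elts t)" for n
 proof -
  have "\<exists>t\<in>G. t \<in> T \<and> \<not> bijM_le n t" if "\<And>t. bijM_le n t <-> hdom t \<in> elts (vnat (Suc n))" for bijM_le
  proof (rule meet)
   show "dfp M (\<lambda>e. \<not> bijM_le n (e 0))" unfolding that by (intro df vnat_inM)
   fix s assume "s \<in> T"
   then obtain u where u: "s = str u" unfolding T_str by blast
   thus "\<exists>t\<in>T. s \<sqsubseteq> t \<and> \<not> bijM_le n t"
    unfolding that by (intro bexI[of _ "str (u @ replicate (Suc n) True)"]) (simp_all add: hdom_str)
  qed
  from this[of "\<lambda>n t. hdom t \<in> elts (vnat (Suc n))"] obtain t where "t \<in> G" "t \<in> T" "hdom t \<notin> elts (vnat (Suc n))" by blast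
  thus ?thesis unfolding B_def T_str by (intro bexI[of _ t]) (auto simp: hdom_str)
 qed
 have infB: "infinite B"
 proof
  assume "finite B"
  hence "finite ((\<lambda>t. card (elts t)) ` B)" by simp
  then obtain n where "\<forall>m\<in>(\<lambda>t. card (elts t)) ` B. m < n" using finite_nat_set_iff_bounded by auto
  thus False using long[of n] by fastforce
 qed
 have "hgraph TT (\<lambda>t. t) \<in> M" by (rule hgraph_id_inM[OF TT_inM])
 from mad_hits[OF F G.p0(1,2) this mad] infB obtain A where A: "A \<in> elts F" "infinite (elts A \<inter> B)"
  unfolding B_def by blast
 have "\<exists>s\<in>T. dense_above s (elts A)"
 proof (rule ccontr)
  assume n: "\<not> ?thesis"
  have AM: "A \<in> M" by (rule trM[OF F A(1)])
  \<comment> \<open>If \<open>A\<close> is dense above no node, some node of the generic branch has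
    no extension in \<open>A\<close>; only its finitely many initial segments are left for
    \<open>A\<close> on the branch.\<close>
  have "\<exists>p\<in>G. p \<in> T \<and> \<not> (\<exists>t\<in>elts A. t \<in> T \<and> p \<sqsubseteq> t)"
  proof (rule meet)
   show "dfp M (\<lambda>e. \<not> (\<exists>t\<in>elts A. t \<in> T \<and> e 0 \<sqsubseteq> t))"
    unfolding elts_TT[symmetric] by (intro df AM TT_inM)
   fix s assume "s \<in> T"
   thus "\<exists>t\<in>T. s \<sqsubseteq> t \<and> \<not> (\<exists>t'\<in>elts A. t' \<in> T \<and> t \<sqsubseteq> t')"
    using n unfolding dense_above_def by blast
  qed
  then obtain p where p: "p \<in> G" "p \<in> T" "\<not> (\<exists>t\<in>elts A. t \<in> T \<and> p \<sqsubseteq> t)" by blast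
  have "elts A \<inter> B \<subseteq> {t \<in> T. t \<sqsubseteq> p}"
   using p chain unfolding chain_T_def B_def by blast
  moreover have "finite {t \<in> T. t \<sqsubseteq> p}"
  proof -
   obtain u where u: "p = str u" using p(2) unfolding T_str by blast
   have "{t \<in> T. t \<sqsubseteq> p} \<subseteq> str ` set (prefixes u)" unfolding u T_str by auto
   thus ?thesis by (rule finite_subset) simp
  qed
  ultimately show False using A(2) finite_subset by blast
 qed
 thus thesis using that[OF A(1) chain A(2)] by blast
qed

end

section \<open>Part (1): combs that meet all Cohen names\<close>

definition tth :: "(nat => bool) => nat => bool list => bool" where
 "tth f n u <-> n < length u \<and> (\<forall>i<n. u ! i = f i) \<and> u ! n \<noteq> f n"

lemma tth_unique: "tth f n u ==> tth f m u ==> n = m"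
 unfolding tth_def by (metis linorder_neqE_nat)

definition comb :: "(nat => bool) => bool list set => bool" where
 "comb f X <-> (\<forall>u\<in>X. \<exists>n. tth f n u) \<and> (\<forall>u\<in>X. \<forall>v\<in>X. \<forall>n. tth f n u --> tth f n v --> u = v)"

text \<open>An extension of \<open>u\<close> leaves the branch at the same height as
  \<open>u\<close>, and a comb has at most one node for each height.\<close>

lemma comb_prefix: "comb f X ==> u \<in> X ==> v \<in> X ==> prefix u v ==> u = v"
proof -
 assume c: "comb f X" and uv: "u \<in> X" "v \<in> X" "prefix u v"
 obtain n m where n: "tth f n u" and m: "tth f m v" using c uv unfolding comb_def by blast
 have p: "length u \<le> length v" "\<And>i. i < length u ==> v ! i = u ! i" using uv(3) by (auto simp: prefix_nth)
 have "tth f n v" using n p unfolding tth_def by auto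
 thus "u = v" using c uv(1,2) n unfolding comb_def by blast
qed

text \<open>A node that follows both branches beyond \<open>d\<close> would have two values at
  \<open>d\<close>. So a common node leaves one of the branches at height at most \<open>d\<close>,
  and each comb has finitely many such nodes.\<close>

lemma comb_finite_Int:
 assumes X: "comb f X" and Y: "comb g Y" and d: "f d \<noteq> g d"
 shows "finite (X \<inter> Y)"
proof -
 have fin: "finite {u \<in> X. \<exists>n\<le>d. tth f n u}" if "comb f X" for f X
 proof -
  have "{u \<in> X. \<exists>n\<le>d. tth f n u} \<subseteq> (\<lambda>n. THE u. u \<in> X \<and> tth f n u) ` {..d}"
  proof
   fix u assume "u \<in> {u \<in> X. \<exists>n\<le>d. tth f n u}"
   then obtain n where n: "u \<in> X" "n \<le> d" "tth f n u" by blast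
   have "(THE u. u \<in> X \<and> tth f n u) = u"
   proof (rule the_equality)
    show "v = u" if "v \<in> X \<and> tth f n v" for v using that n \<open>comb f X\<close> unfolding comb_def by blast
   qed (use n in simp)
   thus "u \<in> (\<lambda>n. THE u. u \<in> X \<and> tth f n u) ` {..d}" using n(2) by (intro image_eqI[of _ _ n]) simp_all
  qed
  thus ?thesis by (rule finite_subset) simp
 qed
 have "X \<inter> Y \<subseteq> {u \<in> X. \<exists>n\<le>d. tth f n u} \<union> {u \<in> Y. \<exists>n\<le>d. tth g n u}"
 proof
  fix u assume u: "u \<in> X \<inter> Y"
  obtain n m where n: "tth f n u" and m: "tth g m u" using X Y u unfolding comb_def by blast
  have "n \<le> d \<or> m \<le> d"
  proof (rule ccontr)
   assume "\<not> ?thesis"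
   hence dn: "d < n" "d < m" by simp_all
   have "u ! d = f d" using n dn(1) unfolding tth_def by blast
   moreover have "u ! d = g d" using m dn(2) unfolding tth_def by blast
   ultimately show False using d by simp
  qed
  thus "u \<in> {u \<in> X. \<exists>n\<le>d. tth f n u} \<union> {u \<in> Y. \<exists>n\<le>d. tth g n u}" using u n m by blast
 qed
 thus ?thesis by (rule finite_subset) (simp add: fin X Y)
qed

section \<open>Combs and closing-off inside the model\<close>

definition toothM :: "hset => hset => hset => bool" where
 "toothM f n t <-> n \<in> elts (hdom t) \<and> (\<forall>i\<in>elts n. ap t i = ap f i) \<and> ap t n \<noteq> ap f n"

lemma ap_str: "i < length u ==> ap (str u) (vnat i) = vb (u ! i)"
 by (rule ap_eq) (auto simp: elts_str)

lemma ap_cantor: "f \<in> cantor M ==> ap f (vnat i) = vb (bits f i)"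
 by (rule ap_eq) (auto simp: cantor_opair cantor_elts)

lemma toothM_iff: "f \<in> cantor M ==> toothM f (vnat n) (str u) <-> tth (bits f) n u"
proof (cases "n < length u")
 case True
 assume f: "f \<in> cantor M"
 have "(\<forall>i\<in>elts (vnat n). ap (str u) i = ap f i) <-> (\<forall>i<n. u ! i = bits f i)"
  unfolding elts_vnat using True by (auto simp: ap_str ap_cantor[OF f])
 thus ?thesis using True by (simp add: toothM_def tth_def hdom_str ap_str ap_cantor[OF f])
qed (simp add: toothM_def tth_def hdom_str)

lemma inj_unbounded:
 fixes d :: "nat => nat"
 assumes "inj d" shows "\<exists>k. m \<le> d k"
proof (rule ccontr)
 assume "\<not> ?thesis"
 hence "range d \<subseteq> {..<m}" by (auto simp: not_le)
 hence "finite (range d)" by (rule finite_subset) simp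
 thus False using assms finite_imageD infinite_UNIV_nat by blast
qed

lemma finite_mono_UN:
 fixes f :: "nat => 'a set"
 assumes "finite A" "\<And>m n. m \<le> n ==> f m \<subseteq> f n" "A \<subseteq> (\<Union>n. f n)"
 shows "\<exists>n. A \<subseteq> f n"
 using assms(1,3)
proof (induction A rule: finite_induct)
 case (insert x A)
 then obtain n m where "A \<subseteq> f n" "x \<in> f m" by auto
 hence "insert x A \<subseteq> f (max m n)" using assms(2)[of n "max m n"] assms(2)[of m "max m n"] by auto
 thus ?case by blast
qed simp

text \<open>At a numeral this is a finite stage of closing \<open>j\<close> under \<open>S\<close>,
  at \<open>omega\<close> the union of the stages. With the index read as a set the definition is an
  instance of \<open>recursion\<close>.\<close>

function iter :: "(hset => hset) => hset => hset => hset" where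
 "iter S j x = hun j (hset_of (\<Union>y\<in>elts x. elts (S (iter S j y))))"
 by auto
termination
 by (relation "inv_image {(x, y). x \<in> elts y} (snd \<circ> snd)") (auto intro!: wf_inv_image wf_elts)
declare iter.simps [simp del]

lemma elts_iter: "elts (iter S j x) = elts j \<union> (\<Union>y\<in>elts x. elts (S (iter S j y)))"
proof -
 have "countable (\<Union>y\<in>elts x. elts (S (iter S j y)))" by simp
 thus ?thesis by (subst iter.simps) simp
qed

lemma long_infinite:
 assumes "A \<subseteq> T" "\<And>m. \<exists>t\<in>A. vnat m \<in> elts (hdom t)"
 shows "infinite A"
proof
 assume "finite A"
 hence "finite ((\<lambda>t. card (elts t)) ` A)" by simp
 then obtain n where n: "\<forall>m\<in>(\<lambda>t. card (elts t)) ` A. m < n" using finite_nat_set_iff_bounded by auto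
 obtain t where t: "t \<in> A" "vnat n \<in> elts (hdom t)" using assms(2) by blast
 obtain u where u: "t = str u" using t(1) assms(1) unfolding T_str by blast
 show False using n t unfolding u by (force simp: hdom_str)
qed

context ctmodel
begin

lemma dft_iter:
 assumes S: "dft M (\<lambda>e. S (e 0))"
 shows "dft M (\<lambda>e. iter S (e 0) (e 1))"
proof (rule recursion[where \<Phi> = "\<lambda>j x f. hun j (hset_of (\<Union>y\<in>elts x. elts (S (ap f y))))"])
 show "dft M (\<lambda>e. hun (e 0) (hset_of (\<Union>y\<in>elts (e 1). elts (S (ap (e 2) y)))))"
  by (intro df dft_app1[OF S])
 fix j x :: hset
 have "(\<Union>y\<in>elts x. elts (S (iter S j y))) = (\<Union>y\<in>elts x. elts (S (ap (hgraph (TC x) (iter S j)) y)))"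
  by (rule SUP_cong) (simp_all add: elts_sub_TC)
 thus "iter S j x = hun j (hset_of (\<Union>y\<in>elts x. elts (S (ap (hgraph (TC x) (iter S j)) y))))"
  by (subst iter.simps) simp
qed

lemma cnt_finite: "x \<in> M ==> finite (elts x) ==> countable_in M x"
proof -
 assume x: "x \<in> M" "finite (elts x)"
 then obtain n where n: "n \<in> elts omega" "bijM x n" using finite_iff by blast
 obtain f where f: "f \<in> M" "\<forall>z\<in>elts x. ap f z \<in> elts n" "\<forall>z\<in>elts x. \<forall>z'\<in>elts x. ap f z = ap f z' --> z = z'"
  using n(2) unfolding bijM_def by (elim bexE conjE)
 have "n \<sqsubseteq> omega" using n(1) by (auto simp: elts_vnat)
 thus ?thesis unfolding cnt_iff[OF x(1)] using f by (intro bexI[OF _ f(1)]) blast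
qed

lemma cnt_image:
 assumes x: "x \<in> M" "countable_in M x" and F: "dft M (\<lambda>e. F (e 0))"
 shows "countable_in M (hset_of (F ` elts x))"
proof (rule cnt_surj[OF x, where R = "\<lambda>a b. b = F a"])
 show "hset_of (F ` elts x) \<in> M" by (rule inM, intro df x dft_app1[OF F])
 show "dfp M (\<lambda>e. e 1 = F (e 0))" by (intro df dft_app1[OF F])
qed auto

lemma cnt_UN_image:
 assumes x: "x \<in> M" "countable_in M x" and F: "dft M (\<lambda>e. F (e 0))"
  and c: "\<And>y. y \<in> elts x ==> countable_in M (F y)"
 shows "countable_in M (hset_of (\<Union>y\<in>elts x. elts (F y)))"
proof -
 have "hset_of (\<Union>y\<in>elts x. elts (F y)) = hUn (hset_of (F ` elts x))"
  by (rule hset_eqI) simp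
 moreover have "hset_of (F ` elts x) \<in> M" by (rule inM, intro df x dft_app1[OF F])
 ultimately show ?thesis using cnt_UN[OF _ cnt_image[OF x F]] c by auto
qed

lemma cnt_hun: "x \<in> M ==> y \<in> M ==> countable_in M x ==> countable_in M y ==> countable_in M (hun x y)"
proof -
 assume *: "x \<in> M" "y \<in> M" "countable_in M x" "countable_in M y"
 have "hun x y = hUn (hset_of {x, y})" by (rule hset_eqI) simp
 moreover have "hset_of {x, y} \<in> M" by (rule inM, intro df *)
 moreover have "countable_in M (hset_of {x, y})" by (rule cnt_finite) (use calculation in simp_all)
 ultimately show ?thesis using cnt_UN[of "hset_of {x, y}"] * by auto
qed

lemma cnt_2: "countable_in M (vnat n)"
 by (rule cnt_finite) simp_all

lemma cnt_FN: "K \<in> M ==> countable_in M K ==> countable_in M (FN K)"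
proof (rule cnt_subset)
 assume K: "K \<in> M" "countable_in M K"
 show "countable_in M (hFin (hprod K (vnat 2)))" using K by (intro cnt_Fin cnt_prod cnt_2) simp_all
 show "hFin (hprod K (vnat 2)) \<in> M" by (rule inM, intro df K vnat_inM)
 show "FN K \<in> M" using K by simp
 show "FN K \<sqsubseteq> (hFin (hprod K (vnat 2)))"
  unfolding FN_eq[OF K(1)] by (subst elts_sep) blast
qed

text \<open>A Loewenheim-Skolem argument: countably many coordinates suffice for \<open>p\<close>
  and for all answers of \<open>g\<close> to conditions over these coordinates.\<close>

lemma closing_off:
 assumes K: "K \<in> M" and p: "p \<in> Fn K" and g: "g \<in> M" and Y: "Y \<in> M" "countable_in M Y"
  and gF: "\<And>q y. q \<in> Fn K ==> p \<sqsubseteq> q ==> y \<in> elts Y ==> ap g (opair q y) \<in> Fn K"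
 obtains J where "J \<in> M" "countable_in M J" "J \<sqsubseteq> K" "p \<in> Fn J"
  "\<And>q y. q \<in> Fn J ==> p \<sqsubseteq> q ==> y \<in> elts Y ==> ap g (opair q y) \<in> Fn J"
proof -
 have pM: "p \<in> M" using trM[OF FN_inM[OF K]] p elts_FN[OF K] by blast
 \<comment> \<open>\<open>Z j\<close> lists the questions that can be posed over \<open>j\<close>,
   and \<open>S j\<close> adds the supports of the answers.\<close>
 define Z where "Z j = hset_of {z \<in> elts (hprod (FN j) Y). p \<sqsubseteq> hfst z}" for j
 define S where "S j = hun j (hset_of (\<Union>z\<in>elts (Z j). elts (hdom (ap g z))))" for j
 have dZ: "dft M (\<lambda>e. Z (e 0))" unfolding Z_def by (intro df Y pM)
 have dS: "dft M (\<lambda>e. S (e 0))" unfolding S_def by (intro df dft_app1[OF dZ] g)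
 have eZ: "elts (Z j) = {z \<in> elts (hprod (FN j) Y). p \<sqsubseteq> hfst z}" for j
  unfolding Z_def by (rule elts_sep)
 have eS: "elts (S j) = elts j \<union> (\<Union>z\<in>elts (Z j). elts (hdom (ap g z)))" for j
 proof -
  have "countable (\<Union>z\<in>elts (Z j). elts (hdom (ap g z)))" by (intro countable_UN countable_elts)
  thus ?thesis unfolding S_def elts_hun by simp
 qed
 define I where "I x = iter S (hdom p) x" for x
 have eI: "elts (I x) = elts (hdom p) \<union> (\<Union>y\<in>elts x. elts (S (I y)))" for x
  unfolding I_def by (rule elts_iter)
 have dI: "dft M (\<lambda>e. I (e 0))"
  unfolding I_def by (rule dft_app2[OF dft_iter[OF dS]]) (intro df pM)+
 have IM: "I x \<in> M" if "x \<in> M" for x by (rule inM, intro dft_app1[OF dI] dft_const that)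
 define J where "J = I omega"
 have domK: "hdom q \<sqsubseteq> K" if "q \<in> Fn K" for q
  using that by (auto elim!: FnD)
 have findom: "finite (elts (hdom q))" if "q \<in> Fn K" for q
 proof -
  have "elts (hdom q) \<subseteq> hfst ` elts q" by (force simp: image_iff)
  thus ?thesis by (rule finite_subset) (use that in \<open>simp add: Fn_def\<close>)
 qed
 have Fnmono: "q \<in> Fn j'" if "q \<in> Fn j" "j \<sqsubseteq> j'" for q j j'
  using that unfolding Fn_def by blast
 have FnJ: "q \<in> Fn j" if "q \<in> Fn K" "hdom q \<sqsubseteq> j" for q j
 proof (rule FnI)
  show "finite (elts q)" using that by (simp add: Fn_def)
  show "\<exists>a\<in>elts j. \<exists>b. z = opair a (vb b)" if z: "z \<in> elts q" for z
  proof -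
   obtain a b where "a \<in> elts K" "z = opair a (vb b)" by (rule FnD[OF \<open>q \<in> Fn K\<close> z])
   thus ?thesis using \<open>elts (hdom q) \<subseteq> elts j\<close> z by auto
  qed
  show "b = c" if "opair a (vb b) \<in> elts q" "opair a (vb c) \<in> elts q" for a b c
   using Fn_fun[OF \<open>q \<in> Fn K\<close> that] by simp
 qed
 have SK: "S j \<sqsubseteq> K \<and> countable_in M (S j)" if j: "j \<in> M" "j \<sqsubseteq> K" "countable_in M j" for j
 proof
  have gz: "ap g z \<in> Fn K" if zj: "z \<in> elts (Z j)" for z
  proof -
   obtain q y where "z = opair q y" "q \<in> Fn j" "y \<in> elts Y" "p \<sqsubseteq> q"
    using zj unfolding eZ by (auto simp: elts_FN[OF j(1)])
   thus ?thesis using gF Fnmono[OF _ j(2)] by simp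
  qed
  show "S j \<sqsubseteq> K" unfolding eS using j(2) domK[OF gz] by blast
  have ZM: "Z j \<in> M" by (rule inM, intro dft_app1[OF dZ] dft_const j)
  have "countable_in M (hprod (FN j) Y)" using j Y by (intro cnt_prod cnt_FN) simp_all
  hence "countable_in M (Z j)" by (rule cnt_subset) (use j Y ZM in \<open>auto simp: eZ\<close>)
  hence "countable_in M (hset_of (\<Union>z\<in>elts (Z j). elts (hdom (ap g z))))"
  proof (rule cnt_UN_image[OF ZM])
   show "dft M (\<lambda>e. hdom (ap g (e 0)))" by (intro df g)
   fix z assume z: "z \<in> elts (Z j)"
   show "countable_in M (hdom (ap g z))"
    by (rule cnt_finite[OF _ findom[OF gz[OF z]]]) (use trM[OF ZM z] g in simp)
  qed
  moreover have "hset_of (\<Union>z\<in>elts (Z j). elts (hdom (ap g z))) \<in> M" by (rule inM, intro df ZM g)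
  ultimately show "countable_in M (S j)" unfolding S_def using j by (intro cnt_hun)
 qed
 have cp: "countable_in M (hdom p)" using findom[OF p] pM by (intro cnt_finite) simp_all
 have IK: "I x \<sqsubseteq> K \<and> countable_in M (I x)"
  if x: "x \<in> M" "countable_in M x" and S: "\<And>y. y \<in> elts x ==> I y \<sqsubseteq> K \<and> countable_in M (I y)" for x
 proof
  have SI: "(S (I y)) \<sqsubseteq> K \<and> countable_in M (S (I y))" if "y \<in> elts x" for y
   using SK[OF IM[OF trM[OF x(1) that]]] S[OF that] by blast
  show "I x \<sqsubseteq> K" unfolding eI using SI domK[OF p] by blast
  have d: "dft M (\<lambda>e. S (I (e 0)))" by (rule dft_app1[OF dS]) (rule dI)
  have "countable_in M (hset_of (\<Union>y\<in>elts x. elts (S (I y))))"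
   by (rule cnt_UN_image[OF x d]) (use SI in blast)
  moreover have "hset_of (\<Union>y\<in>elts x. elts (S (I y))) \<in> M"
   by (rule inM, intro df x dft_app1[OF d])
  moreover have "I x = hun (hdom p) (hset_of (\<Union>y\<in>elts x. elts (S (I y))))"
   unfolding I_def by (rule iter.simps)
  ultimately show "countable_in M (I x)" using cp pM by (simp add: cnt_hun)
 qed
 have In: "(I (vnat n)) \<sqsubseteq> K \<and> countable_in M (I (vnat n))" for n
 proof (induction n rule: less_induct)
  case (less n)
  show ?case by (rule IK) (use less in \<open>auto simp: cnt_2 elts_vnat\<close>)
 qed
 have JK: "J \<sqsubseteq> K \<and> countable_in M J"
  unfolding J_def by (rule IK) (use In cnt_omega in auto)
 have mono: "(I (vnat m)) \<sqsubseteq> (I (vnat n))" if "m \<le> n" for m n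
  unfolding eI[of "vnat m"] eI[of "vnat n"] elts_vnat using that by (intro Un_mono subset_refl UN_mono image_mono) auto
 have SJ: "(S (I (vnat n))) \<sqsubseteq> (I (vnat (Suc n)))" for n
  unfolding eI[of "vnat (Suc n)"] elts_vnat[of "Suc n"] by blast
 have SJ': "(S (I (vnat n))) \<sqsubseteq> J" for n
  unfolding J_def eI[of omega] elts_omega by blast
 have Jun: "elts J \<subseteq> (\<Union>n. elts (I (vnat n)))"
 proof -
  have "hdom p \<sqsubseteq> (I (vnat 0))" unfolding eI[of "vnat 0"] by blast
  thus ?thesis unfolding J_def eI[of omega] elts_omega using SJ by blast
 qed
 have pJ: "p \<in> Fn J" by (rule FnJ[OF p]) (simp only: J_def eI[of omega], blast)
 show thesis
 proof (rule that[OF _ _ _ pJ])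
  show "J \<in> M" unfolding J_def by (rule IM) simp
  fix q y assume q: "q \<in> Fn J" "p \<sqsubseteq> q" "y \<in> elts Y"
  have qK: "q \<in> Fn K" by (rule Fnmono[OF q(1)]) (use JK in simp)
  have "hdom q \<sqsubseteq> J" using q(1) by (auto elim!: FnD)
  hence "elts (hdom q) \<subseteq> (\<Union>n. elts (I (vnat n)))" using Jun by blast
  \<comment> \<open>A condition over the union of the stages has finite support, so it already lives
    at some stage and its answer at the next one.\<close>
  from finite_mono_UN[OF findom[OF qK] mono this] obtain n where n: "hdom q \<sqsubseteq> (I (vnat n))" by blast
  have "q \<in> Fn (I (vnat n))" by (rule FnJ[OF qK n])
  hence "opair q y \<in> elts (Z (I (vnat n)))"
   unfolding eZ using q elts_FN[OF IM[OF vnat_inM]] by (simp add: opair_in_hprod del: elts_hprod)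
  hence "(hdom (ap g (opair q y))) \<sqsubseteq> (S (I (vnat n)))" unfolding eS by blast
  hence "(hdom (ap g (opair q y))) \<sqsubseteq> J" using SJ' by blast
  thus "ap g (opair q y) \<in> Fn J" by (rule FnJ[OF gF[OF qK q(2,3)]])
 qed (use JK in simp_all)
qed

text \<open>A good set is a Cohen name for a subset of the tree that is dense above some node.\<close>
definition good :: "hset => bool" where
 "good R <-> (\<exists>s0\<in>elts TT. \<forall>q\<in>elts (FN omega). \<forall>s\<in>elts TT. s0 \<sqsubseteq> s -->
   (\<exists>q'\<in>elts (FN omega). \<exists>t\<in>elts TT. q \<sqsubseteq> q' \<and> s \<sqsubseteq> t \<and> opair q' t \<in> elts R))"

definition hits :: "hset => hset => bool" where
 "hits R X <-> (\<forall>q\<in>elts (FN omega). \<forall>m\<in>elts omega. \<exists>t\<in>elts X. m \<in> elts (hdom t) \<and>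
   (\<exists>q'\<in>elts (FN omega). q \<sqsubseteq> q' \<and> opair q' t \<in> elts R))"

definition combM :: "hset => hset => bool" where
 "combM f X <-> (\<forall>t\<in>elts X. \<exists>n\<in>elts omega. toothM f n t) \<and>
   (\<forall>s\<in>elts X. \<forall>t\<in>elts X. \<forall>n\<in>elts omega. toothM f n s --> toothM f n t --> s = t)"

lemma dfp_toothM [df]: "dft M f ==> dft M g ==> dft M h ==> dfp M (\<lambda>e. toothM (f e) (g e) (h e))"
 by (rule dfp_app3[where R = toothM], unfold toothM_def) (intro df)

lemma dfp_combM [df]: "dft M f ==> dft M g ==> dfp M (\<lambda>e. combM (f e) (g e))"
 by (rule dfp_app2[where R = combM], unfold combM_def) (intro df omega_inM)

lemma dfp_hits [df]: "dft M f ==> dft M g ==> dfp M (\<lambda>e. hits (f e) (g e))"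
 by (rule dfp_app2[where R = hits], unfold hits_def) (intro df omega_inM)

lemma dfp_good [df]: "dft M f ==> dfp M (\<lambda>e. good (f e))"
 by (rule dfp_app1[where R = good], unfold good_def) (intro df omega_inM TT_inM)

lemma combM_iff:
 assumes "f \<in> cantor M" "elts X \<subseteq> T"
 shows "combM f X <-> comb (bits f) (str -` elts X)"
proof -
 have "elts X = str ` (str -` elts X)" using assms(2) unfolding T_str by auto
 then obtain Y where Y: "elts X = str ` Y" by blast
 show ?thesis unfolding combM_def comb_def Y inj_vimage_image_eq[OF inj_str] by (simp add: toothM_iff[OF assms(1)])
qed

text \<open>Every pair of a condition and a number is a task with its own height on the branch. The
  node for a task leaves the branch there and is forced into the named set by an extension of the
  condition.\<close>

lemma good_comb:
 assumes R: "R \<in> M" "good R" and f: "f \<in> cantor M"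
 obtains X f' m where "X \<in> M" "elts X \<subseteq> T" "f' \<in> cantor M" "\<And>n. m \<le> n ==> bits f' n = bits f n"
  "combM f' X" "hits R X"
proof -
 obtain s0 where s0: "s0 \<in> elts TT" and dn: "\<And>q s. q \<in> Fn omega ==> s \<in> T ==> s0 \<sqsubseteq> s ==>
   \<exists>q'\<in>Fn omega. \<exists>t\<in>T. q \<sqsubseteq> q' \<and> s \<sqsubseteq> t \<and> opair q' t \<in> elts R"
  using R(2) unfolding good_def elts_TT elts_FN[OF omega_inM] by blast
 obtain u0 where u0: "s0 = str u0" using s0 by (auto simp: T_str)
 have fM: "f \<in> M" using f by (simp add: cantor_def)
 \<comment> \<open>The name is dense only above \<open>s0\<close>, so the branch has to pass through
   \<open>s0\<close>; beyond that it is \<open>f\<close>.\<close>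
 define f' where "f' = hgraph omega (\<lambda>n. if n \<in> elts (hdom s0) then ap s0 n else ap f n)"
 have "f' \<in> M" unfolding f'_def by (rule inM, intro df omega_inM trM[OF TT_inM s0] fM)
 moreover have "is_fun f' (elts omega) (elts (vnat 2))"
  unfolding f'_def by (rule is_fun_hgraph) (auto simp: u0 hdom_str ap_str ap_cantor[OF f])
 ultimately have f': "f' \<in> cantor M" by (simp add: cantor_def)
 have "vb (bits f' n) = (if n < length u0 then vb (u0 ! n) else vb (bits f n))" for n
  unfolding ap_cantor[OF f', symmetric] by (simp add: f'_def u0 hdom_str ap_str ap_cantor[OF f])
 hence bf': "bits f' n = (if n < length u0 then u0 ! n else bits f n)" for n
  by (metis vb_inject)
 have cD: "countable_in M (hprod (FN omega) omega)" and DM: "hprod (FN omega) omega \<in> M"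
  by (intro cnt_prod cnt_FN cnt_omega) simp_all
 \<comment> \<open>The second component of a task gives each condition infinitely many heights,
   hence nodes beyond every level.\<close>
 obtain d where d: "d \<in> M" "\<And>z. z \<in> elts (hprod (FN omega) omega) ==> ap d z \<in> elts omega"
  "\<And>y z. y \<in> elts (hprod (FN omega) omega) ==> z \<in> elts (hprod (FN omega) omega) ==> ap d y = ap d z ==> y = z"
  by (rule cntE[OF cD DM]) (rule that)
 \<comment> \<open>A node leaving the branch within \<open>s0\<close> does not extend
   \<open>s0\<close>; tasks with such heights are discarded.\<close>
 define Z where "Z = hset_of {z \<in> elts (hprod (FN omega) omega). ap d z \<notin> elts (hdom s0)}"
 have eZ: "elts Z = {z \<in> elts (hprod (FN omega) omega). ap d z \<notin> elts (hdom s0)}"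
  unfolding Z_def by (rule elts_sep)
 have Z: "Z \<in> M" unfolding Z_def by (rule inM, intro df omega_inM d(1) trM[OF TT_inM s0])
 define S where "S z t <-> t \<in> elts TT \<and> toothM f' (ap d z) t \<and>
   (\<exists>q'\<in>elts (FN omega). hfst z \<sqsubseteq> q' \<and> opair q' t \<in> elts R)" for z t
 obtain H where H: "hgraph Z H \<in> M" "\<And>z. z \<in> elts Z ==> S z (H z)"
 proof (rule uniformize[where R = S, OF _ Z])
  show "dfp M (\<lambda>e. S (e 0) (e 1))"
   unfolding S_def using f' by (intro df omega_inM TT_inM d(1) R(1)) (simp add: cantor_def)
  fix z assume z: "z \<in> elts Z"
  hence zz: "z \<in> elts (hprod (FN omega) omega)" by (simp add: eZ del: elts_hprod)
  then obtain q k where qk: "z = opair q k" "q \<in> Fn omega" by (auto simp: elts_FN)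
  obtain n where n: "ap d z = vnat n" using d(2)[OF zz] by auto
  have nl: "length u0 \<le> n" using z n by (simp add: eZ u0 hdom_str not_less del: elts_hprod)
  \<comment> \<open>All extensions of \<open>v\<close> leave \<open>f'\<close> exactly at
    \<open>n\<close>, so density above \<open>v\<close> supplies the tooth.\<close>
  define v where "v = upto_bits (bits f') n @ [\<not> bits f' n]"
  have "prefix u0 v" unfolding prefix_nth v_def using nl by (auto simp: nth_append bf')
  hence "s0 \<sqsubseteq> str v" by (simp add: u0)
  from dn[OF qk(2) str_in_T this] obtain q' t where t: "q' \<in> Fn omega" "t \<in> T" "q \<sqsubseteq> q'" "str v \<sqsubseteq> t" "opair q' t \<in> elts R" by blast
  obtain u where u: "t = str u" using t(2) unfolding T_str by blast
  have pv: "prefix v u" using t(4) by (simp add: u)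
  have "tth (bits f') n u"
  proof -
   have l: "length v = Suc n" by (simp add: v_def)
   have "u ! i = v ! i" if "i < Suc n" for i using pv that l by (auto simp: prefix_nth)
   moreover have "n < length u" using pv l by (auto simp: prefix_nth)
   ultimately show ?thesis unfolding tth_def by (auto simp: v_def nth_append)
  qed
  hence "S z t" unfolding S_def using t n qk by (auto simp: u toothM_iff[OF f'] elts_FN)
  thus "\<exists>t\<in>M. S z t" using trM[OF TT_inM] t(2) by (intro bexI[of _ t]) simp_all
 qed (rule that)
 define X where "X = hset_of ((\<lambda>z. ap (hgraph Z H) z) ` elts Z)"
 have "elts X = (\<lambda>z. ap (hgraph Z H) z) ` elts Z" unfolding X_def by simp
 hence eX: "elts X = H ` elts Z" by (simp cong: image_cong)
 have XM: "X \<in> M" unfolding X_def by (rule inM, intro df Z H(1))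
 have XT: "elts X \<subseteq> T" unfolding eX using H(2) by (auto simp: S_def)
 have zn: "\<exists>n. ap d z = vnat n" if "z \<in> elts Z" for z using d(2) that by (auto simp: eZ simp del: elts_hprod)
 have cmb: "combM f' X" unfolding combM_def
 proof (intro conjI ballI impI)
  fix t assume "t \<in> elts X"
  then obtain z where "z \<in> elts Z" "t = H z" unfolding eX by blast
  thus "\<exists>n\<in>elts omega. toothM f' n t" using H(2) zn[of z] by (intro bexI[of _ "ap d z"]) (auto simp: S_def)
 next
  fix s t n assume st: "s \<in> elts X" "t \<in> elts X" "n \<in> elts omega" "toothM f' n s" "toothM f' n t"
  obtain k where k: "n = vnat k" using st(3) by auto
  have key: "ap d z = n" if z: "z \<in> elts Z" "toothM f' n (H z)" for z
  proof -
   obtain u where u: "H z = str u" using H(2)[OF z(1)] unfolding S_def by (auto simp: T_str)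
   obtain j where j: "ap d z = vnat j" using zn[OF z(1)] by blast
   have "tth (bits f') j u" "tth (bits f') k u"
    using H(2)[OF z(1)] z(2) unfolding S_def u j k toothM_iff[OF f'] by simp_all
   thus ?thesis using tth_unique j k by blast
  qed
  obtain z z' where z: "z \<in> elts Z" "s = H z" "z' \<in> elts Z" "t = H z'" using st(1,2) unfolding eX by blast
  have "ap d z = ap d z'" using key[OF z(1)] key[OF z(3)] st(4,5) z by simp
  hence "z = z'" using d(3) z(1,3) by (simp add: eZ del: elts_hprod)
  thus "s = t" using z by simp
 qed
 have hit: "hits R X" unfolding hits_def
 proof (intro ballI)
  fix q m assume q: "q \<in> elts (FN omega)" and "m \<in> elts omega"
  then obtain k where k: "m = vnat k" by auto
  have mem: "opair q (vnat i) \<in> elts (hprod (FN omega) omega)" for i using q by (simp add: opair_in_hprod del: elts_hprod)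
  have "\<forall>i. \<exists>n. ap d (opair q (vnat i)) = vnat n" using d(2)[OF mem] by auto
  then obtain \<delta> where \<delta>: "\<And>i. ap d (opair q (vnat i)) = vnat (\<delta> i)" by metis
  have "inj \<delta>"
  proof (rule injI)
   fix i j assume "\<delta> i = \<delta> j"
   hence "opair q (vnat i) = opair q (vnat j)" by (intro d(3)[OF mem mem]) (simp add: \<delta>)
   thus "i = j" by simp
  qed
  then obtain i where i: "max k (length u0) \<le> \<delta> i" using inj_unbounded by blast
  define z where "z = opair q (vnat i)"
  have z: "z \<in> elts Z" unfolding eZ z_def using mem i by (simp add: \<delta> u0 hdom_str del: elts_hprod)
  have Sz: "S z (H z)" by (rule H(2)[OF z])
  obtain u where u: "H z = str u" using Sz unfolding S_def by (auto simp: T_str)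
  have "\<delta> i < length u" using Sz unfolding S_def u by (simp add: z_def \<delta> toothM_def hdom_str)
  hence "m \<in> elts (hdom (H z))" using i by (simp add: u hdom_str k)
  moreover have "H z \<in> elts X" using z unfolding eX by blast
  ultimately show "\<exists>t\<in>elts X. m \<in> elts (hdom t) \<and> (\<exists>q'\<in>elts (FN omega). q \<sqsubseteq> q' \<and> opair q' t \<in> elts R)"
   using Sz unfolding S_def z_def by (intro bexI[of _ "H z"]) (simp_all add: z_def)
 qed
 show thesis by (rule that[OF XM XT f' _ cmb hit, of "length u0"]) (simp add: bf')
qed

lemma hits_long: "hits R X ==> elts X \<subseteq> T ==> infinite (elts X)"
proof (rule long_infinite)
 fix m assume h: "hits R X"
 have "hemp \<in> elts (FN omega)" by (simp add: elts_FN hemp_Fn)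
 thus "\<exists>t\<in>elts X. vnat m \<in> elts (hdom t)" using h unfolding hits_def by (metis elts_omega rangeI)
qed

lemma comb_family:
 obtains F where "F \<in> M" "ad_family F" "\<And>X. X \<in> elts F ==> elts X \<subseteq> T \<and> X \<in> M \<and> infinite (elts X) \<and> antich (elts X)"
  "\<And>R. R \<in> M ==> R \<sqsubseteq> (hprod (FN omega) TT) ==> good R ==> \<exists>X\<in>elts F. hits R X"
proof -
 define D where "D = hprod (FN omega) TT"
 have D: "D \<in> M" by (simp add: D_def)
 have cD: "countable_in M (hprod D omega)" and DM: "hprod D omega \<in> M"
  unfolding D_def by (intro cnt_prod cnt_FN cnt_omega cnt_TT) simp_all
 obtain c where c: "c \<in> M" "\<And>z. z \<in> elts (hprod D omega) ==> ap c z \<in> elts omega"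
  "\<And>y z. y \<in> elts (hprod D omega) ==> z \<in> elts (hprod D omega) ==> ap c y = ap c z ==> y = z"
  by (rule cntE[OF cD DM]) (rule that)
 \<comment> \<open>Each element \<open>z\<close> of \<open>R\<close> is coded at the infinitely many
   places \<open>ap c (opair z k)\<close>.\<close>
 define B where "B R n <-> (\<exists>z\<in>elts R. \<exists>k\<in>elts omega. ap c (opair z k) = n)" for R n
 define fR where "fR R = hgraph omega (\<lambda>n. if B R n then vnat 1 else vnat 0)" for R
 have dfR: "dft M (\<lambda>e. fR (e 0))" unfolding fR_def B_def by (intro df c(1) omega_inM vnat_inM)
 have fRM: "fR R \<in> M" if "R \<in> M" for R by (rule inM, intro dft_app1[OF dfR] dft_const that)
 have fRc: "fR R \<in> cantor M" if "R \<in> M" for R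
 proof -
  have "is_fun (fR R) (elts omega) (elts (vnat 2))" unfolding fR_def by (rule is_fun_hgraph) (simp del: vnat.simps)
  thus ?thesis using fRM[OF that] by (simp add: cantor_def)
 qed
 have bfR: "bits (fR R) n <-> B R (vnat n)" if "R \<in> M" for R n
 proof -
  have "vb (bits (fR R) n) = vb (B R (vnat n))"
   unfolding ap_cantor[OF fRc[OF that], symmetric] by (simp add: fR_def vb_def)
  thus ?thesis by simp
 qed
 \<comment> \<open>The branch of the comb has to agree with \<open>fR R\<close> only from some
   height on, as \<open>good_comb\<close> changes it.\<close>
 define Rel where "Rel R X <-> X \<sqsubseteq> TT \<and> hits R X \<and> (\<exists>f\<in>M. is_fun f (elts omega) (elts (vnat 2)) \<and>
   (\<exists>m\<in>elts omega. \<forall>n\<in>elts omega. n \<in> elts m \<or> ap f n = ap (fR R) n) \<and> combM f X)" for R X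
 have dRel: "dfp M (\<lambda>e. Rel (e 0) (e 1))"
  unfolding Rel_def by (intro df dft_app1[OF dfR] omega_inM vnat_inM TT_inM)
 define RR where "RR = hset_of {R \<in> elts (hPow D). good R}"
 have eRR: "elts RR = {R \<in> elts (hPow D). good R}" unfolding RR_def by (rule elts_sep)
 have RR: "RR \<in> M" unfolding RR_def by (rule inM, intro df D)
 obtain H where H: "hgraph RR H \<in> M" "\<And>R. R \<in> elts RR ==> H R \<in> M" "\<And>R. R \<in> elts RR ==> Rel R (H R)"
 proof (rule uniformize[OF dRel RR])
  fix R assume R: "R \<in> elts RR"
  hence RM: "R \<in> M" "good R" by (simp_all add: eRR)
  obtain X f' m where X: "X \<in> M" "elts X \<subseteq> T" "f' \<in> cantor M" "\<And>n. m \<le> n ==> bits f' n = bits (fR R) n"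
   "combM f' X" "hits R X" by (rule good_comb[OF RM fRc[OF RM(1)]]) (rule that)
  have "\<forall>n\<in>elts omega. n \<in> elts (vnat m) \<or> ap f' n = ap (fR R) n"
   using X(4) by (auto simp: ap_cantor[OF X(3)] ap_cantor[OF fRc[OF RM(1)]] not_less)
  hence "Rel R X" unfolding Rel_def using X by (auto simp: cantor_def intro!: bexI[of _ f'])
  thus "\<exists>X\<in>M. Rel R X" using X(1) by blast
 qed (rule that)
 define F where "F = hset_of ((\<lambda>R. ap (hgraph RR H) R) ` elts RR)"
 have "elts F = (\<lambda>R. ap (hgraph RR H) R) ` elts RR" unfolding F_def by simp
 hence eF: "elts F = H ` elts RR" by (simp cong: image_cong)
 have FM: "F \<in> M" unfolding F_def by (rule inM, intro df RR H(1))
 have prp: "elts (H R) \<subseteq> T \<and> hits R (H R) \<and> (\<exists>f m. f \<in> cantor M \<and> (\<forall>n\<ge>m. bits f n = bits (fR R) n) \<and> comb (bits f) (str -` elts (H R)))"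
  if R: "R \<in> elts RR" for R
 proof -
  have RM: "R \<in> M" using R by (simp add: eRR)
  from H(3)[OF R, unfolded Rel_def elts_TT]
  obtain f m where f: "f \<in> M" "is_fun f (elts omega) (elts (vnat 2))" "m \<in> elts omega"
   "\<forall>n\<in>elts omega. n \<in> elts m \<or> ap f n = ap (fR R) n" "combM f (H R)" and h: "elts (H R) \<subseteq> T" "hits R (H R)"
   by (elim conjE bexE)
  have fc: "f \<in> cantor M" using f by (simp add: cantor_def)
  obtain k where k: "m = vnat k" using f(3) by auto
  have "bits f n = bits (fR R) n" if "k \<le> n" for n
  proof -
   have "ap f (vnat n) = ap (fR R) (vnat n)" using bspec[OF f(4), of "vnat n"] that k by simp
   thus ?thesis by (simp add: ap_cantor[OF fc] ap_cantor[OF fRc[OF RM]])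
  qed
  moreover have "comb (bits f) (str -` elts (H R))" using f(5) combM_iff[OF fc h(1)] by simp
  ultimately show ?thesis using h fc by blast
 qed
 have ad: "finite (elts (H R) \<inter> elts (H R'))" if R: "R \<in> elts RR" "R' \<in> elts RR" "\<not> R \<sqsubseteq> R'" for R R'
 proof -
  have RM: "R \<in> M" "R' \<in> M" using R by (simp_all add: eRR)
  have RD: "R \<sqsubseteq> D" "R' \<sqsubseteq> D" using R by (simp_all add: eRR)
  obtain z where z: "z \<in> elts R" "z \<notin> elts R'" using R(3) by blast
  obtain f m where f: "\<forall>n\<ge>m. bits f n = bits (fR R) n" "comb (bits f) (str -` elts (H R))" and hT: "elts (H R) \<subseteq> T" using prp[OF R(1)] by blast
  obtain f' m' where f': "\<forall>n\<ge>m'. bits f' n = bits (fR R') n" "comb (bits f') (str -` elts (H R'))" using prp[OF R(2)] by blast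
  have mem: "opair y (vnat i) \<in> elts (hprod D omega)" if "y \<in> elts D" for i y using that by (simp add: opair_in_hprod del: elts_hprod)
  note zm = mem[OF subsetD[OF RD(1) z(1)]]
  have "\<forall>i. \<exists>n. ap c (opair z (vnat i)) = vnat n" using c(2)[OF zm] by auto
  then obtain \<delta> where \<delta>: "\<And>i. ap c (opair z (vnat i)) = vnat (\<delta> i)" by metis
  have "inj \<delta>"
  proof (rule injI)
   fix i j assume "\<delta> i = \<delta> j"
   hence "opair z (vnat i) = opair z (vnat j)" by (intro c(3)[OF zm zm]) (simp add: \<delta>)
   thus "i = j" by simp
  qed
  \<comment> \<open>A place coding \<open>z\<close> beyond both finite changes: there the two
    branches really used differ.\<close>
  then obtain i where i: "max m m' \<le> \<delta> i" using inj_unbounded by blast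
  have "B R (vnat (\<delta> i))" unfolding B_def using z(1) \<delta>[of i] by auto
  moreover have "\<not> B R' (vnat (\<delta> i))"
  proof
   assume "B R' (vnat (\<delta> i))"
   then obtain y j where y: "y \<in> elts R'" "ap c (opair y (vnat j)) = vnat (\<delta> i)" unfolding B_def by auto
   have "opair y (vnat j) = opair z (vnat i)" by (rule c(3)[OF mem[OF subsetD[OF RD(2) y(1)]] zm]) (simp add: y \<delta>)
   thus False using y(1) z(2) by simp
  qed
  ultimately have "bits f (\<delta> i) \<noteq> bits f' (\<delta> i)" using f(1) f'(1) i bfR[OF RM(1)] bfR[OF RM(2)] by simp
  from comb_finite_Int[OF f(2) f'(2) this] have "finite (str ` (str -` elts (H R) \<inter> str -` elts (H R')))" by simp
  moreover have "elts (H R) \<inter> elts (H R') \<subseteq> str ` (str -` elts (H R) \<inter> str -` elts (H R'))" using hT unfolding T_str by auto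
  ultimately show ?thesis using finite_subset by blast
 qed
 show thesis
 proof (rule that[OF FM])
  show "ad_family F" unfolding ad_family_def eF
  proof (intro conjI ballI impI)
   fix X assume "X \<in> H ` elts RR"
   then obtain R where R: "R \<in> elts RR" "X = H R" by blast
   show "elts X \<subseteq> T" using prp[OF R(1)] R(2) by simp
   show "infinite (elts X)" using prp[OF R(1)] R(2) hits_long[of R X] by simp
  next
   fix X Y assume "X \<in> H ` elts RR" "Y \<in> H ` elts RR" "X \<noteq> Y"
   then obtain R R' where R: "R \<in> elts RR" "R' \<in> elts RR" "X = H R" "Y = H R'" "R \<noteq> R'" by blast
   hence "\<not> R \<sqsubseteq> R' \<or> \<not> R' \<sqsubseteq> R" using hset_eqI[of R R'] by blast
   thus "finite (elts X \<inter> elts Y)" using ad[OF R(1,2)] ad[OF R(2,1)] R by (auto simp: Int_commute)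
  qed
  fix X assume "X \<in> elts F"
  then obtain R where R: "R \<in> elts RR" "X = H R" unfolding eF by blast
  obtain f where f: "comb (bits f) (str -` elts X)" using prp[OF R(1)] R(2) by blast
  have XT: "elts X \<subseteq> T" using prp[OF R(1)] R(2) by simp
  have "antich (elts X)" unfolding antich_def
  proof (intro ballI impI)
   fix s t assume st: "s \<in> elts X" "t \<in> elts X" "s \<sqsubseteq> t"
   obtain u v where uv: "s = str u" "t = str v" using st XT unfolding T_str by blast
   have "u = v" by (rule comb_prefix[OF f]) (use st uv in simp_all)
   thus "s = t" using uv by simp
  qed
  thus "elts X \<subseteq> T \<and> X \<in> M \<and> infinite (elts X) \<and> antich (elts X)"
   using XT H(2)[OF R(1)] R(2) hits_long[of R X] prp[OF R(1)] by simp
 next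
  fix R assume "R \<in> M" "R \<sqsubseteq> (hprod (FN omega) TT)" "good R"
  hence "R \<in> elts RR" by (simp add: eRR D_def del: elts_hprod)
  thus "\<exists>X\<in>elts F. hits R X" unfolding eF using prp by blast
 qed
qed

end

section \<open>Meeting dense sets in Cohen extensions\<close>

context ctmodel
begin

text \<open>A name over \<open>Fn K\<close> has to be turned into one over \<open>Fn omega\<close>.
  Density of \<open>A\<close> is witnessed over a countable set \<open>J\<close> of coordinates, and
  an enumeration of \<open>J\<close> moves that part of the name to \<open>omega\<close>. What the
  comb of the resulting name achieves is pulled back to \<open>J\<close>, where it is compatible
  with all conditions that agree on \<open>J\<close>.\<close>

lemma comb_hits_ext:
 assumes K: "K \<in> M" and G: "generic M (Fn K) Fn_le G"
  and Fh: "\<And>R. R \<in> M ==> R \<sqsubseteq> (hprod (FN omega) TT) ==> good R ==> \<exists>X\<in>elts F. hits R X"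
  and FX: "\<And>X. X \<in> elts F ==> elts X \<subseteq> T \<and> X \<in> M"
  and A: "A \<in> gen_ext M G" and s0: "s0 \<in> T" and dn: "dense_above s0 (elts A)"
 shows "\<exists>X\<in>elts F. infinite (elts A \<inter> elts X)"
proof -
 interpret G: generic_ext M "FN K" "FnL K" G by (rule generic_ext_Fn[OF K G])
 have P: "elts (FN K) = Fn K" by (rule elts_FN[OF K])
 have le: "opair p q \<in> elts (FnL K) <-> p \<in> Fn K \<and> q \<in> Fn K \<and> q \<sqsubseteq> p" for p q
  by (rule FnL_iff[OF K])
 have s0M: "s0 \<in> M" using trM[OF TT_inM] s0 by simp
 obtain \<nu> where \<nu>: "\<nu> \<in> M" and \<nu>1: "\<And>t. t \<in> elts TT ==> t \<in> elts A <-> (\<exists>p\<in>G. opair p t \<in> elts \<nu>)"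
  and \<nu>2: "\<And>p t. opair p t \<in> elts \<nu> ==> p \<in> elts (FN K) \<and> t \<in> elts TT"
  and \<nu>3: "\<And>p q t. opair p t \<in> elts \<nu> ==> q \<in> elts (FN K) ==> opair q p \<in> elts (FnL K) ==> opair q t \<in> elts \<nu>"
  by (rule G.nice_name[OF A TT_inM]) (rule that)
 have \<nu>4: "opair q t \<in> elts \<nu>" if "opair p t \<in> elts \<nu>" "q \<in> Fn K" "p \<sqsubseteq> q" for p q t
  by (rule \<nu>3[OF that(1)]) (use that \<nu>2[OF that(1)] in \<open>simp_all add: P le\<close>)
 define ok where "ok q s <-> (\<exists>q'\<in>elts (FN K). \<exists>t\<in>elts TT. q \<sqsubseteq> q' \<and> s \<sqsubseteq> t \<and> opair q' t \<in> elts \<nu>)" for q s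
 \<comment> \<open>Either all extensions of \<open>p\<close> admit the density step at all nodes
   above \<open>s0\<close>, or \<open>p\<close> blocks it at some node. Such conditions are dense,
   and the second kind contradicts the density of \<open>A\<close>.\<close>
 have "\<exists>p\<in>G. (\<forall>q\<in>elts (FN K). \<forall>s\<in>elts TT. p \<sqsubseteq> q --> s0 \<sqsubseteq> s --> ok q s) \<or>
   (\<exists>s\<in>elts TT. s0 \<sqsubseteq> s \<and> \<not> ok p s)"
 proof (rule G.G_dense)
  show "dfp M (\<lambda>e. (\<forall>q\<in>elts (FN K). \<forall>s\<in>elts TT. e 0 \<sqsubseteq> q --> s0 \<sqsubseteq> s --> ok q s) \<or>
   (\<exists>s\<in>elts TT. s0 \<sqsubseteq> s \<and> \<not> ok (e 0) s))"
   unfolding ok_def by (intro df K TT_inM s0M \<nu>)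
  fix p assume p: "p \<in> elts (FN K)"
  show "\<exists>q\<in>elts (FN K). opair q p \<in> elts (FnL K) \<and> ((\<forall>q'\<in>elts (FN K). \<forall>s\<in>elts TT. q \<sqsubseteq> q' --> s0 \<sqsubseteq> s --> ok q' s) \<or>
   (\<exists>s\<in>elts TT. s0 \<sqsubseteq> s \<and> \<not> ok q s))"
  proof (cases "\<forall>q\<in>elts (FN K). \<forall>s\<in>elts TT. p \<sqsubseteq> q --> s0 \<sqsubseteq> s --> ok q s")
   case True
   thus ?thesis using p by (intro bexI[of _ p]) (simp_all add: le P)
  next
   case False
   then obtain q s where "q \<in> elts (FN K)" "s \<in> elts TT" "p \<sqsubseteq> q" "s0 \<sqsubseteq> s" "\<not> ok q s" by blast
   thus ?thesis using p by (intro bexI[of _ q]) (auto simp: le P)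
  qed
 qed
 then obtain p where p: "p \<in> G" and pd: "(\<forall>q\<in>elts (FN K). \<forall>s\<in>elts TT. p \<sqsubseteq> q --> s0 \<sqsubseteq> s --> ok q s) \<or>
   (\<exists>s\<in>elts TT. s0 \<sqsubseteq> s \<and> \<not> ok p s)" by (rule bexE)
 have pK: "p \<in> Fn K" using G.G_P[OF p] by (simp add: P)
 have "\<not> (\<exists>s\<in>elts TT. s0 \<sqsubseteq> s \<and> \<not> ok p s)"
 proof
  assume "\<exists>s\<in>elts TT. s0 \<sqsubseteq> s \<and> \<not> ok p s"
  then obtain s where s: "s \<in> T" "s0 \<sqsubseteq> s" "\<not> ok p s" by auto
  obtain t where t: "t \<in> elts A" "t \<in> T" "s \<sqsubseteq> t" using dn s unfolding dense_above_def by blast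
  obtain r where r: "r \<in> G" "opair r t \<in> elts \<nu>" using \<nu>1[of t] t by auto
  obtain q where q: "q \<in> G" "opair q p \<in> elts (FnL K)" "opair q r \<in> elts (FnL K)" using G.G_dir[OF p r(1)] by blast
  have "opair q t \<in> elts \<nu>" by (rule \<nu>4[OF r(2)]) (use q in \<open>simp_all add: le\<close>)
  thus False using s(3) t q G.G_P[OF q(1)] unfolding ok_def by (auto simp: le)
 qed
 hence pall: "\<forall>q\<in>Fn K. \<forall>s\<in>T. p \<sqsubseteq> q --> s0 \<sqsubseteq> s --> ok q s"
  using pd unfolding P elts_TT by blast
 have pok: "ok q s" if "q \<in> Fn K" "p \<sqsubseteq> q" "s \<in> T" "s0 \<sqsubseteq> s" for q s
  using pall that by blast
 have pM: "p \<in> M" by (rule G.P_M[OF G.G_P[OF p]])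
 define Ys where "Ys = hset_of {s \<in> elts TT. s0 \<sqsubseteq> s}"
 have eY: "elts Ys = {s \<in> elts TT. s0 \<sqsubseteq> s}" unfolding Ys_def by (rule elts_sep)
 have Ys: "Ys \<in> M" unfolding Ys_def by (rule inM, intro df TT_inM s0M)
 have cY: "countable_in M Ys" by (rule cnt_subset[OF cnt_TT TT_inM Ys]) (auto simp: eY)
 define Dm where "Dm = hset_of {z \<in> elts (hprod (FN K) Ys). p \<sqsubseteq> hfst z}"
 have eD: "elts Dm = {z \<in> elts (hprod (FN K) Ys). p \<sqsubseteq> hfst z}" unfolding Dm_def by (rule elts_sep)
 have Dm: "Dm \<in> M" unfolding Dm_def by (rule inM, intro df K Ys pM)
 obtain g where g: "hgraph Dm g \<in> M" "\<And>z. z \<in> elts Dm ==> g z \<in> elts (FN K) \<and> hfst z \<sqsubseteq> g z \<and>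
   (\<exists>t\<in>elts TT. hsnd z \<sqsubseteq> t \<and> opair (g z) t \<in> elts \<nu>)"
 proof (rule uniformize[where R = "\<lambda>z q. q \<in> elts (FN K) \<and> hfst z \<sqsubseteq> q \<and>
   (\<exists>t\<in>elts TT. hsnd z \<sqsubseteq> t \<and> opair q t \<in> elts \<nu>)", OF _ Dm])
  show "dfp M (\<lambda>e. e 1 \<in> elts (FN K) \<and> (hfst (e 0)) \<sqsubseteq> e 1 \<and>
   (\<exists>t\<in>elts TT. (hsnd (e 0)) \<sqsubseteq> t \<and> opair (e 1) t \<in> elts \<nu>))" by (intro df K TT_inM \<nu>)
  fix z assume "z \<in> elts Dm"
  then obtain q s where z: "z = opair q s" "q \<in> Fn K" "s \<in> T" "s0 \<sqsubseteq> s" "p \<sqsubseteq> q" by (auto simp: eD eY P)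
  from pok[OF z(2,5,3,4)] show "\<exists>q\<in>M. q \<in> elts (FN K) \<and> hfst z \<sqsubseteq> q \<and>
   (\<exists>t\<in>elts TT. hsnd z \<sqsubseteq> t \<and> opair q t \<in> elts \<nu>)"
   unfolding ok_def z(1) using trM[OF FN_inM[OF K]] by (elim bexE conjE) (intro bexI conjI, simp_all)
 qed (rule that)
 have gD: "opair q y \<in> elts Dm" if "q \<in> Fn K" "p \<sqsubseteq> q" "y \<in> elts Ys" for q y
  using that by (simp add: eD opair_in_hprod P del: elts_hprod)
 obtain J where J: "J \<in> M" "countable_in M J" "J \<sqsubseteq> K" "p \<in> Fn J"
  and Jc: "\<And>q y. q \<in> Fn J ==> p \<sqsubseteq> q ==> y \<in> elts Ys ==> ap (hgraph Dm g) (opair q y) \<in> Fn J"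
 proof (rule closing_off[OF K pK g(1) Ys cY])
  fix q y assume *: "q \<in> Fn K" "p \<sqsubseteq> q" "y \<in> elts Ys"
  show "ap (hgraph Dm g) (opair q y) \<in> Fn K" using g(2)[OF gD[OF *]] gD[OF *] by (simp add: P)
 qed (rule that)
 have FnJK: "q \<in> Fn K" if "q \<in> Fn J" for q using that J(3) unfolding Fn_def by blast
 have Jok: "\<exists>r\<in>Fn J. q \<sqsubseteq> r \<and> (\<exists>t\<in>T. s \<sqsubseteq> t \<and> opair r t \<in> elts \<nu>)"
  if "q \<in> Fn J" "p \<sqsubseteq> q" "s \<in> T" "s0 \<sqsubseteq> s" for q s
 proof -
  have y: "s \<in> elts Ys" using that by (simp add: eY)
  note d = gD[OF FnJK[OF that(1)] that(2) y]
  show ?thesis using g(2)[OF d] Jc[OF that(1,2) y] d by (intro bexI[of _ "g (opair q s)"]) simp_all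
 qed
 obtain b where b: "b \<in> M" "\<And>u. u \<in> elts J ==> ap b u \<in> elts omega"
  "\<And>u z. u \<in> elts J ==> z \<in> elts J ==> ap b u = ap b z ==> u = z"
  by (rule cntE[OF J(2,1)]) (rule that)
 \<comment> \<open>\<open>fw\<close> replaces a coordinate in \<open>J\<close> by its number.
   \<open>push\<close> moves conditions from \<open>Fn J\<close> to \<open>Fn omega\<close>;
   \<open>bk\<close> moves them back, forgetting numbers of no coordinate.\<close>
 define fw where "fw z = opair (ap b (hfst z)) (hsnd z)" for z
 define bk where "bk q = hset_of {z \<in> elts (hprod J (vnat 2)). fw z \<in> elts q}" for q
 have ebk: "elts (bk q) = {z \<in> elts (hprod J (vnat 2)). fw z \<in> elts q}" for q
  unfolding bk_def by (rule elts_sep)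
 have mbk: "opair a (vb c) \<in> elts (bk q) <-> a \<in> elts J \<and> opair (ap b a) (vb c) \<in> elts q" for a c q
  unfolding ebk by (simp add: opair_in_hprod fw_def del: elts_hprod)
 have bkE: "\<exists>a c. a \<in> elts J \<and> z = opair a (vb c)" if z: "z \<in> elts (bk q)" for z q
  using z unfolding ebk by (auto simp: elts_2)
 have dbk: "dft M (\<lambda>e. bk (e 0))" unfolding bk_def fw_def by (intro df J b(1) vnat_inM)
 have bkF: "bk q \<in> Fn J" if q: "q \<in> Fn omega" for q
 proof (rule FnI)
  have "inj_on fw (elts (bk q))"
  proof (rule inj_onI)
   fix x y assume "x \<in> elts (bk q)" "y \<in> elts (bk q)" and e: "fw x = fw y"
   then obtain a c a' c' where "a \<in> elts J" "x = opair a (vb c)" "a' \<in> elts J" "y = opair a' (vb c')" using bkE by metis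
   thus "x = y" using e b(3)[of a a'] by (simp add: fw_def)
  qed
  moreover have "finite (fw ` elts (bk q))"
   by (rule finite_subset[of _ "elts q"]) (use q in \<open>auto simp: ebk Fn_def\<close>)
  ultimately show "finite (elts (bk q))" using finite_imageD by blast
  show "\<exists>a\<in>elts J. \<exists>c. z = opair a (vb c)" if "z \<in> elts (bk q)" for z using bkE[OF that] by blast
  show "c = c'" if "opair a (vb c) \<in> elts (bk q)" "opair a (vb c') \<in> elts (bk q)" for a c c'
   using that Fn_fun[OF q, of "ap b a" "vb c" "vb c'"] unfolding mbk by simp
 qed
 define push where "push r = hset_of (fw ` elts r)" for r
 have epush: "elts (push r) = fw ` elts r" for r by (simp add: push_def)
 have pushF: "push r \<in> Fn omega" if r: "r \<in> Fn J" for r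
 proof (rule FnI)
  show "finite (elts (push r))" using r by (simp add: epush Fn_def)
  show "\<exists>a\<in>elts omega. \<exists>c. z = opair a (vb c)" if z: "z \<in> elts (push r)" for z
  proof -
   obtain y where y: "y \<in> elts r" "z = fw y" using z unfolding epush by blast
   obtain a c where "a \<in> elts J" "y = opair a (vb c)" by (rule FnD[OF r y(1)])
   thus ?thesis using y b(2)[of a] by (simp add: fw_def)
  qed
  fix n c c' assume "opair n (vb c) \<in> elts (push r)" "opair n (vb c') \<in> elts (push r)"
  then obtain y y' where y: "y \<in> elts r" "opair n (vb c) = fw y" "y' \<in> elts r" "opair n (vb c') = fw y'" unfolding epush by blast
  obtain a d where a: "a \<in> elts J" "y = opair a (vb d)" by (rule FnD[OF r y(1)])
  obtain a' d' where a': "a' \<in> elts J" "y' = opair a' (vb d')" by (rule FnD[OF r y(3)])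
  have "a = a'" using y a a' b(3)[of a a'] by (simp add: fw_def)
  thus "c = c'" using y a a' Fn_fun[OF r, of a "vb d" "vb d'"] by (simp add: fw_def)
 qed
 have mpush: "opair (ap b a) (vb c) \<in> elts (push r) <-> opair a (vb c) \<in> elts r" if h: "r \<in> Fn J" "a \<in> elts J" for r a c
 proof
  assume "opair (ap b a) (vb c) \<in> elts (push r)"
  then obtain y where y: "y \<in> elts r" "opair (ap b a) (vb c) = fw y" unfolding epush by blast
  obtain a' d where a': "a' \<in> elts J" "y = opair a' (vb d)" by (rule FnD[OF h(1) y(1)])
  hence "a = a'" using y h(2) b(3)[of a a'] by (simp add: fw_def)
  thus "opair a (vb c) \<in> elts r" using y a' by (simp add: fw_def)
 next
  assume "opair a (vb c) \<in> elts r"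
  thus "opair (ap b a) (vb c) \<in> elts (push r)" unfolding epush by (intro image_eqI[of _ _ "opair a (vb c)"]) (simp_all add: fw_def)
 qed
 \<comment> \<open>Conditions incompatible with \<open>p\<close> are paired with all nodes, so that
   \<open>good\<close> holds for them as well.\<close>
 define R where "R = hset_of {z \<in> elts (hprod (FN omega) TT). hun (bk (hfst z)) p \<notin> elts (FN K) \<or> opair (hun (bk (hfst z)) p) (hsnd z) \<in> elts \<nu>}"
 have R: "R \<in> M" unfolding R_def by (rule inM, intro df omega_inM TT_inM K pM \<nu> dft_app1[OF dbk])
 have mR: "opair q t \<in> elts R <-> q \<in> Fn omega \<and> t \<in> T \<and> (hun (bk q) p \<notin> Fn K \<or> opair (hun (bk q) p) t \<in> elts \<nu>)" for q t
  unfolding R_def by (subst elts_sep) (simp add: opair_in_hprod P elts_FN del: elts_hprod)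
 have absorb: "hun r p = r" if "p \<sqsubseteq> r" for r by (rule hset_eqI) (use that in auto)
 have "good R" unfolding good_def
 proof (rule bexI[of _ s0], intro ballI impI)
  fix q s assume q: "q \<in> elts (FN omega)" and s: "s \<in> elts TT" "s0 \<sqsubseteq> s"
  have qF: "q \<in> Fn omega" using q by (simp add: elts_FN)
  show "\<exists>q'\<in>elts (FN omega). \<exists>t\<in>elts TT. q \<sqsubseteq> q' \<and> s \<sqsubseteq> t \<and> opair q' t \<in> elts R"
  proof (cases "hun (bk q) p \<in> Fn K")
   case False
   thus ?thesis using q s qF by (intro bexI[of _ q] bexI[of _ s]) (simp_all add: mR)
  next
   case True
   have "hun (bk q) p \<in> Fn J"
   proof (rule Fn_hun[OF bkF[OF qF] J(4)])
    fix a c d assume "opair a (vb c) \<in> elts (bk q)" "opair a (vb d) \<in> elts p"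
    thus "c = d" using Fn_fun[OF True, of a "vb c" "vb d"] by simp
   qed
   from Jok[OF this _ _ s(2)] s(1) obtain r t where r: "r \<in> Fn J" "(hun (bk q) p) \<sqsubseteq> r" "t \<in> T" "s \<sqsubseteq> t" "opair r t \<in> elts \<nu>" by auto
   define q' where "q' = hun q (push r)"
   have q'F: "q' \<in> Fn omega" unfolding q'_def
   proof (rule Fn_hun[OF qF pushF[OF r(1)]])
    fix n c c' assume n: "opair n (vb c) \<in> elts q" "opair n (vb c') \<in> elts (push r)"
    then obtain y where y: "y \<in> elts r" "opair n (vb c') = fw y" unfolding epush by blast
    obtain a d where a: "a \<in> elts J" "y = opair a (vb d)" by (rule FnD[OF r(1) y(1)])
    have "opair a (vb c) \<in> elts (bk q)" unfolding mbk using a y n(1) by (simp add: fw_def)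
    hence "opair a (vb c) \<in> elts r" using r(2) by auto
    thus "c = c'" using Fn_fun[OF r(1), of a "vb c" "vb d"] a y by (simp add: fw_def)
   qed
   have "bk q' = r"
   proof (rule hset_eqI, intro set_eqI iffI)
    fix z assume z: "z \<in> elts (bk q')"
    then obtain a c where a: "a \<in> elts J" "z = opair a (vb c)" using bkE by blast
    hence "opair (ap b a) (vb c) \<in> elts q \<or> opair (ap b a) (vb c) \<in> elts (push r)" using z by (simp add: mbk q'_def)
    hence "z \<in> elts (bk q) \<or> z \<in> elts r" using a mpush[OF r(1) a(1)] by (simp add: mbk)
    thus "z \<in> elts r" using r(2) by auto
   next
    fix z assume z: "z \<in> elts r"
    obtain a c where a: "a \<in> elts J" "z = opair a (vb c)" by (rule FnD[OF r(1) z])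
    thus "z \<in> elts (bk q')" using z mpush[OF r(1) a(1)] by (simp add: mbk q'_def)
   qed
   hence "opair q' t \<in> elts R" using q'F r absorb[of r] by (simp add: mR)
   thus ?thesis using q'F r(3,4) by (intro bexI[of _ q'] bexI[of _ t]) (auto simp: elts_FN q'_def)
  qed
 qed (simp add: s0)
 moreover have "R \<sqsubseteq> (hprod (FN omega) TT)"
  unfolding R_def by (subst elts_sep) blast
 ultimately obtain X where X: "X \<in> elts F" "hits R X" using Fh[OF R] by blast
 have XT: "elts X \<subseteq> T" "X \<in> M" using FX[OF X(1)] by simp_all
 have "infinite (elts A \<inter> elts X)"
 proof (rule long_infinite)
  show "elts A \<inter> elts X \<subseteq> T" using XT by blast
  fix m
  have "\<exists>q\<in>G. opair q p \<in> elts (FnL K) \<and> (\<exists>t\<in>elts X. vnat m \<in> elts (hdom t) \<and> opair q t \<in> elts \<nu>)"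
  proof (rule G.G_dense_below[OF _ p])
   show "dfp M (\<lambda>e. \<exists>t\<in>elts X. vnat m \<in> elts (hdom t) \<and> opair (e 0) t \<in> elts \<nu>)" by (intro df XT vnat_inM \<nu>)
   fix q assume "q \<in> elts (FN K)" "opair q p \<in> elts (FnL K)"
   hence q: "q \<in> Fn K" "p \<sqsubseteq> q" by (simp_all add: le)
   \<comment> \<open>Only the part of \<open>q\<close> over \<open>J\<close> is visible to the comb.
     The answer \<open>r\<close> lies over \<open>J\<close> and extends that part, so it is
     compatible with all of \<open>q\<close>; it also contains \<open>p\<close>, so its pair comes
     from \<nu>.\<close>
   define qJ where "qJ = hset_of {z \<in> elts q. hfst z \<in> elts J}"
   have eqJ: "elts qJ = {z \<in> elts q. hfst z \<in> elts J}" unfolding qJ_def by (rule elts_sep)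
   have qJF: "qJ \<in> Fn J"
   proof (rule FnI)
    show "finite (elts qJ)" using q(1) by (simp add: eqJ Fn_def)
    show "\<exists>a\<in>elts J. \<exists>c. z = opair a (vb c)" if z: "z \<in> elts qJ" for z
    proof -
     have zq: "z \<in> elts q" using z by (simp add: eqJ)
     obtain a c where "a \<in> elts K" "z = opair a (vb c)" by (rule FnD[OF q(1) zq])
     thus ?thesis using z by (simp add: eqJ)
    qed
    show "c = c'" if "opair a (vb c) \<in> elts qJ" "opair a (vb c') \<in> elts qJ" for a c c'
     using Fn_fun[OF q(1), of a "vb c" "vb c'"] that by (simp add: eqJ)
   qed
   have pq: "p \<sqsubseteq> qJ"
   proof
    fix z assume z: "z \<in> elts p"
    obtain a c where "a \<in> elts J" "z = opair a (vb c)" by (rule FnD[OF J(4) z])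
    thus "z \<in> elts qJ" using q(2) z by (auto simp: eqJ)
   qed
   from X(2)[unfolded hits_def, rule_format, of "push qJ" "vnat m"]
   obtain t q2 where t: "t \<in> elts X" "vnat m \<in> elts (hdom t)" "q2 \<in> Fn omega" "push qJ \<sqsubseteq> q2" "opair q2 t \<in> elts R"
    using pushF[OF qJF] by (auto simp: elts_FN)
   define r where "r = bk q2"
   have rJ: "r \<in> Fn J" unfolding r_def by (rule bkF[OF t(3)])
   have qr: "qJ \<sqsubseteq> r"
   proof
    fix z assume z: "z \<in> elts qJ"
    obtain a c where a: "a \<in> elts J" "z = opair a (vb c)" by (rule FnD[OF qJF z])
    hence "opair (ap b a) (vb c) \<in> elts (push qJ)" using mpush[OF qJF a(1)] z by simp
    thus "z \<in> elts r" unfolding r_def using a t(4) by (auto simp: mbk)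
   qed
   have "hun r p = r" by (rule absorb) (use pq qr in blast)
   hence rt: "opair r t \<in> elts \<nu>" using t(5) FnJK[OF rJ] unfolding mR r_def by simp
   define q3 where "q3 = hun r q"
   have q3: "q3 \<in> Fn K" unfolding q3_def
   proof (rule Fn_hun[OF FnJK[OF rJ] q(1)])
    fix a c c' assume a: "opair a (vb c) \<in> elts r" "opair a (vb c') \<in> elts q"
    obtain a' d where "a' \<in> elts J" "opair a (vb c) = opair a' (vb d)" by (rule FnD[OF rJ a(1)])
    hence "opair a (vb c') \<in> elts qJ" using a by (simp add: eqJ)
    thus "c = c'" using qr Fn_fun[OF rJ, of a "vb c" "vb c'"] a by auto
   qed
   have "opair q3 t \<in> elts \<nu>" by (rule \<nu>4[OF rt q3]) (simp add: q3_def)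
   thus "\<exists>s\<in>elts (FN K). opair s q \<in> elts (FnL K) \<and> (\<exists>t\<in>elts X. vnat m \<in> elts (hdom t) \<and> opair s t \<in> elts \<nu>)"
    using q3 q(1) t(1,2) by (intro bexI[of _ q3]) (auto simp: le P q3_def)
  qed
  then obtain q t where "q \<in> G" "t \<in> elts X" "vnat m \<in> elts (hdom t)" "opair q t \<in> elts \<nu>" by blast
  thus "\<exists>t\<in>elts A \<inter> elts X. vnat m \<in> elts (hdom t)" using \<nu>1[of t] XT by auto
 qed
 thus ?thesis using X(1) by blast
qed

lemma part1:
 "\<exists>F\<in>M. ad_family F \<and> elts F \<subseteq> antichains_T M \<and>
   (\<forall>\<kappa> G. cardinal_in M \<kappa> --> generic M (Fn \<kappa>) Fn_le G --> \<not> extends_to_cohen_indestructible_in (gen_ext M G) F)"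
proof -
 obtain F where F: "F \<in> M" "ad_family F" and FX: "\<And>X. X \<in> elts F ==> elts X \<subseteq> T \<and> X \<in> M \<and> infinite (elts X) \<and> antich (elts X)"
  and Fh: "\<And>R. R \<in> M ==> R \<sqsubseteq> (hprod (FN omega) TT) ==> good R ==> \<exists>X\<in>elts F. hits R X"
  by (rule comb_family) (rule that)
 have "elts F \<subseteq> antichains_T M"
 proof
  fix X assume "X \<in> elts F"
  from FX[OF this] show "X \<in> antichains_T M" unfolding antichains_T_def antich_def T_le_def by blast
 qed
 moreover have "\<not> extends_to_cohen_indestructible_in (gen_ext M G) F" if K: "cardinal_in M \<kappa>" and G: "generic M (Fn \<kappa>) Fn_le G" for \<kappa> G
 proof
  have KM: "\<kappa> \<in> M" using K by (simp add: cardinal_in_def)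
  interpret G: generic_ext M "FN \<kappa>" "FnL \<kappa>" G by (rule generic_ext_Fn[OF KM G])
  interpret N: ctmodel "gen_ext M G" by (rule G.ctmodel_N)
  assume "extends_to_cohen_indestructible_in (gen_ext M G) F"
  then obtain F' G' where F': "F' \<in> gen_ext M G" "F \<sqsubseteq> F'" "mad_in (gen_ext M G) F'"
   and G': "generic (gen_ext M G) (Fn omega) Fn_le G'" "mad_in (gen_ext (gen_ext M G) G') F'"
   unfolding extends_to_cohen_indestructible_in_def destructible_in_def by blast
  have ad: "ad_family F'" using F'(3) by (simp add: mad_in_def)
  hence F'T: "elts X \<subseteq> T" if "X \<in> elts F'" for X using that by (simp add: ad_family_def)
  obtain A B s where A: "A \<in> elts F'" "chain_T B" "infinite (elts A \<inter> B)" "s \<in> T" "dense_above s (elts A)"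
   by (rule N.cohen_hits[OF F'(1) F'T G']) (assumption, rule that)
  have "X \<in> elts F ==> elts X \<subseteq> T \<and> X \<in> M" for X using FX by simp
  from comb_hits_ext[OF KM G Fh this N.trM[OF F'(1) A(1)] A(4,5)]
  obtain X where X: "X \<in> elts F" "infinite (elts A \<inter> elts X)" by auto
  have "X \<in> elts F'" using F'(2) X(1) by blast
  hence "A = X" using ad A(1) X(2) unfolding ad_family_def by blast
  moreover have "finite (elts X \<inter> B)" by (rule antich_chain[OF _ A(2)]) (use FX[OF X(1)] in simp)
  ultimately show False using A(3) by simp
 qed
 ultimately show ?thesis using F by blast
qed

end

section \<open>The first uncountable ordinal and its preservation\<close>

text \<open>\<open>limfin (l + n) = (l, n)\<close> for \<open>l\<close> zero or a limit ordinal.\<close>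
function limfin :: "hset => hset" where
 "limfin x = (if hUn x \<in> elts x \<and> x = hins (hUn x) (hUn x)
   then opair (hfst (limfin (hUn x))) (hins (hsnd (limfin (hUn x))) (hsnd (limfin (hUn x)))) else opair x hemp)"
 by pat_completeness auto
termination
 by (relation "{(x, y). x \<in> elts y}") (auto intro: wf_elts)
declare limfin.simps [simp del]

lemma limfin_nat: "\<exists>n. hsnd (limfin x) = vnat n"
proof (induction x rule: elts_induct)
 case (step x)
 show ?case
 proof (cases "hUn x \<in> elts x \<and> x = hins (hUn x) (hUn x)")
  case True
  obtain n where "hsnd (limfin (hUn x)) = vnat n" using step[of "hUn x"] True by blast
  hence "hsnd (limfin x) = vnat (Suc n)" using True by (subst limfin.simps) (simp add: vnat_Suc)
  thus ?thesis by blast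
 next
  case False
  hence "hsnd (limfin x) = vnat 0" by (subst limfin.simps) (simp only: if_False hsnd_opair vnat_0)
  thus ?thesis by blast
 qed
qed

lemma hUn_succ: "is_ord i ==> hUn (hins i i) = i"
 by (rule hset_eqI) (auto simp: is_ord_def transitive_def)

lemma limfin_succ:
 assumes "is_ord i"
 shows "limfin (hins i i) = opair (hfst (limfin i)) (hins (hsnd (limfin i)) (hsnd (limfin i)))"
proof -
 have "hUn (hins i i) \<in> elts (hins i i) \<and> hins i i = hins (hUn (hins i i)) (hUn (hins i i))"
  unfolding hUn_succ[OF assms] by simp
 from if_P[OF this] show ?thesis by (subst limfin.simps) (simp only: hUn_succ[OF assms])
qed

lemma limfin_inj: "limfin i = limfin j ==> i = j"
proof (induction i arbitrary: j rule: elts_induct)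
 case (step i)
 let ?S = "\<lambda>x. hUn x \<in> elts x \<and> x = hins (hUn x) (hUn x)"
 obtain n m where nm: "hsnd (limfin (hUn i)) = vnat n" "hsnd (limfin (hUn j)) = vnat m" using limfin_nat by metis
 have s: "limfin x = opair (hfst (limfin (hUn x))) (hins (hsnd (limfin (hUn x))) (hsnd (limfin (hUn x))))" if "?S x" for x
  by (subst limfin.simps) (rule if_P[OF that])
 have ns: "limfin x = opair x hemp" if "\<not> ?S x" for x by (subst limfin.simps) (rule if_not_P[OF that])
 have ne: "hins a b \<noteq> hemp" for a b by (metis elts_hemp elts_hins insert_not_empty)
 consider "?S i" "?S j" | "?S i" "\<not> ?S j" | "\<not> ?S i" "?S j" | "\<not> ?S i" "\<not> ?S j" by blast
 thus ?case
 proof cases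
  case 1
  have e: "hfst (limfin (hUn i)) = hfst (limfin (hUn j))" "vnat (Suc n) = vnat (Suc m)"
   using step.prems unfolding s[OF 1(1)] s[OF 1(2)] nm by (simp_all only: opair_inject vnat_Suc)
  have "limfin (hUn i) = limfin (hUn j)"
  proof -
   have "\<exists>a b. limfin x = opair a b" for x by (subst limfin.simps) auto
   then obtain a b c d where "limfin (hUn i) = opair a b" "limfin (hUn j) = opair c d" by metis
   thus ?thesis using e nm by simp
  qed
  hence "hUn i = hUn j" using step.IH[of "hUn i"] 1(1) by blast
  thus ?thesis using 1 by metis
 next
  case 2
  thus ?thesis using step.prems ne unfolding s[OF 2(1)] ns[OF 2(2)] by simp
 next
  case 3
  have "hemp = hins (hsnd (limfin (hUn j))) (hsnd (limfin (hUn j)))"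
   using step.prems unfolding ns[OF 3(1)] s[OF 3(2)] by (simp only: opair_inject)
  thus ?thesis using ne by metis
 next
  case 4
  thus ?thesis using step.prems ns by simp
 qed
qed

lemma limfin_lim: "is_ord i ==> (hfst (limfin i) = i \<or> hfst (limfin i) \<in> elts i) \<and> limfin (hfst (limfin i)) = opair (hfst (limfin i)) hemp"
proof (induction i rule: elts_induct)
 case (step i)
 show ?case
 proof (cases "hUn i \<in> elts i \<and> i = hins (hUn i) (hUn i)")
  case True
  have o: "is_ord (hUn i)" using is_ord_mem[OF step.prems] True by blast
  have f: "hfst (limfin i) = hfst (limfin (hUn i))"
   using limfin_succ[OF o] True by simp
  have m: "hUn i \<in> elts i" using True by blast
  from step.IH[OF m o] have "hfst (limfin (hUn i)) = hUn i \<or> hfst (limfin (hUn i)) \<in> elts (hUn i)"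
   "limfin (hfst (limfin (hUn i))) = opair (hfst (limfin (hUn i))) hemp" by (rule conjunct1, rule conjunct2)
  moreover have "hfst (limfin (hUn i)) \<in> elts i" if "hfst (limfin (hUn i)) \<in> elts (hUn i)"
   by (rule is_ord_trans[OF step.prems m that])
  ultimately show ?thesis using m unfolding f by metis
 next
  case False
  hence "limfin i = opair i hemp" by (subst limfin.simps) (simp only: if_False)
  thus ?thesis by simp
 qed
qed

lemma is_ord_succ: "is_ord i ==> is_ord (hins i i)"
 by (auto simp: is_ord_def transitive_def)

text \<open>A diagonal construction of distinct reals indexed by countable ordinals: with
  \<open>E x\<close> injective on \<open>x\<close>, the value at \<open>x\<close> is made to differ
  from the value at each earlier \<open>y\<close> at the place \<open>ap (ap E x) y\<close>.\<close>

function diag :: "hset => hset => hset" where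
 "diag E x = hset_of {n \<in> elts omega. \<exists>y\<in>elts x. n = ap (ap E x) y \<and> n \<notin> elts (diag E y)}"
 by auto
termination
 by (relation "inv_image {(x, y). x \<in> elts y} snd") (auto intro!: wf_inv_image wf_elts)
declare diag.simps [simp del]

context ctmodel
begin

lemma dft_limfin [df]: "dft M f ==> dft M (\<lambda>e. limfin (f e))"
proof (rule dft_app1[where F = limfin])
 have "dft M (\<lambda>e. (\<lambda>_. limfin) (e 0) (e 1))"
 proof (rule recursion[where \<Phi> = "\<lambda>a x f. if hUn x \<in> elts x \<and> x = hins (hUn x) (hUn x)
   then opair (hfst (ap f (hUn x))) (hins (hsnd (ap f (hUn x))) (hsnd (ap f (hUn x)))) else opair x hemp"])
  fix a x :: hset
  show "limfin x = (if hUn x \<in> elts x \<and> x = hins (hUn x) (hUn x)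
   then opair (hfst (ap (hgraph (TC x) limfin) (hUn x))) (hins (hsnd (ap (hgraph (TC x) limfin) (hUn x))) (hsnd (ap (hgraph (TC x) limfin) (hUn x))))
   else opair x hemp)"
  proof (cases "hUn x \<in> elts x \<and> x = hins (hUn x) (hUn x)")
   case True
   hence "ap (hgraph (TC x) limfin) (hUn x) = limfin (hUn x)" by (simp only: ap_hgraph elts_sub_TC)
   thus ?thesis using True by (subst limfin.simps) (simp only:)
  next
   case False
   thus ?thesis by (subst limfin.simps) (simp only: if_False)
  qed
 qed (intro df hemp_inM)
 from dft_app2[OF this, of "\<lambda>e. hemp" "\<lambda>e. e 0"] show "dft M (\<lambda>e. limfin (e 0))"
  by (simp add: dft_const dft_var)
qed

lemma dft_diag:
 assumes "E \<in> M" shows "dft M (\<lambda>e. diag E (e 0))"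
proof -
 have "dft M (\<lambda>e. (\<lambda>_. diag E) (e 0) (e 1))"
 proof (rule recursion[where \<Phi> = "\<lambda>a x f. hset_of {n \<in> elts omega. \<exists>y\<in>elts x. n = ap (ap E x) y \<and> n \<notin> elts (ap f y)}"])
  fix a x :: hset
  have "{n \<in> elts omega. \<exists>y\<in>elts x. n = ap (ap E x) y \<and> n \<notin> elts (diag E y)} =
   {n \<in> elts omega. \<exists>y\<in>elts x. n = ap (ap E x) y \<and> n \<notin> elts (ap (hgraph (TC x) (diag E)) y)}"
   by (intro Collect_cong conj_cong refl bex_cong) (simp add: elts_sub_TC)
  thus "diag E x = hset_of {n \<in> elts omega. \<exists>y\<in>elts x. n = ap (ap E x) y \<and> n \<notin> elts (ap (hgraph (TC x) (diag E)) y)}"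
   by (subst diag.simps) (rule arg_cong[of _ _ hset_of])
 qed (intro df omega_inM assms)
 from dft_app2[OF this, of "\<lambda>e. hemp" "\<lambda>e. e 0"] show ?thesis by (simp add: dft_const dft_var)
qed

context
 fixes w assumes w: "is_omega1_in M w"
begin

lemma w_M: "w \<in> M" and w_ord: "is_ord w" and w_unc: "\<not> countable_in M w"
 and w_cnt: "a \<in> elts w ==> countable_in M a"
 using w unfolding is_omega1_in_def by blast+

lemma w_mem_M: "i \<in> elts w ==> i \<in> M"
 by (rule trM[OF w_M])

lemma w_succ: "i \<in> elts w ==> hins i i \<in> elts w"
proof -
 assume i: "i \<in> elts w"
 have o: "is_ord i" by (rule is_ord_mem[OF w_ord i])
 have iM: "i \<in> M" by (rule w_mem_M[OF i])
 have "countable_in M (hset_of {i})" by (rule cnt_finite) (use iM in simp_all)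
 moreover have "hins i i = hun (hset_of {i}) i" by (rule hset_eqI) simp
 ultimately have c: "countable_in M (hins i i)" using cnt_hun[OF _ iM _ w_cnt[OF i], of "hset_of {i}"] iM by simp
 have "hins i i \<noteq> w" using c w_unc by blast
 moreover have "w \<notin> elts (hins i i)"
  using i is_ord_irrefl[OF w_ord i] mem_irrefl[of w] by auto
 ultimately show ?thesis using is_ord_linear[OF is_ord_succ[OF o] w_ord] by blast
qed

lemma limfin_reach:
 assumes l: "l \<in> elts w" "limfin l = opair l hemp"
 shows "\<exists>a\<in>elts w. limfin a = opair l (vnat n)"
proof (induction n)
 case 0
 thus ?case using l by (intro bexI[of _ l]) (simp_all add: vnat_0)
next
 case (Suc n)
 then obtain a where a: "a \<in> elts w" "limfin a = opair l (vnat n)" by blast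
 have "limfin (hins a a) = opair l (vnat (Suc n))"
  using limfin_succ[OF is_ord_mem[OF w_ord a(1)]] a(2) by (simp add: vnat_Suc)
 thus ?case using w_succ[OF a(1)] by blast
qed

text \<open>Write \<open>i\<close> as \<open>l + n\<close>. The pair of \<open>i\<close> and
  \<open>y\<close> goes to \<open>l + m\<close> with \<open>m\<close> a code of \<open>n\<close> and
  \<open>y\<close>. Only the finite part changes, so the value stays below \<open>w\<close>.\<close>

lemma omega1_pairing:
 assumes Y: "Y \<in> M" "countable_in M Y"
 obtains a where "a \<in> M" "\<And>i y. i \<in> elts w ==> y \<in> elts Y ==> ap a (opair i y) \<in> elts w"
  "\<And>i y i' y'. i \<in> elts w ==> y \<in> elts Y ==> i' \<in> elts w ==> y' \<in> elts Y ==>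
    ap a (opair i y) = ap a (opair i' y') ==> i = i' \<and> y = y'"
proof -
 have DM: "hprod omega Y \<in> M" using Y by simp
 have cD: "countable_in M (hprod omega Y)" using Y by (intro cnt_prod cnt_omega) simp_all
 obtain c where c: "c \<in> M" "\<And>z. z \<in> elts (hprod omega Y) ==> ap c z \<in> elts omega"
  "\<And>y z. y \<in> elts (hprod omega Y) ==> z \<in> elts (hprod omega Y) ==> ap c y = ap c z ==> y = z"
  by (rule cntE[OF cD DM]) (rule that)
 define S where "S z b <-> b \<in> elts w \<and> limfin b = opair (hfst (limfin (hfst z))) (ap c (opair (hsnd (limfin (hfst z))) (hsnd z)))" for z b
 have D: "hprod w Y \<in> M" using w_M Y by simp
 have mem: "opair (hsnd (limfin i)) y \<in> elts (hprod omega Y)" if "y \<in> elts Y" for i y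
  using limfin_nat[of i] that by (auto simp: opair_in_hprod simp del: elts_hprod)
 obtain H where H: "hgraph (hprod w Y) H \<in> M" "\<And>z. z \<in> elts (hprod w Y) ==> S z (H z)"
 proof (rule uniformize[where R = S, OF _ D])
  show "dfp M (\<lambda>e. S (e 0) (e 1))" unfolding S_def by (intro df w_M c(1))
  fix z assume "z \<in> elts (hprod w Y)"
  then obtain i y where z: "z = opair i y" "i \<in> elts w" "y \<in> elts Y" by auto
  obtain n where n: "ap c (opair (hsnd (limfin i)) y) = vnat n" using c(2)[OF mem[OF z(3), of i]] by auto
  note l = limfin_lim[OF is_ord_mem[OF w_ord z(2)]]
  have "hfst (limfin i) \<in> elts w" using l z(2) is_ord_trans[OF w_ord z(2)] by auto
  from limfin_reach[OF this, of n] l obtain a where "a \<in> elts w" "limfin a = opair (hfst (limfin i)) (vnat n)" by blast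
  thus "\<exists>b\<in>M. S z b" unfolding S_def z(1) using n w_mem_M by (intro bexI[of _ a]) simp_all
 qed (rule that)
 have zD: "opair i y \<in> elts (hprod w Y)" if "i \<in> elts w" "y \<in> elts Y" for i y
  using that by (simp add: opair_in_hprod del: elts_hprod)
 show thesis
 proof (rule that[OF H(1)])
  fix i y assume i: "i \<in> elts w" "y \<in> elts Y"
  show "ap (hgraph (hprod w Y) H) (opair i y) \<in> elts w" using H(2)[OF zD[OF i]] zD[OF i] by (simp add: S_def del: elts_hprod)
  fix i' y' assume i': "i' \<in> elts w" "y' \<in> elts Y"
   and e: "ap (hgraph (hprod w Y) H) (opair i y) = ap (hgraph (hprod w Y) H) (opair i' y')"
  have "H (opair i y) = H (opair i' y')" using e zD[OF i] zD[OF i'] by (simp del: elts_hprod)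
  hence *: "hfst (limfin i) = hfst (limfin i')"
   "ap c (opair (hsnd (limfin i)) y) = ap c (opair (hsnd (limfin i')) y')"
   using H(2)[OF zD[OF i]] H(2)[OF zD[OF i']] unfolding S_def by simp_all
  from c(3)[OF mem[OF i(2)] mem[OF i'(2)] *(2)] have "hsnd (limfin i) = hsnd (limfin i')" "y = y'" by simp_all
  moreover have "limfin x = opair (hfst (limfin x)) (hsnd (limfin x))" for x by (subst (1 2 3) limfin.simps) simp
  ultimately have "limfin i = limfin i'" using *(1) by metis
  thus "i = i' \<and> y = y'" using limfin_inj \<open>y = y'\<close> by blast
 qed
qed

lemma omega1_injections:
 obtains E where "E \<in> M" "\<And>i j. i \<in> elts w ==> j \<in> elts i ==> ap (ap E i) j \<in> elts omega"
  "\<And>i j k. i \<in> elts w ==> j \<in> elts i ==> k \<in> elts i ==> ap (ap E i) j = ap (ap E i) k ==> j = k"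
proof -
 define Inj where "Inj x f <-> (\<forall>y\<in>elts x. ap f y \<in> elts omega) \<and> (\<forall>y\<in>elts x. \<forall>z\<in>elts x. ap f y = ap f z --> y = z)" for x f
 obtain G where G: "hgraph w G \<in> M" "\<And>x. x \<in> elts w ==> Inj x (G x)"
 proof (rule uniformize[where R = Inj, OF _ w_M])
  show "dfp M (\<lambda>e. Inj (e 0) (e 1))" unfolding Inj_def by (intro df omega_inM)
  show "\<exists>f\<in>M. Inj x f" if "x \<in> elts w" for x
   using w_cnt[OF that] unfolding cnt_iff[OF w_mem_M[OF that]] Inj_def .
 qed (rule that)
 show thesis
 proof (rule that[OF G(1)])
  fix i j assume ij: "i \<in> elts w" "j \<in> elts i"
  show "ap (ap (hgraph w G) i) j \<in> elts omega" using G(2)[OF ij(1)] ij unfolding Inj_def by simp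
  fix k assume "k \<in> elts i" "ap (ap (hgraph w G) i) j = ap (ap (hgraph w G) i) k"
  thus "j = k" using G(2)[OF ij(1)] ij unfolding Inj_def by simp
 qed
qed

lemma omega1_reals:
 obtains x where "dft M (\<lambda>e. x (e 0))" "\<And>a. x a \<sqsubseteq> omega"
  "\<And>a b. a \<in> elts w ==> b \<in> elts w ==> x a = x b ==> a = b"
proof -
 obtain E where E: "E \<in> M" "\<And>i j. i \<in> elts w ==> j \<in> elts i ==> ap (ap E i) j \<in> elts omega"
  "\<And>i j k. i \<in> elts w ==> j \<in> elts i ==> k \<in> elts i ==> ap (ap E i) j = ap (ap E i) k ==> j = k"
  by (rule omega1_injections) (rule that)
 have ed: "n \<in> elts (diag E a) <-> n \<in> elts omega \<and> (\<exists>y\<in>elts a. n = ap (ap E a) y \<and> n \<notin> elts (diag E y))" for n a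
  by (subst diag.simps, subst elts_sep) simp
 have ne: "diag E a \<noteq> diag E b" if a: "a \<in> elts w" and b: "b \<in> elts a" for a b
 proof
  assume e: "diag E a = diag E b"
  define n where "n = ap (ap E a) b"
  have n: "n \<in> elts omega" unfolding n_def by (rule E(2)[OF a b])
  have "n \<in> elts (diag E a) <-> n \<notin> elts (diag E b)"
  proof
   assume "n \<in> elts (diag E a)"
   then obtain y where y: "y \<in> elts a" "n = ap (ap E a) y" "n \<notin> elts (diag E y)" unfolding ed[of n a] by blast
   have "b = y" by (rule E(3)[OF a b y(1)]) (use y n_def in simp)
   thus "n \<notin> elts (diag E b)" using y by simp
  next
   assume "n \<notin> elts (diag E b)"
   thus "n \<in> elts (diag E a)" unfolding ed[of n a] using n b n_def by blast
  qed
  thus False using e by simp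
 qed
 show thesis
 proof (rule that[of "diag E"])
  show "dft M (\<lambda>e. diag E (e 0))" by (rule dft_diag[OF E(1)])
  show "diag E a \<sqsubseteq> omega" for a using ed[of _ a] by blast
  show "a = b" if ab: "a \<in> elts w" "b \<in> elts w" "diag E a = diag E b" for a b
   using ne[OF ab(1), of b] ne[OF ab(2), of a] ab(3) is_ord_linear[OF is_ord_mem[OF w_ord ab(1)] is_ord_mem[OF w_ord ab(2)]] by metis
 qed
qed

end

end

section \<open>Preservation of the first uncountable ordinal\<close>

context generic_ext
begin

text \<open>Each \<open>a\<close> gets a condition that decides its number under the supposed
  injection; all these conditions lie below one that forces injectivity. Equal numbers then mean
  incompatible conditions, which both preservation arguments contradict.\<close>

lemma inj_name:
 assumes w: "w \<in> M" and c: "countable_in N w"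
 obtains H where "hgraph w H \<in> M" "\<And>a. a \<in> elts w ==> H a \<in> elts (hprod P omega)"
  "\<And>a b r. a \<in> elts w ==> b \<in> elts w ==> a \<noteq> b ==> hsnd (H a) = hsnd (H b) ==> r \<in> elts P ==>
    le r (hfst (H a)) ==> le r (hfst (H b)) ==> False"
proof -
 interpret N: ctmodel N by (rule ctmodel_N)
 obtain f where f: "f \<in> N" "\<And>u. u \<in> elts w ==> ap f u \<in> elts omega"
  "\<And>u z. u \<in> elts w ==> z \<in> elts w ==> ap f u = ap f z ==> u = z"
  by (rule N.cntE[OF c M_sub_N[OF w]]) (rule that)
 define A where "A = hgraph w (\<lambda>a. ap f a)"
 have A: "A \<in> N" unfolding A_def by (rule N.inM, intro df f(1) M_sub_N[OF w])
 have mA: "opair a n \<in> elts A <-> a \<in> elts w \<and> n = ap f a" for a n by (auto simp: A_def)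
 have X: "hprod w omega \<in> M" using w by simp
 obtain \<nu> where \<nu>: "\<nu> \<in> M" and \<nu>1: "\<And>t. t \<in> elts (hprod w omega) ==> t \<in> elts A <-> (\<exists>p\<in>G. opair p t \<in> elts \<nu>)"
  and \<nu>2: "\<And>p t. opair p t \<in> elts \<nu> ==> p \<in> elts P \<and> t \<in> elts (hprod w omega)"
  and \<nu>3: "\<And>p q t. opair p t \<in> elts \<nu> ==> q \<in> elts P ==> le q p ==> opair q t \<in> elts \<nu>"
  by (rule nice_name[OF A X]) (rule that)
 \<comment> \<open>A bad condition gives two points the same number. None is in the filter, so some
   member of the filter has no bad extension.\<close>
 define bad where "bad q <-> (\<exists>a\<in>elts w. \<exists>b\<in>elts w. \<exists>n\<in>elts omega. a \<noteq> b \<and> opair q (opair a n) \<in> elts \<nu> \<and> opair q (opair b n) \<in> elts \<nu>)" for q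
 have db: "dfp M (\<lambda>e. bad (e 0))" unfolding bad_def by (intro df w omega_inM \<nu>)
 have nbad: "\<not> bad q" if q: "q \<in> G" for q
 proof
  assume "bad q"
  then obtain a b n where ab: "a \<in> elts w" "b \<in> elts w" "n \<in> elts omega" "a \<noteq> b" "opair q (opair a n) \<in> elts \<nu>" "opair q (opair b n) \<in> elts \<nu>"
   unfolding bad_def by blast
  have "opair a n \<in> elts A" "opair b n \<in> elts A"
   using \<nu>1[of "opair a n"] \<nu>1[of "opair b n"] \<nu>2 ab q by blast+
  hence "ap f a = ap f b" unfolding mA by simp
  thus False using f(3)[OF ab(1,2)] ab(4) by simp
 qed
 have "\<exists>p\<in>G. bad p \<or> (\<forall>q\<in>elts P. le q p --> \<not> bad q)"
 proof (rule G_dense)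
  show "dfp M (\<lambda>e. bad (e 0) \<or> (\<forall>q\<in>elts P. le q (e 0) --> \<not> bad q))" by (intro df db dfp_app1[OF db] P L)
  fix p assume p: "p \<in> elts P"
  show "\<exists>q\<in>elts P. le q p \<and> (bad q \<or> (\<forall>r\<in>elts P. le r q --> \<not> bad r))"
  proof (cases "\<exists>q\<in>elts P. le q p \<and> bad q")
   case True thus ?thesis by blast
  next
   case False thus ?thesis using p le_refl[OF p] by (intro bexI[of _ p]) blast+
  qed
 qed
 then obtain p where p: "p \<in> G" "\<And>q. q \<in> elts P ==> le q p ==> \<not> bad q" using nbad by blast
 have pP: "p \<in> elts P" by (rule G_P[OF p(1)])
 have ex: "\<exists>q\<in>elts P. le q p \<and> (\<exists>n\<in>elts omega. opair q (opair a n) \<in> elts \<nu>)" if a: "a \<in> elts w" for a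
 proof -
  have z: "opair a (ap f a) \<in> elts (hprod w omega)" using a f(2)[OF a] by (simp add: opair_in_hprod del: elts_hprod)
  moreover have "opair a (ap f a) \<in> elts A" using a by (simp add: mA)
  ultimately obtain r where r: "r \<in> G" "opair r (opair a (ap f a)) \<in> elts \<nu>" using \<nu>1 by blast
  obtain q where q: "q \<in> G" "le q p" "le q r" using G_dir[OF p(1) r(1)] by blast
  have "opair q (opair a (ap f a)) \<in> elts \<nu>" by (rule \<nu>3[OF r(2) G_P[OF q(1)] q(3)])
  thus ?thesis using q G_P[OF q(1)] f(2)[OF a] by blast
 qed
 define S where "S a z <-> z \<in> elts (hprod P omega) \<and> le (hfst z) p \<and> opair (hfst z) (opair a (hsnd z)) \<in> elts \<nu>" for a z
 obtain H where H: "hgraph w H \<in> M" "\<And>a. a \<in> elts w ==> S a (H a)"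
 proof (rule uniformize[where R = S, OF _ w])
  show "dfp M (\<lambda>e. S (e 0) (e 1))" unfolding S_def by (intro df P L omega_inM P_M[OF pP] \<nu>)
  fix a assume "a \<in> elts w"
  from ex[OF this] obtain q n where "q \<in> elts P" "le q p" "n \<in> elts omega" "opair q (opair a n) \<in> elts \<nu>" by blast
  thus "\<exists>z\<in>M. S a z" unfolding S_def using P_M trM[OF omega_inM]
   by (intro bexI[of _ "opair q n"]) (simp_all add: opair_in_hprod del: elts_hprod elts_omega)
 qed (rule that)
 show thesis
 proof (rule that[OF H(1)])
  show "H a \<in> elts (hprod P omega)" if "a \<in> elts w" for a using H(2)[OF that] unfolding S_def by simp
  fix a b r assume ab: "a \<in> elts w" "b \<in> elts w" "a \<noteq> b" "hsnd (H a) = hsnd (H b)"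
   and r: "r \<in> elts P" "le r (hfst (H a))" "le r (hfst (H b))"
  have Sa: "S a (H a)" "S b (H b)" by (rule H(2)[OF ab(1)], rule H(2)[OF ab(2)])
  obtain q n where qn: "H a = opair q n" "q \<in> elts P" "n \<in> elts omega" using Sa(1) unfolding S_def by auto
  have "opair r (opair a n) \<in> elts \<nu>" "opair r (opair b n) \<in> elts \<nu>"
   using Sa ab(4) r \<nu>3[of _ _ r] qn unfolding S_def by auto
  hence "bad r" unfolding bad_def using ab qn(3) by blast
  moreover have "le r p"
  proof (rule le_trans[OF r(1) qn(2) pP])
   show "le r q" using r(2) qn(1) by simp
   show "le q p" using Sa(1) qn(1) unfolding S_def by simp
  qed
  ultimately show False using p(2)[OF r(1)] by blast
 qed
qed

text \<open>For each number the conditions attached to it are an antichain, and distinct points have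
  distinct ones, since a condition is compatible with itself. So \<open>w\<close> would be a
  countable union of countable sets.\<close>

lemma ccc_preserves_uncountable:
 assumes w: "w \<in> M" "\<not> countable_in M w" and ccc: "ccc_in M (elts P) (order_of L)"
 shows "\<not> countable_in N w"
proof
 assume "countable_in N w"
 then obtain H where H: "hgraph w H \<in> M" "\<And>a. a \<in> elts w ==> H a \<in> elts (hprod P omega)"
  and inc: "\<And>a b r. a \<in> elts w ==> b \<in> elts w ==> a \<noteq> b ==> hsnd (H a) = hsnd (H b) ==> r \<in> elts P ==>
    le r (hfst (H a)) ==> le r (hfst (H b)) ==> False"
  by (rule inj_name[OF w(1)]) (rule that)
 have HP: "hfst (H a) \<in> elts P" "hsnd (H a) \<in> elts omega" if "a \<in> elts w" for a using H(2)[OF that] by auto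
 define h where "h a = ap (hgraph w H) a" for a
 have hH: "h a = H a" if "a \<in> elts w" for a using that by (simp add: h_def)
 define wn where "wn n = hset_of {a \<in> elts w. hsnd (h a) = n}" for n
 have ewn: "elts (wn n) = {a \<in> elts w. hsnd (h a) = n}" for n unfolding wn_def by (rule elts_sep)
 have dwn: "dft M (\<lambda>e. wn (e 0))" unfolding wn_def h_def by (intro df w H(1))
 have "countable_in M (wn n)" if n: "n \<in> elts omega" for n
 proof -
  have nM: "n \<in> M" by (rule trM[OF omega_inM n])
  have wnM: "wn n \<in> M" by (rule inM, intro dft_app1[OF dwn] dft_const nM)
  define An where "An = hset_of ((\<lambda>a. hfst (h a)) ` elts (wn n))"
  have An: "An \<in> M" unfolding An_def h_def by (rule inM, intro df wnM H(1))
  have eAn: "elts An = (\<lambda>a. hfst (h a)) ` elts (wn n)" by (simp add: An_def)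
  have "countable_in M An"
  proof (rule ccc[unfolded ccc_in_def, rule_format, OF An])
   show "An \<sqsubseteq> P" unfolding eAn using HP hH by (auto simp: ewn)
   fix p q assume "p \<in> elts An" "q \<in> elts An" "p \<noteq> q"
   then obtain a b where ab: "a \<in> elts (wn n)" "p = hfst (h a)" "b \<in> elts (wn n)" "q = hfst (h b)" "a \<noteq> b"
    unfolding eAn by blast
   hence *: "a \<in> elts w" "b \<in> elts w" "hsnd (h a) = hsnd (h b)" by (simp_all add: ewn)
   have "p = hfst (H a)" "q = hfst (H b)" "hsnd (H a) = hsnd (H b)"
    using ab *(3) unfolding hH[OF *(1)] hH[OF *(2)] by simp_all
   thus "\<not> (\<exists>r\<in>elts P. order_of L r p \<and> order_of L r q)" using inc[OF *(1,2) ab(5)] unfolding order_of_def by blast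
  qed
  moreover have "hgraph (wn n) (\<lambda>a. hfst (h a)) \<in> M" unfolding h_def by (rule inM, intro df wnM H(1))
  ultimately show ?thesis
  proof (rule cnt_inj[OF wnM An])
   fix a b assume ab: "a \<in> elts (wn n)" "b \<in> elts (wn n)" "hfst (h a) = hfst (h b)"
   hence w': "a \<in> elts w" "b \<in> elts w" "hsnd (h a) = hsnd (h b)" by (simp_all add: ewn)
   hence *: "a \<in> elts w" "b \<in> elts w" "hsnd (H a) = hsnd (H b)" "hfst (H a) = hfst (H b)"
    using ab(3) unfolding hH[OF w'(1)] hH[OF w'(2)] by simp_all
   show "a = b"
   proof (rule ccontr)
    assume "a \<noteq> b"
    thus False using inc[OF *(1,2) _ *(3) HP(1)[OF *(1)]] le_refl[OF HP(1)[OF *(1)]] *(4) by simp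
   qed
  qed (simp add: eAn)
 qed
 hence "countable_in M (hset_of (\<Union>n\<in>elts omega. elts (wn n)))" by (rule cnt_UN_image[OF omega_inM cnt_omega dwn])
 moreover have "(\<Union>n\<in>elts omega. elts (wn n)) = elts w"
 proof (intro set_eqI iffI)
  fix a assume a: "a \<in> elts w"
  hence "a \<in> elts (wn (hsnd (h a)))" by (simp add: ewn)
  thus "a \<in> (\<Union>n\<in>elts omega. elts (wn n))" using HP(2)[OF a] hH[OF a] by auto
 qed (auto simp: ewn)
 ultimately show False using w(2) by simp
qed

end

lemma finite_separate:
 assumes "finite D" "\<And>a b. a \<in> D ==> b \<in> D ==> a \<noteq> b ==> \<exists>k::nat. P a k \<noteq> P b k"
 shows "\<exists>m. \<forall>a\<in>D. \<forall>b\<in>D. (\<forall>k<m. P a k = P b k) --> a = b"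
proof -
 have "\<exists>k. P a k \<noteq> P b k \<or> a = b" if "a \<in> D" "b \<in> D" for a b using assms(2)[OF that] by blast
 then obtain k where k: "\<And>a b. a \<in> D ==> b \<in> D ==> a \<noteq> b ==> P a (k a b) \<noteq> P b (k a b)" by metis
 have "finite ((\<lambda>(a, b). k a b) ` (D \<times> D))" using assms(1) by simp
 then obtain m where "\<forall>n\<in>(\<lambda>(a, b). k a b) ` (D \<times> D). n < m" using finite_nat_set_iff_bounded by blast
 hence "k a b < m" if "a \<in> D" "b \<in> D" for a b using that by auto
 thus ?thesis using k by blast
qed

context ctmodel
begin

text \<open>\<open>Fn w\<close> is \<open>\<sigma>\<close>-centered: attach distinct reals \<open>x a\<close> to the coordinates and code a condition by
 initial parts of the reals of its coordinates that are long enough to separate them.\<close>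
lemma Fn_preserves_omega1:
 assumes w: "is_omega1_in M w" and G: "generic M (Fn w) Fn_le G"
 shows "\<not> countable_in (gen_ext M G) w"
proof
 note wM = w_M[OF w]
 interpret G: generic_ext M "FN w" "FnL w" G by (rule generic_ext_Fn[OF wM G])
 assume "countable_in (gen_ext M G) w"
 then obtain H where H: "hgraph w H \<in> M" "\<And>a. a \<in> elts w ==> H a \<in> elts (hprod (FN w) omega)"
  and inc: "\<And>a b r. a \<in> elts w ==> b \<in> elts w ==> a \<noteq> b ==> hsnd (H a) = hsnd (H b) ==> r \<in> elts (FN w) ==>
    opair r (hfst (H a)) \<in> elts (FnL w) ==> opair r (hfst (H b)) \<in> elts (FnL w) ==> False"
  by (rule G.inj_name[OF wM]) (rule that)
 obtain x where x: "dft M (\<lambda>e. x (e 0))" "\<And>a. x a \<sqsubseteq> omega"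
  "\<And>a b. a \<in> elts w ==> b \<in> elts w ==> x a = x b ==> a = b"
  by (rule omega1_reals[OF w]) (rule that)
 define h where "h a = ap (hgraph w H) a" for a
 have hH: "h a = H a" if "a \<in> elts w" for a using that by (simp add: h_def)
 define xm where "xm a m = hset_of {n \<in> elts (x a). n \<in> elts m}" for a m
 have exm: "elts (xm a m) = {n \<in> elts (x a). n \<in> elts m}" for a m unfolding xm_def by (rule elts_sep)
 define code where "code q m = hset_of ((\<lambda>z. opair (xm (hfst z) m) (hsnd z)) ` elts q)" for q m
 have ecode: "elts (code q m) = (\<lambda>z. opair (xm (hfst z) m) (hsnd z)) ` elts q" for q m by (simp add: code_def)
 have dxm: "dft M (\<lambda>e. xm (e 0) (e 1))" unfolding xm_def by (intro df dft_app1[OF x(1)])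
 have dcode: "dft M (\<lambda>e. code (e 0) (e 1))" unfolding code_def by (intro df dft_app2[OF dxm])
 define fn where "fn c <-> (\<forall>y\<in>elts c. \<forall>z\<in>elts c. hfst y = hfst z --> y = z)" for c
 define Cd where "Cd = hprod omega (hprod omega (hFin (hprod (hFin omega) (vnat 2))))"
 have FM: "hFin omega \<in> M" by (rule inM, intro df omega_inM)
 have F2M: "hFin (hprod (hFin omega) (vnat 2)) \<in> M" by (rule inM, intro df omega_inM vnat_inM)
 have Cd: "Cd \<in> M" unfolding Cd_def using F2M by simp
 have cCd: "countable_in M Cd" unfolding Cd_def using FM F2M
  by (intro cnt_prod cnt_Fin cnt_omega cnt_2) simp_all
 have Hq: "\<exists>q n. H a = opair q (vnat n) \<and> q \<in> Fn w" if "a \<in> elts w" for a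
  using H(2)[OF that] by (auto simp: elts_FN[OF wM])
 \<comment> \<open>The code consists of the number, a length \<open>m\<close>, and the condition
   with each coordinate replaced by the first \<open>m\<close> bits of its real; \<open>fn\<close>
   says that \<open>m\<close> is long enough for the result to be a function still.\<close>
 define S where "S a y <-> y \<in> elts Cd \<and> hfst y = hsnd (h a) \<and> hsnd (hsnd y) = code (hfst (h a)) (hfst (hsnd y)) \<and> fn (hsnd (hsnd y))" for a y
 obtain F where F: "hgraph w F \<in> M" "\<And>a. a \<in> elts w ==> S a (F a)"
 proof (rule uniformize[where R = S, OF _ wM])
  show "dfp M (\<lambda>e. S (e 0) (e 1))" unfolding S_def fn_def h_def by (intro df Cd dft_app2[OF dcode] H(1) wM)
  fix a assume a: "a \<in> elts w"
  obtain q n where q: "H a = opair q (vnat n)" "q \<in> Fn w" using Hq[OF a] by blast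
  define D where "D = hfst ` elts q"
  have "finite D" using q(2) by (simp add: D_def Fn_def)
  have Dw: "D \<subseteq> elts w" unfolding D_def using q(2) by (auto elim!: FnD)
  have "\<exists>m. \<forall>a\<in>D. \<forall>b\<in>D. (\<forall>k<m. (vnat k \<in> elts (x a)) = (vnat k \<in> elts (x b))) --> a = b"
  proof (rule finite_separate[OF \<open>finite D\<close>])
   fix a b assume ab: "a \<in> D" "b \<in> D" "a \<noteq> b"
   have "x a \<noteq> x b" using x(3)[of a b] ab Dw by blast
   hence "elts (x a) \<noteq> elts (x b)" using hset_eqI by blast
   then obtain u where u: "(u \<in> elts (x a)) \<noteq> (u \<in> elts (x b))" by blast
   hence "u \<in> elts omega" using x(2) by blast
   thus "\<exists>k. (vnat k \<in> elts (x a)) \<noteq> (vnat k \<in> elts (x b))" using u by auto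
  qed
  then obtain m where m: "\<And>a b. a \<in> D ==> b \<in> D ==> (\<And>k. k < m ==> (vnat k \<in> elts (x a)) = (vnat k \<in> elts (x b))) ==> a = b" by blast
  have sep: "b = c" if "b \<in> D" "c \<in> D" and e: "xm b (vnat m) = xm c (vnat m)" for b c
  proof (rule m[OF that(1,2)])
   fix k assume "k < m"
   hence "vnat k \<in> elts (xm d (vnat m)) <-> vnat k \<in> elts (x d)" for d by (simp add: exm)
   thus "(vnat k \<in> elts (x b)) = (vnat k \<in> elts (x c))" using e by metis
  qed
  have fnc: "fn (code q (vnat m))" unfolding fn_def ecode
  proof (intro ballI impI)
   fix y z assume "y \<in> (\<lambda>z. opair (xm (hfst z) (vnat m)) (hsnd z)) ` elts q" "z \<in> (\<lambda>z. opair (xm (hfst z) (vnat m)) (hsnd z)) ` elts q" and e: "hfst y = hfst z"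
   then obtain y' z' where yz: "y' \<in> elts q" "z' \<in> elts q" "y = opair (xm (hfst y') (vnat m)) (hsnd y')" "z = opair (xm (hfst z') (vnat m)) (hsnd z')" by blast
   have "hfst y' = hfst z'" by (rule sep) (use yz e in \<open>simp_all add: D_def\<close>)
   hence "y' = z'" using q(2) yz(1,2) unfolding Fn_eq by blast
   thus "y = z" using yz by simp
  qed
  have "code q (vnat m) \<in> elts (hFin (hprod (hFin omega) (vnat 2)))"
  proof -
   have "opair (xm (hfst z) (vnat m)) (hsnd z) \<in> elts (hprod (hFin omega) (vnat 2))" if z: "z \<in> elts q" for z
   proof -
    obtain b c where "z = opair b (vb c)" by (rule FnD[OF q(2) z])
    moreover have "xm b (vnat m) \<in> elts (hFin omega)" for b
    proof -
     have "finite (elts (xm b (vnat m)))" by (rule finite_subset[of _ "elts (vnat m)"]) (auto simp: exm)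
     moreover have "(xm b (vnat m)) \<sqsubseteq> omega" unfolding exm using x(2)[of b] by blast
     ultimately show ?thesis unfolding elts_hFin[OF omega_inM] mem_Collect_eq by blast
    qed
    ultimately show ?thesis by (simp add: opair_in_hprod del: elts_hprod)
   qed
   moreover have "finite (elts (code q (vnat m)))" using q(2) by (simp add: ecode Fn_def)
   moreover have "hprod (hFin omega) (vnat 2) \<in> M" using FM by simp
   ultimately show ?thesis by (subst elts_hFin) (auto simp: ecode simp del: elts_hprod)
  qed
  hence "opair (vnat n) (opair (vnat m) (code q (vnat m))) \<in> elts Cd" by (simp add: Cd_def opair_in_hprod del: elts_hprod)
  hence "S a (opair (vnat n) (opair (vnat m) (code q (vnat m))))" unfolding S_def using fnc hH[OF a] q(1) by simp
  thus "\<exists>y\<in>M. S a y" using trM[OF Cd] unfolding S_def by blast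
 qed (rule that)
 have "countable_in M w"
 proof (rule cnt_inj[OF wM Cd cCd F(1)])
  fix a assume a: "a \<in> elts w"
  show "F a \<in> elts Cd" using F(2)[OF a] by (simp add: S_def)
  fix b assume b: "b \<in> elts w" and e: "F a = F b"
  show "a = b"
  proof (rule ccontr)
   assume n: "a \<noteq> b"
   define m where "m = hfst (hsnd (F a))"
   obtain q k where q: "H a = opair q (vnat k)" "q \<in> Fn w" using Hq[OF a] by blast
   obtain r l where r: "H b = opair r (vnat l)" "r \<in> Fn w" using Hq[OF b] by blast
   have kl: "hsnd (H a) = hsnd (H b)" using F(2)[OF a] F(2)[OF b] e hH a b unfolding S_def by metis
   have c: "code q m = code r m" "fn (code q m)"
    using F(2)[OF a] F(2)[OF b] e unfolding S_def m_def hH[OF a] hH[OF b] q(1) r(1) hfst_opair by metis+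
   \<comment> \<open>A common coordinate of \<open>q\<close> and \<open>r\<close> gives pairs with
     the same first component in the common code, which is a function; so the bits agree and
     \<open>q\<close> and \<open>r\<close> are compatible.\<close>
   have qr: "hun q r \<in> Fn w"
   proof (rule Fn_hun[OF q(2) r(2)])
    fix d u v assume d: "opair d (vb u) \<in> elts q" "opair d (vb v) \<in> elts r"
    have "opair (xm d m) (vb u) \<in> elts (code q m)" unfolding ecode by (rule image_eqI[OF _ d(1)]) simp
    moreover have "opair (xm d m) (vb v) \<in> elts (code q m)" unfolding c(1) ecode by (rule image_eqI[OF _ d(2)]) simp
    ultimately have "opair (xm d m) (vb u) = opair (xm d m) (vb v)" using c(2) unfolding fn_def by (metis hfst_opair)
    thus "u = v" by simp
   qed
   show False
    by (rule inc[OF a b n kl, of "hun q r"]) (use qr q r in \<open>simp_all add: elts_FN[OF wM] FnL_iff[OF wM]\<close>)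
  qed
 qed
 thus False using w_unc[OF w] by blast
qed

lemma countable_in_ext:
 assumes "x \<in> M" "countable_in M x" "\<And>y. y \<in> M ==> y \<in> M'"
 shows "countable_in M' x"
 using assms unfolding countable_in_def by blast

lemma Fn_omega1:
 assumes w: "is_omega1_in M w" and G: "generic M (Fn w) Fn_le G"
 shows "is_omega1_in (gen_ext M G) w"
proof -
 interpret G: generic_ext M "FN w" "FnL w" G by (rule generic_ext_Fn[OF w_M[OF w] G])
 show ?thesis unfolding is_omega1_in_def
  using Fn_preserves_omega1[OF w G] w_ord[OF w] G.M_sub_N w_M[OF w] countable_in_ext[OF w_mem_M[OF w] w_cnt[OF w]] by blast
qed

end

section \<open>The almost disjoint family coded by \<open>\<omega>\<^sub>1\<close> Cohen reals\<close>

lemma finite_rel: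
 assumes "finite A" "\<And>x. x \<in> S ==> \<exists>a\<in>A. R a x" "\<And>a x y. x \<in> S ==> y \<in> S ==> R a x ==> R a y ==> x = y"
 shows "finite S"
proof -
 obtain f where f: "\<And>x. x \<in> S ==> f x \<in> A \<and> R (f x) x" using assms(2) by metis
 have "inj_on f S" by (rule inj_onI) (metis f assms(3))
 moreover have "f ` S \<subseteq> A" using f by blast
 ultimately show ?thesis using assms(1) finite_subset finite_imageD by blast
qed

lemma (in ctmodel) vb_inM [simp]: "vb b \<in> M"
 unfolding vb_def by (rule vnat_inM)

text \<open>\<open>a\<close> reserves a coordinate for each stream, choice number and node.
  \<open>kk i\<close> is the node that stream \<open>i\<close> watches over, and \<open>bb\<close>
  shows that every node is watched over by streams with indices coming injectively from
  \<open>w\<close>. \<open>E\<close> numbers the predecessors of an index, \<open>tc\<close> the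
  nodes, and \<open>Y\<close> holds the pieces to choose from. By \<open>Y_len\<close> the
  \<open>n\<close>th choice is longer than \<open>n\<close>, so a given node can only be a choice
  with small number.\<close>

locale streams = ctmodel M for M :: "hset set" +
 fixes w a kk bb E tc Y :: hset and g :: "hset set"
 assumes w1: "is_omega1_in M w"
  and par: "a \<in> M" "kk \<in> M" "bb \<in> M" "E \<in> M" "tc \<in> M" "Y \<in> M"
  and a_w: "\<And>i n t. i \<in> elts w ==> n \<in> elts omega ==> t \<in> T ==> ap a (opair i (opair n t)) \<in> elts w"
  and a_inj: "\<And>i n t i' n' t'. i \<in> elts w ==> n \<in> elts omega ==> t \<in> T ==> i' \<in> elts w ==> n' \<in> elts omega ==> t' \<in> T ==>
    ap a (opair i (opair n t)) = ap a (opair i' (opair n' t')) ==> i = i' \<and> n = n' \<and> t = t'"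
  and kk: "\<And>i. i \<in> elts w ==> ap kk i \<in> T"
  and bb: "\<And>j s. j \<in> elts w ==> s \<in> T ==> ap bb (opair j s) \<in> elts w \<and> ap kk (ap bb (opair j s)) = s"
  and bb_inj: "\<And>j j' s. j \<in> elts w ==> j' \<in> elts w ==> s \<in> T ==> ap bb (opair j s) = ap bb (opair j' s) ==> j = j'"
  and E_om: "\<And>i j. i \<in> elts w ==> j \<in> elts i ==> ap (ap E i) j \<in> elts omega"
  and E_inj: "\<And>i j k. i \<in> elts w ==> j \<in> elts i ==> k \<in> elts i ==> ap (ap E i) j = ap (ap E i) k ==> j = k"
  and tc_om: "\<And>t. t \<in> T ==> ap tc t \<in> elts omega"
  and tc_inj: "\<And>t t'. t \<in> T ==> t' \<in> T ==> ap tc t = ap tc t' ==> t = t'"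
  and Y_len: "\<And>s n t. t \<in> T ==> opair s (opair n t) \<in> elts Y ==> n \<in> elts (hdom t)"
  and Y_inf: "\<And>s. s \<in> T ==> \<exists>n0. \<forall>n\<ge>n0. \<forall>m. \<exists>u. m < length u \<and> opair s (opair (vnat n) (str u)) \<in> elts Y"
  and gen: "generic M (Fn w) Fn_le g"
begin

lemma wM: "w \<in> M" by (rule w_M[OF w1])

sublocale g: generic_ext M "FN w" "FnL w" g by (rule generic_ext_Fn[OF wM gen])
sublocale W: ctmodel "gen_ext M g" by (rule g.ctmodel_N)

lemma eP: "elts (FN w) = Fn w" by (rule elts_FN[OF wM])
lemma leP: "opair p q \<in> elts (FnL w) <-> p \<in> Fn w \<and> q \<in> Fn w \<and> q \<sqsubseteq> p" by (rule FnL_iff[OF wM])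
lemma g_Fn: "q \<in> g ==> q \<in> Fn w" using g.G_P eP by simp

definition cd :: "hset => hset => hset => hset" where "cd i n t = ap a (opair i (opair n t))"

definition Yr :: "hset => hset => hset => bool" where "Yr s n t <-> opair s (opair n t) \<in> elts Y"

text \<open>Stream \<open>i\<close> is the part of the generic real read on the coordinates \<open>cd i n t\<close>. Its \<open>n\<close>th choice is the
 first node \<open>t\<close> (in the enumeration \<open>tc\<close>) of the piece \<open>Yr (ap kk i) n\<close> of the tree that carries bit 1;
 \<open>pos\<close> and \<open>neg\<close> say that the condition decides this positively or negatively. In \<open>fx\<close> a choice is kept
 only if no earlier stream \<open>j\<close> with number \<open>ap (ap E i) j\<close> below \<open>n\<close> chooses it too: hence almost disjointness.\<close>
definition pos :: "hset => hset => hset => hset => bool" where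
 "pos q i n t <-> Yr (ap kk i) n t \<and> opair (cd i n t) (vb True) \<in> elts q \<and>
   (\<forall>t'\<in>elts TT. Yr (ap kk i) n t' --> ap tc t' \<in> elts (ap tc t) --> opair (cd i n t') (vb False) \<in> elts q)"

definition neg :: "hset => hset => hset => hset => bool" where
 "neg q i n t <-> \<not> Yr (ap kk i) n t \<or> opair (cd i n t) (vb False) \<in> elts q \<or>
   (\<exists>t'\<in>elts TT. Yr (ap kk i) n t' \<and> ap tc t' \<in> elts (ap tc t) \<and> opair (cd i n t') (vb True) \<in> elts q)"

definition fx :: "hset => hset => hset => bool" where
 "fx q i t <-> (\<exists>n\<in>elts omega. pos q i n t \<and>
   (\<forall>j\<in>elts i. ap (ap E i) j \<in> elts n --> (\<forall>n'\<in>elts (hdom t). neg q j n' t)))"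

definition X :: "hset => hset" where
 "X i = hset_of {t \<in> elts TT. \<exists>q\<in>elts (hset_of g). fx q i t}"

text \<open>The choices of a stream before repetitions of earlier streams are dropped.\<close>

definition C :: "hset => hset set" where
 "C i = {t \<in> T. \<exists>n\<in>elts omega. \<exists>q\<in>g. pos q i n t}"

lemma eX: "elts (X i) = {t \<in> T. \<exists>q\<in>g. fx q i t}"
 unfolding X_def by (subst elts_sep) simp

lemma X_C: "elts (X i) \<subseteq> C i"
 unfolding eX C_def fx_def by blast

lemma X_T: "elts (X i) \<subseteq> T"
 unfolding eX by blast

lemma dfp_fx:
 assumes N: "ctmodel N'" and sub: "\<And>x. x \<in> M ==> x \<in> N'"
 shows "dfp N' (\<lambda>e. fx (e 0) (e 1) (e 2))"
proof -
 interpret N': ctmodel N' by (rule N)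
 show ?thesis unfolding fx_def pos_def neg_def Yr_def cd_def by (intro df par[THEN sub] N'.TT_inM N'.vb_inM omega_inM[THEN sub])
qed

lemma cd_w: "i \<in> elts w ==> n \<in> elts omega ==> t \<in> T ==> cd i n t \<in> elts w"
 unfolding cd_def by (rule a_w)

lemma cd_inj:
 assumes "cd i n t = cd i' n' t'" "i \<in> elts w" "n \<in> elts omega" "t \<in> T" "i' \<in> elts w" "n' \<in> elts omega" "t' \<in> T"
 shows "i = i'" "n = n'" "t = t'"
 using a_inj[OF assms(2-7)] assms(1) unfolding cd_def by simp_all

lemma X_W: "i \<in> elts w ==> X i \<in> g.N"
 unfolding X_def
 by (rule W.inM, intro df W.TT_inM g.G_N g.M_sub_N[OF w_mem_M[OF w1]] W.dfp_app3[OF dfp_fx[OF g.ctmodel_N g.M_sub_N]])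

lemma neg_mono: "neg q i n t ==> q \<sqsubseteq> q' ==> neg q' i n t"
 unfolding neg_def by blast

lemma fin_pred: "t \<in> T ==> finite {t' \<in> T. ap tc t' \<in> elts (ap tc t)}"
proof -
 assume "t \<in> T"
 from tc_om[OF this] obtain k where k: "ap tc t = vnat k" by auto
 show ?thesis
  by (rule finite_rel[where A = "elts (vnat k)" and R = "\<lambda>x t'. x = ap tc t'"]) (use tc_inj k in auto)
qed

lemma fin_E: "i \<in> elts w ==> finite {j \<in> elts i. ap (ap E i) j \<in> elts (vnat k)}"
 by (rule finite_rel[where A = "elts (vnat k)" and R = "\<lambda>x j. x = ap (ap E i) j"]) (use E_inj in auto)

text \<open>If \<open>q\<close> says nothing about the \<open>n\<close>th choice of stream
  \<open>i\<close>, that choice can be set to \<open>t\<close>: bit 1 at \<open>t\<close> and bit 0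
  at the finitely many nodes enumerated before \<open>t\<close>.\<close>

lemma ext_fx:
 assumes q: "q \<in> Fn w" and i: "i \<in> elts w" and n: "n \<in> elts omega" and t: "t \<in> T" "Yr (ap kk i) n t"
  and new: "\<And>t' c. t' \<in> T ==> opair (cd i n t') c \<notin> elts q"
  and ng: "\<And>j n'. j \<in> elts i ==> ap (ap E i) j \<in> elts n ==> n' \<in> elts (hdom t) ==> neg q j n' t"
 shows "\<exists>q'\<in>Fn w. q \<sqsubseteq> q' \<and> fx q' i t"
proof -
 let ?S = "{t' \<in> T. ap tc t' \<in> elts (ap tc t)}"
 define r where "r = hset_of (insert (opair (cd i n t) (vb True)) ((\<lambda>t'. opair (cd i n t') (vb False)) ` ?S))"
 have er: "elts r = insert (opair (cd i n t) (vb True)) ((\<lambda>t'. opair (cd i n t') (vb False)) ` ?S)"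
  unfolding r_def using fin_pred[OF t(1)] by (intro elts_hset_of countable_finite finite.insertI finite_imageI)
 have tS: "t \<notin> ?S" using mem_irrefl by blast
 have r: "r \<in> Fn w"
 proof (rule FnI)
  show "finite (elts r)" unfolding er using fin_pred[OF t(1)] by simp
  show "\<exists>x\<in>elts w. \<exists>b. z = opair x (vb b)" if "z \<in> elts r" for z
   using that cd_w[OF i n] t(1) unfolding er by blast
  fix x b c assume "opair x (vb b) \<in> elts r" "opair x (vb c) \<in> elts r"
  moreover have "cd i n t \<noteq> cd i n t'" if "t' \<in> ?S" for t' using cd_inj(3)[OF _ i n t(1) i n, of t'] tS that by blast
  ultimately show "b = c" unfolding er by auto
 qed
 have q': "hun q r \<in> Fn w"
 proof (rule Fn_hun[OF q r])
  fix x b c assume x: "opair x (vb b) \<in> elts q" "opair x (vb c) \<in> elts r"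
  then obtain t' where "t' \<in> T" "x = cd i n t'" using t(1) unfolding er by auto
  thus "b = c" using new x(1) by blast
 qed
 have "fx (hun q r) i t" unfolding fx_def
 proof (intro bexI[OF _ n] conjI ballI impI)
  show "pos (hun q r) i n t" unfolding pos_def using t(2) by (auto simp: er)
  fix j n' assume "j \<in> elts i" "ap (ap E i) j \<in> elts n" "n' \<in> elts (hdom t)"
  from ng[OF this] show "neg (hun q r) j n' t" by (rule neg_mono) simp
 qed
 thus ?thesis using q' by (intro bexI[of _ "hun q r"]) simp_all
qed

lemma fresh_n:
 assumes q: "q \<in> Fn w" and i: "i \<in> elts w"
 shows "\<exists>m. \<forall>n\<ge>m. \<forall>t\<in>T. \<forall>c. opair (cd i (vnat n) t) c \<notin> elts q"
proof -
 let ?S = "{n. \<exists>t\<in>T. \<exists>c. opair (cd i (vnat n) t) c \<in> elts q}"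
 have "finite ?S"
 proof (rule finite_rel[where A = "elts q" and R = "\<lambda>z n. \<exists>t\<in>T. hfst z = cd i (vnat n) t"])
  show "finite (elts q)" using q by (simp add: Fn_def)
  show "\<exists>z\<in>elts q. \<exists>t\<in>T. hfst z = cd i (vnat n) t" if "n \<in> ?S" for n using that by force
  fix z n m assume "\<exists>t\<in>T. hfst z = cd i (vnat n) t" "\<exists>t\<in>T. hfst z = cd i (vnat m) t"
  then obtain t t' where "t \<in> T" "t' \<in> T" "cd i (vnat n) t = cd i (vnat m) t'" by metis
  from cd_inj(2)[OF this(3) i _ this(1) i _ this(2)] show "n = m" by simp
 qed
 then obtain m where "\<forall>n\<in>?S. n < m" using finite_nat_set_iff_bounded by blast
 thus ?thesis by (intro exI[of _ m]) force
qed

lemma fresh_t: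
 assumes q: "q \<in> Fn w"
 shows "\<exists>m. \<forall>u. m \<le> length u --> (\<forall>j\<in>elts w. \<forall>n\<in>elts omega. \<forall>c. opair (cd j n (str u)) c \<notin> elts q)"
proof -
 let ?S = "{u. \<exists>j\<in>elts w. \<exists>n\<in>elts omega. \<exists>c. opair (cd j n (str u)) c \<in> elts q}"
 have "finite ?S"
 proof (rule finite_rel[where A = "elts q" and R = "\<lambda>z u. \<exists>j\<in>elts w. \<exists>n\<in>elts omega. hfst z = cd j n (str u)"])
  show "finite (elts q)" using q by (simp add: Fn_def)
  show "\<exists>z\<in>elts q. \<exists>j\<in>elts w. \<exists>n\<in>elts omega. hfst z = cd j n (str u)" if "u \<in> ?S" for u
  proof -
   obtain j n c where "j \<in> elts w" "n \<in> elts omega" "opair (cd j n (str u)) c \<in> elts q" using \<open>u \<in> ?S\<close> by blast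
   thus ?thesis by (intro bexI[of _ "opair (cd j n (str u)) c"] bexI[of _ j] bexI[of _ n]) simp_all
  qed
  fix z u v assume "\<exists>j\<in>elts w. \<exists>n\<in>elts omega. hfst z = cd j n (str u)" "\<exists>j\<in>elts w. \<exists>n\<in>elts omega. hfst z = cd j n (str v)"
  then obtain j n j' n' where "j \<in> elts w" "n \<in> elts omega" "j' \<in> elts w" "n' \<in> elts omega" "cd j n (str u) = cd j' n' (str v)" by metis
  from cd_inj(3)[OF this(5) this(1,2) _ this(3,4)] show "u = v" by simp
 qed
 hence "finite (length ` ?S)" by simp
 then obtain m where "\<forall>n\<in>length ` ?S. n < m" using finite_nat_set_iff_bounded by blast
 thus ?thesis by (intro exI[of _ m]) force
qed

text \<open>Freshness is needed twice: in the choice number, to make \<open>u\<close> the next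
  choice of \<open>i\<close>, and in the node, so that the relevant earlier streams can be told not
  to choose \<open>u\<close>.\<close>

lemma dense_fx:
 assumes q: "q \<in> Fn w" and i: "i \<in> elts w"
 shows "\<exists>q'\<in>Fn w. q \<sqsubseteq> q' \<and> (\<exists>t\<in>T. vnat m \<in> elts (hdom t) \<and> fx q' i t)"
proof -
 obtain n0 where n0: "\<And>n m. n0 \<le> n ==> \<exists>u. m < length u \<and> Yr (ap kk i) (vnat n) (str u)"
  using Y_inf[OF kk[OF i]] unfolding Yr_def by blast
 obtain n1 where n1: "\<And>n t c. n1 \<le> n ==> t \<in> T ==> opair (cd i (vnat n) t) c \<notin> elts q" using fresh_n[OF q i] by blast
 obtain k where k: "\<And>u j n c. k \<le> length u ==> j \<in> elts w ==> n \<in> elts omega ==> opair (cd j n (str u)) c \<notin> elts q"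
  using fresh_t[OF q] by blast
 define n where "n = max n0 n1"
 obtain u where u: "max k m < length u" "Yr (ap kk i) (vnat n) (str u)" using n0[of n "max k m"] by (auto simp: n_def)
 let ?J = "{j \<in> elts i. ap (ap E i) j \<in> elts (vnat n)}"
 have Jw: "j \<in> elts w" if "j \<in> ?J" for j using is_ord_trans[OF w_ord[OF w1] i] that by blast
 \<comment> \<open>Bit 0 at \<open>u\<close> in all relevant earlier streams. Choice numbers below
   the length of \<open>u\<close> are enough, since by \<open>Y_len\<close> no later choice is
   \<open>u\<close>.\<close>
 let ?R = "(\<lambda>(j, n'). opair (cd j (vnat n') (str u)) (vb False)) ` (?J \<times> {..<length u})"
 have fR: "finite ?R" by (intro finite_imageI finite_cartesian_product fin_E[OF i] finite_lessThan)
 define r where "r = hset_of ?R"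
 have er: "elts r = ?R" unfolding r_def by (rule elts_hset_of[OF countable_finite[OF fR]])
 have r: "r \<in> Fn w"
 proof (rule FnI)
  show "finite (elts r)" unfolding er by (rule fR)
  show "\<exists>x\<in>elts w. \<exists>b. z = opair x (vb b)" if "z \<in> elts r" for z
   using that cd_w[OF Jw _ str_in_T] unfolding er by auto
 qed (auto simp: er)
 have qr: "hun q r \<in> Fn w"
 proof (rule Fn_hun[OF q r])
  fix x b c assume x: "opair x (vb b) \<in> elts q" "opair x (vb c) \<in> elts r"
  then obtain j n' where "j \<in> ?J" "x = cd j (vnat n') (str u)" unfolding er by auto
  thus "b = c" using k[OF _ Jw, of u j "vnat n'"] x(1) u(1) by auto
 qed
 have "\<exists>q'\<in>Fn w. hun q r \<sqsubseteq> q' \<and> fx q' i (str u)"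
 proof (rule ext_fx[OF qr i _ _ u(2)])
  fix t' c assume t': "t' \<in> T"
  show "opair (cd i (vnat n) t') c \<notin> elts (hun q r)"
  proof
   assume "opair (cd i (vnat n) t') c \<in> elts (hun q r)"
   hence "opair (cd i (vnat n) t') c \<in> elts r" using n1[OF _ t'] n_def by auto
   then obtain j n' where j: "j \<in> ?J" "cd i (vnat n) t' = cd j (vnat n') (str u)" unfolding er by auto
   from cd_inj(1)[OF j(2) i _ t' Jw[OF j(1)] _ str_in_T] have "i = j" by simp
   thus False using j(1) mem_irrefl by blast
  qed
 next
  fix j n' assume j: "j \<in> elts i" "ap (ap E i) j \<in> elts (vnat n)" "n' \<in> elts (hdom (str u))"
  then obtain l where l: "n' = vnat l" "l < length u" by (auto simp: hdom_str elts_vnat)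
  have "opair (cd j n' (str u)) (vb False) \<in> elts r" unfolding er l(1) by (rule image_eqI[of _ _ "(j, l)"]) (use j l in auto)
  thus "neg (hun q r) j n' (str u)" unfolding neg_def by simp
 qed simp_all
 then obtain q' where "q' \<in> Fn w" "hun q r \<sqsubseteq> q'" "fx q' i (str u)" by blast
 moreover have "vnat m \<in> elts (hdom (str u))" unfolding hdom_str using u(1) by simp
 ultimately show ?thesis using str_in_T[of u] by (intro bexI[of _ q']) auto
qed

lemma X_inf: "i \<in> elts w ==> infinite (elts (X i))"
proof (rule long_infinite[OF X_T])
 fix m assume i: "i \<in> elts w"
 have "\<exists>q\<in>g. \<exists>t\<in>elts TT. vnat m \<in> elts (hdom t) \<and> fx q i t"
 proof (rule g.G_dense)
  show "dfp M (\<lambda>e. \<exists>t\<in>elts TT. vnat m \<in> elts (hdom t) \<and> fx (e 0) i t)"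
   by (intro df TT_inM vnat_inM w_mem_M[OF w1 i] dfp_app3[OF dfp_fx[OF ctmodel_axioms]])
  show "\<exists>q'\<in>elts (FN w). opair q' q \<in> elts (FnL w) \<and> (\<exists>t\<in>elts TT. vnat m \<in> elts (hdom t) \<and> fx q' i t)" if "q \<in> elts (FN w)" for q
   using dense_fx[of q i m] that i unfolding eP leP elts_TT by blast
 qed
 thus "\<exists>t\<in>elts (X i). vnat m \<in> elts (hdom t)" unfolding eX by auto
qed

lemma g_compat: "q \<in> g ==> q' \<in> g ==> opair x b \<in> elts q ==> opair x c \<in> elts q' ==> b = c"
proof -
 assume *: "q \<in> g" "q' \<in> g" "opair x b \<in> elts q" "opair x c \<in> elts q'"
 obtain r where r: "r \<in> g" "opair r q \<in> elts (FnL w)" "opair r q' \<in> elts (FnL w)" using g.G_dir[OF *(1,2)] by blast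
 hence "opair x b \<in> elts r" "opair x c \<in> elts r" using * unfolding leP by blast+
 thus ?thesis using Fn_fun[OF g_Fn[OF r(1)]] by blast
qed

lemma g_bound: "finite S ==> S \<subseteq> g ==> \<exists>r\<in>g. \<forall>q\<in>S. q \<sqsubseteq> r"
proof (induction S rule: finite_induct)
 case empty
 thus ?case using g.G_ne by blast
next
 case (insert q S)
 then obtain r where r: "r \<in> g" "\<forall>q\<in>S. q \<sqsubseteq> r" "q \<in> g" by blast
 obtain r' where "r' \<in> g" "opair r' r \<in> elts (FnL w)" "opair r' q \<in> elts (FnL w)" using g.G_dir[OF r(1,3)] by blast
 thus ?case using r(2) unfolding leP by (intro bexI[of _ r']) auto
qed

lemma g_total: "x \<in> elts w ==> \<exists>q\<in>g. \<exists>b. opair x (vb b) \<in> elts q"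
proof -
 assume x: "x \<in> elts w"
 have "\<exists>q\<in>g. opair x (vb True) \<in> elts q \<or> opair x (vb False) \<in> elts q"
 proof (rule g.G_dense)
  show "dfp M (\<lambda>e. opair x (vb True) \<in> elts (e 0) \<or> opair x (vb False) \<in> elts (e 0))"
   by (intro df w_mem_M[OF w1 x] vb_inM)
  fix p assume "p \<in> elts (FN w)"
  hence p: "p \<in> Fn w" by (simp add: eP)
  show "\<exists>q\<in>elts (FN w). opair q p \<in> elts (FnL w) \<and> (opair x (vb True) \<in> elts q \<or> opair x (vb False) \<in> elts q)"
  proof (cases "\<exists>b. opair x (vb b) \<in> elts p")
   case True
   then obtain b where "opair x (vb b) \<in> elts p" by blast
   thus ?thesis using p unfolding eP leP by (intro bexI[of _ p]) (cases b, auto)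
  next
   case False
   have "hset_of {opair x (vb True)} \<in> Fn w" by (rule FnI) (use x in auto)
   hence "hun p (hset_of {opair x (vb True)}) \<in> Fn w" by (rule Fn_hun[OF p]) (use False in auto)
   thus ?thesis using p unfolding eP leP by (intro bexI[of _ "hun p (hset_of {opair x (vb True)})"]) auto
  qed
 qed
 thus ?thesis by blast
qed

text \<open>Whether \<open>t\<close> is chosen depends on the bits at \<open>t\<close> and at the
  finitely many nodes enumerated before it, and finitely many conditions of \<open>g\<close> have a
  common extension in \<open>g\<close>.\<close>

lemma decide:
 assumes i: "i \<in> elts w" and n: "n \<in> elts omega" and t: "t \<in> T" and np: "\<And>q. q \<in> g ==> \<not> pos q i n t"
 shows "\<exists>q\<in>g. neg q i n t"
proof (rule ccontr)
 assume c: "\<not> ?thesis"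
 have Y: "Yr (ap kk i) n t" using c g.G_ne unfolding neg_def by blast
 let ?S = "{t' \<in> T. ap tc t' \<in> elts (ap tc t) \<and> Yr (ap kk i) n t'}"
 have "\<exists>q\<in>g. opair (cd i n t') (vb False) \<in> elts q" if t': "t' \<in> ?S" for t'
 proof -
  have T': "t' \<in> T" "ap tc t' \<in> elts (ap tc t)" "Yr (ap kk i) n t'" using t' by simp_all
  from g_total[OF cd_w[OF i n T'(1)]] obtain q b where q: "q \<in> g" "opair (cd i n t') (vb b) \<in> elts q" by (elim bexE exE)
  have "\<not> b"
  proof
   assume b
   hence "opair (cd i n t') (vb True) \<in> elts q" using q(2) by simp
   hence "neg q i n t" unfolding neg_def using T' by auto
   thus False using c q(1) by blast
  qed
  thus ?thesis using q by auto
 qed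
 then obtain h where h: "\<And>t'. t' \<in> ?S ==> h t' \<in> g \<and> opair (cd i n t') (vb False) \<in> elts (h t')" by metis
 from g_total[OF cd_w[OF i n t]] obtain q b where q: "q \<in> g" "opair (cd i n t) (vb b) \<in> elts q" by (elim bexE exE)
 have b: "b"
 proof (rule ccontr)
  assume "\<not> b"
  hence "neg q i n t" unfolding neg_def using q(2) by simp
  thus False using c q(1) by blast
 qed
 have "finite ?S" by (rule finite_subset[OF _ fin_pred[OF t]]) blast
 then obtain r where r: "r \<in> g" "\<forall>q'\<in>insert q (h ` ?S). q' \<sqsubseteq> r" using g_bound[of "insert q (h ` ?S)"] h q(1) by blast
 have "pos r i n t" unfolding pos_def
 proof (intro conjI ballI impI)
  show "opair (cd i n t) (vb True) \<in> elts r" using q(2) b r(2) by auto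
  fix t' assume "t' \<in> elts TT" "Yr (ap kk i) n t'" "ap tc t' \<in> elts (ap tc t)"
  hence "t' \<in> ?S" by simp
  thus "opair (cd i n t') (vb False) \<in> elts r" using h r(2) by blast
 qed (rule Y)
 thus False using np r(1) by blast
qed

lemma pos_neg: "q \<in> g ==> q' \<in> g ==> pos q i n t ==> \<not> neg q' i n t"
proof
 assume *: "q \<in> g" "q' \<in> g" "pos q i n t" "neg q' i n t"
 have g: "\<not> (opair x (vb b) \<in> elts q \<and> opair x (vb (\<not> b)) \<in> elts q')" for x b
  using g_compat[OF *(1,2), of x "vb b" "vb (\<not> b)"] by auto
 show False using *(3,4) g[of _ True] g[of _ False] unfolding pos_def neg_def by auto
qed

lemma pos_unique:
 assumes q: "q \<in> g" "q' \<in> g" and t: "t \<in> T" "t' \<in> T" and p: "pos q i n t" "pos q' i n t'"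
 shows "t = t'"
proof -
 have g: "\<not> (opair x (vb b) \<in> elts q \<and> opair x (vb (\<not> b)) \<in> elts q')" for x b
  using g_compat[OF q, of x "vb b" "vb (\<not> b)"] by auto
 obtain k l where kl: "ap tc t = vnat k" "ap tc t' = vnat l" using tc_om[OF t(1)] tc_om[OF t(2)] by auto
 have "\<not> k < l"
 proof
  assume "k < l"
  hence "ap tc t \<in> elts (ap tc t')" unfolding kl by simp
  hence "opair (cd i n t) (vb False) \<in> elts q'" using p t(1) unfolding pos_def by simp
  thus False using p(1) g[of "cd i n t" True] unfolding pos_def by simp
 qed
 moreover have "\<not> l < k"
 proof
  assume "l < k"
  hence "ap tc t' \<in> elts (ap tc t)" unfolding kl by simp
  hence "opair (cd i n t') (vb False) \<in> elts q" using p t(2) unfolding pos_def by simp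
  thus False using p(2) g[of "cd i n t'" False] unfolding pos_def by simp
 qed
 ultimately show ?thesis using tc_inj[OF t] kl by simp
qed

lemma C_E:
 assumes "t \<in> C i"
 obtains n q where "t \<in> T" "n \<in> elts omega" "q \<in> g" "pos q i n t" "Yr (ap kk i) n t" "n \<in> elts (hdom t)"
 using assms Y_len unfolding C_def pos_def Yr_def by blast

lemma C_fin: "finite {t \<in> C i. \<exists>n\<in>elts (vnat k). \<exists>q\<in>g. pos q i n t}"
 by (rule finite_rel[where A = "elts (vnat k)" and R = "\<lambda>n t. \<exists>q\<in>g. pos q i n t"]) (auto simp: C_def intro: pos_unique)

text \<open>If stream \<open>i\<close> makes a choice with number above that of \<open>j\<close>
  under \<open>E i\<close>, it is kept only if \<open>j\<close> never makes the same choice. So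
  common elements come from the finitely many earlier choice numbers.\<close>

lemma X_ad:
 assumes i: "i \<in> elts w" and j: "j \<in> elts i"
 shows "finite (elts (X i) \<inter> elts (X j))"
proof -
 obtain k where k: "ap (ap E i) j = vnat k" using E_om[OF i j] by auto
 have "t \<in> {t \<in> C i. \<exists>n\<in>elts (vnat (Suc k)). \<exists>q\<in>g. pos q i n t}" if t: "t \<in> elts (X i)" "t \<in> elts (X j)" for t
 proof -
  obtain q n where q: "q \<in> g" "n \<in> elts omega" "pos q i n t"
   "\<And>n'. vnat k \<in> elts n ==> n' \<in> elts (hdom t) ==> neg q j n' t"
   using t(1) j k unfolding eX fx_def by force
  obtain m q' where m: "q' \<in> g" "pos q' j m t" "m \<in> elts (hdom t)" using t(2) X_C[of j] C_E[of t j] by blast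
  obtain l where l: "n = vnat l" using q(2) by auto
  have "\<not> k < l" using pos_neg[OF m(1) q(1) m(2)] q(4)[OF _ m(3)] l by auto
  hence "n \<in> elts (vnat (Suc k))" using l by (simp only: elts_vnat) auto
  thus ?thesis using t(1) X_C[of i] q by blast
 qed
 thus ?thesis by (intro finite_subset[OF _ C_fin[of i "Suc k"]]) blast
qed

lemma X_ad2: "i \<in> elts w ==> j \<in> elts w ==> i \<noteq> j ==> finite (elts (X i) \<inter> elts (X j))"
 using X_ad[of i j] X_ad[of j i] is_ord_linear[OF is_ord_mem[OF w_ord[OF w1]] is_ord_mem[OF w_ord[OF w1]], of i j]
 by (auto simp: Int_commute)

lemma X_inj: "i \<in> elts w ==> j \<in> elts w ==> X i = X j ==> i = j"
 using X_ad2[of i j] X_inf[of i] by fastforce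

section \<open>The family in the Cohen extension and its hitting property\<close>

definition F :: hset where "F = hset_of (X ` elts w)"

lemma elts_F: "elts F = X ` elts w" by (simp add: F_def)

lemma dft_X: "dft g.N (\<lambda>e. X (e 0))"
 unfolding X_def by (intro df W.TT_inM g.G_N W.dfp_app3[OF dfp_fx[OF g.ctmodel_N g.M_sub_N]])

lemma F_W: "F \<in> g.N"
 unfolding F_def by (rule W.inM, intro df W.dft_app1[OF dft_X] g.M_sub_N wM)

lemma F_ad: "ad_family F"
 unfolding ad_family_def elts_F
proof (intro conjI ballI impI)
 fix x y assume "x \<in> X ` elts w" "y \<in> X ` elts w" "x \<noteq> y"
 thus "finite (elts x \<inter> elts y)" using X_ad2 by blast
qed (use X_T X_inf in blast)+

lemma F_aleph1: "card_aleph1_in g.N F"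
 unfolding card_aleph1_in_def equipotent_in_def
proof (intro exI[of _ w] conjI bexI[of _ "hgraph w X"])
 show "is_omega1_in g.N w" by (rule Fn_omega1[OF w1 gen])
 show "hgraph w X \<in> g.N" by (rule W.inM, intro df W.dft_app1[OF dft_X] g.M_sub_N wM)
 show f: "is_fun (hgraph w X) (elts w) (elts F)" by (rule is_fun_hgraph) (simp add: elts_F)
 have "app (hgraph w X) i = X i" if "i \<in> elts w" for i using is_fun_ap[OF f that] that by simp
 thus "bij_betw (app (hgraph w X)) (elts w) (elts F)"
  unfolding bij_betw_def elts_F inj_on_def using X_inj by auto
qed

text \<open>Suppose all intersections are finite. Countably many Cohen conditions decide the
  elements of \<open>A\<close>, so some stream watching over \<open>s\<close> has no coordinate in
  them. On this stream a condition of \<open>g\<close> can be altered without harming these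
  decisions, so as to choose an element of \<open>A\<close> outside the supposed finite
  intersection. The hypothesis \<open>big\<close> provides one that the finitely many competing
  streams leave alone.\<close>

lemma hitting:
 assumes PL: "P \<in> M" "L \<in> M" "poset (elts P) (order_of L)" and ccc: "ccc_in g.N (elts P) (order_of L)"
  and G: "generic g.N (elts P) (order_of L) G"
  and A: "A \<in> gen_ext g.N G" "elts A \<subseteq> T" and s: "s \<in> T"
  and big: "\<And>n J. n0 \<le> n ==> finite J ==> J \<subseteq> elts w ==> infinite ({t \<in> elts A. Yr s (vnat n) t} - (\<Union>j\<in>J. C j))"
 shows "\<exists>i\<in>elts w. infinite (elts A \<inter> elts (X i))"
proof (rule ccontr)
 assume nh: "\<not> ?thesis"
 interpret G: generic_ext g.N P L G
  by (unfold_locales) (use PL g.M_sub_N G in auto)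
 interpret U: ctmodel "G.N" by (rule G.ctmodel_N)
 have WU: "x \<in> G.N" if "x \<in> M" for x by (rule G.M_sub_N[OF g.M_sub_N[OF that]])
 obtain N1 where N1: "N1 \<in> g.N" "\<And>t. t \<in> elts TT ==> t \<in> elts A <-> (\<exists>p\<in>G. opair p t \<in> elts N1)"
  "\<And>p t. opair p t \<in> elts N1 ==> p \<in> elts P \<and> t \<in> elts TT"
  "\<And>p q t. opair p t \<in> elts N1 ==> q \<in> elts P ==> G.le q p ==> opair q t \<in> elts N1"
  by (rule G.nice_name[OF A(1) W.TT_inM]) (rule that)
 have XM: "hprod P TT \<in> M" using PL(1) by simp
 obtain N2 where N2: "N2 \<in> M" "\<And>z. z \<in> elts (hprod P TT) ==> z \<in> elts N1 <-> (\<exists>q\<in>g. opair q z \<in> elts N2)"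
  "\<And>q z. opair q z \<in> elts N2 ==> q \<in> elts (FN w) \<and> z \<in> elts (hprod P TT)"
  "\<And>p q z. opair p z \<in> elts N2 ==> q \<in> elts (FN w) ==> opair q p \<in> elts (FnL w) ==> opair q z \<in> elts N2"
  by (rule g.nice_name[OF N1(1) XM]) (rule that)
 \<comment> \<open>A relation in \<open>V\<close> for the two-step name: \<open>q\<close> forces
   that a condition weaker than or equal to \<open>p\<close> puts \<open>t\<close> into
   \<open>A\<close>. Passing to weaker conditions makes it closed downwards in
   \<open>p\<close>.\<close>
 define R where "R q p t <-> (\<exists>p'\<in>elts P. opair p p' \<in> elts L \<and> opair q (opair p' t) \<in> elts N2)" for q p t
 have RN1: "opair p t \<in> elts N1" if "q \<in> g" "p \<in> elts P" "t \<in> T" and h: "R q p t" for q p t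
 proof -
  obtain p' where p': "p' \<in> elts P" "opair p p' \<in> elts L" "opair q (opair p' t) \<in> elts N2" using h unfolding R_def by blast
  have "opair p' t \<in> elts N1" using N2(2)[of "opair p' t"] p' that(1,3) by (auto simp: opair_in_hprod simp del: elts_hprod)
  thus ?thesis by (rule N1(4)[OF _ that(2) p'(2)])
 qed
 \<comment> \<open>First \<open>p0\<close> excludes common elements outside \<open>S\<close> over
   the Cohen extension. Since \<open>P\<close> lies in \<open>V\<close> and \<open>S\<close> is
   finite, both \<open>p0\<close> and \<open>S\<close> are in \<open>V\<close>, so this can in turn
   be secured by a condition \<open>q0\<close> of \<open>g\<close>.\<close>
 have key: "\<exists>q0\<in>g. \<exists>p0\<in>G. \<exists>S. finite S \<and> (\<forall>q\<in>Fn w. q0 \<sqsubseteq> q --> (\<forall>p\<in>elts P. opair p p0 \<in> elts L -->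
   (\<forall>t\<in>T - S. \<not> (R q p t \<and> fx q i t))))" if i: "i \<in> elts w" for i
 proof -
  define S where "S = hset_of (elts A \<inter> elts (X i))"
  have fin: "finite (elts A \<inter> elts (X i))" using nh i by blast
  have eS: "elts S = elts A \<inter> elts (X i)" unfolding S_def by simp
  have SM: "S \<in> M" using finite_inM[of "elts S"] fin eS trM[OF TT_inM] A(2) by (metis Int_iff elts_TT hset_of_elts subset_iff)
  have iM: "i \<in> M" by (rule w_mem_M[OF w1 i])
  define Q1 where "Q1 p <-> (\<exists>t\<in>elts TT. t \<notin> elts S \<and> t \<in> elts (X i) \<and> opair p t \<in> elts N1)" for p
  have "\<exists>p\<in>G. Q1 p \<or> (\<forall>p'\<in>elts P. opair p' p \<in> elts L --> \<not> Q1 p')"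
  proof (rule G.G_dense)
   show "dfp g.N (\<lambda>e. Q1 (e 0) \<or> (\<forall>p'\<in>elts P. opair p' (e 0) \<in> elts L --> \<not> Q1 p'))"
    unfolding Q1_def by (intro df W.TT_inM g.M_sub_N SM PL N1(1) X_W i)
   show "\<exists>q\<in>elts P. G.le q p \<and> (Q1 q \<or> (\<forall>p'\<in>elts P. opair p' q \<in> elts L --> \<not> Q1 p'))" if "p \<in> elts P" for p
    using G.le_refl[OF that] that by blast
  qed
  then obtain p0 where p0: "p0 \<in> G" "Q1 p0 \<or> (\<forall>p'\<in>elts P. opair p' p0 \<in> elts L --> \<not> Q1 p')" by blast
  have "\<not> Q1 p0" using N1(2) p0(1) eS unfolding Q1_def by blast
  hence p0': "\<And>p'. p' \<in> elts P ==> opair p' p0 \<in> elts L ==> \<not> Q1 p'" using p0(2) by blast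
  have p0M: "p0 \<in> M" by (rule trM[OF PL(1) G.G_P[OF p0(1)]])
  define Q2 where "Q2 q <-> (\<exists>p\<in>elts P. opair p p0 \<in> elts L \<and> (\<exists>t\<in>elts TT. t \<notin> elts S \<and> R q p t \<and> fx q i t))" for q
  have "\<exists>q\<in>g. Q2 q \<or> (\<forall>q'\<in>elts (FN w). opair q' q \<in> elts (FnL w) --> \<not> Q2 q')"
  proof (rule g.G_dense)
   show "dfp M (\<lambda>e. Q2 (e 0) \<or> (\<forall>q'\<in>elts (FN w). opair q' (e 0) \<in> elts (FnL w) --> \<not> Q2 q'))"
    unfolding Q2_def R_def by (intro df TT_inM SM PL wM FnL_inM N2(1) p0M iM dfp_app3[OF dfp_fx[OF ctmodel_axioms]])
   show "\<exists>q\<in>elts (FN w). opair q p \<in> elts (FnL w) \<and> (Q2 q \<or> (\<forall>q'\<in>elts (FN w). opair q' q \<in> elts (FnL w) --> \<not> Q2 q'))"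
    if "p \<in> elts (FN w)" for p
    using g.le_refl[OF that] g.le_trans that by (meson leP)
  qed
  then obtain q0 where q0: "q0 \<in> g" "Q2 q0 \<or> (\<forall>q'\<in>elts (FN w). opair q' q0 \<in> elts (FnL w) --> \<not> Q2 q')" by blast
  have nQ2: "\<not> Q2 q0"
  proof
   assume "Q2 q0"
   then obtain p t where p: "p \<in> elts P" "opair p p0 \<in> elts L" "t \<in> T" "t \<notin> elts S" "R q0 p t" "fx q0 i t"
    unfolding Q2_def elts_TT by blast
   have "t \<in> elts (X i)" unfolding eX using p q0(1) by blast
   hence "Q1 p" unfolding Q1_def elts_TT using RN1[OF q0(1) p(1,3,5)] p by blast
   thus False using p0'[OF p(1,2)] by blast
  qed
  show ?thesis
  proof (intro bexI[OF _ q0(1)] bexI[OF _ p0(1)] exI[of _ "elts S"] conjI ballI impI)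
   show "finite (elts S)" using fin eS by simp
   fix q p t assume *: "q \<in> Fn w" "q0 \<sqsubseteq> q" "p \<in> elts P" "opair p p0 \<in> elts L" "t \<in> T - elts S"
   have "\<not> Q2 q" using q0 nQ2 * g_Fn[OF q0(1)] unfolding eP leP by blast
   thus "\<not> (R q p t \<and> fx q i t)" unfolding Q2_def elts_TT using * by blast
  qed
 qed
 have gU: "hset_of g \<in> G.N" by (rule G.M_sub_N[OF g.G_N])
 \<comment> \<open>For every \<open>t\<close> in \<open>A\<close> one Cohen condition in
   \<open>g\<close> that puts it there, chosen in the final extension.\<close>
 obtain H where H: "hgraph A H \<in> G.N"
  "\<And>t. t \<in> elts A ==> H t \<in> elts (hset_of g) \<and> (\<exists>p\<in>elts (hset_of G). opair (H t) (opair p t) \<in> elts N2)"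
 proof (rule U.uniformize[where R = "\<lambda>t r. r \<in> elts (hset_of g) \<and> (\<exists>p\<in>elts (hset_of G). opair r (opair p t) \<in> elts N2)", OF _ A(1)])
  show "dfp G.N (\<lambda>e. e 1 \<in> elts (hset_of g) \<and> (\<exists>p\<in>elts (hset_of G). opair (e 1) (opair p (e 0)) \<in> elts N2))"
   by (intro df gU G.G_N WU N2(1))
  fix t assume t: "t \<in> elts A"
  then obtain p where p: "p \<in> G" "opair p t \<in> elts N1" using N1(2) A(2) by auto
  have "opair p t \<in> elts (hprod P TT)" using N1(3)[OF p(2)] by (simp add: opair_in_hprod del: elts_hprod)
  from N2(2)[OF this] obtain r where r: "r \<in> g" "opair r (opair p t) \<in> elts N2" using p by blast
  have "r \<in> G.N" by (rule U.trM[OF gU]) (simp add: r)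
  thus "\<exists>r\<in>G.N. r \<in> elts (hset_of g) \<and> (\<exists>p\<in>elts (hset_of G). opair r (opair p t) \<in> elts N2)"
   using r p(1) by (intro bexI[of _ r]) auto
 qed (rule that)
 define D where "D = hset_of (\<Union>t\<in>elts A. elts (ap (hgraph A H) t))"
 have eD: "elts D = (\<Union>t\<in>elts A. elts (H t))" unfolding D_def by (subst elts_hset_of) auto
 have DU: "D \<in> G.N" unfolding D_def by (rule U.inM, intro df H(1) A(1))
 have Hg: "H t \<in> g" if "t \<in> elts A" for t using H(2)[OF that] by simp
 have cA: "countable_in G.N A" by (rule U.cnt_subset[OF U.cnt_TT U.TT_inM A(1)]) (simp add: A(2))
 have cD: "countable_in G.N D" unfolding D_def
 proof (rule U.cnt_UN_image[OF A(1) cA])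
  show "dft G.N (\<lambda>e. ap (hgraph A H) (e 0))" by (intro df H(1))
  fix t assume t: "t \<in> elts A"
  show "countable_in G.N (ap (hgraph A H) t)"
  proof (rule U.cnt_finite)
   show "finite (elts (ap (hgraph A H) t))" using g_Fn[OF Hg[OF t]] t by (simp add: Fn_def)
   show "ap (hgraph A H) t \<in> G.N" using U.trM[OF gU, of "H t"] Hg[OF t] t by simp
  qed
 qed
 \<comment> \<open>The indices whose stream at \<open>s\<close> has a coordinate in the support of
   some chosen condition. A coordinate determines its stream, so there are countably many, and as
   \<open>w\<close> is still uncountable one index is left over.\<close>
 define J0 where "J0 = hset_of {j \<in> elts w. \<exists>z\<in>elts D. \<exists>n\<in>elts omega. \<exists>t\<in>elts TT. hfst z = cd (ap bb (opair j s)) n t}"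
 have eJ0: "elts J0 = {j \<in> elts w. \<exists>z\<in>elts D. \<exists>n\<in>elts omega. \<exists>t\<in>elts TT. hfst z = cd (ap bb (opair j s)) n t}"
  unfolding J0_def by (rule elts_sep)
 have sM: "s \<in> M" using trM[OF TT_inM] s by simp
 have J0U: "J0 \<in> G.N" unfolding J0_def cd_def by (rule U.inM, intro df DU U.TT_inM WU wM omega_inM par sM)
 have "countable_in G.N J0"
 proof (rule U.cnt_surj[OF DU cD J0U, where R = "\<lambda>z j. \<exists>n\<in>elts omega. \<exists>t\<in>elts TT. hfst z = cd (ap bb (opair j s)) n t"])
  show "dfp G.N (\<lambda>e. \<exists>n\<in>elts omega. \<exists>t\<in>elts TT. hfst (e 0) = cd (ap bb (opair (e 1) s)) n t)"
   unfolding cd_def by (intro df U.TT_inM WU omega_inM par sM)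
  show "\<exists>z\<in>elts D. \<exists>n\<in>elts omega. \<exists>t\<in>elts TT. hfst z = cd (ap bb (opair j s)) n t" if "j \<in> elts J0" for j
   using that unfolding eJ0 by blast
  fix z j j' assume j: "j \<in> elts J0" "j' \<in> elts J0" "\<exists>n\<in>elts omega. \<exists>t\<in>elts TT. hfst z = cd (ap bb (opair j s)) n t"
   "\<exists>n\<in>elts omega. \<exists>t\<in>elts TT. hfst z = cd (ap bb (opair j' s)) n t"
  hence jw: "j \<in> elts w" "j' \<in> elts w" unfolding eJ0 by blast+
  obtain n t n' t' where "n \<in> elts omega" "t \<in> T" "n' \<in> elts omega" "t' \<in> T"
   "cd (ap bb (opair j s)) n t = cd (ap bb (opair j' s)) n' t'" using j(3,4) unfolding elts_TT by metis
  from cd_inj(1)[OF this(5) _ this(1,2) _ this(3,4)] bb[OF jw(1) s] bb[OF jw(2) s]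
  have "ap bb (opair j s) = ap bb (opair j' s)" by blast
  thus "j = j'" by (rule bb_inj[OF jw s])
 qed
 moreover have "\<not> countable_in G.N w"
  by (rule G.ccc_preserves_uncountable[OF g.M_sub_N[OF wM] _ ccc]) (use Fn_omega1[OF w1 gen] in \<open>simp add: is_omega1_in_def\<close>)
 moreover have "J0 \<sqsubseteq> w" unfolding eJ0 by blast
 ultimately obtain j where j: "j \<in> elts w" "j \<notin> elts J0" by (metis hset_eqI subsetI subset_antisym)
 define i where "i = ap bb (opair j s)"
 have i: "i \<in> elts w" "ap kk i = s" using bb[OF j(1) s] by (simp_all add: i_def)
 have iD: "opair (cd i n t) c \<notin> elts (H t')" if "n \<in> elts omega" "t \<in> T" "t' \<in> elts A" for n t c t'
 proof
  assume "opair (cd i n t) c \<in> elts (H t')"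
  hence "opair (cd i n t) c \<in> elts D" using that unfolding eD by blast
  moreover have "hfst (opair (cd i n t) c) = cd (ap bb (opair j s)) n t" by (simp add: i_def)
  ultimately have "j \<in> elts J0" unfolding eJ0 elts_TT using that j(1) by blast
  thus False using j(2) by blast
 qed
 from key[OF i(1)] obtain q0 p0 S where q0: "q0 \<in> g" "p0 \<in> G" "finite S"
  and no: "\<And>q p t. q \<in> Fn w ==> q0 \<sqsubseteq> q ==> p \<in> elts P ==> opair p p0 \<in> elts L ==> t \<in> T ==> t \<notin> S ==> R q p t ==> fx q i t ==> False"
  by (elim bexE exE conjE) blast
 obtain n1 where n1: "\<And>n t c. n1 \<le> n ==> t \<in> T ==> opair (cd i (vnat n) t) c \<notin> elts q0" using fresh_n[OF g_Fn[OF q0(1)] i(1)] by blast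
 define n where "n = max n0 n1"
 let ?J = "{j \<in> elts i. ap (ap E i) j \<in> elts (vnat n)}"
 have Jw: "j \<in> elts w" if "j \<in> ?J" for j using is_ord_trans[OF w_ord[OF w1] i(1)] that by blast
 have "infinite ({t \<in> elts A. Yr s (vnat n) t} - (\<Union>j\<in>?J. C j))"
  by (rule big) (use Jw fin_E[OF i(1)] in \<open>auto simp: n_def\<close>)
 from Diff_infinite_finite[OF q0(3) this] obtain t where t0: "t \<in> {t \<in> elts A. Yr s (vnat n) t} - (\<Union>j\<in>?J. C j) - S"
  by (metis finite.emptyI ex_in_conv)
 have t: "t \<in> elts A" "Yr s (vnat n) t" "t \<notin> S" using t0 by simp_all
 have t3: "t \<notin> C j" if "j \<in> ?J" for j using t0 that by simp
 have tT: "t \<in> T" using t(1) A(2) by blast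
 obtain p1 where p1: "p1 \<in> G" "opair (H t) (opair p1 t) \<in> elts N2" using H(2)[OF t(1)] by auto
 obtain p where p: "p \<in> G" "opair p p0 \<in> elts L" "opair p p1 \<in> elts L" using G.G_dir[OF q0(2) p1(1)] by blast
 have "\<exists>q\<in>g. neg q j n' t" if j: "j \<in> ?J" and n': "n' \<in> elts omega" for j n'
  by (rule decide[OF Jw[OF j] n' tT]) (use t3[OF j] tT n' in \<open>auto simp: C_def\<close>)
 then obtain h where h: "\<And>j n'. j \<in> ?J ==> n' \<in> elts omega ==> h j n' \<in> g \<and> neg (h j n') j n' t" by metis
 obtain u where u: "t = str u" using tT unfolding T_str by blast
 have hd: "hdom t \<sqsubseteq> omega" "finite (elts (hdom t))" unfolding u hdom_str by (auto simp: elts_vnat)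
 let ?B = "insert q0 (insert (H t) ((\<lambda>(j, n'). h j n') ` (?J \<times> elts (hdom t))))"
 have "finite ?B" using fin_E[OF i(1), of n] hd(2) by simp
 moreover have "?B \<subseteq> g" using q0(1) Hg[OF t(1)] h hd(1) by auto
 ultimately have "\<exists>r\<in>g. \<forall>q\<in>?B. q \<sqsubseteq> r" by (rule g_bound)
 then obtain r where r: "r \<in> g" "\<And>q. q \<in> ?B ==> q \<sqsubseteq> r" by metis
 \<comment> \<open>From a common extension \<open>r\<close> all bits for the \<open>n\<close>th
   choice of \<open>i\<close> are deleted. The conditions \<open>q0\<close>, \<open>H t\<close> and
   the refusals of the other streams have no bits there and stay included, and now that choice can
   be set to \<open>t\<close>.\<close>
 define q1 where "q1 = hset_of {z \<in> elts r. \<forall>t'\<in>T. hfst z \<noteq> cd i (vnat n) t'}"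
 have eq1: "elts q1 = {z \<in> elts r. \<forall>t'\<in>T. hfst z \<noteq> cd i (vnat n) t'}" unfolding q1_def by (rule elts_sep)
 have q1: "q1 \<in> Fn w" by (rule Fn_sub[OF g_Fn[OF r(1)]]) (auto simp: eq1)
 have no_c: "z \<in> elts q1" if z: "z \<in> elts q" and q: "q \<in> Fn w" "q \<sqsubseteq> r" "\<And>t' c. t' \<in> T ==> opair (cd i (vnat n) t') c \<notin> elts q" for q z
 proof -
  obtain x b where zx: "z = opair x (vb b)" by (rule FnD[OF q(1) z])
  show ?thesis unfolding eq1 zx using q(2,3) z zx by auto
 qed
 have "\<exists>q'\<in>Fn w. q1 \<sqsubseteq> q' \<and> fx q' i t"
 proof (rule ext_fx[OF q1 i(1) _ tT])
  show "Yr (ap kk i) (vnat n) t" using t(2) i(2) by simp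
  show "opair (cd i (vnat n) t') c \<notin> elts q1" if "t' \<in> T" for t' c using that by (auto simp: eq1)
  fix j' n' assume j': "j' \<in> elts i" "ap (ap E i) j' \<in> elts (vnat n)" "n' \<in> elts (hdom t)"
  hence jJ: "j' \<in> ?J" and n': "n' \<in> elts omega" using hd(1) by blast+
  have "h j' n' \<in> ?B" by (intro insertI2 image_eqI[of _ _ "(j', n')"]) (use jJ j'(3) in simp_all)
  hence sub: "h j' n' \<sqsubseteq> r" by (rule r(2))
  have keep: "opair (cd j' n' t') c \<in> elts q1" if "t' \<in> T" "opair (cd j' n' t') c \<in> elts (h j' n')" for t' c
  proof -
   have "cd j' n' t' \<noteq> cd i (vnat n) t''" if "t'' \<in> T" for t''
    using cd_inj(1)[OF _ Jw[OF jJ] n' \<open>t' \<in> T\<close> i(1) _ that, of "vnat n"] mem_irrefl[of i] j'(1) by auto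
   thus ?thesis using that sub by (auto simp: eq1)
  qed
  have "neg (h j' n') j' n' t" using h[OF jJ n'] by simp
  thus "neg q1 j' n' t" using keep[OF tT] keep unfolding neg_def elts_TT by (elim disjE bexE conjE) blast+
 qed simp
 then obtain q' where q': "q' \<in> Fn w" "q1 \<sqsubseteq> q'" "fx q' i t" by blast
 have q0q1: "q0 \<sqsubseteq> q1"
  by (rule subsetI, rule no_c[OF _ g_Fn[OF q0(1)] r(2)]) (use n1[of n] in \<open>simp_all add: n_def\<close>)
 have Hq1: "H t \<sqsubseteq> q1"
  by (rule subsetI, rule no_c[OF _ g_Fn[OF Hg[OF t(1)]] r(2)]) (use iD[OF _ _ t(1), of "vnat n"] in simp_all)
 have "opair q' (opair p1 t) \<in> elts N2"
  by (rule N2(4)[OF p1(2)]) (use q' Hq1 g_Fn[OF Hg[OF t(1)]] in \<open>auto simp: eP leP\<close>)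
 hence "R q' p t" unfolding R_def using p(3) G.G_P[OF p1(1)] by blast
 thus False by (rule no[OF q'(1) order_trans[OF q0q1 q'(2)] G.G_P[OF p(1)] p(2) tT t(3) _ q'(3)])
qed

end

section \<open>Part (2): streams choosing nodes in the teeth of a comb\<close>

text \<open>Both kinds of indexing come from \<open>omega1_pairing\<close>, with
  \<open>omega \<times> TT\<close> for coordinates and with \<open>TT\<close> for distributing
  streams over nodes.\<close>

lemma (in ctmodel) streams_exist:
 assumes w: "is_omega1_in M w" and gen: "generic M (Fn w) Fn_le g" and Y: "Y \<in> M"
  and Y_len: "\<And>s n t. t \<in> T ==> opair s (opair n t) \<in> elts Y ==> n \<in> elts (hdom t)"
  and Y_inf: "\<And>s. s \<in> T ==> \<exists>n0. \<forall>n\<ge>n0. \<forall>m. \<exists>u. m < length u \<and> opair s (opair (vnat n) (str u)) \<in> elts Y"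
 shows "\<exists>a kk bb E tc. streams M w a kk bb E tc Y g"
proof -
 have cD: "countable_in M (hprod omega TT)" and DM: "hprod omega TT \<in> M" by (intro cnt_prod cnt_omega cnt_TT) simp_all
 obtain a where a: "a \<in> M" "\<And>i y. i \<in> elts w ==> y \<in> elts (hprod omega TT) ==> ap a (opair i y) \<in> elts w"
  "\<And>i y i' y'. i \<in> elts w ==> y \<in> elts (hprod omega TT) ==> i' \<in> elts w ==> y' \<in> elts (hprod omega TT) ==>
    ap a (opair i y) = ap a (opair i' y') ==> i = i' \<and> y = y'"
  by (rule omega1_pairing[OF w DM cD]) (rule that)
 obtain bb where bb: "bb \<in> M" "\<And>i y. i \<in> elts w ==> y \<in> elts TT ==> ap bb (opair i y) \<in> elts w"
  "\<And>i y i' y'. i \<in> elts w ==> y \<in> elts TT ==> i' \<in> elts w ==> y' \<in> elts TT ==>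
    ap bb (opair i y) = ap bb (opair i' y') ==> i = i' \<and> y = y'"
  by (rule omega1_pairing[OF w TT_inM cnt_TT]) (rule that)
 obtain E where E: "E \<in> M" "\<And>i j. i \<in> elts w ==> j \<in> elts i ==> ap (ap E i) j \<in> elts omega"
  "\<And>i j k. i \<in> elts w ==> j \<in> elts i ==> k \<in> elts i ==> ap (ap E i) j = ap (ap E i) k ==> j = k"
  by (rule omega1_injections[OF w]) (rule that)
 obtain tc where tc: "tc \<in> M" "\<And>y. y \<in> elts TT ==> ap tc y \<in> elts omega"
  "\<And>y z. y \<in> elts TT ==> z \<in> elts TT ==> ap tc y = ap tc z ==> y = z"
  by (rule cntE[OF cnt_TT TT_inM]) (rule that)
 \<comment> \<open>Reads the node off an index in the range of \<open>bb\<close>, where injectivity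
   makes it unique.\<close>
 define R where "R i s <-> s \<in> elts TT \<and> (\<forall>j\<in>elts w. \<forall>s'\<in>elts TT. i = ap bb (opair j s') --> s = s')" for i s
 obtain K where K: "hgraph w K \<in> M" "\<And>i. i \<in> elts w ==> R i (K i)"
 proof (rule uniformize[where R = R, OF _ w_M[OF w]])
  show "dfp M (\<lambda>e. R (e 0) (e 1))" unfolding R_def by (intro df TT_inM w_M[OF w] bb(1))
  fix i assume "i \<in> elts w"
  show "\<exists>s\<in>M. R i s"
  proof (cases "\<exists>j\<in>elts w. \<exists>s\<in>elts TT. i = ap bb (opair j s)")
   case True
   then obtain j s where js: "j \<in> elts w" "s \<in> elts TT" "i = ap bb (opair j s)" by blast
   have "R i s" unfolding R_def
   proof (intro conjI ballI impI js(2))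
    fix j' s' assume "j' \<in> elts w" "s' \<in> elts TT" "i = ap bb (opair j' s')"
    from bb(3)[OF js(1,2) this(1,2)] this(3) js(3) show "s = s'" by simp
   qed
   thus ?thesis using trM[OF TT_inM js(2)] by blast
  next
   case False
   \<comment> \<open>Indices outside the range of \<open>bb\<close> get the root as a
     default.\<close>
   hence "R i (str [])" unfolding R_def using str_in_T by auto
   thus ?thesis using str_inM by blast
  qed
 qed (rule that)
 have mem: "opair n t \<in> elts (hprod omega TT)" if "n \<in> elts omega" "t \<in> T" for n t
  using that by (simp add: opair_in_hprod del: elts_hprod elts_omega)
 have "streams M w a (hgraph w K) bb E tc Y g"
 proof unfold_locales
  show "is_omega1_in M w" "generic M (Fn w) Fn_le g" "Y \<in> M" by (fact w gen Y)+
  show "a \<in> M" "hgraph w K \<in> M" "bb \<in> M" "E \<in> M" "tc \<in> M" by (fact a(1) K(1) bb(1) E(1) tc(1))+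
  show "ap a (opair i (opair n t)) \<in> elts w" if "i \<in> elts w" "n \<in> elts omega" "t \<in> T" for i n t
   by (rule a(2)[OF that(1) mem[OF that(2,3)]])
  show "i = i' \<and> n = n' \<and> t = t'" if "i \<in> elts w" "n \<in> elts omega" "t \<in> T" "i' \<in> elts w" "n' \<in> elts omega" "t' \<in> T"
   "ap a (opair i (opair n t)) = ap a (opair i' (opair n' t'))" for i n t i' n' t'
   using a(3)[OF that(1) mem[OF that(2,3)] that(4) mem[OF that(5,6)] that(7)] by simp
  show "ap (hgraph w K) i \<in> T" if "i \<in> elts w" for i using K(2)[OF that] that by (simp add: R_def)
  show "ap bb (opair j s) \<in> elts w \<and> ap (hgraph w K) (ap bb (opair j s)) = s" if "j \<in> elts w" "s \<in> T" for j s
  proof -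
   have s: "s \<in> elts TT" using that by simp
   note b = bb(2)[OF that(1) s]
   have "K (ap bb (opair j s)) = s" using K(2)[OF b, unfolded R_def, THEN conjunct2, rule_format, OF that(1) s refl] .
   thus ?thesis using b by simp
  qed
  show "j = j'" if "j \<in> elts w" "j' \<in> elts w" "s \<in> T" "ap bb (opair j s) = ap bb (opair j' s)" for j j' s
   using bb(3)[OF that(1) _ that(2) _ that(4)] that(3) by simp
  show "ap (ap E i) j \<in> elts omega" if "i \<in> elts w" "j \<in> elts i" for i j by (rule E(2)[OF that])
  show "j = k" if "i \<in> elts w" "j \<in> elts i" "k \<in> elts i" "ap (ap E i) j = ap (ap E i) k" for i j k by (rule E(3)[OF that])
  show "ap tc t \<in> elts omega" if "t \<in> T" for t by (rule tc(2)) (simp add: that)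
  show "t = t'" if "t \<in> T" "t' \<in> T" "ap tc t = ap tc t'" for t t' by (rule tc(3)) (simp_all add: that)
  show "n \<in> elts (hdom t)" if "t \<in> T" "opair s (opair n t) \<in> elts Y" for s n t by (rule Y_len[OF that])
  show "\<exists>n0. \<forall>n\<ge>n0. \<forall>m. \<exists>u. m < length u \<and> opair s (opair (vnat n) (str u)) \<in> elts Y" if "s \<in> T" for s by (rule Y_inf[OF that])
 qed
 thus ?thesis by blast
qed

text \<open>Either no member of the antichain extends \<open>s\<close>, or one does; then no member
  lies above a proper extension of that one, and the cone is moved there.\<close>

lemma dense_remove_antich:
 assumes d: "dense_above s A" and s: "s \<in> T" and C: "antich C"
 shows "\<exists>s'\<in>T. s \<sqsubseteq> s' \<and> dense_above s' (A - C)"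
proof (cases "\<exists>t\<in>C \<inter> T. s \<sqsubseteq> t")
 case True
 then obtain u where u: "str u \<in> C" "s \<sqsubseteq> str u" unfolding T_str by blast
 let ?s = "str (u @ [False])"
 have us: "elts (str u) \<subseteq> elts ?s" by simp
 have "dense_above ?s (A - C)" unfolding dense_above_def
 proof (intro ballI impI)
  fix s' assume s': "s' \<in> T" "elts ?s \<subseteq> elts s'"
  then obtain t where t: "t \<in> A" "t \<in> T" "s' \<sqsubseteq> t" using d u(2) us unfolding dense_above_def by (meson order_trans)
  have st: "elts ?s \<subseteq> elts t" using s'(2) t(3) by (rule order_trans)
  have "t \<notin> C"
  proof
   assume "t \<in> C"
   hence "str u = t" using C u(1) order_trans[OF us st] unfolding antich_def by blast
   with st have "prefix (u @ [False]) u" by (metis str_subset)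
   thus False using prefix_length_le by fastforce
  qed
  thus "\<exists>t\<in>A - C. t \<in> T \<and> s' \<sqsubseteq> t" using t by blast
 qed
 thus ?thesis using order_trans[OF u(2) us] str_in_T by blast
next
 case False
 have "dense_above s (A - C)" unfolding dense_above_def
 proof (intro ballI impI)
  fix s' assume s': "s' \<in> T" "s \<sqsubseteq> s'"
  then obtain t where t: "t \<in> A" "t \<in> T" "s' \<sqsubseteq> t" using d unfolding dense_above_def by blast
  hence "t \<notin> C" using False order_trans[OF s'(2) t(3)] by blast
  thus "\<exists>t\<in>A - C. t \<in> T \<and> s' \<sqsubseteq> t" using t by blast
 qed
 thus ?thesis using s by blast
qed

lemma dense_remove_antichs:
 assumes "finite J" "dense_above s A" "s \<in> T" "\<And>j. j \<in> J ==> antich (C j)"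
 shows "\<exists>s'\<in>T. s \<sqsubseteq> s' \<and> dense_above s' (A - (\<Union>j\<in>J. C j))"
 using assms(1,4)
proof (induction J rule: finite_induct)
 case empty
 thus ?case using assms(2,3) by auto
next
 case (insert j J)
 then obtain s' where s': "s' \<in> T" "s \<sqsubseteq> s'" "dense_above s' (A - (\<Union>j\<in>J. C j))" by auto
 from dense_remove_antich[OF s'(3,1), of "C j"] insert.prems
 obtain s'' where s'': "s'' \<in> T" "s' \<sqsubseteq> s''" "dense_above s'' (A - (\<Union>j\<in>J. C j) - C j)" by auto
 moreover have "A - (\<Union>j\<in>J. C j) - C j = A - (\<Union>j\<in>insert j J. C j)" by blast
 ultimately show ?case using s'(2) by (intro bexI[OF _ s''(1)]) auto
qed

lemma dense_infinite:
 assumes d: "dense_above s A" and s: "s \<in> T"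
 shows "infinite {t \<in> A. s \<sqsubseteq> t}"
proof
 assume fin: "finite {t \<in> A. s \<sqsubseteq> t}"
 obtain v where v: "s = str v" using s unfolding T_str by blast
 have "infinite {t \<in> A. t \<in> T \<and> s \<sqsubseteq> t}"
 proof (rule long_infinite)
  fix m
  have sv: "s \<sqsubseteq> (str (v @ replicate (Suc m) False))" unfolding v by simp
  obtain t where t: "t \<in> A" "t \<in> T" "(str (v @ replicate (Suc m) False)) \<sqsubseteq> t" using d sv unfolding dense_above_def by (meson str_in_T)
  obtain u where u: "t = str u" using t(2) unfolding T_str by blast
  have "m < length u" using t(3) prefix_length_le[of "v @ replicate (Suc m) False" u] unfolding u by simp
  hence "vnat m \<in> elts (hdom t)" unfolding u hdom_str by simp
  thus "\<exists>t\<in>{t \<in> A. t \<in> T \<and> s \<sqsubseteq> t}. vnat m \<in> elts (hdom t)" using t(1,2) order_trans[OF sv t(3)] by blast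
 qed blast
 moreover have "{t \<in> A. t \<in> T \<and> s \<sqsubseteq> t} \<subseteq> {t \<in> A. s \<sqsubseteq> t}" by blast
 ultimately show False using finite_subset[OF _ fin] by simp
qed

context ctmodel
begin

text \<open>A branch is a chain, so it meets an antichain finitely often: the limit set is
  empty.\<close>

lemma antichain_ND:
 assumes X: "X \<in> M" "elts X \<subseteq> T" "infinite (elts X)" "antich (elts X)"
 shows "X \<in> ND_T M"
proof -
 have "finite (branch f \<inter> elts X)" if f: "f \<in> cantor M" for f
 proof -
  have "chain_T (branch f)" unfolding chain_T_def branch_str[OF f]
  proof (intro conjI ballI)
   fix s t assume "s \<in> range (\<lambda>n. str (upto_bits (bits f) n))" "t \<in> range (\<lambda>n. str (upto_bits (bits f) n))"
   then obtain n m where nm: "s = str (upto_bits (bits f) n)" "t = str (upto_bits (bits f) m)" by blast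
   thus "s \<sqsubseteq> t \<or> t \<sqsubseteq> s"
    by (cases "n \<le> m") (simp_all add: prefix_nth)
  qed (auto simp: T_str)
  from antich_chain[OF X(4) this] show ?thesis by (simp add: Int_commute)
 qed
 hence "lim_set M X = {}" unfolding lim_set_def by blast
 hence "closure_in M (lim_set M X) = {}" unfolding closure_in_def by simp
 moreover have "interior_in M {} = {}"
 proof -
  have "f \<in> cyl M (restr f n)" if f: "f \<in> cantor M" for f n
   unfolding cyl_def using f by (simp add: restr_str[OF f] str_sub_cantor[OF f])
  thus ?thesis unfolding interior_in_def by blast
 qed
 ultimately show ?thesis unfolding ND_T_def nowhere_dense_in_def using X by simp
qed

text \<open>The piece with number \<open>n\<close> at \<open>s\<close> is a tooth of the comb along
  \<open>s\<close> continued by zeros: extensions of \<open>s\<close> whose first 1 from the length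
  of \<open>s\<close> on is at \<open>n\<close>.\<close>

definition Y2 :: hset where
 "Y2 = hset_of {z \<in> elts (hprod TT (hprod omega TT)). hfst z \<sqsubseteq> (hsnd (hsnd z)) \<and>
   hfst (hsnd z) \<in> elts (hdom (hsnd (hsnd z))) \<and> hfst (hsnd z) \<notin> elts (hdom (hfst z)) \<and>
   ap (hsnd (hsnd z)) (hfst (hsnd z)) = vb True \<and>
   (\<forall>i\<in>elts (hfst (hsnd z)). i \<notin> elts (hdom (hfst z)) --> ap (hsnd (hsnd z)) i = vb False)}"

lemma Y2_M: "Y2 \<in> M"
 unfolding Y2_def by (rule inM, intro df TT_inM omega_inM vb_inM)

lemma Y2_iff: "opair s (opair n t) \<in> elts Y2 <-> s \<in> T \<and> n \<in> elts omega \<and> t \<in> T \<and> s \<sqsubseteq> t \<and> n \<in> elts (hdom t) \<and>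
  n \<notin> elts (hdom s) \<and> ap t n = vb True \<and> (\<forall>i\<in>elts n. i \<notin> elts (hdom s) --> ap t i = vb False)"
 unfolding Y2_def by (subst elts_sep) (auto simp: opair_in_hprod simp del: elts_hprod elts_hdom)

lemma Y2_cone: "length v \<le> n ==> opair (str v) (opair (vnat n) (str (v @ replicate (n - length v) False @ True # z))) \<in> elts Y2"
 unfolding Y2_iff hdom_str by (auto simp: ap_str nth_append elts_vnat)

lemma part2:
 assumes w: "is_omega1_in M w" and gen: "generic M (Fn w) Fn_le g"
 shows "\<exists>F\<in>gen_ext M g. ad_family F \<and> elts F \<subseteq> ND_T (gen_ext M g) \<and> card_aleph1_in (gen_ext M g) F \<and>
  (\<forall>P\<in>M. \<forall>L\<in>M. \<forall>G. poset (elts P) (order_of L) --> ccc_in (gen_ext M g) (elts P) (order_of L) -->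
    generic (gen_ext M g) (elts P) (order_of L) G -->
    \<not> extends_to_cohen_indestructible_in (gen_ext (gen_ext M g) G) F)"
proof -
 have "\<exists>a kk bb E tc. streams M w a kk bb E tc Y2 g"
 proof (rule streams_exist[OF w gen Y2_M])
  show "n \<in> elts (hdom t)" if "opair s (opair n t) \<in> elts Y2" for s n t using that unfolding Y2_iff by blast
  fix s assume "s \<in> T"
  then obtain v where v: "s = str v" unfolding T_str by blast
  show "\<exists>n0. \<forall>n\<ge>n0. \<forall>m. \<exists>u. m < length u \<and> opair s (opair (vnat n) (str u)) \<in> elts Y2"
  proof (intro exI[of _ "length v"] allI impI)
   fix n m assume n: "length v \<le> n"
   show "\<exists>u. m < length u \<and> opair s (opair (vnat n) (str u)) \<in> elts Y2"
    unfolding v by (rule exI[of _ "v @ replicate (n - length v) False @ True # replicate m False"]) (simp add: Y2_cone[OF n])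
  qed
 qed
 then obtain a kk bb E tc where "streams M w a kk bb E tc Y2 g" by blast
 then interpret S: streams M w a kk bb E tc Y2 g .
 \<comment> \<open>Comparable nodes lie in the same tooth, that is, they are choices with the same
   number, and a choice is unique.\<close>
 have C_antich: "antich (S.C j)" if jw: "j \<in> elts w" for j
  unfolding antich_def
 proof (intro ballI impI)
  fix t t' assume t: "t \<in> S.C j" "t' \<in> S.C j" and sub: "t \<sqsubseteq> t'"
  obtain n q where n: "t \<in> T" "n \<in> elts omega" "q \<in> g" "S.pos q j n t" "S.Yr (ap kk j) n t" by (rule S.C_E[OF t(1)])
  obtain m r where m: "t' \<in> T" "m \<in> elts omega" "r \<in> g" "S.pos r j m t'" "S.Yr (ap kk j) m t'" by (rule S.C_E[OF t(2)])
  obtain u where u: "t = str u" using n(1) unfolding T_str by blast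
  obtain u' where u': "t' = str u'" using m(1) unfolding T_str by blast
  obtain s where s: "ap kk j = str s" using S.kk[OF jw] unfolding T_str by blast
  obtain k l where kl: "n = vnat k" "m = vnat l" using n(2) m(2) by auto
  have p: "prefix u u'" using sub unfolding u u' by simp
  have k: "k < length u" "\<not> k < length s" "u ! k" "\<And>i. i < k ==> \<not> i < length s ==> \<not> u ! i"
   using n(5) unfolding S.Yr_def Y2_iff u s kl hdom_str by (auto simp: ap_str elts_vnat)
  have l: "l < length u'" "\<not> l < length s" "u' ! l" "\<And>i. i < l ==> \<not> i < length s ==> \<not> u' ! i"
   using m(5) unfolding S.Yr_def Y2_iff u' s kl hdom_str by (auto simp: ap_str elts_vnat)
  have "u' ! k" using k(1,3) p unfolding prefix_nth by simp
  hence "\<not> k < l" using l(4)[of k] k(2) by blast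
  moreover have "\<not> l < k"
  proof
   assume lk: "l < k"
   hence "u' ! l = u ! l" using p k(1) unfolding prefix_nth by simp
   thus False using k(4)[OF lk l(2)] l(3) by simp
  qed
  ultimately have "n = m" using kl by simp
  thus "t = t'" using S.pos_unique[OF n(3) m(3) n(1) m(1) n(4)] m(4) by simp
 qed
 have X_antich: "antich (elts (S.X j))" if "j \<in> elts w" for j
  using C_antich[OF that] S.X_C[of j] unfolding antich_def by blast
 show ?thesis
 proof (intro bexI[OF _ S.F_W] conjI S.F_ad S.F_aleph1 ballI allI impI)
  show "elts S.F \<subseteq> ND_T (gen_ext M g)" unfolding S.elts_F
   using S.W.antichain_ND[OF S.X_W S.X_T S.X_inf X_antich] by blast
  fix P L G assume PL: "P \<in> M" "L \<in> M" "poset (elts P) (order_of L)" and ccc: "ccc_in (gen_ext M g) (elts P) (order_of L)"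
   and G: "generic (gen_ext M g) (elts P) (order_of L) G"
  interpret G: generic_ext "gen_ext M g" P L G
   by (unfold_locales) (use PL S.g.M_sub_N G in auto)
  interpret U: ctmodel "G.N" by (rule G.ctmodel_N)
  show "\<not> extends_to_cohen_indestructible_in G.N S.F"
  proof
   assume "extends_to_cohen_indestructible_in G.N S.F"
   then obtain F' G' where F': "F' \<in> G.N" "S.F \<sqsubseteq> F'" "mad_in G.N F'"
    and G': "generic G.N (Fn omega) Fn_le G'" "mad_in (gen_ext G.N G') F'"
    unfolding extends_to_cohen_indestructible_in_def destructible_in_def by blast
   have ad: "ad_family F'" using F'(3) by (simp add: mad_in_def)
   hence FT: "A \<in> elts F' ==> elts A \<subseteq> T" for A by (simp add: ad_family_def)
   obtain A B s where A: "A \<in> elts F'" "chain_T B" "infinite (elts A \<inter> B)" "s \<in> T" "dense_above s (elts A)"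
    by (rule U.cohen_hits[OF F'(1) FT G']) (assumption, rule that)
   have AU: "A \<in> G.N" by (rule U.trM[OF F'(1) A(1)])
   obtain v where v: "s = str v" using A(4) unfolding T_str by blast
   have "\<exists>i\<in>elts w. infinite (elts A \<inter> elts (S.X i))"
   proof (rule S.hitting[OF PL ccc G AU FT[OF A(1)] A(4), of "length v"])
    fix n J assume n: "length v \<le> n" and J: "finite J" "J \<subseteq> elts w"
    \<comment> \<open>The root of the tooth at height \<open>n\<close>: the whole cone above it lies
      in the piece with number \<open>n\<close>, and \<open>A\<close> stays dense there after the
      antichains are removed.\<close>
    define s0 where "s0 = str (v @ replicate (n - length v) False @ [True])"
    have s0: "s0 \<in> T" by (simp add: s0_def)
    have d0: "dense_above s0 (elts A)" unfolding dense_above_def v s0_def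
    proof (intro ballI impI)
     fix s' assume "s' \<in> T" "(str (v @ replicate (n - length v) False @ [True])) \<sqsubseteq> s'"
     moreover have "str v \<sqsubseteq> (str (v @ replicate (n - length v) False @ [True]))" by simp
     ultimately show "\<exists>t\<in>elts A. t \<in> T \<and> s' \<sqsubseteq> t" using A(5) unfolding dense_above_def v by (meson order_trans)
    qed
    have "\<exists>s'\<in>T. s0 \<sqsubseteq> s' \<and> dense_above s' (elts A - (\<Union>j\<in>J. S.C j))"
     by (rule dense_remove_antichs[OF J(1) d0 s0]) (use C_antich J(2) in blast)
    then obtain s' where s': "s' \<in> T" "s0 \<sqsubseteq> s'" "dense_above s' (elts A - (\<Union>j\<in>J. S.C j))" by blast
    have "S.Yr s (vnat n) t" if t: "t \<in> T" "s' \<sqsubseteq> t" for t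
    proof -
     obtain u where u: "t = str u" using t(1) unfolding T_str by blast
     have "prefix (v @ replicate (n - length v) False @ [True]) u"
      using order_trans[OF s'(2) t(2)] unfolding s0_def u by simp
     then obtain z where "u = v @ replicate (n - length v) False @ True # z" unfolding prefix_def by auto
     thus ?thesis using Y2_cone[OF n, of z] unfolding S.Yr_def u v by simp
    qed
    hence "{t \<in> elts A - (\<Union>j\<in>J. S.C j). s' \<sqsubseteq> t} \<subseteq> {t \<in> elts A. S.Yr s (vnat n) t} - (\<Union>j\<in>J. S.C j)"
     using FT[OF A(1)] by blast
    thus "infinite ({t \<in> elts A. S.Yr s (vnat n) t} - (\<Union>j\<in>J. S.C j))"
     using dense_infinite[OF s'(3,1)] infinite_super by blast
   qed
   then obtain i where i: "i \<in> elts w" "infinite (elts A \<inter> elts (S.X i))" by blast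
   have "S.X i \<in> elts F'" using F'(2) i(1) unfolding S.elts_F by blast
   hence "A = S.X i" using ad A(1) i(2) unfolding ad_family_def by blast
   thus False using antich_chain[OF X_antich[OF i(1)] A(2)] A(3) by simp
  qed
 qed
qed

end

section \<open>Null sets and Borel sets inside a model\<close>

text \<open>Total weight at most \<open>(1/2) ^ k\<close>. Bounding finite subsets avoids infinite
  sums, which the model would have to express.\<close>

definition light :: "nat => hset set => bool" where
 "light k X <-> (\<forall>Y. finite Y --> Y \<subseteq> X --> (\<Sum>t\<in>Y. (1/2::real) ^ card (elts t)) \<le> (1/2) ^ k)"

text \<open>Measure zero with light sets of nodes as covers in place of sequences; this form is
  definable in the model and easily combined.\<close>

definition nullS :: "hset set => hset set => bool" where
 "nullS M S <-> (\<forall>k. \<exists>X\<in>M. elts X \<subseteq> T \<and> light k (elts X) \<and> (\<forall>f\<in>S. \<exists>t\<in>elts X. t \<sqsubseteq> f))"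

lemma light_subset: "light k X ==> Y \<subseteq> X ==> light k Y"
 unfolding light_def by blast

lemma light_Un:
 assumes "light (Suc k) X" "light (Suc k) Y"
 shows "light k (X \<union> Y)"
 unfolding light_def
proof (intro allI impI)
 fix Z :: "hset set" assume Z: "finite Z" "Z \<subseteq> X \<union> Y"
 let ?f = "\<lambda>t. (1/2::real) ^ card (elts t)"
 have "sum ?f Z \<le> sum ?f (Z \<inter> X) + sum ?f (Z - X)"
  using Z(1) by (simp add: sum.Int_Diff[of Z ?f X])
 also have "\<dots> \<le> (1/2) ^ Suc k + (1/2) ^ Suc k"
  using assms Z unfolding light_def by (intro add_mono) (auto intro!: finite_subset[of _ Z])
 finally show "sum ?f Z \<le> (1/2) ^ k" by simp
qed

text \<open>The tail of the geometric series telescopes: for \<open>r = 1/2\<close> one has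
  \<open>r ^ Suc n = r ^ n - r ^ Suc n\<close>.\<close>

lemma geo_tail: "finite I ==> (\<And>n. n \<in> I ==> k \<le> n) ==> (\<Sum>n\<in>I. (1/2::real) ^ Suc n) \<le> (1/2) ^ k"
proof -
 assume I: "finite I" "\<And>n. n \<in> I ==> k \<le> n"
 obtain m where m: "\<forall>n\<in>I. n < m" using I(1) finite_nat_set_iff_bounded by blast
 have h: "r ^ j = 2 * r ^ Suc j" if "2 * r = 1" for r :: real and j
  using that by (simp add: mult.assoc[symmetric])
 have "(\<Sum>n=k..<k+j. r ^ Suc n) = r^k - r^(k+j)" if "2 * r = 1" for r :: real and j
 proof (induction j)
  case (Suc j)
  have "(\<Sum>n=k..<k + Suc j. r ^ Suc n) = (\<Sum>n=k..<k + j. r ^ Suc n) + r ^ Suc (k + j)"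
   unfolding add_Suc_right by (rule sum.atLeastLessThan_Suc) simp
  thus ?case using h[OF that, of "k + j"] Suc unfolding add_Suc_right by linarith
 qed simp
 note s = this[of "1/2" m]
 have "(\<Sum>n\<in>I. (1/2::real) ^ Suc n) \<le> (\<Sum>n=k..<k+m. (1/2::real) ^ Suc n)"
  using I m by (intro sum_mono2) force+
 also have "(\<Sum>n=k..<k+m. (1/2::real) ^ Suc n) = (1/2)^k - (1/2)^(k+m)"
  by (rule s) simp
 finally show ?thesis by (smt (verit) zero_le_power zero_le_divide_1_iff)
qed

lemma card_extensions: "length v \<le> l ==> card {str u |u. prefix v u \<and> length u = l} = 2 ^ (l - length v)"
proof -
 assume l: "length v \<le> l"
 have "{str u |u. prefix v u \<and> length u = l} = (\<lambda>z. str (v @ z)) ` {z. set z \<subseteq> UNIV \<and> length z = l - length v}"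
  using l by (auto simp: prefix_def)
 moreover have "inj_on (\<lambda>z. str (v @ z)) {z. set z \<subseteq> UNIV \<and> length z = l - length v}" by (auto simp: inj_on_def)
 ultimately show ?thesis using card_lists_length_eq[of "UNIV :: bool set" "l - length v"] by (simp add: card_image)
qed

text \<open>\<open>cntle k Y\<close> expresses \<open>\<Sum>t\<in>Y. 2\<^sup>-\<^sup>|\<^sup>t\<^sup>| \<le> 2\<^sup>-\<^sup>k\<close> by counting the extensions at a common level \<open>l\<close>.\<close>
definition lev :: "hset => hset => hset" where
 "lev Y l = hset_of {z \<in> elts (hprod Y TT). hdom (hsnd z) = l \<and> hfst z \<sqsubseteq> hsnd z}"

text \<open>For \<open>k \<le> l\<close> a set with \<open>2 ^ (l - k)\<close> elements that is
  definable without arithmetic: strings of length \<open>l\<close> starting with \<open>k\<close>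
  zeros.\<close>

definition zlev :: "hset => hset => hset" where
 "zlev k l = hset_of {s \<in> elts TT. hdom s = l \<and> (\<forall>i\<in>elts k. ap s i = vb False)}"

lemma hdom_T: "t \<in> T ==> hdom t = vnat (card (elts t))"
 unfolding T_str by (auto simp: hdom_str simp del: elts_hdom)

lemma card_lev:
 assumes Y: "finite (elts Y)" "elts Y \<subseteq> T" and l: "\<And>t. t \<in> elts Y ==> card (elts t) \<le> l"
 shows "finite (elts (lev Y (vnat l)))" "card (elts (lev Y (vnat l))) = (\<Sum>t\<in>elts Y. 2 ^ (l - card (elts t)))"
proof -
 have e: "elts (lev Y (vnat l)) = (\<lambda>(t, s). opair t s) ` (SIGMA t:elts Y. {s \<in> T. card (elts s) = l \<and> t \<sqsubseteq> s})"
  unfolding lev_def by (subst elts_sep) (auto simp: hdom_T simp del: elts_hdom)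
 have ext: "{s \<in> T. card (elts s) = l \<and> t \<sqsubseteq> s} = {str u |u. prefix v u \<and> length u = l}" if "t = str v" for t v
 proof (intro set_eqI iffI)
  fix s assume s: "s \<in> {s \<in> T. card (elts s) = l \<and> t \<sqsubseteq> s}"
  then obtain u where "s = str u" unfolding T_str by blast
  thus "s \<in> {str u |u. prefix v u \<and> length u = l}" using s that by simp
 next
  fix s assume "s \<in> {str u |u. prefix v u \<and> length u = l}"
  then obtain u where "s = str u" "prefix v u" "length u = l" by blast
  thus "s \<in> {s \<in> T. card (elts s) = l \<and> t \<sqsubseteq> s}" using that by simp
 qed
 have c: "card {s \<in> T. card (elts s) = l \<and> t \<sqsubseteq> s} = 2 ^ (l - card (elts t)) \<and> finite {s \<in> T. card (elts s) = l \<and> t \<sqsubseteq> s}"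
  if t: "t \<in> elts Y" for t
 proof -
  obtain v where v: "t = str v" using t Y(2) unfolding T_str by blast
  hence "length v \<le> l" using l[OF t] by simp
  from card_extensions[OF this] show ?thesis unfolding ext[OF v] using v by (auto intro: card_ge_0_finite)
 qed
 have inj: "inj_on (\<lambda>(t, s). opair t s) A" for A by (auto simp: inj_on_def)
 show "finite (elts (lev Y (vnat l)))" unfolding e using Y(1) c by (intro finite_imageI finite_SigmaI) auto
 show "card (elts (lev Y (vnat l))) = (\<Sum>t\<in>elts Y. 2 ^ (l - card (elts t)))"
  unfolding e card_image[OF inj] using Y(1) c by (subst card_SigmaI) auto
qed

lemma card_zlev:
 assumes "k \<le> l"
 shows "finite (elts (zlev (vnat k) (vnat l)))" "card (elts (zlev (vnat k) (vnat l))) = 2 ^ (l - k)"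
proof -
 have "elts (zlev (vnat k) (vnat l)) = {str u |u. prefix (replicate k False) u \<and> length u = l}"
 proof -
  have "elts (zlev (vnat k) (vnat l)) = {s \<in> T. hdom s = vnat l \<and> (\<forall>i\<in>elts (vnat k). ap s i = vb False)}"
   unfolding zlev_def by (subst elts_sep) simp
  also have "\<dots> = {str u |u. prefix (replicate k False) u \<and> length u = l}"
   unfolding T_str using assms by (auto simp: hdom_str elts_vnat ap_str prefix_nth simp del: elts_hdom)
  finally show ?thesis .
 qed
 thus "finite (elts (zlev (vnat k) (vnat l)))" "card (elts (zlev (vnat k) (vnat l))) = 2 ^ (l - k)"
  using card_extensions[of "replicate k False" l] assms by (auto intro: card_ge_0_finite)
qed

section \<open>Weights and null sets in the language of the model\<close>

context ctmodel
begin

definition cntle :: "hset => hset => bool" where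
 "cntle k Y <-> (\<exists>l\<in>elts omega. k \<sqsubseteq> l \<and> (\<forall>t\<in>elts Y. hdom t \<sqsubseteq> l) \<and>
   (\<exists>a\<in>elts omega. \<exists>b\<in>elts omega. bijM (lev Y l) a \<and> bijM (zlev k l) b \<and> a \<sqsubseteq> b))"

lemma vnat_sub [simp]: "vnat m \<sqsubseteq> vnat n <-> m \<le> n"
 using vnat_inject by (auto simp: elts_vnat inj_image_subset_iff inj_def)

lemma lev_M: "Y \<in> M ==> l \<in> M ==> lev Y l \<in> M"
 unfolding lev_def by (rule inM, intro df TT_inM) assumption+

lemma zlev_M: "k \<in> M ==> l \<in> M ==> zlev k l \<in> M"
 unfolding zlev_def by (rule inM, intro df TT_inM vb_inM) assumption+

text \<open>Multiplying by \<open>2 ^ l\<close> turns weights into numbers of extensions of length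
  \<open>l\<close>, once \<open>l\<close> is at least \<open>k\<close> and all lengths in
  \<open>Y\<close>.\<close>

lemma cntle_iff:
 assumes Y: "Y \<in> M" "finite (elts Y)" "elts Y \<subseteq> T"
 shows "cntle (vnat k) Y <-> (\<Sum>t\<in>elts Y. (1/2::real) ^ card (elts t)) \<le> (1/2) ^ k"
proof -
 have key: "card (elts (lev Y (vnat l))) \<le> card (elts (zlev (vnat k) (vnat l))) <->
   (\<Sum>t\<in>elts Y. (1/2::real) ^ card (elts t)) \<le> (1/2) ^ k" (is "?L <-> ?R")
  if l: "k \<le> l" "\<And>t. t \<in> elts Y ==> card (elts t) \<le> l" for l
 proof -
  have p: "(2::real) ^ (l - m) = 2 ^ l * (1/2) ^ m" if "m \<le> l" for m
   using that by (simp add: power_diff power_one_over divide_simps)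
  have "?L <-> (\<Sum>t\<in>elts Y. 2 ^ (l - card (elts t))) \<le> (2::nat) ^ (l - k)"
   by (simp add: card_lev(2)[OF Y(2,3) l(2)] card_zlev(2)[OF l(1)])
  also have "\<dots> <-> real (\<Sum>t\<in>elts Y. 2 ^ (l - card (elts t))) \<le> real (2 ^ (l - k))" by (simp only: of_nat_le_iff)
  also have "real (\<Sum>t\<in>elts Y. 2 ^ (l - card (elts t))) = (\<Sum>t\<in>elts Y. 2 ^ l * (1/2) ^ card (elts t))"
   by (simp add: p l(2))
  also have "\<dots> = 2 ^ l * (\<Sum>t\<in>elts Y. (1/2) ^ card (elts t))" by (simp add: sum_distrib_left)
  also have "real (2 ^ (l - k)) = 2 ^ l * (1/2) ^ k" using p[OF l(1)] by simp
  finally show ?thesis by simp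
 qed
 have dom: "(\<forall>t\<in>elts Y. hdom t \<sqsubseteq> vnat l) <-> (\<forall>t\<in>elts Y. card (elts t) \<le> l)" for l
 proof (intro ball_cong refl)
  fix t assume "t \<in> elts Y"
  hence "hdom t = vnat (card (elts t))" using Y(3) by (intro hdom_T) blast
  thus "hdom t \<sqsubseteq> vnat l <-> card (elts t) \<le> l" by (simp del: elts_hdom)
 qed
 have "(\<exists>a\<in>elts omega. \<exists>b\<in>elts omega. bijM (lev Y (vnat l)) a \<and> bijM (zlev (vnat k) (vnat l)) b \<and> a \<sqsubseteq> b) <->
   card (elts (lev Y (vnat l))) \<le> card (elts (zlev (vnat k) (vnat l)))"
  if l: "k \<le> l" "\<And>t. t \<in> elts Y ==> card (elts t) \<le> l" for l
  using card_lev(1)[OF Y(2,3) l(2)] card_zlev(1)[OF l(1)]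
  by (simp add: bijM_iff[OF lev_M[OF Y(1) vnat_inM]] bijM_iff[OF zlev_M[OF vnat_inM vnat_inM]])
 note * = this
 have "\<exists>l. k \<le> l \<and> (\<forall>t\<in>elts Y. card (elts t) \<le> l)"
 proof (intro exI conjI ballI)
  show "card (elts t) \<le> k + (\<Sum>t\<in>elts Y. card (elts t))" if "t \<in> elts Y" for t
   using member_le_sum[OF that, of "\<lambda>t. card (elts t)"] Y(2) by simp
 qed simp
 thus ?thesis unfolding cntle_def using dom * key by (simp del: elts_hdom) blast
qed

lemma dfp_light: "dfp M (\<lambda>e. \<forall>Y\<in>elts (hFin TT). Y \<sqsubseteq> e 0 --> cntle (e 1) Y)"
proof -
 have "hFin TT \<in> M" by (rule inM, intro df TT_inM)
 thus ?thesis unfolding cntle_def lev_def zlev_def by (intro df TT_inM omega_inM vb_inM)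
qed

lemma light_iff:
 assumes X: "X \<in> M" "elts X \<subseteq> T"
 shows "light k (elts X) <-> (\<forall>Y\<in>elts (hFin TT). Y \<sqsubseteq> X --> cntle (vnat k) Y)"
proof
 assume l: "light k (elts X)"
 show "\<forall>Y\<in>elts (hFin TT). Y \<sqsubseteq> X --> cntle (vnat k) Y"
 proof (intro ballI impI)
  fix Y assume Y: "Y \<in> elts (hFin TT)" "Y \<sqsubseteq> X"
  have fY: "finite (elts Y)" "elts Y \<subseteq> T" using Y(1) by (simp_all add: elts_hFin[OF TT_inM])
  have YM: "Y \<in> M" using finite_inM[OF fY(1)] fY(2) subM[OF TT_inM] by simp
  show "cntle (vnat k) Y" unfolding cntle_iff[OF YM fY] using l Y(2) fY(1) unfolding light_def by blast
 qed
next
 assume r: "\<forall>Y\<in>elts (hFin TT). Y \<sqsubseteq> X --> cntle (vnat k) Y"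
 show "light k (elts X)" unfolding light_def
 proof (intro allI impI)
  fix Z assume Z: "finite Z" "Z \<subseteq> elts X"
  have e: "elts (hset_of Z) = Z" using Z(1) by (simp add: countable_finite)
  have ZM: "hset_of Z \<in> M" using finite_inM[OF Z(1)] Z(2) subM[OF X(1)] by blast
  have "cntle (vnat k) (hset_of Z)" using r Z X(2) e by (simp add: elts_hFin[OF TT_inM])
  thus "(\<Sum>t\<in>Z. (1/2::real) ^ card (elts t)) \<le> (1/2) ^ k" using cntle_iff[OF ZM] Z X(2) e by (metis subset_trans)
 qed
qed

lemma dfp_nullS [df]:
 assumes "dft M f" shows "dfp M (\<lambda>e. nullS M (elts (f e)))"
proof (rule dfp_app1[where R = "\<lambda>x. nullS M (elts x)", OF _ assms])
 have eq: "nullS M (elts x) <-> (\<forall>k\<in>elts omega. \<exists>X\<in>M. X \<sqsubseteq> TT \<and>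
   (\<forall>Y\<in>elts (hFin TT). Y \<sqsubseteq> X --> cntle k Y) \<and> (\<forall>f\<in>elts x. \<exists>t\<in>elts X. t \<sqsubseteq> f))" for x
 proof -
  have "(\<exists>X\<in>M. elts X \<subseteq> T \<and> light k (elts X) \<and> Q X) <-> (\<exists>X\<in>M. X \<sqsubseteq> TT \<and>
   (\<forall>Y\<in>elts (hFin TT). Y \<sqsubseteq> X --> cntle (vnat k) Y) \<and> Q X)" for k Q
   by (intro bex_cong refl) (use light_iff in auto)
  thus ?thesis unfolding nullS_def elts_omega by auto
 qed
 show "dfp M (\<lambda>e. nullS M (elts (e 0)))"
  unfolding eq by (intro df dfp_app2[OF dfp_light] omega_inM TT_inM)
qed

definition CM :: hset where "CM = hset_of (cantor M)"

lemma elts_CM: "elts CM = cantor M"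
 unfolding CM_def by (rule elts_hset_of[OF countM]) (auto simp: cantor_def)

lemma CM_M: "CM \<in> M"
proof -
 have "cantor M = {f \<in> elts (hPow (hprod omega (vnat 2))). is_fun f (elts omega) (elts (vnat 2))}"
  unfolding cantor_def by (auto simp: is_fun_def simp del: elts_omega)
 thus ?thesis unfolding CM_def by (simp only:) (rule inM, intro df omega_inM vnat_inM)
qed

lemma nullS_mono: "nullS M S ==> S' \<subseteq> S ==> nullS M S'"
 unfolding nullS_def by (meson subsetD)

lemma nullS_Un:
 assumes "nullS M S" "nullS M S'"
 shows "nullS M (S \<union> S')"
 unfolding nullS_def
proof
 fix k
 obtain X where X: "X \<in> M" "elts X \<subseteq> T" "light (Suc k) (elts X)" "\<And>f. f \<in> S ==> \<exists>t\<in>elts X. t \<sqsubseteq> f"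
  using assms(1) unfolding nullS_def by meson
 obtain Y where Y: "Y \<in> M" "elts Y \<subseteq> T" "light (Suc k) (elts Y)" "\<And>f. f \<in> S' ==> \<exists>t\<in>elts Y. t \<sqsubseteq> f"
  using assms(2) unfolding nullS_def by meson
 have "hun X Y \<in> M" by (rule inM, intro df X(1) Y(1))
 thus "\<exists>Z\<in>M. elts Z \<subseteq> T \<and> light k (elts Z) \<and> (\<forall>f\<in>S \<union> S'. \<exists>t\<in>elts Z. t \<sqsubseteq> f)"
  using X Y light_Un[OF X(3) Y(3)] by (intro bexI[of _ "hun X Y"]) (auto, blast+)
qed

lemma nullS_empty: "nullS M {}"
proof -
 have "light k (elts hemp)" for k by (auto simp: light_def)
 thus ?thesis unfolding nullS_def using hemp_inM by (intro allI bexI[of _ hemp]) auto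
qed

lemma nullS_UN: "finite I ==> (\<And>i. i \<in> I ==> nullS M (S i)) ==> nullS M (\<Union>i\<in>I. S i)"
 by (induction I rule: finite_induct) (simp_all add: nullS_empty nullS_Un)

text \<open>Addition of a fixed external number, as an iterated successor.\<close>

lemma dft_shift: "dft M (\<lambda>e. ((\<lambda>x. hins x x) ^^ k) (e 0))"
 by (induction k) (simp_all, intro df, intro df)

lemma shift_vnat: "((\<lambda>x. hins x x) ^^ k) (vnat n) = vnat (n + k)"
 by (induction k) (simp_all add: vnat_Suc)

lemma app_ap: "is_fun f (elts a) B ==> x \<in> elts a ==> app f x = ap f x"
 by (rule is_fun_ap(3))

text \<open>A light set has to be arranged as a sequence indexed by \<open>omega\<close>, with an
  entry at every index. Indices that code no node of the set are padded with long nodes of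
  negligible total weight.\<close>

lemma nullS_measure:
 assumes "nullS M S" and SC: "S \<subseteq> cantor M"
 shows "coin_measure M S = 0"
proof -
 \<comment> \<open>The set and the padding contribute at most \<open>(1/2) ^ k\<close> each; 3 is a
   generous constant for their sum.\<close>
 have "coin_measure M S \<le> ennreal (3 * (1/2) ^ k)" for k
 proof -
  obtain X where X: "X \<in> M" "elts X \<subseteq> T" "light k (elts X)" "\<And>f. f \<in> S ==> \<exists>t\<in>elts X. t \<sqsubseteq> f"
   using assms(1) unfolding nullS_def by meson
  obtain tc where tc: "tc \<in> M" "\<And>y. y \<in> elts TT ==> ap tc y \<in> elts omega"
   "\<And>y z. y \<in> elts TT ==> z \<in> elts TT ==> ap tc y = ap tc z ==> y = z"
   by (rule cntE[OF cnt_TT TT_inM]) (rule that)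
  \<comment> \<open>At \<open>n\<close> stands the node with code \<open>n\<close> if it is in
    \<open>X\<close>, otherwise a node of length above \<open>n + k\<close>.\<close>
  define R where "R n t <-> t \<in> elts TT \<and> ((t \<in> elts X \<and> ap tc t = n) \<or>
   ((\<forall>s\<in>elts X. ap tc s \<noteq> n) \<and> ((\<lambda>x. hins x x) ^^ k) n \<in> elts (hdom t)))" for n t
  obtain c where c: "hgraph omega c \<in> M" "\<And>n. n \<in> elts omega ==> R n (c n)"
  proof (rule uniformize[where R = R, OF _ omega_inM])
   show "dfp M (\<lambda>e. R (e 0) (e 1))" unfolding R_def by (intro df TT_inM X(1) tc(1) dft_app1[OF dft_shift])
   fix n assume "n \<in> elts omega"
   then obtain m where m: "n = vnat m" by auto
   show "\<exists>t\<in>M. R n t"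
   proof (cases "\<exists>s\<in>elts X. ap tc s = n")
    case True
    thus ?thesis unfolding R_def using X(2) trM[OF X(1)] by auto
   next
    case False
    have "vnat (m + k) \<in> elts (hdom (str (replicate (Suc (m + k)) False)))" unfolding hdom_str by simp
    hence "R n (str (replicate (Suc (m + k)) False))" unfolding R_def m shift_vnat using False m by (simp del: elts_hdom)
    thus ?thesis using str_inM by blast
   qed
  qed (rule that)
  define d where "d n = c (vnat n)" for n
  have Rd: "R (vnat n) (d n)" for n unfolding d_def by (rule c(2)) simp
  have dT: "d n \<in> T" for n using Rd[of n] by (simp add: R_def)
  have fc: "is_fun (hgraph omega c) (elts omega) T" by (rule is_fun_hgraph) (use c(2) in \<open>simp add: R_def\<close>)
  have ac: "app (hgraph omega c) (vnat n) = d n" for n using app_ap[OF fc] by (simp add: d_def)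
  have dX: "\<exists>n. t = d n" if t: "t \<in> elts X" for t
  proof -
   have tT: "t \<in> elts TT" using t X(2) by auto
   obtain n where n: "ap tc t = vnat n" using tc(2)[OF tT] by auto
   have "ap tc (d n) = vnat n" using Rd[of n] t n unfolding R_def by blast
   thus ?thesis using tc(3)[OF tT, of "d n"] n dT by auto
  qed
  have cov: "hgraph omega c \<in> covers M S" unfolding covers_def mem_Collect_eq ac
  proof (intro conjI c(1) fc subsetI)
   fix f assume f: "f \<in> S"
   obtain t where t: "t \<in> elts X" "t \<sqsubseteq> f" using X(4)[OF f] by blast
   from dX[OF t(1)] obtain n where "t = d n" by blast
   thus "f \<in> (\<Union>n. cyl M (d n))" using f SC t(2) by (auto simp: cyl_def)
  qed
  have part: "(\<Sum>n<N. (1/2::real) ^ card (elts (d n))) \<le> 3 * (1/2) ^ k" for N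
  proof -
   let ?H = "{n \<in> {..<N}. d n \<in> elts X \<and> ap tc (d n) = vnat n}"
   have "(\<Sum>n<N. (1/2::real) ^ card (elts (d n))) = (\<Sum>n\<in>?H. (1/2) ^ card (elts (d n))) + (\<Sum>n\<in>{..<N} - ?H. (1/2) ^ card (elts (d n)))"
    by (subst add.commute) (rule sum.subset_diff, auto)
   also have "(\<Sum>n\<in>?H. (1/2::real) ^ card (elts (d n))) = (\<Sum>t\<in>d ` ?H. (1/2) ^ card (elts t))"
   proof -
    have "inj_on d ?H"
    proof (rule inj_onI)
     fix a b assume "a \<in> ?H" "b \<in> ?H" "d a = d b"
     hence "vnat a = ap tc (d a)" "vnat b = ap tc (d a)" by simp_all
     hence "vnat a = vnat b" by (rule trans[OF _ sym])
     thus "a = b" by simp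
    qed
    thus ?thesis by (subst sum.reindex) simp_all
   qed
   also have "\<dots> \<le> (1/2) ^ k" by (rule X(3)[unfolded light_def, rule_format]) auto
   also have "(\<Sum>n\<in>{..<N} - ?H. (1/2::real) ^ card (elts (d n))) \<le> (\<Sum>n\<in>{..<N} - ?H. (1/2) ^ Suc (n + k))"
   proof (intro sum_mono power_decreasing)
    fix n assume "n \<in> {..<N} - ?H"
    hence "vnat (n + k) \<in> elts (hdom (d n))" using Rd[of n] unfolding R_def shift_vnat by blast
    thus "Suc (n + k) \<le> card (elts (d n))" unfolding hdom_T[OF dT] by simp
   qed auto
   also have "(\<Sum>n\<in>{..<N} - ?H. (1/2::real) ^ Suc (n + k)) = (\<Sum>n\<in>(\<lambda>n. n + k) ` ({..<N} - ?H). (1/2) ^ Suc n)"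
    by (subst sum.reindex) (simp_all add: inj_on_def)
   also have "\<dots> \<le> (1/2) ^ k" by (rule geo_tail) auto
   finally show ?thesis by (simp add: field_simps)
  qed
  have "coin_measure M S \<le> (\<Sum>n. ennreal ((1/2) ^ card (elts (app (hgraph omega c) (vnat n)))))"
   unfolding coin_measure_def by (rule INF_lower[OF cov])
  also have "\<dots> = (\<Sum>n. ennreal ((1/2) ^ card (elts (d n))))" unfolding ac ..
  also have "\<dots> \<le> ennreal (3 * (1/2) ^ k)"
   by (rule suminf_le_const) (use part in \<open>simp_all add: sum_ennreal\<close>)
  finally show ?thesis .
 qed
 moreover have "(\<lambda>k. ennreal (3 * (1/2) ^ k)) \<longlonglongrightarrow> ennreal 0"
  by (rule tendsto_ennrealI) (auto intro!: tendsto_eq_intros LIMSEQ_power_zero)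
 ultimately have "coin_measure M S \<le> ennreal 0" by (intro LIMSEQ_le_const) auto
 thus ?thesis by simp
qed

text \<open>The range of a cover of small weight is light: a node repeated in the sequence counts
  once in the set, which only lowers the sum.\<close>

lemma measure_nullS:
 assumes "coin_measure M S = 0"
 shows "nullS M S"
 unfolding nullS_def
proof
 fix k
 have "coin_measure M S < ennreal ((1/2) ^ k)" using assms by simp
 then obtain c where c: "c \<in> covers M S" and s: "(\<Sum>n. ennreal ((1/2) ^ card (elts (app c (vnat n))))) < ennreal ((1/2) ^ k)"
  unfolding coin_measure_def INF_less_iff by blast
 have c': "c \<in> M" "is_fun c (elts omega) T" "S \<subseteq> (\<Union>n. cyl M (app c (vnat n)))" using c unfolding covers_def by blast+
 have ac: "app c (vnat n) = ap c (vnat n)" for n using app_ap[OF c'(2)] by simp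
 define X where "X = hset_of (ap c ` elts omega)"
 have XM: "X \<in> M" unfolding X_def by (rule inM, intro df c'(1) omega_inM)
 have eX: "elts X = (\<lambda>n. app c (vnat n)) ` UNIV" unfolding X_def ac by (subst elts_hset_of) auto
 have XT: "elts X \<subseteq> T" unfolding eX ac using is_fun_ap(2)[OF c'(2)] by auto
 have "light k (elts X)" unfolding light_def
 proof (intro allI impI)
  fix Y assume Y: "finite Y" "Y \<subseteq> elts X"
  have "\<forall>t\<in>Y. \<exists>n. t = app c (vnat n)" using Y(2) unfolding eX by blast
  then obtain n where n: "\<And>t. t \<in> Y ==> t = app c (vnat (n t))" by metis
  have inj: "inj_on n Y" by (rule inj_onI) (metis n)
  have "ennreal (\<Sum>t\<in>Y. (1/2) ^ card (elts t)) = (\<Sum>t\<in>Y. ennreal ((1/2) ^ card (elts t)))" by (simp add: sum_ennreal)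
  also have "\<dots> = (\<Sum>t\<in>Y. ennreal ((1/2) ^ card (elts (app c (vnat (n t))))))" using n by (intro sum.cong) auto
  also have "\<dots> = (\<Sum>i\<in>n ` Y. ennreal ((1/2) ^ card (elts (app c (vnat i)))))" by (simp add: sum.reindex[OF inj])
  also have "\<dots> \<le> (\<Sum>i. ennreal ((1/2) ^ card (elts (app c (vnat i)))))" by (rule sum_le_suminf) (use Y(1) in auto)
  also have "\<dots> \<le> ennreal ((1/2) ^ k)" using s by simp
  finally show "(\<Sum>t\<in>Y. (1/2::real) ^ card (elts t)) \<le> (1/2) ^ k" by (simp add: ennreal_le_iff)
 qed
 moreover have "\<exists>t\<in>elts X. t \<sqsubseteq> f" if "f \<in> S" for f
  using c'(3) that unfolding eX cyl_def by blast
 ultimately show "\<exists>X\<in>M. elts X \<subseteq> T \<and> light k (elts X) \<and> (\<forall>f\<in>S. \<exists>t\<in>elts X. t \<sqsubseteq> f)" using XM XT by blast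
qed

end

section \<open>Borel sets inside the model\<close>

context ctmodel
begin

definition OU :: "hset => hset" where
 "OU X = hset_of {f \<in> elts CM. \<exists>t\<in>elts X. t \<sqsubseteq> f}"

lemma elts_OU: "elts (OU X) = {f \<in> cantor M. \<exists>t\<in>elts X. t \<sqsubseteq> f}"
 unfolding OU_def by (subst elts_sep) (simp add: elts_CM)

lemma OU_M: "X \<in> M ==> OU X \<in> M"
 unfolding OU_def by (rule inM, intro df CM_M) assumption

definition openM :: "hset => bool" where
 "openM U <-> (\<forall>f\<in>elts U. \<exists>t\<in>elts TT. t \<sqsubseteq> f \<and> (\<forall>h\<in>elts CM. t \<sqsubseteq> h --> h \<in> elts U))"

lemma openM_iff:
 assumes U: "elts U \<subseteq> cantor M"
 shows "openM U <-> interior_in M (elts U) = elts U"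
proof -
 have "(\<exists>t\<in>T. t \<sqsubseteq> f \<and> (\<forall>h\<in>cantor M. t \<sqsubseteq> h --> h \<in> elts U)) <-> (\<exists>n. cyl M (restr f n) \<subseteq> elts U)"
  if f: "f \<in> cantor M" for f
 proof
  assume "\<exists>t\<in>T. t \<sqsubseteq> f \<and> (\<forall>h\<in>cantor M. t \<sqsubseteq> h --> h \<in> elts U)"
  then obtain u where u: "str u \<sqsubseteq> f" "\<And>h. h \<in> cantor M ==> str u \<sqsubseteq> h ==> h \<in> elts U" unfolding T_str by blast
  have "restr f (length u) = str u" using u(1) unfolding restr_str[OF f] str_sub_cantor[OF f] by simp
  thus "\<exists>n. cyl M (restr f n) \<subseteq> elts U" using u(2) unfolding cyl_def by (intro exI[of _ "length u"]) auto
 next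
  assume "\<exists>n. cyl M (restr f n) \<subseteq> elts U"
  then obtain n where n: "cyl M (restr f n) \<subseteq> elts U" by blast
  have "restr f n \<sqsubseteq> f" unfolding restr_str[OF f] by (simp add: str_sub_cantor[OF f])
  thus "\<exists>t\<in>T. t \<sqsubseteq> f \<and> (\<forall>h\<in>cantor M. t \<sqsubseteq> h --> h \<in> elts U)"
   using n unfolding restr_str[OF f] cyl_def by (intro bexI[of _ "str (upto_bits (bits f) n)"]) auto
 qed
 moreover have "f \<in> elts U" if f: "f \<in> cantor M" "cyl M (restr f n) \<subseteq> elts U" for f n
 proof -
  have "f \<in> cyl M (restr f n)" unfolding cyl_def restr_str[OF f(1)] using f(1) by (simp add: str_sub_cantor[OF f(1)])
  thus ?thesis using f(2) by blast
 qed
 ultimately show ?thesis using U unfolding openM_def interior_in_def elts_TT elts_CM by blast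
qed

lemma OU_open: "elts X \<subseteq> T ==> openM (OU X)"
 unfolding openM_def elts_OU elts_CM elts_TT by blast

text \<open>The requirements on the algebras in \<open>borel_in\<close>, with complements and unions
  compared pointwise on \<open>CM\<close>. In this form they are expressible in the model, which
  makes the family of Borel sets a member of it.\<close>

definition sigop :: "hset => bool" where
 "sigop S <-> (\<forall>B\<in>elts S. \<exists>C\<in>elts S. \<forall>f\<in>elts CM. f \<in> elts C <-> f \<notin> elts B) \<and>
   (\<forall>h\<in>M. is_fun h (elts omega) (elts S) --> (\<exists>U\<in>elts S. \<forall>f\<in>elts CM. f \<in> elts U <-> (\<exists>n\<in>elts omega. f \<in> elts (ap h n)))) \<and>
   (\<forall>U\<in>elts (hPow CM). openM U --> U \<in> elts S)"

lemma sigop_iff: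
 assumes S: "S \<in> M"
 shows "(S \<in> elts (hPow (hPow CM)) \<and> sigop S) <-> sigma_algebra_in M S \<and>
  (\<forall>U\<in>M. elts U \<subseteq> cantor M --> interior_in M (elts U) = elts U --> U \<in> elts S)"
proof -
 have a: "S \<in> elts (hPow (hPow CM)) <-> (\<forall>B\<in>elts S. elts B \<subseteq> cantor M)"
  using S subM[OF S] by (auto simp: elts_CM)
 have d: "(\<forall>U\<in>elts (hPow CM). openM U --> U \<in> elts S) <->
   (\<forall>U\<in>M. elts U \<subseteq> cantor M --> interior_in M (elts U) = elts U --> U \<in> elts S)"
  using openM_iff by (auto simp: elts_CM)
 show ?thesis
 proof (cases "\<forall>B\<in>elts S. elts B \<subseteq> cantor M")
  case True
  have b: "(\<forall>f\<in>elts CM. f \<in> elts C <-> f \<notin> elts B) <-> elts C = cantor M - elts B" if "C \<in> elts S" for B C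
   using True that unfolding elts_CM by blast
  have c: "(\<forall>f\<in>elts CM. f \<in> elts U <-> (\<exists>n\<in>elts omega. f \<in> elts (ap h n))) <-> elts U = (\<Union>n. elts (app h (vnat n)))"
   if "U \<in> elts S" and h: "is_fun h (elts omega) (elts S)" for U h
  proof -
   have "elts (ap h (vnat n)) \<subseteq> cantor M" for n using is_fun_ap(2)[OF h, of "vnat n"] True by auto
   moreover have "app h (vnat n) = ap h (vnat n)" for n using app_ap[OF h, of "vnat n"] by simp
   moreover have "elts U \<subseteq> cantor M" using True that by blast
   ultimately show ?thesis unfolding elts_CM elts_omega by fastforce
  qed
  show ?thesis unfolding a d sigop_def sigma_algebra_in_def using S True b c
   by (simp del: elts_omega cong: bex_cong)
 next
  case False
  thus ?thesis unfolding a sigma_algebra_in_def by blast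
 qed
qed

definition BB :: hset where
 "BB = hset_of {B \<in> elts (hPow CM). \<forall>S\<in>elts (hPow (hPow CM)). sigop S --> B \<in> elts S}"

lemma BB_M: "BB \<in> M"
 unfolding BB_def sigop_def openM_def by (rule inM, intro df CM_M omega_inM TT_inM)

lemma BB_iff: "B \<in> elts BB <-> B \<in> M \<and> elts B \<subseteq> cantor M \<and> (\<forall>S\<in>elts (hPow (hPow CM)). sigop S --> B \<in> elts S)"
 unfolding BB_def by (subst elts_sep) (simp add: elts_CM)

lemma BB_borel: "B \<in> elts BB <-> borel_in M B"
proof -
 have "(\<forall>S\<in>elts (hPow (hPow CM)). sigop S --> B \<in> elts S) <-> (\<forall>S. sigma_algebra_in M S -->
   (\<forall>U\<in>M. elts U \<subseteq> cantor M --> interior_in M (elts U) = elts U --> U \<in> elts S) --> B \<in> elts S)" (is "?L <-> ?R")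
 proof
  assume L: ?L
  show ?R
  proof (intro allI impI)
   fix S assume S: "sigma_algebra_in M S" "\<forall>U\<in>M. elts U \<subseteq> cantor M --> interior_in M (elts U) = elts U --> U \<in> elts S"
   have "S \<in> M" using S(1) unfolding sigma_algebra_in_def by blast
   from sigop_iff[OF this] S L show "B \<in> elts S" by blast
  qed
 next
  assume R: ?R
  show ?L
  proof (intro ballI impI)
   fix S assume S: "S \<in> elts (hPow (hPow CM))" "sigop S"
   have "S \<in> M" using S(1) by simp
   from sigop_iff[OF this] S R show "B \<in> elts S" by blast
  qed
 qed
 thus ?thesis unfolding BB_iff borel_in_def by blast
qed

lemma BB_open: "U \<in> M ==> elts U \<subseteq> cantor M ==> openM U ==> U \<in> elts BB"
 unfolding BB_iff sigop_def by (simp add: elts_CM)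

definition hdiff :: "hset => hset => hset" where "hdiff a b = hset_of {x \<in> elts a. x \<notin> elts b}"

lemma elts_hdiff: "elts (hdiff a b) = elts a - elts b"
 unfolding hdiff_def by (subst elts_sep) blast

lemma hdiff_M: "a \<in> M ==> b \<in> M ==> hdiff a b \<in> M"
 unfolding hdiff_def by (rule inM, intro df) assumption+

text \<open>The difference is the complement of the union of the complement of \<open>B\<close> with
  \<open>U\<close>. The union is taken along the sequence that starts with that complement and is
  then constantly \<open>U\<close>.\<close>

lemma BB_diff:
 assumes B: "B \<in> elts BB" and U: "U \<in> M" "elts U \<subseteq> cantor M" "openM U"
 shows "hdiff B U \<in> elts BB"
 unfolding BB_iff
proof (intro conjI ballI impI)
 have BM: "B \<in> M" "elts B \<subseteq> cantor M" using B unfolding BB_iff by blast+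
 show "hdiff B U \<in> M" by (rule hdiff_M[OF BM(1) U(1)])
 show "elts (hdiff B U) \<subseteq> cantor M" using BM(2) unfolding elts_hdiff by blast
 fix S assume S: "S \<in> elts (hPow (hPow CM))" "sigop S"
 have SM: "S \<in> M" and SC: "\<And>B. B \<in> elts S ==> elts B \<subseteq> cantor M" using S(1) subM by (auto simp: elts_CM)
 have compl: "hdiff CM D \<in> elts S" if D: "D \<in> elts S" for D
 proof -
  obtain C where C: "C \<in> elts S" "\<forall>f\<in>elts CM. f \<in> elts C <-> f \<notin> elts D" using S(2) D unfolding sigop_def by blast
  have "C = hdiff CM D" by (rule hset_eqI) (use SC[OF C(1)] C(2) in \<open>auto simp: elts_hdiff elts_CM\<close>)
  thus ?thesis using C(1) by simp
 qed
 have BS: "B \<in> elts S" using B S unfolding BB_iff by blast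
 have US: "U \<in> elts S" using S(2) U unfolding sigop_def by (simp add: elts_CM)
 define F where "F n = (if n = hemp then hdiff CM B else U)" for n
 have FS: "F n \<in> elts S" for n using compl[OF BS] US by (simp add: F_def)
 have hM: "hgraph omega F \<in> M" unfolding F_def by (rule inM, intro df omega_inM hemp_inM hdiff_M CM_M BM(1) U(1))
 have "is_fun (hgraph omega F) (elts omega) (elts S)" by (rule is_fun_hgraph) (rule FS)
 then obtain V where V: "V \<in> elts S" "\<forall>f\<in>elts CM. f \<in> elts V <-> (\<exists>n\<in>elts omega. f \<in> elts (ap (hgraph omega F) n))"
  using S(2) hM unfolding sigop_def by blast
 have "(\<exists>n\<in>elts omega. f \<in> elts (ap (hgraph omega F) n)) <-> f \<in> elts (hdiff CM B) \<or> f \<in> elts U" for f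
 proof
  assume "f \<in> elts (hdiff CM B) \<or> f \<in> elts U"
  hence "f \<in> elts (F (vnat 0)) \<or> f \<in> elts (F (vnat 1))" using vnat_inject[of 1 0] by (auto simp: F_def vnat_0[symmetric] simp del: vnat_inject)
  thus "\<exists>n\<in>elts omega. f \<in> elts (ap (hgraph omega F) n)" by auto
 qed (auto simp: F_def split: if_splits)
 hence "\<forall>f\<in>elts CM. f \<in> elts V <-> f \<in> elts (hdiff CM B) \<or> f \<in> elts U" using V(2) by blast
 hence "hdiff CM V = hdiff B U"
  using BM(2) by (intro hset_eqI) (auto simp: elts_hdiff elts_CM)
 thus "hdiff B U \<in> elts S" using compl[OF V(1)] by simp
qed

lemma BB_diff_OU: "B \<in> elts BB ==> X \<in> M ==> elts X \<subseteq> T ==> hdiff B (OU X) \<in> elts BB"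
 by (rule BB_diff[OF _ OU_M]) (auto simp: elts_OU intro: OU_open)

subsection \<open>Random reals\<close>

definition RF :: hset where "RF = hset_of {B \<in> elts BB. \<not> nullS M (elts B)}"

lemma elts_RF: "elts RF = {B \<in> elts BB. \<not> nullS M (elts B)}"
 unfolding RF_def by (rule elts_sep)

lemma RF_M: "RF \<in> M"
 unfolding RF_def by (rule inM, intro df BB_M)

lemma RF_random: "elts RF = random_forcing M"
proof -
 have "nullS M (elts B) <-> coin_measure M (elts B) = 0" if "elts B \<subseteq> cantor M" for B
  using nullS_measure[OF _ that] measure_nullS[of "elts B"] by blast
 thus ?thesis unfolding random_forcing_def elts_RF zero_less_iff_neq_zero BB_borel by (auto simp: borel_in_def)
qed

text \<open>The cylinders over these nodes form the complement of the cylinder over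
  \<open>t\<close>, so restricting to a cylinder becomes subtracting an open set
  \<open>OU (Sib t)\<close>, as \<open>BB_diff_OU\<close> provides.\<close>

definition Sib :: "hset => hset" where "Sib t = hset_of {s \<in> elts TT. hdom s = hdom t \<and> s \<noteq> t}"

lemma elts_Sib: "elts (Sib t) = {s \<in> T. hdom s = hdom t \<and> s \<noteq> t}"
 unfolding Sib_def by (subst elts_sep) simp

lemma Sib_M: "t \<in> T ==> Sib t \<in> M"
proof -
 assume "t \<in> T"
 hence t: "t \<in> M" using trM[OF TT_inM] by simp
 show ?thesis unfolding Sib_def by (rule inM, intro df TT_inM t)
qed

lemma Sib_compl:
 assumes f: "f \<in> cantor M" and t: "t \<in> T"
 shows "f \<in> elts (OU (Sib t)) <-> \<not> t \<sqsubseteq> f"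
proof -
 obtain u where u: "t = str u" using t unfolding T_str by blast
 have "(\<exists>s\<in>elts (Sib t). s \<sqsubseteq> f) <-> (\<exists>v. length v = length u \<and> v \<noteq> u \<and> v = upto_bits (bits f) (length v))"
  unfolding elts_Sib T_str u by (auto simp: hdom_str str_sub_cantor[OF f] simp del: elts_hdom)
 also have "\<dots> <-> u \<noteq> upto_bits (bits f) (length u)" by (metis diff_zero length_map length_upt)
 finally show ?thesis unfolding elts_OU using f by (simp add: u str_sub_cantor[OF f])
qed

definition thin :: "hset => bool" where
 "thin C <-> C \<in> M \<and> elts C \<subseteq> T \<and> (\<forall>k. \<exists>S. finite S \<and> light k (elts C - S))"

text \<open>A branch meeting \<open>X\<close> infinitely often passes through a node of
  \<open>X\<close> outside any finite set, so light cofinite parts cover the limit set.\<close>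

lemma thin_null:
 assumes C: "thin C" and X: "X \<sqsubseteq> C" "X \<in> M"
 shows "coin_measure M (lim_set M X) = 0"
proof (rule nullS_measure)
 show "lim_set M X \<subseteq> cantor M" unfolding lim_set_def by blast
 show "nullS M (lim_set M X)" unfolding nullS_def
 proof
  fix k
  obtain S where S: "finite S" "light k (elts C - S)" using C unfolding thin_def by blast
  define S' where "S' = hset_of (elts X \<inter> S)"
  have eS: "elts S' = elts X \<inter> S" using S(1) by (simp add: S'_def)
  have SM: "S' \<in> M" unfolding S'_def by (rule finite_inM) (use S(1) subM[OF X(2)] in auto)
  show "\<exists>Y\<in>M. elts Y \<subseteq> T \<and> light k (elts Y) \<and> (\<forall>f\<in>lim_set M X. \<exists>t\<in>elts Y. t \<sqsubseteq> f)"
  proof (intro bexI[OF _ hdiff_M[OF X(2) SM]] conjI ballI)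
   show "light k (elts (hdiff X S'))" by (rule light_subset[OF S(2)]) (use X(1) in \<open>auto simp: elts_hdiff eS\<close>)
   show "elts (hdiff X S') \<subseteq> T" using X(1) C unfolding thin_def elts_hdiff by blast
   fix f assume "f \<in> lim_set M X"
   hence f: "f \<in> cantor M" "infinite (branch f \<inter> elts X)" unfolding lim_set_def by blast+
   from Diff_infinite_finite[OF S(1) f(2)] obtain t where t: "t \<in> branch f" "t \<in> elts X" "t \<notin> S" by (metis Diff_iff Int_iff ex_in_conv finite.emptyI)
   obtain n where "t = str (upto_bits (bits f) n)" using t(1) unfolding branch_str[OF f(1)] by blast
   hence "t \<sqsubseteq> f" by (simp add: str_sub_cantor[OF f(1)])
   thus "\<exists>t\<in>elts (hdiff X S'). t \<sqsubseteq> f" using t by (auto simp: elts_hdiff eS)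
  qed
 qed
qed

text \<open>If every finite \<open>S\<close> left a null set, then for each \<open>k\<close> a light
  cofinite part of \<open>C\<close> and a light cover of the remainder would together cover
  \<open>B\<close>, which would be null.\<close>

lemma random_thin:
 assumes C: "thin C" and B: "B \<in> elts RF"
 shows "\<exists>S\<in>elts (hFin TT). hdiff B (OU (hdiff C S)) \<in> elts RF"
proof (rule ccontr)
 assume n: "\<not> ?thesis"
 have CM': "C \<in> M" "elts C \<subseteq> T" using C unfolding thin_def by blast+
 have BB: "B \<in> elts BB" "\<not> nullS M (elts B)" using B unfolding elts_RF by blast+
 have "nullS M (elts B)" unfolding nullS_def
 proof
  fix k
  obtain S where S: "finite S" "light (Suc k) (elts C - S)" using C unfolding thin_def by blast
  define S' where "S' = hset_of (elts C \<inter> S)"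
  have eS: "elts S' = elts C \<inter> S" using S(1) by (simp add: S'_def)
  have SM: "S' \<in> M" unfolding S'_def by (rule finite_inM) (use S(1) subM[OF CM'(1)] in auto)
  have SF: "S' \<in> elts (hFin TT)" unfolding elts_hFin[OF TT_inM] using eS S(1) CM'(2) by auto
  define D where "D = hdiff C S'"
  have D: "D \<in> M" "elts D \<subseteq> T" "light (Suc k) (elts D)"
   using hdiff_M[OF CM'(1) SM] CM'(2) light_subset[OF S(2), of "elts D"] by (auto simp: D_def elts_hdiff eS)
  have "hdiff B (OU D) \<in> elts BB" by (rule BB_diff_OU[OF BB(1) D(1,2)])
  hence "nullS M (elts B - elts (OU D))" using n SF unfolding elts_RF D_def elts_hdiff[symmetric] by blast
  then obtain X where X: "X \<in> M" "elts X \<subseteq> T" "light (Suc k) (elts X)" "\<And>f. f \<in> elts B - elts (OU D) ==> \<exists>t\<in>elts X. t \<sqsubseteq> f"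
   unfolding nullS_def by meson
  have BC: "elts B \<subseteq> cantor M" using BB(1) unfolding BB_iff by blast
  have "hun X D \<in> M" by (rule inM, intro df X(1) D(1))
  moreover have "\<exists>t\<in>elts (hun X D). t \<sqsubseteq> f" if f: "f \<in> elts B" for f
  proof (cases "f \<in> elts (OU D)")
   case True
   thus ?thesis unfolding elts_OU by auto
  next
   case False
   then obtain t where "t \<in> elts X" "t \<sqsubseteq> f" using X(4) f by blast
   thus ?thesis by (intro bexI[of _ t]) simp_all
  qed
  ultimately show "\<exists>X\<in>M. elts X \<subseteq> T \<and> light k (elts X) \<and> (\<forall>f\<in>elts B. \<exists>t\<in>elts X. t \<sqsubseteq> f)"
   using X(2) D(2) light_Un[OF X(3) D(3)] by (intro bexI[of _ "hun X D"]) simp_all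
 qed
 thus False using BB(2) by blast
qed

text \<open>The finitely many cylinders of length \<open>m\<close> split \<open>B\<close>, and a
  finite union of null sets is null.\<close>

lemma random_level:
 assumes B: "B \<in> elts RF"
 shows "\<exists>u. length u = m \<and> hdiff B (OU (Sib (str u))) \<in> elts RF"
proof (rule ccontr)
 assume n: "\<not> ?thesis"
 have BB: "B \<in> elts BB" "\<not> nullS M (elts B)" using B unfolding elts_RF by blast+
 have BC: "elts B \<subseteq> cantor M" using BB(1) unfolding BB_iff by blast
 have null: "nullS M (elts (hdiff B (OU (Sib (str u)))))" if u: "u \<in> {u. length u = m}" for u
 proof -
  have "hdiff B (OU (Sib (str u))) \<in> elts BB" by (rule BB_diff_OU[OF BB(1) Sib_M[OF str_in_T]]) (auto simp: elts_Sib)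
  thus ?thesis using n u unfolding elts_RF by blast
 qed
 have fin: "finite {u :: bool list. length u = m}" using finite_lists_length_eq[of "UNIV :: bool set" m] by simp
 have "elts B \<subseteq> (\<Union>u\<in>{u. length u = m}. elts (hdiff B (OU (Sib (str u)))))"
 proof
  fix f assume f: "f \<in> elts B"
  hence fC: "f \<in> cantor M" using BC by blast
  have "f \<notin> elts (OU (Sib (str (upto_bits (bits f) m))))" unfolding Sib_compl[OF fC str_in_T] by (simp add: str_sub_cantor[OF fC])
  thus "f \<in> (\<Union>u\<in>{u. length u = m}. elts (hdiff B (OU (Sib (str u)))))" using f
   by (intro UN_I[of "upto_bits (bits f) m"]) (simp_all add: elts_hdiff)
 qed
 from nullS_mono[OF nullS_UN[OF fin null] this] show False using BB(2) by blast
qed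

text \<open>The new branch consists of the nodes whose cylinder \<open>D t\<close> is in the filter.
  Two density arguments show that it is infinite and meets each thin set of the ground model in a
  finite set; \<open>mad_hits\<close> then provides \<open>A\<close>.\<close>

lemma random_hits:
 assumes F: "F \<in> M" and G: "generic M (random_forcing M) random_le G" and mad: "mad_in (gen_ext M G) F"
 obtains A B where "A \<in> elts F" "B \<subseteq> T" "infinite (elts A \<inter> B)" "\<And>C. thin C ==> finite (B \<inter> elts C)"
proof -
 define D where "D t = hset_of {f \<in> elts CM. t \<sqsubseteq> f}" for t
 have eD: "elts (D t) = {f \<in> cantor M. t \<sqsubseteq> f}" for t
  unfolding D_def by (subst elts_sep) (simp add: elts_CM)
 note gen = G[unfolded generic_def RF_random[symmetric] random_le_def]
 have GR: "G \<subseteq> elts RF" and Gne: "G \<noteq> {}" using gen by simp_all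
 have Gup: "q \<in> G" if "p \<in> G" "q \<in> elts RF" "p \<sqsubseteq> q" for p q
  by (rule gen[THEN conjunct2, THEN conjunct2, THEN conjunct1, rule_format, OF that])
 have Gdir: "\<exists>r\<in>G. r \<sqsubseteq> p \<and> r \<sqsubseteq> q" if "p \<in> G" "q \<in> G" for p q
  by (rule gen[THEN conjunct2, THEN conjunct2, THEN conjunct2, THEN conjunct1, rule_format, OF that])
 have Gd: "G \<inter> elts E \<noteq> {}" if "E \<in> M" "E \<sqsubseteq> RF" "\<And>p. p \<in> elts RF ==> \<exists>d\<in>elts E. d \<sqsubseteq> p" for E
  by (rule gen[THEN conjunct2, THEN conjunct2, THEN conjunct2, THEN conjunct2, rule_format, OF that])
 have Gel: "\<exists>f. f \<in> elts p \<and> f \<in> elts q" if "p \<in> G" "q \<in> G" for p q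
 proof -
  obtain r where r: "r \<in> G" "r \<sqsubseteq> p" "r \<sqsubseteq> q" using Gdir[OF \<open>p \<in> G\<close> \<open>q \<in> G\<close>] by blast
  have "elts r \<noteq> {}" using r(1) GR nullS_empty unfolding elts_RF by fastforce
  thus ?thesis using r by blast
 qed
 let ?B = "{t \<in> T. D t \<in> G}"
 have RFC: "elts p \<subseteq> cantor M" if "p \<in> elts RF" for p using that unfolding elts_RF BB_iff by blast
 have DB: "D (str u) \<in> elts BB" for u
 proof (rule BB_open)
  show "D (str u) \<in> M" unfolding D_def by (rule inM, intro df CM_M str_inM)
  show "elts (D (str u)) \<subseteq> cantor M" "openM (D (str u))" unfolding openM_def eD elts_CM elts_TT using str_in_T by blast+
 qed
 have inf: "infinite ?B"
 proof (rule long_infinite)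
  fix m
  \<comment> \<open>Conditions contained in the cylinder over some node of length
    \<open>m + 1\<close>, so that this node is in the branch.\<close>
  define E where "E = hset_of {Q \<in> elts RF. \<exists>t\<in>elts TT. hdom t = vnat (Suc m) \<and> (\<forall>f\<in>elts Q. t \<sqsubseteq> f)}"
  have eE: "elts E = {Q \<in> elts RF. \<exists>t\<in>elts TT. hdom t = vnat (Suc m) \<and> (\<forall>f\<in>elts Q. t \<sqsubseteq> f)}"
   unfolding E_def by (rule elts_sep)
  have "G \<inter> elts E \<noteq> {}"
  proof (rule Gd)
   show "E \<in> M" unfolding E_def by (rule inM, intro df RF_M TT_inM vnat_inM)
   show "E \<sqsubseteq> RF" unfolding eE by blast
   fix p assume p: "p \<in> elts RF"
   obtain u where u: "length u = Suc m" "hdiff p (OU (Sib (str u))) \<in> elts RF" using random_level[OF p] by blast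
   have "hdiff p (OU (Sib (str u))) \<in> elts E" unfolding eE
   proof (intro CollectI conjI u(2) bexI[of _ "str u"] ballI)
    show "hdom (str u) = vnat (Suc m)" using u(1) by (simp only: hdom_str)
    show "str u \<sqsubseteq> f" if "f \<in> elts (hdiff p (OU (Sib (str u))))" for f
     using that RFC[OF p] Sib_compl[OF _ str_in_T, of f u] unfolding elts_hdiff by blast
   qed simp
   thus "\<exists>d\<in>elts E. d \<sqsubseteq> p" by (rule rev_bexI) (auto simp: elts_hdiff)
  qed
  then obtain Q t where Q: "Q \<in> G" "t \<in> T" "hdom t = vnat (Suc m)" "\<And>f. f \<in> elts Q ==> t \<sqsubseteq> f"
   unfolding eE elts_TT by blast
  obtain u where u: "t = str u" using Q(2) unfolding T_str by blast
  have QR: "Q \<in> elts RF" using Q(1) GR by blast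
  have sub: "Q \<sqsubseteq> D t" using Q(4) RFC[OF QR] unfolding eD by blast
  have "D t \<in> elts RF" unfolding elts_RF using DB[of u] u nullS_mono[OF _ sub] QR unfolding elts_RF by blast
  hence "D t \<in> G" by (rule Gup[OF Q(1) _ sub])
  thus "\<exists>t\<in>?B. vnat m \<in> elts (hdom t)" using Q(2,3) by (intro bexI[of _ t]) (simp_all del: elts_hdom)
 qed blast
 obtain p where p: "p \<in> G" using Gne by blast
 have pM: "p \<in> M" by (rule trM[OF RF_M]) (use p GR in blast)
 have DM: "hgraph TT D \<in> M" unfolding D_def by (rule inM, intro df TT_inM CM_M)
 obtain A where A: "A \<in> elts F" "infinite (elts A \<inter> ?B)" using mad_hits[OF F p pM DM mad inf] by blast
 have "finite (?B \<inter> elts C)" if C: "thin C" for C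
 proof -
  have CM': "C \<in> M" "elts C \<subseteq> T" using C unfolding thin_def by blast+
  \<comment> \<open>Conditions whose points avoid all but finitely many nodes of \<open>C\<close>. A
    node of the branch outside the exceptional set would need a point of \<open>Q\<close> in its
    cylinder.\<close>
  define E where "E = hset_of {Q \<in> elts RF. \<exists>S\<in>elts (hFin TT). \<forall>f\<in>elts Q. \<forall>t\<in>elts C. t \<notin> elts S --> \<not> t \<sqsubseteq> f}"
  have eE: "elts E = {Q \<in> elts RF. \<exists>S\<in>elts (hFin TT). \<forall>f\<in>elts Q. \<forall>t\<in>elts C. t \<notin> elts S --> \<not> t \<sqsubseteq> f}"
   unfolding E_def by (rule elts_sep)
  have "G \<inter> elts E \<noteq> {}"
  proof (rule Gd)
   show "E \<in> M" unfolding E_def by (rule inM, intro df RF_M TT_inM CM'(1))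
   show "E \<sqsubseteq> RF" unfolding eE by blast
   fix p assume p: "p \<in> elts RF"
   obtain S where S: "S \<in> elts (hFin TT)" "hdiff p (OU (hdiff C S)) \<in> elts RF" using random_thin[OF C p] by blast
   have "\<not> t \<sqsubseteq> f" if "f \<in> elts (hdiff p (OU (hdiff C S)))" "t \<in> elts C" "t \<notin> elts S" for f t
    using that RFC[OF p] unfolding elts_hdiff elts_OU by blast
   with S have "hdiff p (OU (hdiff C S)) \<in> elts E" unfolding eE by (intro CollectI conjI bexI[of _ S] ballI impI)
   thus "\<exists>d\<in>elts E. d \<sqsubseteq> p" by (rule rev_bexI) (auto simp: elts_hdiff)
  qed
  then obtain Q S where Q: "Q \<in> G" "S \<in> elts (hFin TT)" "\<And>f t. f \<in> elts Q ==> t \<in> elts C ==> t \<notin> elts S ==> \<not> t \<sqsubseteq> f"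
   unfolding eE by blast
  have "t \<in> elts S" if t: "t \<in> ?B" "t \<in> elts C" for t
  proof (rule ccontr)
   assume nS: "t \<notin> elts S"
   obtain f where f: "f \<in> elts Q" "f \<in> elts (D t)" using Gel[OF Q(1), of "D t"] t(1) by blast
   thus False using Q(3)[OF f(1) t(2) nS] unfolding eD by blast
  qed
  hence "?B \<inter> elts C \<subseteq> elts S" by blast
  thus ?thesis using finite_subset Q(2) unfolding elts_hFin[OF TT_inM] by blast
 qed
 with A show thesis by (intro that[of A ?B]) auto
qed

subsection \<open>Part (3): streams choosing one node beyond each level\<close>

text \<open>The pieces are the same at every node: any node longer than \<open>n\<close> may be the
  \<open>n\<close>th choice, so the weights of the choices are summable.\<close>

definition Y3 :: hset where
 "Y3 = hset_of {z \<in> elts (hprod TT (hprod omega TT)). hfst (hsnd z) \<in> elts (hdom (hsnd (hsnd z)))}"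

lemma Y3_M: "Y3 \<in> M"
 unfolding Y3_def by (rule inM, intro df TT_inM omega_inM)

lemma Y3_iff: "opair s (opair n t) \<in> elts Y3 <-> s \<in> T \<and> n \<in> elts omega \<and> t \<in> T \<and> n \<in> elts (hdom t)"
 unfolding Y3_def by (subst elts_sep) (auto simp: opair_in_hprod simp del: elts_hprod elts_hdom)

end

section \<open>Smallness of the choices of a stream\<close>

context streams
begin

definition hC :: "hset => hset" where
 "hC i = hset_of {t \<in> elts TT. \<exists>n\<in>elts omega. \<exists>q\<in>elts (hset_of g). pos q i n t}"

lemma elts_hC: "elts (hC i) = C i"
 unfolding hC_def C_def by (subst elts_sep) simp

lemma hC_W: "i \<in> elts w ==> hC i \<in> gen_ext M g"
 unfolding hC_def pos_def Yr_def cd_def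
 by (rule W.inM, intro df W.TT_inM W.omega_inM W.vb_inM g.G_N par[THEN g.M_sub_N] g.M_sub_N[OF w_mem_M[OF w1]])

text \<open>A choice with number \<open>n\<close> has weight at most \<open>(1/2) ^ Suc n\<close>,
  and different nodes have different numbers; what remains after the finitely many choices below
  \<open>k\<close> is a tail of the geometric series.\<close>

lemma C_thin: "\<exists>S. finite S \<and> light k (C i - S)"
proof -
 let ?S = "{t \<in> C i. \<exists>n\<in>elts (vnat k). \<exists>q\<in>g. pos q i n t}"
 have "\<exists>n. (\<exists>q\<in>g. pos q i (vnat n) t) \<and> n < card (elts t)" if tC: "t \<in> C i" for t
 proof -
  obtain n q where n: "t \<in> T" "n \<in> elts omega" "q \<in> g" "pos q i n t" "n \<in> elts (hdom t)" by (rule C_E[OF tC])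
  thus ?thesis unfolding hdom_T[OF n(1)] by auto
 qed
 then obtain n where n: "\<And>t. t \<in> C i ==> (\<exists>q\<in>g. pos q i (vnat (n t)) t) \<and> n t < card (elts t)" by metis
 have inj: "inj_on n (C i)"
 proof (rule inj_onI)
  fix t t' assume t: "t \<in> C i" "t' \<in> C i" "n t = n t'"
  obtain q q' where "q \<in> g" "q' \<in> g" "pos q i (vnat (n t)) t" "pos q' i (vnat (n t)) t'" using n[OF t(1)] n[OF t(2)] t(3) by auto
  thus "t = t'" using pos_unique[of q q' t t' i "vnat (n t)"] t unfolding C_def by blast
 qed
 have "light k (C i - ?S)" unfolding light_def
 proof (intro allI impI)
  fix Y assume Y: "finite Y" "Y \<subseteq> C i - ?S"
  have nk: "k \<le> n t" if "t \<in> Y" for t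
  proof (rule ccontr)
   assume "\<not> k \<le> n t"
   hence "t \<in> ?S" using n[of t] that Y(2) by (intro CollectI conjI rev_bexI[of "vnat (n t)" "elts (vnat k)"]) auto
   thus False using that Y(2) by blast
  qed
  have "(\<Sum>t\<in>Y. (1/2::real) ^ card (elts t)) \<le> (\<Sum>t\<in>Y. (1/2) ^ Suc (n t))"
   using n Y(2) by (intro sum_mono power_decreasing) (auto simp: Suc_le_eq)
  also have "\<dots> = (\<Sum>m\<in>n ` Y. (1/2) ^ Suc m)" using inj_on_subset[OF inj, of Y] Y(2) by (subst sum.reindex) auto
  also have "\<dots> \<le> (1/2) ^ k" by (rule geo_tail) (use Y(1) nk in auto)
  finally show "(\<Sum>t\<in>Y. (1/2::real) ^ card (elts t)) \<le> (1/2) ^ k" .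
 qed
 thus ?thesis using C_fin by blast
qed

end

lemma (in ctmodel) part3:
 assumes w: "is_omega1_in M w" and gen: "generic M (Fn w) Fn_le g"
 shows "\<exists>F\<in>gen_ext M g. ad_family F \<and> elts F \<subseteq> Null_T (gen_ext M g) \<and> card_aleph1_in (gen_ext M g) F \<and>
  (\<forall>P\<in>M. \<forall>L\<in>M. \<forall>G. poset (elts P) (order_of L) --> ccc_in (gen_ext M g) (elts P) (order_of L) -->
    generic (gen_ext M g) (elts P) (order_of L) G -->
    \<not> extends_to_random_indestructible_in (gen_ext (gen_ext M g) G) F)"
proof -
 have "\<exists>a kk bb E tc. streams M w a kk bb E tc Y3 g"
 proof (rule streams_exist[OF w gen Y3_M])
  show "n \<in> elts (hdom t)" if "opair s (opair n t) \<in> elts Y3" for s n t using that unfolding Y3_iff by blast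
  fix s assume s: "s \<in> T"
  show "\<exists>n0. \<forall>n\<ge>n0. \<forall>m. \<exists>u. m < length u \<and> opair s (opair (vnat n) (str u)) \<in> elts Y3"
  proof (intro exI[of _ 0] allI impI)
   fix n m :: nat
   show "\<exists>u. m < length u \<and> opair s (opair (vnat n) (str u)) \<in> elts Y3"
    unfolding Y3_iff hdom_str using s by (intro exI[of _ "replicate (Suc (max m n)) False"]) (simp add: less_Suc_eq_le)
  qed
 qed
 then obtain a kk bb E tc where "streams M w a kk bb E tc Y3 g" by blast
 then interpret S: streams M w a kk bb E tc Y3 g .
 show ?thesis
 proof (intro bexI[OF _ S.F_W] conjI S.F_ad S.F_aleph1 ballI allI impI)
  show "elts S.F \<subseteq> Null_T (gen_ext M g)"
  proof
   fix x assume "x \<in> elts S.F"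
   then obtain i where i: "i \<in> elts w" "x = S.X i" unfolding S.elts_F by blast
   have "S.W.thin (S.hC i)" unfolding S.W.thin_def using S.hC_W[OF i(1)] S.C_thin[of _ i] by (auto simp: S.elts_hC S.C_def)
   from S.W.thin_null[OF this _ S.X_W[OF i(1)]] have "coin_measure (gen_ext M g) (lim_set (gen_ext M g) (S.X i)) = 0"
    by (simp add: S.elts_hC S.X_C)
   thus "x \<in> Null_T (gen_ext M g)" unfolding Null_T_def i(2) using S.X_W[OF i(1)] S.X_T S.X_inf[OF i(1)] by simp
  qed
  fix P L G assume PL: "P \<in> M" "L \<in> M" "poset (elts P) (order_of L)" and ccc: "ccc_in (gen_ext M g) (elts P) (order_of L)"
   and G: "generic (gen_ext M g) (elts P) (order_of L) G"
  interpret G: generic_ext "gen_ext M g" P L G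
   by (unfold_locales) (use PL S.g.M_sub_N G in auto)
  interpret U: ctmodel "G.N" by (rule G.ctmodel_N)
  \<comment> \<open>Thinness concerns finite sums only, so it passes from the Cohen extension to the
    further extension.\<close>
  have thinU: "U.thin (S.hC i)" if "i \<in> elts w" for i
   unfolding U.thin_def using G.M_sub_N[OF S.hC_W[OF that]] S.C_thin[of _ i] by (auto simp: S.elts_hC S.C_def)
  show "\<not> extends_to_random_indestructible_in G.N S.F"
  proof
   assume "extends_to_random_indestructible_in G.N S.F"
   then obtain F' G' where F': "F' \<in> G.N" "S.F \<sqsubseteq> F'" "mad_in G.N F'"
    and G': "generic G.N (random_forcing G.N) random_le G'"
     "mad_in (gen_ext G.N G') F'"
    unfolding extends_to_random_indestructible_in_def destructible_in_def by blast
   have ad: "ad_family F'" using F'(3) by (simp add: mad_in_def)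
   obtain A B where A: "A \<in> elts F'" "B \<subseteq> T" "infinite (elts A \<inter> B)" and thin: "\<And>C. U.thin C ==> finite (B \<inter> elts C)"
    by (rule U.random_hits[OF F'(1) G']) (rule that)
   have AU: "A \<in> G.N" by (rule U.trM[OF F'(1) A(1)])
   have AT: "elts A \<subseteq> T" using ad A(1) by (simp add: ad_family_def)
   have BC: "finite (B \<inter> S.C i)" if "i \<in> elts w" for i using thin[OF thinU[OF that]] by (simp add: S.elts_hC)
   \<comment> \<open>The pieces do not depend on the node, so the root can be used. \<open>A\<close>
     meets the random branch infinitely often, while finitely many streams account for only finitely
     many nodes of the branch, and only finitely many nodes have length at most
     \<open>n\<close>.\<close>
   have "\<exists>i\<in>elts w. infinite (elts A \<inter> elts (S.X i))"
   proof (rule S.hitting[OF PL ccc G AU AT str_in_T[of "[]"], of 0])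
    fix n J assume J: "finite J" "J \<subseteq> elts w"
    have fin: "finite (\<Union>j\<in>J. B \<inter> S.C j)" using J BC by blast
    have "finite {u :: bool list. length u \<le> n}" using finite_lists_length_le[of "UNIV :: bool set" n] by simp
    hence fn: "finite (str ` {u. length u \<le> n})" by simp
    have "elts A \<inter> B - (\<Union>j\<in>J. B \<inter> S.C j) - str ` {u. length u \<le> n} \<subseteq> {t \<in> elts A. S.Yr (str []) (vnat n) t} - (\<Union>j\<in>J. S.C j)"
    proof
     fix t assume t: "t \<in> elts A \<inter> B - (\<Union>j\<in>J. B \<inter> S.C j) - str ` {u. length u \<le> n}"
     hence "t \<in> T" using AT by blast
     then obtain u where u: "t = str u" unfolding T_str by blast
     hence "n < length u" using t by force
     hence "S.Yr (str []) (vnat n) t" unfolding S.Yr_def Y3_iff u hdom_str by simp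
     thus "t \<in> {t \<in> elts A. S.Yr (str []) (vnat n) t} - (\<Union>j\<in>J. S.C j)" using t by blast
    qed
    from infinite_super[OF this Diff_infinite_finite[OF fn Diff_infinite_finite[OF fin A(3)]]]
    show "infinite ({t \<in> elts A. S.Yr (str []) (vnat n) t} - (\<Union>j\<in>J. S.C j))" .
   qed
   then obtain i where i: "i \<in> elts w" "infinite (elts A \<inter> elts (S.X i))" by blast
   have "S.X i \<in> elts F'" using F'(2) i(1) unfolding S.elts_F by blast
   hence "A = S.X i" using ad A(1) i(2) unfolding ad_family_def by blast
   hence "elts A \<inter> B \<subseteq> B \<inter> S.C i" using S.X_C by blast
   thus False using BC[OF i(1)] A(3) finite_subset by blast
  qed
 qed
qed

theorem theorem5p1:
  fixes V :: "hset set"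
  assumes "ctm V"
  shows
    "(CH_in V \<longrightarrow>
       (\<exists>F\<in>V. ad_family F \<and> elts F \<subseteq> antichains_T V \<and>
          (\<forall>\<kappa> G. cardinal_in V \<kappa> \<longrightarrow> generic V (Fn \<kappa>) Fn_le G \<longrightarrow>
             \<not> extends_to_cohen_indestructible_in (gen_ext V G) F)))
     \<and>
     (\<forall>w g W. is_omega1_in V w \<longrightarrow> generic V (Fn w) Fn_le g \<longrightarrow> W = gen_ext V g \<longrightarrow>
       (\<exists>F\<in>W. ad_family F \<and> elts F \<subseteq> ND_T W \<and> card_aleph1_in W F \<and>
          (\<forall>P\<in>V. \<forall>L\<in>V. \<forall>G. poset (elts P) (order_of L) \<longrightarrow>
             ccc_in W (elts P) (order_of L) \<longrightarrow> generic W (elts P) (order_of L) G \<longrightarrow>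
             \<not> extends_to_cohen_indestructible_in (gen_ext W G) F)))
     \<and>
     (\<forall>w g W. is_omega1_in V w \<longrightarrow> generic V (Fn w) Fn_le g \<longrightarrow> W = gen_ext V g \<longrightarrow>
       (\<exists>F\<in>W. ad_family F \<and> elts F \<subseteq> Null_T W \<and> card_aleph1_in W F \<and>
          (\<forall>P\<in>V. \<forall>L\<in>V. \<forall>G. poset (elts P) (order_of L) \<longrightarrow>
             ccc_in W (elts P) (order_of L) \<longrightarrow> generic W (elts P) (order_of L) G \<longrightarrow>
             \<not> extends_to_random_indestructible_in (gen_ext W G) F)))"
proof -
 interpret V: ctmodel V using assms by (simp add: ctm_iff)
 show ?thesis
 proof (intro conjI impI allI)
  fix w g W assume h: "is_omega1_in V w" "generic V (Fn w) Fn_le g" "W = gen_ext V g"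
  show "\<exists>F\<in>W. ad_family F \<and> elts F \<subseteq> ND_T W \<and> card_aleph1_in W F \<and>
     (\<forall>P\<in>V. \<forall>L\<in>V. \<forall>G. poset (elts P) (order_of L) -->
       ccc_in W (elts P) (order_of L) --> generic W (elts P) (order_of L) G -->
       \<not> extends_to_cohen_indestructible_in (gen_ext W G) F)"
   unfolding h(3) by (rule V.part2[OF h(1,2)])
  show "\<exists>F\<in>W. ad_family F \<and> elts F \<subseteq> Null_T W \<and> card_aleph1_in W F \<and>
     (\<forall>P\<in>V. \<forall>L\<in>V. \<forall>G. poset (elts P) (order_of L) -->
       ccc_in W (elts P) (order_of L) --> generic W (elts P) (order_of L) G -->
       \<not> extends_to_random_indestructible_in (gen_ext W G) F)"
   unfolding h(3) by (rule V.part3[OF h(1,2)])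
 qed (rule V.part1)
qed

end
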